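(* Let $(M,\varphi)$ be an integrable $G_2$ manifold of constant type, i.e. $d{*\varphi}=\theta\wedge *\varphi$ with $\theta$ the Lee form and $(d\varphi,*\varphi)=\mathrm{const}$. Suppose that the curvature $R$ of the characteristic connection $\nabla$ is a $G_2$-instanton and that the Ricci tensor of $\nabla$ vanishes, $Ric=0$. Then the torsion 3-form $T$ of $\nabla$ is parallel with respect to both the Levi-Civita connection $\nabla^g$ and the characteristic connection: $\nabla^gT=\nabla T=0$. In particular, the torsion 3-form is harmonic, $\delta T=dT=0$, and the 4-form $\sigma^T$ vanishes, $\sigma^T=0$.
   Context: Manifolds are smooth. A $G_2$ manifold $(M,\varphi)$ is a 7-manifold with a 3-form $\varphi$ that near each point can be written, in a local coframe $e_1,\dots,e_7$, as $\varphi=e_{127}+e_{135}-e_{146}-e_{236}-e_{245}+e_{347}+e_{567}$, where $e_{ijk}=e_i\wedge e_j\wedge e_k$. It induces the metric $g$ and orientation for which such coframes are oriented orthonormal; $*$ is the Hodge star, $(\cdot,\cdot)$ the induced scalar product on forms, $\nabla^g$ the Levi-Civita connection, and $\delta=(-1)^k*d*$ the codifferential on $k$-forms. Vectors and covectors are identified via $g$, indices refer to a local orthonormal frame, and repeated indices are summed. The Lee form is $\theta=-\frac13*( *d\varphi\wedge\varphi)$. The $G_2$ structure is integrable if $d{*\varphi}=\theta\wedge*\varphi$. It is of constant type if it is integrable and the function $(d\varphi,*\varphi)$ is constant. On an integrable $G_2$ manifold there is a unique linear connection $\nabla$ (the characteristic connection) with $\nabla g=0$, $\nabla\varphi=0$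 and totally skew-symmetric torsion, i.e. $T(X,Y,Z)=g(\nabla_XY-\nabla_YX-[X,Y],Z)$ is a 3-form; explicitly $T=-*d\varphi+*(\theta\wedge\varphi)+\frac16(d\varphi,*\varphi)\varphi$. Curvature: $R(X,Y)Z=[\nabla_X,\nabla_Y]Z-\nabla_{[X,Y]}Z$, $R(X,Y,Z,V)=g(R(X,Y)Z,V)$, and $Ric(X,Y)=\sum_a R(e_a,X,Y,e_a)$. $R$ is a $G_2$-instanton if $R_{abij}\varphi_{abk}=0$ for all $i,j,k$, i.e. the curvature 2-form lies in $\mathfrak g_2\cong\{\alpha\in\Lambda^2: *(\alpha\wedge\varphi)=-\alpha\}$; equivalently (since $\nabla\varphi=0$) $R\in\mathfrak g_2\otimes\mathfrak g_2$. The 4-form $\sigma^T$ is $\sigma^T=\frac12\sum_{j}(e_j\lrcorner T)\wedge(e_j\lrcorner T)$ for an orthonormal frame $\{e_j\}$, where $(e_j\lrcorner T)(X,Y)=T(e_j,X,Y)$. *)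

theory Defs
  imports "HOL-Analysis.Analysis" "HOL-Combinatorics.Permutations"
begin

section \<open>Smooth 7-manifolds\<close>

text \<open>For open \<open>S\<close> in a Euclidean space this is the usual class \<open>C\<^sup>n\<close>: the function is
  differentiable and all its directional derivatives are of class \<open>C\<^sup>n\<^sup>-\<^sup>1\<close>.\<close>

primrec ck_on :: "nat \<Rightarrow> 'a::real_normed_vector set \<Rightarrow> ('a \<Rightarrow> 'b::real_normed_vector) \<Rightarrow> bool" where
  "ck_on 0 S f = continuous_on S f"
| "ck_on (Suc n) S f =
    ((\<forall>x\<in>S. f differentiable (at x)) \<and> (\<forall>v. ck_on n S (\<lambda>x. frechet_derivative f (at x) v)))"

definition smooth_on :: "'a::real_normed_vector set \<Rightarrow> ('a \<Rightarrow> 'b::real_normed_vector) \<Rightarrow> bool" where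
  "smooth_on S f \<longleftrightarrow> (\<forall>n. ck_on n S f)"

type_synonym vec7 = "real^7"

text \<open>A chart is a pair of a domain and a coordinate map.\<close>

type_synonym 'a chart = "'a set \<times> ('a \<Rightarrow> vec7)"

definition chart_range :: "'a chart \<Rightarrow> vec7 set" where
  "chart_range c = snd c ` fst c"

definition is_chart :: "'a::topological_space chart \<Rightarrow> bool" where
  "is_chart c \<longleftrightarrow> open (fst c) \<and> open (chart_range c)
     \<and> (\<exists>y. homeomorphism (fst c) (chart_range c) (snd c) y)"

definition transition :: "'a chart \<Rightarrow> 'a chart \<Rightarrow> vec7 \<Rightarrow> vec7" where
  "transition c c' = snd c' \<circ> inv_into (fst c) (snd c)"

definition overlap :: "'a chart \<Rightarrow> 'a chart \<Rightarrow> vec7 set" where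
  "overlap c c' = snd c ` (fst c \<inter> fst c')"

text \<open>The manifold is the union of the chart domains.  The smooth structure is determined by
  the atlas, which is not required to be maximal.  The Hausdorff property and second countability
  come from the type classes.\<close>

definition smooth_atlas :: "'a::{t2_space, second_countable_topology} chart set \<Rightarrow> bool" where
  "smooth_atlas A \<longleftrightarrow> (\<forall>c\<in>A. is_chart c)
     \<and> (\<forall>c\<in>A. \<forall>c'\<in>A. smooth_on (overlap c c') (transition c c'))"

section \<open>Forms, tensor fields and connections in charts\<close>

text \<open>A covariant \<open>k\<close>-tensor on the model space \<open>\<real>\<^sup>7\<close> is a function on lists of vectors; only its
  values on lists of length \<open>k\<close> are meaningful.  A tensor field on an open subset of \<open>\<real>\<^sup>7\<close> is a
  tensor-valued function (the argument vectors being identified with their coordinate components),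
  and a tensor field on a manifold is a family of such local representatives, one for each chart,
  subject to the transformation law.\<close>

type_synonym tensor = "vec7 list \<Rightarrow> real"
type_synonym tfield = "vec7 \<Rightarrow> tensor"

definition multilinear :: "nat \<Rightarrow> tensor \<Rightarrow> bool" where
  "multilinear k \<alpha> \<longleftrightarrow> (\<forall>vs i. length vs = k \<longrightarrow> i < k \<longrightarrow> linear (\<lambda>x. \<alpha> (vs[i := x])))"

definition alternating :: "nat \<Rightarrow> tensor \<Rightarrow> bool" where
  "alternating k \<alpha> \<longleftrightarrow> multilinear k \<alpha> \<and>
     (\<forall>vs i j. length vs = k \<longrightarrow> i < j \<longrightarrow> j < k \<longrightarrow> vs ! i = vs ! j \<longrightarrow> \<alpha> vs = 0)"

definition differential_form :: "'a chart set \<Rightarrow> nat \<Rightarrow> ('a chart \<Rightarrow> tfield) \<Rightarrow> bool" where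
  "differential_form A k \<omega> \<longleftrightarrow>
     (\<forall>c\<in>A. \<forall>p\<in>chart_range c. alternating k (\<omega> c p)) \<and>
     (\<forall>c\<in>A. \<forall>vs. length vs = k \<longrightarrow> smooth_on (chart_range c) (\<lambda>p. \<omega> c p vs)) \<and>
     (\<forall>c\<in>A. \<forall>c'\<in>A. \<forall>p\<in>overlap c c'. \<forall>vs. length vs = k \<longrightarrow>
        \<omega> c p vs = \<omega> c' (transition c c' p) (map (frechet_derivative (transition c c') (at p)) vs))"

definition vanishes :: "'a chart set \<Rightarrow> nat \<Rightarrow> ('a chart \<Rightarrow> tfield) \<Rightarrow> bool" where
  "vanishes A k \<omega> \<longleftrightarrow> (\<forall>c\<in>A. \<forall>p\<in>chart_range c. \<forall>vs. length vs = k \<longrightarrow> \<omega> c p vs = 0)"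

definition wedge :: "nat \<Rightarrow> nat \<Rightarrow> tensor \<Rightarrow> tensor \<Rightarrow> tensor" where
  "wedge k l \<alpha> \<beta> vs = 1 / (fact k * fact l) *
     (\<Sum>\<pi> | \<pi> permutes {..<k + l}.
        of_int (sign \<pi>) * \<alpha> (take k (permute_list \<pi> vs)) * \<beta> (drop k (permute_list \<pi> vs)))"

text \<open>The wedge product of a list of covectors, \<open>(a\<^sub>1 \<and> \<dots> \<and> a\<^sub>k) (v\<^sub>1, \<dots>, v\<^sub>k) = det (a\<^sub>i v\<^sub>j)\<close>;
  this agrees with iterating \<open>wedge\<close>.\<close>

definition wedge_covectors :: "(vec7 \<Rightarrow> real) list \<Rightarrow> tensor" where
  "wedge_covectors as vs =
     (\<Sum>\<pi> | \<pi> permutes {..<length as}.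
        of_int (sign \<pi>) * (\<Prod>i<length as. (as ! i) (vs ! \<pi> i)))"

definition interior_prod :: "vec7 \<Rightarrow> tensor \<Rightarrow> tensor" where
  "interior_prod x \<alpha> vs = \<alpha> (x # vs)"

text \<open>Exterior derivative, evaluated on vector fields with constant coefficients (whose Lie
  brackets vanish).\<close>

definition ext_deriv :: "tfield \<Rightarrow> tfield" where
  "ext_deriv \<omega> p vs =
     (\<Sum>i<length vs. (-1) ^ i *
        frechet_derivative (\<lambda>q. \<omega> q (take i vs @ drop (Suc i) vs)) (at p) (vs ! i))"

text \<open>The local representative \<open>\<Gamma>\<close> of a linear connection consists of its Christoffel symbols:
  \<open>\<nabla>\<^sub>X Y = DY(X) + \<Gamma>(X, Y)\<close>.\<close>

type_synonym christoffel = "vec7 \<Rightarrow> vec7 \<Rightarrow> vec7 \<Rightarrow> vec7"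
type_synonym vfield = "vec7 \<Rightarrow> vec7"

definition nabla :: "christoffel \<Rightarrow> vfield \<Rightarrow> vfield \<Rightarrow> vfield" where
  "nabla \<Gamma> X Y p = frechet_derivative Y (at p) (X p) + \<Gamma> p (X p) (Y p)"

definition lie_bracket :: "vfield \<Rightarrow> vfield \<Rightarrow> vfield" where
  "lie_bracket X Y p = frechet_derivative Y (at p) (X p) - frechet_derivative X (at p) (Y p)"

text \<open>The transformation law of the Christoffel symbols says
  \<open>D\<tau> (\<nabla>\<^sub>u v) = \<nabla>'\<^bsub>D\<tau> u\<^esub> (D\<tau> v)\<close> for constant \<open>u\<close>, \<open>v\<close> and the change of charts \<open>\<tau>\<close>.\<close>

definition linear_connection :: "'a chart set \<Rightarrow> ('a chart \<Rightarrow> christoffel) \<Rightarrow> bool" where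
  "linear_connection A D \<longleftrightarrow>
     (\<forall>c\<in>A. \<forall>p\<in>chart_range c. bilinear (D c p)) \<and>
     (\<forall>c\<in>A. \<forall>u v. smooth_on (chart_range c) (\<lambda>p. D c p u v)) \<and>
     (\<forall>c\<in>A. \<forall>c'\<in>A. \<forall>p\<in>overlap c c'. \<forall>u v.
        let \<tau> = transition c c'; D\<tau> = (\<lambda>q. frechet_derivative \<tau> (at q)) in
        D\<tau> p (D c p u v) =
          frechet_derivative (\<lambda>q. D\<tau> q v) (at p) u + D c' (\<tau> p) (D\<tau> p u) (D\<tau> p v))"

text \<open>The covariant derivative of a covariant tensor field; the first argument vector is the
  direction of differentiation:
  \<open>(\<nabla>\<^sub>u \<alpha>)(v\<^sub>1, \<dots>) = u(\<alpha>(v\<^sub>1, \<dots>)) - \<Sum>\<^sub>i \<alpha>(\<dots>, \<nabla>\<^sub>u v\<^sub>i, \<dots>)\<close>, for constant vector fields.\<close>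

definition nabla_tensor :: "christoffel \<Rightarrow> tfield \<Rightarrow> tfield" where
  "nabla_tensor \<Gamma> \<alpha> p us =
     (let u = hd us; vs = tl us in
        frechet_derivative (\<lambda>q. \<alpha> q vs) (at p) u
        - (\<Sum>i<length vs. \<alpha> p (vs[i := nabla \<Gamma> (\<lambda>_. u) (\<lambda>_. vs ! i) p])))"

text \<open>Torsion and curvature are tensorial, so their values at a point may be computed from the
  constant extensions of the argument vectors.\<close>

definition torsion :: "christoffel \<Rightarrow> vec7 \<Rightarrow> vec7 \<Rightarrow> vec7 \<Rightarrow> vec7" where
  "torsion \<Gamma> p u v =
     (let X = (\<lambda>_. u); Y = (\<lambda>_. v) in nabla \<Gamma> X Y p - nabla \<Gamma> Y X p - lie_bracket X Y p)"

definition curvature :: "christoffel \<Rightarrow> vec7 \<Rightarrow> vec7 \<Rightarrow> vec7 \<Rightarrow> vec7 \<Rightarrow> vec7" where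
  "curvature \<Gamma> p u v w =
     (let X = (\<lambda>_. u); Y = (\<lambda>_. v); Z = (\<lambda>_. w) in
        nabla \<Gamma> X (nabla \<Gamma> Y Z) p - nabla \<Gamma> Y (nabla \<Gamma> X Z) p - nabla \<Gamma> (lie_bracket X Y) Z p)"

section \<open>$G_2$ structures\<close>

text \<open>Coframes and frames are indexed by \<open>{1..7}\<close>.\<close>

definition phi_model :: "(nat \<Rightarrow> vec7 \<Rightarrow> real) \<Rightarrow> tensor" where
  "phi_model e vs =
     (let w = (\<lambda>i j k. wedge_covectors [e i, e j, e k] vs) in
        w 1 2 7 + w 1 3 5 - w 1 4 6 - w 2 3 6 - w 2 4 5 + w 3 4 7 + w 5 6 7)"

text \<open>Seven covectors on \<open>\<real>\<^sup>7\<close> form a coframe iff their common kernel is trivial.\<close>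

definition coframe :: "(nat \<Rightarrow> vec7 \<Rightarrow> real) \<Rightarrow> bool" where
  "coframe e \<longleftrightarrow> (\<forall>i\<in>{1..7}. linear (e i)) \<and> (\<forall>v. (\<forall>i\<in>{1..7}. e i v = 0) \<longrightarrow> v = 0)"

definition adapted_coframe :: "tensor \<Rightarrow> (nat \<Rightarrow> vec7 \<Rightarrow> real) \<Rightarrow> bool" where
  "adapted_coframe \<phi> e \<longleftrightarrow> coframe e \<and> (\<forall>vs. length vs = 3 \<longrightarrow> \<phi> vs = phi_model e vs)"

definition G2_structure :: "'a chart set \<Rightarrow> ('a chart \<Rightarrow> tfield) \<Rightarrow> bool" where
  "G2_structure A \<phi> \<longleftrightarrow> differential_form A 3 \<phi> \<and>
     (\<forall>c\<in>A. \<forall>p\<in>chart_range c. \<exists>W e. open W \<and> p \<in> W \<and> W \<subseteq> chart_range c \<and>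
        (\<forall>i\<in>{1..7}. \<forall>v. smooth_on W (\<lambda>q. e q i v)) \<and>
        (\<forall>q\<in>W. adapted_coframe (\<phi> c q) (e q)))"

text \<open>The stabilizer of the model form is \<open>G\<^sub>2 \<subset> SO(7)\<close>, so the metric and the volume form below do
  not depend on the adapted coframe chosen at the point (and hence they are smooth).  In the
  definitions below, \<open>\<phi>\<close> is the value of the 3-form at a point.\<close>

definition G2_coframe :: "tensor \<Rightarrow> nat \<Rightarrow> vec7 \<Rightarrow> real" where
  "G2_coframe \<phi> = (SOME e. adapted_coframe \<phi> e)"

definition G2_frame :: "tensor \<Rightarrow> nat \<Rightarrow> vec7" where
  "G2_frame \<phi> i = (THE v. \<forall>j\<in>{1..7}. G2_coframe \<phi> j v = (if j = i then 1 else 0))"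

definition G2_metric :: "tensor \<Rightarrow> vec7 \<Rightarrow> vec7 \<Rightarrow> real" where
  "G2_metric \<phi> u v = (\<Sum>i = 1..7. G2_coframe \<phi> i u * G2_coframe \<phi> i v)"

definition G2_vol :: "tensor \<Rightarrow> tensor" where
  "G2_vol \<phi> = wedge_covectors (map (G2_coframe \<phi>) [1..<8])"

definition multi_indices :: "nat \<Rightarrow> nat list set" where
  "multi_indices k = {is. length is = k \<and> set is \<subseteq> {1..7}}"

definition form_inner :: "tensor \<Rightarrow> nat \<Rightarrow> tensor \<Rightarrow> tensor \<Rightarrow> real" where
  "form_inner \<phi> k \<alpha> \<beta> = 1 / fact k *
     (\<Sum>is\<in>multi_indices k. \<alpha> (map (G2_frame \<phi>) is) * \<beta> (map (G2_frame \<phi>) is))"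

text \<open>The Hodge star on \<open>k\<close>-forms, normalised by \<open>\<beta> \<and> *\<alpha> = (\<beta>, \<alpha>) vol\<close>.\<close>

definition hodge :: "tensor \<Rightarrow> nat \<Rightarrow> tensor \<Rightarrow> tensor" where
  "hodge \<phi> k \<alpha> ws = 1 / fact k *
     (\<Sum>is\<in>multi_indices k. \<alpha> (map (G2_frame \<phi>) is) * G2_vol \<phi> (map (G2_frame \<phi>) is @ ws))"

text \<open>From here on, \<open>\<phi>\<close> is the local representative of the 3-form in a chart.\<close>

definition metric_tensor :: "tfield \<Rightarrow> tfield" where
  "metric_tensor \<phi> p vs = G2_metric (\<phi> p) (vs ! 0) (vs ! 1)"

definition hodge_field :: "tfield \<Rightarrow> nat \<Rightarrow> tfield \<Rightarrow> tfield" where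
  "hodge_field \<phi> k \<omega> p = hodge (\<phi> p) k (\<omega> p)"

definition codiff :: "tfield \<Rightarrow> nat \<Rightarrow> tfield \<Rightarrow> tfield" where
  "codiff \<phi> k \<omega> p vs =
     (-1) ^ k * hodge_field \<phi> (8 - k) (ext_deriv (hodge_field \<phi> k \<omega>)) p vs"

definition lee_form :: "tfield \<Rightarrow> tfield" where
  "lee_form \<phi> p vs =
     - (1 / 3) * hodge (\<phi> p) 6 (wedge 3 3 (hodge (\<phi> p) 4 (ext_deriv \<phi> p)) (\<phi> p)) vs"

definition integrable_G2 :: "'a chart set \<Rightarrow> ('a chart \<Rightarrow> tfield) \<Rightarrow> bool" where
  "integrable_G2 A \<phi> \<longleftrightarrow>
     (\<forall>c\<in>A. \<forall>p\<in>chart_range c. \<forall>vs. length vs = 5 \<longrightarrow>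
        ext_deriv (hodge_field (\<phi> c) 3 (\<phi> c)) p vs =
        wedge 1 4 (lee_form (\<phi> c) p) (hodge (\<phi> c p) 3 (\<phi> c p)) vs)"

definition constant_type :: "'a chart set \<Rightarrow> ('a chart \<Rightarrow> tfield) \<Rightarrow> bool" where
  "constant_type A \<phi> \<longleftrightarrow> integrable_G2 A \<phi> \<and>
     (\<exists>K. \<forall>c\<in>A. \<forall>p\<in>chart_range c.
        form_inner (\<phi> c p) 4 (ext_deriv (\<phi> c) p) (hodge (\<phi> c p) 3 (\<phi> c p)) = K)"

definition torsion_form :: "tfield \<Rightarrow> christoffel \<Rightarrow> tfield" where
  "torsion_form \<phi> \<Gamma> p vs = G2_metric (\<phi> p) (torsion \<Gamma> p (vs ! 0) (vs ! 1)) (vs ! 2)"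

definition levi_civita ::
  "'a chart set \<Rightarrow> ('a chart \<Rightarrow> tfield) \<Rightarrow> ('a chart \<Rightarrow> christoffel) \<Rightarrow> bool" where
  "levi_civita A \<phi> D \<longleftrightarrow> linear_connection A D \<and>
     vanishes A 3 (\<lambda>c. nabla_tensor (D c) (metric_tensor (\<phi> c))) \<and>
     (\<forall>c\<in>A. \<forall>p\<in>chart_range c. \<forall>u v. torsion (D c) p u v = 0)"

definition characteristic_connection ::
  "'a chart set \<Rightarrow> ('a chart \<Rightarrow> tfield) \<Rightarrow> ('a chart \<Rightarrow> christoffel) \<Rightarrow> bool" where
  "characteristic_connection A \<phi> D \<longleftrightarrow> linear_connection A D \<and>
     vanishes A 3 (\<lambda>c. nabla_tensor (D c) (metric_tensor (\<phi> c))) \<and>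
     vanishes A 4 (\<lambda>c. nabla_tensor (D c) (\<phi> c)) \<and>
     (\<forall>c\<in>A. \<forall>p\<in>chart_range c. alternating 3 (torsion_form (\<phi> c) (D c) p))"

definition curvature_tensor ::
  "tfield \<Rightarrow> christoffel \<Rightarrow> vec7 \<Rightarrow> vec7 \<Rightarrow> vec7 \<Rightarrow> vec7 \<Rightarrow> vec7 \<Rightarrow> real" where
  "curvature_tensor \<phi> \<Gamma> p x y z v = G2_metric (\<phi> p) (curvature \<Gamma> p x y z) v"

definition ricci :: "tfield \<Rightarrow> christoffel \<Rightarrow> vec7 \<Rightarrow> vec7 \<Rightarrow> vec7 \<Rightarrow> real" where
  "ricci \<phi> \<Gamma> p x y =
     (\<Sum>a = 1..7. let e = G2_frame (\<phi> p) in curvature_tensor \<phi> \<Gamma> p (e a) x y (e a))"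

definition G2_instanton ::
  "'a chart set \<Rightarrow> ('a chart \<Rightarrow> tfield) \<Rightarrow> ('a chart \<Rightarrow> christoffel) \<Rightarrow> bool" where
  "G2_instanton A \<phi> D \<longleftrightarrow>
     (\<forall>c\<in>A. \<forall>p\<in>chart_range c. \<forall>i\<in>{1..7}. \<forall>j\<in>{1..7}. \<forall>k\<in>{1..7}.
        let e = G2_frame (\<phi> c p) in
        (\<Sum>a = 1..7. \<Sum>b = 1..7.
           curvature_tensor (\<phi> c) (D c) p (e a) (e b) (e i) (e j) * \<phi> c p [e a, e b, e k]) = 0)"

definition ricci_flat ::
  "'a chart set \<Rightarrow> ('a chart \<Rightarrow> tfield) \<Rightarrow> ('a chart \<Rightarrow> christoffel) \<Rightarrow> bool" where
  "ricci_flat A \<phi> D \<longleftrightarrow> (\<forall>c\<in>A. \<forall>p\<in>chart_range c. \<forall>x y. ricci (\<phi> c) (D c) p x y = 0)"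

definition sigma_form :: "tfield \<Rightarrow> tfield \<Rightarrow> tfield" where
  "sigma_form \<phi> T p vs =
     1 / 2 * (\<Sum>j = 1..7. let e = G2_frame (\<phi> p) in
        wedge 2 2 (interior_prod (e j) (T p)) (interior_prod (e j) (T p)) vs)"

end

theory Submission
  imports Defs
begin

text \<open>Everything is local, in a smooth adapted frame. A curvature in \<open>\<Lambda>\<^sup>2 \<otimes> \<gg>\<^sub>2\<close> with vanishing Ricci
  tensor has vanishing total antisymmetrization, so by the first Bianchi identity the Bianchi sum of
  \<open>R\<close> is \<open>b\<^sub>l = \<nabla>\<^sub>l T - \<sigma>\<^sub>l / 3\<close>, where \<open>\<sigma>\<^sub>l\<close> is a contraction of \<open>\<sigma>\<^sup>T\<close>. The trace of the second Bianchi identity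
  gives \<open>R\<^sub>s\<^sub>u\<^sub>v\<^sub>x T\<^sub>s\<^sub>v\<^sub>x = 0\<close>; its contraction with \<open>*\<phi>\<close> together with the instanton condition computes the
  divergence of \<open>R\<close>. Taking the divergence of the former relation yields \<open>|b|\<^sup>2 = 0\<close>, that is,
  \<open>\<nabla>\<^sub>l T = \<sigma>\<^sub>l / 3\<close>.

  The constant \<open>(d\<phi>, *\<phi>)\<close> is a multiple of \<open>(T, \<phi>)\<close>, so \<open>(\<sigma>\<^sub>l, \<phi>) = 0\<close>. Let \<open>T\<close> act by the Clifford
  multiplication \<open>h\<close> on the spinors \<open>\<real> \<oplus> \<real>\<^sup>7\<close>, the octonions, and let \<open>\<eta>\<close> be the invariant spinor. Then
  \<open>h\<^sup>2 \<eta>\<close> is a multiple of \<open>\<eta>\<close>, and differentiating this relation along \<open>\<nabla>\<^sub>l T = \<sigma>\<^sub>l / 3\<close> forces \<open>h\<^sup>2\<close> to be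
  scalar, that is \<open>\<sigma>\<^sup>T = 0\<close> and \<open>\<nabla>T = 0\<close>. As \<open>\<nabla>\<^sup>g\<close> and \<open>\<nabla>\<close> differ by the action of \<open>T\<close> on itself, which is
  \<open>\<sigma>\<^sup>T\<close>, also \<open>\<nabla>\<^sup>g T = 0\<close>; since \<open>\<nabla>\<^sup>g\<close> is torsion free and preserves the Hodge star, \<open>T\<close> and \<open>*T\<close> are closed.\<close>

section \<open>The model form in components\<close>

text \<open>The metric and the star rest on \<open>G2_coframe\<close>, picked by \<open>SOME\<close>
  at each point, so nothing built on it is visibly differentiable. All contractions are moved to the
  dual frame of a smooth adapted coframe; this is legitimate because two adapted coframes of one
  form differ by an orthogonal matrix of determinant one. In such a frame the parallel form \<phi>
  has constant components, so the connection form lies in g_2 and each algebraic identity between T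
  and R may be differentiated covariantly.

  Two facts carry the algebra. As g_2 is the eigenspace of eigenvalue -2 for contraction with the
  Hodge dual of \<phi>, this contraction turns either pair of indices of R into a Ricci trace; it is
  also injective on 4-forms, which is why Ricci flatness kills the antisymmetrization. At the end,
  constant type controls only a 7-dimensional part of the 4-form \<sigma>, namely its contraction
  with \<phi>. The spinors give more because T acts on them by a symmetric operator, so that an
  identity between a square and a negative multiple of a norm forces both to vanish.\<close>

datatype i7 = I1 | I2 | I3 | I4 | I5 | I6 | I7

lemma UNIV_i7: "UNIV = {I1, I2, I3, I4, I5, I6, I7}"
  using i7.exhaust by auto

instance i7 :: finite
  by standard (simp add: UNIV_i7)

lemma sum_i7: "(\<Sum>i\<in>UNIV. f i) = f I1 + (f I2 + (f I3 + (f I4 + (f I5 + (f I6 + f I7)))))"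
  by (simp add: UNIV_i7)

text \<open>Frames are indexed by \<open>{1..7}\<close>, but a seven-element type allows sums over
  \<open>UNIV\<close> and exhaustive case splits. The order given by \<open>ix\<close> also serves
  to orient antisymmetry rules for rewriting.\<close>

primrec ix :: "i7 \<Rightarrow> nat" where
  "ix I1 = 1" | "ix I2 = 2" | "ix I3 = 3" | "ix I4 = 4" | "ix I5 = 5" | "ix I6 = 6" | "ix I7 = 7"

lemma range_ix: "range ix = {1..7}"
  by (auto simp: UNIV_i7)

lemma inj_ix: "inj ix"
  by (rule injI, rename_tac a b, case_tac a; case_tac b; simp)

lemma sum_ix: "(\<Sum>i=1..7. f i) = (\<Sum>i\<in>UNIV. f (ix i))"
  unfolding range_ix[symmetric] by (simp add: sum.reindex inj_ix)

text \<open>The Fano plane: two distinct indices lie in exactly one of the seven triples of the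
  model form, and the entry is the third index. The diagonal entries are arbitrary, since
  \<open>cross_sign\<close> vanishes there. Contractions of \<open>phi0\<close> over one index thus
  collapse to a single term.\<close>

primrec cross_index :: "i7 \<Rightarrow> i7 \<Rightarrow> i7" where
"cross_index I1 b = (case b of I1 \<Rightarrow> I1 | I2 \<Rightarrow> I7 | I3 \<Rightarrow> I5 | I4 \<Rightarrow> I6 | I5 \<Rightarrow> I3 | I6 \<Rightarrow> I4 | I7 \<Rightarrow> I2)"
| "cross_index I2 b = (case b of I1 \<Rightarrow> I7 | I2 \<Rightarrow> I1 | I3 \<Rightarrow> I6 | I4 \<Rightarrow> I5 | I5 \<Rightarrow> I4 | I6 \<Rightarrow> I3 | I7 \<Rightarrow> I1)"
| "cross_index I3 b = (case b of I1 \<Rightarrow> I5 | I2 \<Rightarrow> I6 | I3 \<Rightarrow> I1 | I4 \<Rightarrow> I7 | I5 \<Rightarrow> I1 | I6 \<Rightarrow> I2 | I7 \<Rightarrow> I4)"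
| "cross_index I4 b = (case b of I1 \<Rightarrow> I6 | I2 \<Rightarrow> I5 | I3 \<Rightarrow> I7 | I4 \<Rightarrow> I1 | I5 \<Rightarrow> I2 | I6 \<Rightarrow> I1 | I7 \<Rightarrow> I3)"
| "cross_index I5 b = (case b of I1 \<Rightarrow> I3 | I2 \<Rightarrow> I4 | I3 \<Rightarrow> I1 | I4 \<Rightarrow> I2 | I5 \<Rightarrow> I1 | I6 \<Rightarrow> I7 | I7 \<Rightarrow> I6)"
| "cross_index I6 b = (case b of I1 \<Rightarrow> I4 | I2 \<Rightarrow> I3 | I3 \<Rightarrow> I2 | I4 \<Rightarrow> I1 | I5 \<Rightarrow> I7 | I6 \<Rightarrow> I1 | I7 \<Rightarrow> I5)"
| "cross_index I7 b = (case b of I1 \<Rightarrow> I2 | I2 \<Rightarrow> I1 | I3 \<Rightarrow> I4 | I4 \<Rightarrow> I3 | I5 \<Rightarrow> I6 | I6 \<Rightarrow> I5 | I7 \<Rightarrow> I1)"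

primrec cross_sign :: "i7 \<Rightarrow> i7 \<Rightarrow> real" where
"cross_sign I1 b = (case b of I1 \<Rightarrow> 0 | I2 \<Rightarrow> 1 | I3 \<Rightarrow> 1 | I4 \<Rightarrow> -1 | I5 \<Rightarrow> -1 | I6 \<Rightarrow> 1 | I7 \<Rightarrow> -1)"
| "cross_sign I2 b = (case b of I1 \<Rightarrow> -1 | I2 \<Rightarrow> 0 | I3 \<Rightarrow> -1 | I4 \<Rightarrow> -1 | I5 \<Rightarrow> 1 | I6 \<Rightarrow> 1 | I7 \<Rightarrow> 1)"
| "cross_sign I3 b = (case b of I1 \<Rightarrow> -1 | I2 \<Rightarrow> 1 | I3 \<Rightarrow> 0 | I4 \<Rightarrow> 1 | I5 \<Rightarrow> 1 | I6 \<Rightarrow> -1 | I7 \<Rightarrow> -1)"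
| "cross_sign I4 b = (case b of I1 \<Rightarrow> 1 | I2 \<Rightarrow> 1 | I3 \<Rightarrow> -1 | I4 \<Rightarrow> 0 | I5 \<Rightarrow> -1 | I6 \<Rightarrow> -1 | I7 \<Rightarrow> 1)"
| "cross_sign I5 b = (case b of I1 \<Rightarrow> 1 | I2 \<Rightarrow> -1 | I3 \<Rightarrow> -1 | I4 \<Rightarrow> 1 | I5 \<Rightarrow> 0 | I6 \<Rightarrow> 1 | I7 \<Rightarrow> -1)"
| "cross_sign I6 b = (case b of I1 \<Rightarrow> -1 | I2 \<Rightarrow> -1 | I3 \<Rightarrow> 1 | I4 \<Rightarrow> 1 | I5 \<Rightarrow> -1 | I6 \<Rightarrow> 0 | I7 \<Rightarrow> 1)"
| "cross_sign I7 b = (case b of I1 \<Rightarrow> 1 | I2 \<Rightarrow> -1 | I3 \<Rightarrow> 1 | I4 \<Rightarrow> -1 | I5 \<Rightarrow> 1 | I6 \<Rightarrow> -1 | I7 \<Rightarrow> 0)"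

definition phi0 :: "i7 \<Rightarrow> i7 \<Rightarrow> i7 \<Rightarrow> real" where
  "phi0 a b c = (if c = cross_index a b then cross_sign a b else 0)"

definition dl :: "i7 \<Rightarrow> i7 \<Rightarrow> real" where
  "dl a b = (if a = b then 1 else 0)"

lemma dl_sym: "dl a b = dl b a" by (simp add: dl_def)

lemma sum_dl [simp]: "(\<Sum>a\<in>UNIV. dl a b * f a) = f b" "(\<Sum>a\<in>UNIV. dl b a * f a) = f b"
  "(\<Sum>a\<in>UNIV. f a * dl a b) = f b" "(\<Sum>a\<in>UNIV. f a * dl b a) = f b"
  by (simp_all add: dl_def if_distrib[of "\<lambda>x. x * _"] if_distrib[of "\<lambda>x. _ * x"] cong: if_cong)

lemma phi0_swap12: "phi0 a b c = - phi0 b a c"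
  by (cases a; cases b; cases c; simp add: phi0_def)

lemma phi0_swap23: "phi0 a b c = - phi0 a c b"
  by (cases a; cases b; cases c; simp add: phi0_def)

lemma phi0_cycle: "phi0 a b c = phi0 b c a"
  using phi0_swap12 phi0_swap23 by (metis minus_minus)

lemma sum_phi0_left: "(\<Sum>k\<in>UNIV. phi0 a b k * f k) = cross_sign a b * f (cross_index a b)"
  by (simp add: phi0_def if_distrib[of "\<lambda>x. x * _"] cong: if_cong)

text \<open>The components of the Hodge dual of \<phi>, introduced so that the contraction identity
  holds by definition. Agreement with the star is \<open>star_phi0\<close>.\<close>

definition psi0 :: "i7 \<Rightarrow> i7 \<Rightarrow> i7 \<Rightarrow> i7 \<Rightarrow> real" where
  "psi0 a b c d = (\<Sum>k\<in>UNIV. phi0 a b k * phi0 c d k) - dl a c * dl b d + dl a d * dl b c"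

lemma phi0_phi0: "(\<Sum>k\<in>UNIV. phi0 a b k * phi0 c d k) = psi0 a b c d + dl a c * dl b d - dl a d * dl b c"
  by (simp add: psi0_def)

lemma psi0_swap12: "psi0 a b c d = - psi0 b a c d"
  by (simp add: psi0_def phi0_swap12[of a b] sum_negf)

lemma psi0_swap34: "psi0 a b c d = - psi0 a b d c"
  by (simp add: psi0_def phi0_swap12[of c d] sum_negf)

lemma psi0_explicit: "psi0 a b c d = (if cross_index a b = cross_index c d then cross_sign a b * cross_sign c d else 0)
   - dl a c * dl b d + dl a d * dl b c"
  by (simp add: psi0_def sum_phi0_left) (simp add: phi0_def)

text \<open>The one symmetry that the definition hides; with skewness in each pair it makes
  \<open>psi0\<close> totally antisymmetric.\<close>

lemma psi0_swap23: "psi0 a b c d = - psi0 a c b d"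
  by (cases a; cases b; cases c; cases d; simp add: psi0_explicit dl_def)

lemma sum_rot3: "(\<Sum>x\<in>X. \<Sum>y\<in>Y. \<Sum>z\<in>Z. f x y z) = (\<Sum>y\<in>Y. \<Sum>z\<in>Z. \<Sum>x\<in>X. f x y z)"
proof -
  have "(\<Sum>x\<in>X. \<Sum>y\<in>Y. \<Sum>z\<in>Z. f x y z) = (\<Sum>y\<in>Y. \<Sum>x\<in>X. \<Sum>z\<in>Z. f x y z)" by (rule sum.swap)
  also have "\<dots> = (\<Sum>y\<in>Y. \<Sum>z\<in>Z. \<Sum>x\<in>X. f x y z)" by (intro sum.cong refl sum.swap)
  finally show ?thesis .
qed

text \<open>The trace of the contraction identity: \<open>psi0\<close> has no trace, one delta term
  contributes 7 and the other takes away 1.\<close>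

lemma phi0_contr2: "(\<Sum>a\<in>UNIV. \<Sum>b\<in>UNIV. phi0 a b c * phi0 a b d) = 6 * dl c d"
proof -
  have "(\<Sum>a\<in>UNIV. \<Sum>b\<in>UNIV. phi0 a b c * phi0 a b d) = (\<Sum>a\<in>UNIV. \<Sum>b\<in>UNIV. phi0 c a b * phi0 d a b)"
    by (simp only: phi0_cycle[of c] phi0_cycle[of d])
  also have "\<dots> = (\<Sum>a\<in>UNIV. psi0 c a d a + dl c d * dl a a - dl c a * dl a d)"
    by (simp only: phi0_phi0)
  also have "\<dots> = 6 * dl c d"
  proof -
    have "psi0 c a d a = 0" for a using psi0_swap12[of c a d a] psi0_swap23[of c a d a] psi0_swap34[of c d a a] by simp
    then show ?thesis by (cases c; cases d; simp add: sum_i7 dl_def)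
  qed
  finally show ?thesis .
qed

lemma psi0_phi0_contr: "(\<Sum>c\<in>UNIV. \<Sum>d\<in>UNIV. psi0 a b c d * phi0 c d k) = 4 * phi0 a b k"
proof -
  have "(\<Sum>c\<in>UNIV. \<Sum>d\<in>UNIV. psi0 a b c d * phi0 c d k)
     = (\<Sum>c\<in>UNIV. \<Sum>d\<in>UNIV. \<Sum>m\<in>UNIV. phi0 a b m * (phi0 c d m * phi0 c d k))
       - (\<Sum>c\<in>UNIV. \<Sum>d\<in>UNIV. dl a c * (dl b d * phi0 c d k)) + (\<Sum>c\<in>UNIV. \<Sum>d\<in>UNIV. dl a d * (dl b c * phi0 c d k))"
    by (simp only: psi0_def left_diff_distrib distrib_right sum_distrib_right sum.distrib sum_subtractf mult.assoc)
  also have "(\<Sum>c\<in>UNIV. \<Sum>d\<in>UNIV. \<Sum>m\<in>UNIV. phi0 a b m * (phi0 c d m * phi0 c d k))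
     = (\<Sum>m\<in>UNIV. phi0 a b m * (\<Sum>c\<in>UNIV. \<Sum>d\<in>UNIV. phi0 c d m * phi0 c d k))"
    by (subst sum_rot3[symmetric]) (simp only: sum_distrib_left)
  also have "\<dots> = 6 * phi0 a b k" by (simp add: phi0_contr2 mult.left_commute[of _ 6] sum_distrib_left[symmetric])
  also have "(\<Sum>c\<in>UNIV. \<Sum>d\<in>UNIV. dl a c * (dl b d * phi0 c d k)) = phi0 a b k"
    by (simp add: sum_distrib_left[symmetric])
  also have "(\<Sum>c\<in>UNIV. \<Sum>d\<in>UNIV. dl a d * (dl b c * phi0 c d k)) = phi0 b a k"
    by (simp add: mult.left_commute[of "dl a _"] sum_distrib_left[symmetric])
  finally show ?thesis by (simp add: phi0_swap12[of b a])
qed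

text \<open>Contracting the hypothesis with a second \<open>phi0\<close> brings in the identity for
  a product of two \<open>phi0\<close>; its two delta terms produce the eigenvalue -2. Used for the
  first pair of indices of R, where g_2 enters through the instanton condition.\<close>

lemma g2_psi_of_contr:
  assumes contr: "\<And>k. (\<Sum>a\<in>UNIV. \<Sum>b\<in>UNIV. \<alpha> a b * phi0 a b k) = 0" and sk: "\<And>a b. \<alpha> a b = - \<alpha> b a"
  shows "(\<Sum>a\<in>UNIV. \<Sum>b\<in>UNIV. \<alpha> a b * psi0 a b c d) = - 2 * \<alpha> c d"
proof -
  have "0 = (\<Sum>k\<in>UNIV. (\<Sum>a\<in>UNIV. \<Sum>b\<in>UNIV. \<alpha> a b * phi0 a b k) * phi0 c d k)" by (simp add: contr)
  also have "\<dots> = (\<Sum>k\<in>UNIV. \<Sum>a\<in>UNIV. \<Sum>b\<in>UNIV. \<alpha> a b * (phi0 a b k * phi0 c d k))"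
    by (simp only: sum_distrib_right mult.assoc)
  also have "\<dots> = (\<Sum>a\<in>UNIV. \<Sum>b\<in>UNIV. \<alpha> a b * (\<Sum>k\<in>UNIV. phi0 a b k * phi0 c d k))"
    by (subst sum_rot3) (simp only: sum_distrib_left)
  also have "\<dots> = (\<Sum>a\<in>UNIV. \<Sum>b\<in>UNIV. \<alpha> a b * psi0 a b c d)
     + (\<Sum>a\<in>UNIV. \<Sum>b\<in>UNIV. dl a c * (dl b d * \<alpha> a b)) - (\<Sum>a\<in>UNIV. \<Sum>b\<in>UNIV. dl a d * (dl b c * \<alpha> a b))"
    by (simp only: phi0_phi0 right_diff_distrib distrib_left sum.distrib sum_subtractf mult_ac)
  also have "(\<Sum>a\<in>UNIV. \<Sum>b\<in>UNIV. dl a c * (dl b d * \<alpha> a b)) = \<alpha> c d"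
    by (simp add: sum_distrib_left[symmetric])
  also have "(\<Sum>a\<in>UNIV. \<Sum>b\<in>UNIV. dl a d * (dl b c * \<alpha> a b)) = \<alpha> d c"
    by (simp add: sum_distrib_left[symmetric])
  finally show ?thesis using sk[of d c] by simp
qed

text \<open>The same eigenvalue from infinitesimal invariance of \<phi>: contraction with
  \<open>phi0 a b d\<close> gives \<open>2 * S1 + 6 * \<alpha> c d = 0\<close>, and
  \<open>S1\<close> is the left side minus \<alpha>. Used for the last pair of indices of R, where
  g_2 enters through the parallel form.\<close>

lemma g2_psi_of_inv:
  assumes inv: "\<And>a b c. (\<Sum>s\<in>UNIV. \<alpha> a s * phi0 s b c + \<alpha> b s * phi0 a s c + \<alpha> c s * phi0 a b s) = 0"
    and sk: "\<And>a b. \<alpha> a b = - \<alpha> b a"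
  shows "(\<Sum>a\<in>UNIV. \<Sum>b\<in>UNIV. \<alpha> a b * psi0 a b c d) = - 2 * \<alpha> c d"
proof -
  define S1 where "S1 = (\<Sum>a\<in>UNIV. \<Sum>b\<in>UNIV. \<Sum>s\<in>UNIV. \<alpha> a s * phi0 s b c * phi0 a b d)"
  have "0 = (\<Sum>a\<in>UNIV. \<Sum>b\<in>UNIV. (\<Sum>s\<in>UNIV. \<alpha> a s * phi0 s b c + \<alpha> b s * phi0 a s c + \<alpha> c s * phi0 a b s) * phi0 a b d)"
    by (simp only: inv) simp
  also have "\<dots> = S1 + (\<Sum>a\<in>UNIV. \<Sum>b\<in>UNIV. \<Sum>s\<in>UNIV. \<alpha> b s * phi0 a s c * phi0 a b d)
     + (\<Sum>a\<in>UNIV. \<Sum>b\<in>UNIV. \<Sum>s\<in>UNIV. \<alpha> c s * (phi0 a b s * phi0 a b d))"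
    by (simp only: S1_def sum_distrib_right distrib_right sum.distrib mult.assoc)
  also have "(\<Sum>a\<in>UNIV. \<Sum>b\<in>UNIV. \<Sum>s\<in>UNIV. \<alpha> b s * phi0 a s c * phi0 a b d) = S1"
    unfolding S1_def by (subst sum.swap, intro sum.cong refl, subst (1 2) phi0_swap12, simp)
  also have "(\<Sum>a\<in>UNIV. \<Sum>b\<in>UNIV. \<Sum>s\<in>UNIV. \<alpha> c s * (phi0 a b s * phi0 a b d)) = 6 * \<alpha> c d"
    by (subst sum_rot3[symmetric]) (simp add: sum_distrib_left[symmetric] phi0_contr2 mult.left_commute[of _ 6])
  also have "S1 = (\<Sum>a\<in>UNIV. \<Sum>s\<in>UNIV. \<alpha> a s * (\<Sum>b\<in>UNIV. phi0 c s b * phi0 d a b))"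
  proof -
    have "S1 = (\<Sum>a\<in>UNIV. \<Sum>s\<in>UNIV. \<Sum>b\<in>UNIV. \<alpha> a s * phi0 s b c * phi0 a b d)"
      unfolding S1_def by (intro sum.cong[OF refl] sum.swap)
    then show ?thesis
      by (simp only: sum_distrib_left mult.assoc phi0_cycle[of c] phi0_cycle[of d])
  qed
  also have "\<dots> = (\<Sum>a\<in>UNIV. \<Sum>s\<in>UNIV. \<alpha> a s * psi0 a s c d)
     + (\<Sum>a\<in>UNIV. \<Sum>s\<in>UNIV. dl c d * (dl s a * \<alpha> a s)) - (\<Sum>a\<in>UNIV. \<Sum>s\<in>UNIV. dl c a * (dl s d * \<alpha> a s))"
  proof -
    have *: "psi0 c s d a = psi0 a s c d" for a s
      using psi0_swap12 psi0_swap23 psi0_swap34 by (metis minus_minus)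
    have "\<alpha> a s * (\<Sum>b\<in>UNIV. phi0 c s b * phi0 d a b)
        = \<alpha> a s * psi0 a s c d + dl c d * (dl s a * \<alpha> a s) - dl c a * (dl s d * \<alpha> a s)" for a s
      unfolding phi0_phi0 * by (simp add: algebra_simps)
    then show ?thesis by (simp only: sum.distrib sum_subtractf)
  qed
  also have "(\<Sum>a\<in>UNIV. \<Sum>s\<in>UNIV. dl c d * (dl s a * \<alpha> a s)) = 0"
    using equal_neg_zero[of "\<alpha> _ _"] sk[of a a for a] by (simp add: sum_distrib_left[symmetric])
  also have "(\<Sum>a\<in>UNIV. \<Sum>s\<in>UNIV. dl c a * (dl s d * \<alpha> a s)) = \<alpha> c d"
    by (simp add: sum_distrib_left[symmetric])
  finally show ?thesis by simp
qed

text \<open>The seven linear conditions express seven of the 21 components through the other 14, the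
  dimension of g_2; substitution then verifies invariance entry by entry.\<close>

lemma g2_inv_of_contr:
  assumes contr: "\<And>k. (\<Sum>a\<in>UNIV. \<Sum>b\<in>UNIV. \<alpha> a b * phi0 a b k) = 0" and sk: "\<And>a b. \<alpha> a b = - \<alpha> b a"
  shows "(\<Sum>s\<in>UNIV. \<alpha> a s * phi0 s b c + \<alpha> b s * phi0 a s c + \<alpha> c s * phi0 a b s) = 0"
proof -
  have d: "\<alpha> x x = 0" for x using sk[of x x] by simp
  \<comment> \<open>Guarded by the order of the indices, antisymmetry becomes a terminating rewrite
    rule. The same device is used in the later finite checks.\<close>
  have o: "ix y < ix x \<Longrightarrow> \<alpha> x y = - \<alpha> y x" for x y by (rule sk)
  note eqs = contr[of I1] contr[of I2] contr[of I3] contr[of I4] contr[of I5] contr[of I6] contr[of I7]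
  have e: "\<alpha> I1 I2 = - \<alpha> I3 I4 - \<alpha> I5 I6" "\<alpha> I1 I3 = \<alpha> I2 I4 - \<alpha> I6 I7" "\<alpha> I1 I4 = - \<alpha> I2 I3 - \<alpha> I5 I7"
     "\<alpha> I1 I5 = \<alpha> I2 I6 + \<alpha> I4 I7"
     "\<alpha> I1 I6 = - \<alpha> I2 I5 + \<alpha> I3 I7" "\<alpha> I1 I7 = - \<alpha> I3 I6 - \<alpha> I4 I5" "\<alpha> I2 I7 = - \<alpha> I3 I5 + \<alpha> I4 I6"
    using eqs by (simp_all add: sum_i7 phi0_def o d)
  show ?thesis
    by (cases a; cases b; cases c; simp add: sum_i7 phi0_def o d e)
qed

section \<open>Algebraic curvature and torsion identities\<close>

lemma sum_rot4: "(\<Sum>x\<in>X. \<Sum>y\<in>Y. \<Sum>z\<in>Z. \<Sum>w\<in>U. f x y z w) = (\<Sum>y\<in>Y. \<Sum>z\<in>Z. \<Sum>w\<in>U. \<Sum>x\<in>X. f x y z w)"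
proof -
  have "(\<Sum>x\<in>X. \<Sum>y\<in>Y. \<Sum>z\<in>Z. \<Sum>w\<in>U. f x y z w) = (\<Sum>y\<in>Y. \<Sum>x\<in>X. \<Sum>z\<in>Z. \<Sum>w\<in>U. f x y z w)" by (rule sum.swap)
  also have "\<dots> = (\<Sum>y\<in>Y. \<Sum>z\<in>Z. \<Sum>w\<in>U. \<Sum>x\<in>X. f x y z w)" by (intro sum.cong refl sum_rot3)
  finally show ?thesis .
qed

text \<open>The 35 unknowns decouple. The equations with a = b involve only the seven components on
  which \<open>psi0\<close> is nonzero; the equations for the three pairs a, b with a common
  \<open>cross_index\<close> involve four further components. This gives one block of seven and
  seven blocks of four, each solved separately.\<close>

lemma alt4_zero:
  assumes s12: "\<And>i j k l. \<alpha> i j k l = - \<alpha> j i k l" and s23: "\<And>i j k l. \<alpha> i j k l = - \<alpha> i k j l"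
    and s34: "\<And>i j k l. \<alpha> i j k l = - \<alpha> i j l k"
    and c: "\<And>a b. (\<Sum>i\<in>UNIV. \<Sum>j\<in>UNIV. \<Sum>k\<in>UNIV. \<alpha> i j k a * psi0 i j k b) = 0"
  shows "\<alpha> i j k l = (0::real)"
proof -
  have d12: "\<alpha> i i k l = 0" for i k l using s12[of i i k l] by simp
  have d23: "\<alpha> i k k l = 0" for i k l using s23[of i k k l] by simp
  have d34: "\<alpha> i k l l = 0" for i k l using s34[of i k l l] by simp
  have o12: "ix j < ix i \<Longrightarrow> \<alpha> i j k l = - \<alpha> j i k l" for i j k l by (rule s12)
  have o23: "ix k < ix j \<Longrightarrow> \<alpha> i j k l = - \<alpha> i k j l" for i j k l by (rule s23)
  have o34: "ix l < ix k \<Longrightarrow> \<alpha> i j k l = - \<alpha> i j l k" for i j k l by (rule s34)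
  note o = d12 d23 d34 o12 o23 o34
  note p = sum_i7 psi0_explicit dl_def
  have z1: "\<alpha> I1 I2 I3 I4 = 0 \<and> \<alpha> I1 I2 I5 I6 = 0 \<and> \<alpha> I1 I3 I6 I7 = 0 \<and> \<alpha> I1 I4 I5 I7 = 0 \<and> \<alpha> I2 I3 I5 I7 = 0 \<and> \<alpha> I2 I4 I6 I7 = 0 \<and> \<alpha> I3 I4 I5 I6 = 0"
    using c[of I1 I1]
    c[of I2 I2]
    c[of I3 I3]
    c[of I4 I4]
    c[of I5 I5]
    c[of I6 I6]
    c[of I7 I7]
    by (simp add: p o)
  have z2: "\<alpha> I1 I3 I5 I7 = 0 \<and> \<alpha> I1 I4 I6 I7 = 0 \<and> \<alpha> I2 I3 I6 I7 = 0 \<and> \<alpha> I2 I4 I5 I7 = 0"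
    using c[of I1 I2]
    c[of I2 I1]
    c[of I3 I4]
    c[of I4 I3]
    c[of I5 I6]
    c[of I6 I5]
    by (simp add: p o)
  have z3: "\<alpha> I1 I2 I5 I7 = 0 \<and> \<alpha> I1 I4 I5 I6 = 0 \<and> \<alpha> I2 I3 I5 I6 = 0 \<and> \<alpha> I3 I4 I5 I7 = 0"
    using c[of I1 I3]
    c[of I2 I4]
    c[of I3 I1]
    c[of I4 I2]
    c[of I6 I7]
    c[of I7 I6]
    by (simp add: p o)
  have z4: "\<alpha> I1 I2 I6 I7 = 0 \<and> \<alpha> I1 I3 I5 I6 = 0 \<and> \<alpha> I2 I4 I5 I6 = 0 \<and> \<alpha> I3 I4 I6 I7 = 0"
    using c[of I1 I4]
    c[of I2 I3]
    c[of I3 I2]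
    c[of I4 I1]
    c[of I5 I7]
    c[of I7 I5]
    by (simp add: p o)
  have z5: "\<alpha> I1 I2 I3 I7 = 0 \<and> \<alpha> I1 I3 I4 I6 = 0 \<and> \<alpha> I2 I3 I4 I5 = 0 \<and> \<alpha> I3 I5 I6 I7 = 0"
    using c[of I1 I5]
    c[of I2 I6]
    c[of I4 I7]
    c[of I5 I1]
    c[of I6 I2]
    c[of I7 I4]
    by (simp add: p o)
  have z6: "\<alpha> I1 I2 I4 I7 = 0 \<and> \<alpha> I1 I3 I4 I5 = 0 \<and> \<alpha> I2 I3 I4 I6 = 0 \<and> \<alpha> I4 I5 I6 I7 = 0"
    using c[of I1 I6]
    c[of I2 I5]
    c[of I3 I7]
    c[of I5 I2]
    c[of I6 I1]
    c[of I7 I3]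
    by (simp add: p o)
  have z7: "\<alpha> I1 I2 I3 I5 = 0 \<and> \<alpha> I1 I2 I4 I6 = 0 \<and> \<alpha> I2 I3 I4 I7 = 0 \<and> \<alpha> I2 I5 I6 I7 = 0"
    using c[of I1 I7]
    c[of I3 I6]
    c[of I4 I5]
    c[of I5 I4]
    c[of I6 I3]
    c[of I7 I1]
    by (simp add: p o)
  have z8: "\<alpha> I1 I2 I3 I6 = 0 \<and> \<alpha> I1 I2 I4 I5 = 0 \<and> \<alpha> I1 I3 I4 I7 = 0 \<and> \<alpha> I1 I5 I6 I7 = 0"
    using c[of I2 I7]
    c[of I3 I5]
    c[of I4 I6]
    c[of I5 I3]
    c[of I6 I4]
    c[of I7 I2]
    by (simp add: p o)
  show ?thesis
    by (cases i; cases j; cases k; cases l; simp add: o z1 z2 z3 z4 z5 z6 z7 z8)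
qed

text \<open>The six terms form, up to a factor, the total antisymmetrization of R. Contracted with
  \<open>psi0\<close> over three indices, each term becomes a multiple of a Ricci trace, by the
  eigenvalue -2 on the first or on the last pair; \<open>alt4_zero\<close> concludes.\<close>

lemma curvature_alt_zero:
  fixes R :: "i7 \<Rightarrow> i7 \<Rightarrow> i7 \<Rightarrow> i7 \<Rightarrow> real"
  assumes r12: "\<And>i j k l. R i j k l = - R j i k l" and r34: "\<And>i j k l. R i j k l = - R i j l k"
    and p12: "\<And>i j c d. (\<Sum>a\<in>UNIV. \<Sum>b\<in>UNIV. R a b i j * psi0 a b c d) = - 2 * R c d i j"
    and p34: "\<And>i j c d. (\<Sum>a\<in>UNIV. \<Sum>b\<in>UNIV. R i j a b * psi0 a b c d) = - 2 * R i j c d"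
    and ric: "\<And>x y. (\<Sum>a\<in>UNIV. R a x y a) = 0"
  shows "R i j k l + R j k i l + R k i j l + R k l i j + R i l j k + R j l k i = 0"
proof (rule alt4_zero[of "\<lambda>i j k l. R i j k l + R j k i l + R k i j l + R k l i j + R i l j k + R j l k i"])
  fix i j k l
  show "R i j k l + R j k i l + R k i j l + R k l i j + R i l j k + R j l k i
     = - (R j i k l + R i k j l + R k j i l + R k l j i + R j l i k + R i l k j)"
    using r12[of i j k l] r12[of j k i l] r12[of k i j l] r34[of k l i j] r34[of i l j k] r34[of j l k i] by linarith
  show "R i j k l + R j k i l + R k i j l + R k l i j + R i l j k + R j l k i
     = - (R i k j l + R k j i l + R j i k l + R j l i k + R i l k j + R k l j i)"
    using r12[of i j k l] r12[of j k i l] r12[of k i j l] r34[of k l i j] r34[of i l j k] r34[of j l k i] by linarith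
  show "R i j k l + R j k i l + R k i j l + R k l i j + R i l j k + R j l k i
     = - (R i j l k + R j l i k + R l i j k + R l k i j + R i k j l + R j k l i)"
    using r34[of i j k l] r34[of j l k i] r12[of i l j k] r12[of k l i j] r12[of k i j l] r34[of j k i l] by linarith
next
  fix a b
  have X: "(\<Sum>i\<in>UNIV. \<Sum>j\<in>UNIV. \<Sum>k\<in>UNIV. R i j k a * psi0 i j k b) = 0"
  proof -
    have "(\<Sum>i\<in>UNIV. \<Sum>j\<in>UNIV. \<Sum>k\<in>UNIV. R i j k a * psi0 i j k b)
       = (\<Sum>k\<in>UNIV. \<Sum>i\<in>UNIV. \<Sum>j\<in>UNIV. R i j k a * psi0 i j k b)" by (rule sum_rot3[symmetric])
    also have "\<dots> = (\<Sum>k\<in>UNIV. 2 * R k b a k)"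
      by (intro sum.cong refl, simp only: p12) (subst r34, simp)
    finally show ?thesis by (simp add: ric sum_distrib_left[symmetric])
  qed
  have Y: "(\<Sum>i\<in>UNIV. \<Sum>j\<in>UNIV. \<Sum>k\<in>UNIV. R k a i j * psi0 i j k b) = 0"
  proof -
    have "(\<Sum>i\<in>UNIV. \<Sum>j\<in>UNIV. \<Sum>k\<in>UNIV. R k a i j * psi0 i j k b)
       = (\<Sum>k\<in>UNIV. \<Sum>i\<in>UNIV. \<Sum>j\<in>UNIV. R k a i j * psi0 i j k b)" by (rule sum_rot3[symmetric])
    also have "\<dots> = (\<Sum>k\<in>UNIV. 2 * R k a b k)"
      by (intro sum.cong refl, simp only: p34) (subst r34, simp)
    finally show ?thesis by (simp add: ric sum_distrib_left[symmetric])
  qed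
  have cyc: "psi0 i j k b = psi0 j k i b" for i j k
    using psi0_swap12 psi0_swap23 by (metis minus_minus)
  have X1: "(\<Sum>i\<in>UNIV. \<Sum>j\<in>UNIV. \<Sum>k\<in>UNIV. R j k i a * psi0 i j k b) = 0"
    by (subst cyc, subst sum_rot3, rule X)
  have X2: "(\<Sum>i\<in>UNIV. \<Sum>j\<in>UNIV. \<Sum>k\<in>UNIV. R k i j a * psi0 i j k b) = 0"
    by (subst cyc[symmetric], subst sum_rot3[symmetric], rule X)
  have Y1: "(\<Sum>i\<in>UNIV. \<Sum>j\<in>UNIV. \<Sum>k\<in>UNIV. R i a j k * psi0 i j k b) = 0"
    by (subst cyc, subst sum_rot3, rule Y)
  have Y2: "(\<Sum>i\<in>UNIV. \<Sum>j\<in>UNIV. \<Sum>k\<in>UNIV. R j a k i * psi0 i j k b) = 0"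
    by (subst cyc[symmetric], subst sum_rot3[symmetric], rule Y)
  show "(\<Sum>i\<in>UNIV. \<Sum>j\<in>UNIV. \<Sum>k\<in>UNIV. (R i j k a + R j k i a + R k i j a + R k a i j + R i a j k + R j a k i) * psi0 i j k b) = 0"
    by (simp only: distrib_right sum.distrib X X1 X2 Y Y1 Y2)
qed

text \<open>The components of \<open>\<sigma>\<^sup>T\<close>; equivalently the Jacobi expression of
  the bracket with structure constants T.\<close>

definition sig :: "(i7 \<Rightarrow> i7 \<Rightarrow> i7 \<Rightarrow> real) \<Rightarrow> i7 \<Rightarrow> i7 \<Rightarrow> i7 \<Rightarrow> i7 \<Rightarrow> real" where
  "sig T i j k l = (\<Sum>s\<in>UNIV. T i j s * T s k l + T j k s * T s i l + T k i s * T s j l)"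

definition alt3 :: "(i7 \<Rightarrow> i7 \<Rightarrow> i7 \<Rightarrow> real) \<Rightarrow> bool" where
  "alt3 T \<longleftrightarrow> (\<forall>i j k. T i j k = - T j i k \<and> T i j k = - T i k j)"

lemma alt3_swap12: "alt3 T \<Longrightarrow> T i j k = - T j i k"
  and alt3_swap23: "alt3 T \<Longrightarrow> T i j k = - T i k j"
  and alt3_cycle: "alt3 T \<Longrightarrow> T i j k = T j k i"
  unfolding alt3_def by (blast, blast, metis minus_minus)

lemma sig_swap12: assumes "alt3 T" shows "sig T i j k l = - sig T j i k l"
  unfolding sig_def sum_negf[symmetric]
proof (intro sum.cong refl)
  fix s show "T i j s * T s k l + T j k s * T s i l + T k i s * T s j l
       = - (T j i s * T s k l + T i k s * T s j l + T k j s * T s i l)"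
    by (subst (1 3 5) alt3_swap12[OF assms]) simp
qed

lemma sig_cycle3: "sig T i j k l = sig T j k i l"
  by (simp add: sig_def algebra_simps)

lemma sig_swap34: assumes "alt3 T" shows "sig T i j k l = - sig T i j l k"
  unfolding sig_def sum_negf[symmetric]
proof (intro sum.cong refl)
  fix s
  have "T s l k = - T s k l" "T j l s = T s j l" "T s i k = - T k i s" "T l i s = - T s i l" "T s j k = T j k s"
    using alt3_swap12[OF assms] alt3_swap23[OF assms] by (metis minus_minus)+
  then show "T i j s * T s k l + T j k s * T s i l + T k i s * T s j l
       = - (T i j s * T s l k + T j l s * T s i k + T l i s * T s j k)"
    by simp
qed

lemma sum4_sq_zero:
  fixes b :: "i7 \<Rightarrow> i7 \<Rightarrow> i7 \<Rightarrow> i7 \<Rightarrow> real"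
  assumes "(\<Sum>i\<in>UNIV. \<Sum>j\<in>UNIV. \<Sum>k\<in>UNIV. \<Sum>l\<in>UNIV. b i j k l * b i j k l) = 0"
  shows "b i j k l = 0"
  using assms by (simp add: sum_nonneg_eq_0_iff sum_nonneg)

text \<open>Splitting \<open>R\<close> into its part symmetric and its part antisymmetric under exchange of the pairs, the
  contraction with \<open>\<nabla>T\<close> only sees the latter and is the square of its Bianchi sum.\<close>

lemma nabla_torsion_eq:
  fixes R nT :: "i7 \<Rightarrow> i7 \<Rightarrow> i7 \<Rightarrow> i7 \<Rightarrow> real"
  assumes r12: "\<And>i j k l. R i j k l = - R j i k l" and r34: "\<And>i j k l. R i j k l = - R i j l k"
    and alt: "\<And>i j k l. R i j k l + R j k i l + R k i j l + R k l i j + R i l j k + R j l k i = 0"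
    and T: "alt3 T" and nT: "\<And>a. alt3 (nT a)"
    and bianchi: "\<And>i j k l. R i j k l + R j k i l + R k i j l = nT i j k l + nT j k i l + nT k i j l + sig T i j k l"
    and orth: "(\<Sum>a\<in>UNIV. \<Sum>d\<in>UNIV. \<Sum>i\<in>UNIV. \<Sum>j\<in>UNIV. R a d i j * nT a d i j) = 0"
  shows "nT l i j k = sig T i j k l / 3" and "R i j k l + R j k i l + R k i j l = 0"
proof -
  define b where "b i j k l = R i j k l + R j k i l + R k i j l" for i j k l
  note s12 = sig_swap12[OF T] and s34 = sig_swap34[OF T]
  have s4: "sig T i j k l = - sig T j k l i" for i j k l
    using s12 s34 sig_cycle3 by (metis minus_minus)
  \<comment> \<open>The alternating sum of b over cyclic shifts vanishes by \<open>alt\<close>. With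
    \<open>bianchi\<close> inserted it reads 3 D + 4 \<sigma> = 0, where D is the alternating sum of
    the four terms of \<nabla>T. Since b is D + \<sigma> plus the term with derivative index l, the
    coefficient of \<sigma> is 1 - 4/3 = -1/3.\<close>
  have b1: "b i j k l = nT l i j k - sig T i j k l / 3" for i j k l
  proof -
    have n: "nT a i j k = nT a j k i" "nT a i j k = - nT a i k j" "nT a i j k = - nT a k j i" for a i j k
      using alt3_cycle[OF nT, of a i j k] alt3_swap23[OF nT, of a i j k] alt3_swap12[OF nT, of a j k i] by simp_all
    have "b i j k l - b j k l i + b k l i j - b l i j k = 0"
      unfolding b_def using alt[of i j k l]
        r34[of j k l i] r34[of k l j i] r12[of l j k i] r12[of l i k j] r34[of i l k j]
        r12[of i k l j] r34[of k i l j] r12[of l i j k] r34[of i j l k] r34[of j l i k]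
      by linarith
    then show ?thesis
      unfolding b_def bianchi
      using n(2)[of j k l i] n(3)[of k l j i] n(1)[of l i j k] n(1)[of k l i j] n(2)[of l i k j]
        n(1)[of i j k l] n(2)[of i j l k] n(3)[of j l i k] s4[of i j k l] s4[of j k l i] s4[of k l i j]
      by linarith
  qed
  have b3: "b i j k l = b j k i l" for i j k l by (simp add: b_def)
  \<comment> \<open>By \<open>alt\<close>, the cyclic sum over the last three indices is again a
    Bianchi sum.\<close>
  have b2: "R a d i j + R a i j d + R a j d i = b d i j a" for a d i j
    unfolding b_def using alt[of d i j a] r12[of j a d i] r12[of d a i j] r12[of i a j d] by linarith
  \<comment> \<open>Against a 4-form, R contributes only its total antisymmetrization, which is
    zero.\<close>
  have Rs: "(\<Sum>a\<in>UNIV. \<Sum>d\<in>UNIV. \<Sum>i\<in>UNIV. \<Sum>j\<in>UNIV. R a d i j * sig T d i j a) = 0"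
  proof -
    let ?S = "\<lambda>f :: i7 \<Rightarrow> i7 \<Rightarrow> i7 \<Rightarrow> i7 \<Rightarrow> real. \<Sum>i\<in>UNIV. \<Sum>j\<in>UNIV. \<Sum>k\<in>UNIV. \<Sum>l\<in>UNIV. f i j k l * sig T i j k l"
    have c3: "?S (\<lambda>i j k l. f j k i l) = ?S f" for f
    proof -
      have "?S (\<lambda>i j k l. f j k i l) = (\<Sum>i\<in>UNIV. \<Sum>j\<in>UNIV. \<Sum>k\<in>UNIV. \<Sum>l\<in>UNIV. f j k i l * sig T j k i l)"
        by (simp only: sig_cycle3[symmetric])
      also have "\<dots> = ?S f" by (rule sum_rot3)
      finally show ?thesis .
    qed
    have c4: "?S (\<lambda>i j k l. f j k l i) = - ?S f" for f
    proof -
      have "?S (\<lambda>i j k l. f j k l i) = - (\<Sum>i\<in>UNIV. \<Sum>j\<in>UNIV. \<Sum>k\<in>UNIV. \<Sum>l\<in>UNIV. f j k l i * sig T j k l i)"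
        by (subst s4) (simp only: mult_minus_right sum_negf)
      also have "(\<Sum>i\<in>UNIV. \<Sum>j\<in>UNIV. \<Sum>k\<in>UNIV. \<Sum>l\<in>UNIV. f j k l i * sig T j k l i) = ?S f" by (rule sum_rot4)
      finally show ?thesis .
    qed
    have "?S (\<lambda>i j k l. R k l i j) = ?S R"
      using c4[of "\<lambda>i j k l. R j k l i"] c4[of R] by simp
    moreover have "?S (\<lambda>i j k l. R i l j k) = ?S (\<lambda>i j k l. R k l i j)"
      using c3[of "\<lambda>i j k l. R k l i j"] by simp
    moreover have "?S (\<lambda>i j k l. R j l k i) = ?S (\<lambda>i j k l. R i l j k)"
      using c3[of "\<lambda>i j k l. R i l j k"] by simp
    moreover have "?S (\<lambda>i j k l. R j k i l) = ?S R" by (rule c3)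
    moreover have "?S (\<lambda>i j k l. R k i j l) = ?S (\<lambda>i j k l. R j k i l)"
      using c3[of "\<lambda>i j k l. R j k i l"] by simp
    moreover have "?S (\<lambda>i j k l. R i j k l + R j k i l + R k i j l + R k l i j + R i l j k + R j l k i) = 0"
      by (simp only: alt) simp
    ultimately have "?S R = 0"
      by (simp only: distrib_right sum.distrib)
    moreover have "(\<Sum>a\<in>UNIV. \<Sum>d\<in>UNIV. \<Sum>i\<in>UNIV. \<Sum>j\<in>UNIV. R a d i j * sig T d i j a) = - ?S R"
      by (subst (2) s4) (simp only: mult_minus_right sum_negf minus_minus)
    ultimately show ?thesis by simp
  qed
  have "(\<Sum>a\<in>UNIV. \<Sum>d\<in>UNIV. \<Sum>i\<in>UNIV. \<Sum>j\<in>UNIV. R a d i j * b d i j a) = 0"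
    using orth Rs unfolding b1
    by (simp add: right_diff_distrib sum_subtractf sum_divide_distrib[symmetric])
  moreover have "(\<Sum>d\<in>UNIV. \<Sum>i\<in>UNIV. \<Sum>j\<in>UNIV. R a i j d * b d i j a) = (\<Sum>d\<in>UNIV. \<Sum>i\<in>UNIV. \<Sum>j\<in>UNIV. R a d i j * b d i j a)" for a
    by (subst b3, subst sum_rot3, rule refl)
  moreover have "(\<Sum>d\<in>UNIV. \<Sum>i\<in>UNIV. \<Sum>j\<in>UNIV. R a j d i * b d i j a) = (\<Sum>d\<in>UNIV. \<Sum>i\<in>UNIV. \<Sum>j\<in>UNIV. R a d i j * b d i j a)" for a
    by (subst b3[symmetric], subst sum_rot3[symmetric], rule refl)
  \<comment> \<open>The three cyclic terms pair equally with b, as b is cyclic in its first three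
    indices. By \<open>b2\<close> this vanishing sum is the squared norm of b.\<close>
  ultimately have "(\<Sum>a\<in>UNIV. \<Sum>d\<in>UNIV. \<Sum>i\<in>UNIV. \<Sum>j\<in>UNIV. (R a d i j + R a i j d + R a j d i) * b d i j a) = 0"
    by (simp only: distrib_right sum.distrib)
  then have "b d i j a = 0" for a d i j
    unfolding b2 using sum4_sq_zero[of "\<lambda>a d i j. b d i j a" a d i j] by simp
  then show "R i j k l + R j k i l + R k i j l = 0" "nT l i j k = sig T i j k l / 3"
    using b1[of i j k l] by (auto simp: b_def)
qed

text \<open>Put w = v and z = x and sum: all derivative terms and two of the three torsion terms
  become Ricci traces, and the remaining torsion term is the claim.\<close>

lemma second_bianchi_trace:
  fixes R :: "i7 \<Rightarrow> i7 \<Rightarrow> i7 \<Rightarrow> i7 \<Rightarrow> real" and N :: "i7 \<Rightarrow> i7 \<Rightarrow> i7 \<Rightarrow> i7 \<Rightarrow> i7 \<Rightarrow> real"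
  assumes n12: "\<And>x i j k l. N x i j k l = - N x j i k l" and n34: "\<And>x i j k l. N x i j k l = - N x i j l k"
    and ricN: "\<And>x i j. (\<Sum>a\<in>UNIV. N x a i j a) = 0"
    and r12: "\<And>i j k l. R i j k l = - R j i k l" and r34: "\<And>i j k l. R i j k l = - R i j l k"
    and ric: "\<And>x y. (\<Sum>a\<in>UNIV. R a x y a) = 0" and T: "alt3 T"
    and bianchi2: "\<And>x u v w z. N x u v w z + N u v x w z + N v x u w z
      + (\<Sum>s\<in>UNIV. T x u s * R s v w z + T u v s * R s x w z + T v x s * R s u w z) = 0"
  shows "(\<Sum>d\<in>UNIV. \<Sum>i\<in>UNIV. \<Sum>j\<in>UNIV. R u d i j * T d i j) = 0"
proof -
  have a1: "(\<Sum>v\<in>UNIV. \<Sum>x\<in>UNIV. N x u v v x) = 0"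
  proof -
    have "N x u v v x = N x v u x v" for x v using n12[of x u v v x] n34[of x v u v x] by simp
    then have "(\<Sum>v\<in>UNIV. \<Sum>x\<in>UNIV. N x u v v x) = (\<Sum>x\<in>UNIV. \<Sum>v\<in>UNIV. N x v u x v)"
      by (subst sum.swap) (simp only:)
    then show ?thesis by (simp only: ricN) simp
  qed
  have a2: "(\<Sum>x\<in>UNIV. N u v x v x) = 0" for v
    using ricN[of u v v] by (subst n12) (simp add: sum_negf)
  have a3: "(\<Sum>x\<in>UNIV. N v x u v x) = 0" for v by (rule ricN)
  have t1: "(\<Sum>v\<in>UNIV. \<Sum>x\<in>UNIV. \<Sum>s\<in>UNIV. T x u s * R s v v x) = 0"
  proof -
    have e: "R s v v x = R v s x v" for s v x using r12[of s v v x] r34[of v s v x] by simp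
    have "(\<Sum>v\<in>UNIV. \<Sum>x\<in>UNIV. \<Sum>s\<in>UNIV. T x u s * R s v v x)
        = (\<Sum>x\<in>UNIV. \<Sum>s\<in>UNIV. T x u s * (\<Sum>v\<in>UNIV. R v s x v))"
      by (subst e, subst sum_rot3) (simp only: sum_distrib_left)
    then show ?thesis by (simp only: ric) simp
  qed
  have t2: "(\<Sum>v\<in>UNIV. \<Sum>x\<in>UNIV. \<Sum>s\<in>UNIV. T u v s * R s x v x) = 0"
  proof -
    have "(\<Sum>x\<in>UNIV. \<Sum>s\<in>UNIV. T u v s * R s x v x) = (\<Sum>s\<in>UNIV. T u v s * (\<Sum>x\<in>UNIV. R s x v x))" for v
      by (subst sum.swap) (simp only: sum_distrib_left)
    moreover have "(\<Sum>x\<in>UNIV. R s x v x) = 0" for s v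
      using ric[of s v] by (subst r12) (simp add: sum_negf)
    ultimately show ?thesis by simp
  qed
  have "(\<Sum>v\<in>UNIV. \<Sum>x\<in>UNIV. N x u v v x + N u v x v x + N v x u v x
      + (\<Sum>s\<in>UNIV. T x u s * R s v v x + T u v s * R s x v x + T v x s * R s u v x)) = 0"
    by (simp only: bianchi2) simp
  then have "(\<Sum>v\<in>UNIV. \<Sum>x\<in>UNIV. \<Sum>s\<in>UNIV. T v x s * R s u v x) = 0"
    by (simp only: sum.distrib a1 a2 a3 t1 t2) simp
  moreover have "T v x s * R s u v x = - (R u s v x * T s v x)" for v x s
    using r12[of s u v x] alt3_cycle[OF T, of s v x] by simp
  ultimately have "(\<Sum>v\<in>UNIV. \<Sum>x\<in>UNIV. \<Sum>s\<in>UNIV. R u s v x * T s v x) = 0"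
    by (simp add: sum_negf)
  then show ?thesis by (subst sum_rot3)
qed

text \<open>\<open>psi0\<close> is a polynomial in \<open>phi0\<close> and the identity matrix, and
  F annihilates both.\<close>

lemma psi0_inv:
  assumes inv: "\<And>a b c. (\<Sum>s\<in>UNIV. F a s * phi0 s b c + F b s * phi0 a s c + F c s * phi0 a b s) = 0"
    and sk: "\<And>a b. F a b = - F b a"
  shows "(\<Sum>s\<in>UNIV. F a s * psi0 s b c d + F b s * psi0 a s c d + F c s * psi0 a b s d + F d s * psi0 a b c s) = 0"
proof -
  have 1: "(\<Sum>s\<in>UNIV. F a s * phi0 s b k + F b s * phi0 a s k) = - (\<Sum>s\<in>UNIV. F k s * phi0 a b s)" for a b k
    using inv[of a b k] by (simp add: sum.distrib)
  have "(\<Sum>s\<in>UNIV. F a s * psi0 s b c d + F b s * psi0 a s c d + F c s * psi0 a b s d + F d s * psi0 a b c s)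
     = (\<Sum>s\<in>UNIV. \<Sum>k\<in>UNIV. (F a s * phi0 s b k + F b s * phi0 a s k) * phi0 c d k)
       + (\<Sum>s\<in>UNIV. \<Sum>k\<in>UNIV. (F c s * phi0 s d k + F d s * phi0 c s k) * phi0 a b k)
       + (\<Sum>s\<in>UNIV. dl s d * (F a s * dl b c) - dl s c * (F a s * dl b d) + dl s c * (F b s * dl a d) - dl s d * (F b s * dl a c)
          + dl s b * (F c s * dl a d) - dl s a * (F c s * dl b d) + dl s a * (F d s * dl b c) - dl s b * (F d s * dl a c))"
    unfolding sum.distrib[symmetric]
    by (intro sum.cong refl)
       (simp add: psi0_def sum.distrib sum_distrib_left algebra_simps dl_sym[of _ b] dl_sym[of _ a])
  also have "(\<Sum>s\<in>UNIV. dl s d * (F a s * dl b c) - dl s c * (F a s * dl b d) + dl s c * (F b s * dl a d) - dl s d * (F b s * dl a c)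
          + dl s b * (F c s * dl a d) - dl s a * (F c s * dl b d) + dl s a * (F d s * dl b c) - dl s b * (F d s * dl a c)) = 0"
    using sk[of a d] sk[of a c] sk[of b c] sk[of b d] by (simp add: sum.distrib sum_subtractf)
  also have "(\<Sum>s\<in>UNIV. \<Sum>k\<in>UNIV. (F a s * phi0 s b k + F b s * phi0 a s k) * phi0 c d k)
     = - (\<Sum>k\<in>UNIV. \<Sum>s\<in>UNIV. F k s * (phi0 a b s * phi0 c d k))"
    by (subst sum.swap) (simp add: sum_distrib_right[symmetric] 1 sum_negf mult.assoc[symmetric])
  also have "(\<Sum>s\<in>UNIV. \<Sum>k\<in>UNIV. (F c s * phi0 s d k + F d s * phi0 c s k) * phi0 a b k)
     = - (\<Sum>k\<in>UNIV. \<Sum>s\<in>UNIV. F k s * (phi0 c d s * phi0 a b k))"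
    by (subst sum.swap) (simp add: sum_distrib_right[symmetric] 1 sum_negf mult.assoc[symmetric])
  also have "(\<Sum>k\<in>UNIV. \<Sum>s\<in>UNIV. F k s * (phi0 c d s * phi0 a b k)) = (\<Sum>k\<in>UNIV. \<Sum>s\<in>UNIV. F s k * (phi0 a b s * phi0 c d k))"
    by (subst sum.swap) (simp add: mult.commute)
  also have "\<dots> = - (\<Sum>k\<in>UNIV. \<Sum>s\<in>UNIV. F k s * (phi0 a b s * phi0 c d k))"
    by (subst sk) (simp add: sum_negf)
  finally show ?thesis by simp
qed

text \<open>Invariance of \<open>psi0\<close> under F, contracted with T. By cyclicity of T and
  \<open>psi0\<close> the three terms in which F meets an index of T agree, whence the factor 3; the
  fourth term is the right side.\<close>

lemma g2_psi_torsion: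
  assumes inv: "\<And>a b c. (\<Sum>s\<in>UNIV. F a s * phi0 s b c + F b s * phi0 a s c + F c s * phi0 a b s) = 0"
    and sk: "\<And>a b. F a b = - F b a" and T: "alt3 T"
  shows "3 * (\<Sum>a\<in>UNIV. \<Sum>b\<in>UNIV. \<Sum>s\<in>UNIV. \<Sum>c\<in>UNIV. T a b s * F s c * psi0 a b c d)
    = (\<Sum>c\<in>UNIV. (\<Sum>a\<in>UNIV. \<Sum>b\<in>UNIV. \<Sum>s\<in>UNIV. T a b s * psi0 a b s c) * F c d)"
proof -
  define Y where "Y = (\<Sum>a\<in>UNIV. \<Sum>b\<in>UNIV. \<Sum>s\<in>UNIV. \<Sum>c\<in>UNIV. T a b s * F s c * psi0 a b c d)"
  have cyc: "psi0 i j k b = psi0 j k i b" for i j k b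
    using psi0_swap12 psi0_swap23 by (metis minus_minus)
  have "0 = (\<Sum>a\<in>UNIV. \<Sum>b\<in>UNIV. \<Sum>s\<in>UNIV. T a b s * (\<Sum>c\<in>UNIV. F a c * psi0 c b s d + F b c * psi0 a c s d + F s c * psi0 a b c d + F d c * psi0 a b s c))"
    by (simp only: psi0_inv[OF inv sk]) simp
  also have "\<dots> = (\<Sum>a\<in>UNIV. \<Sum>b\<in>UNIV. \<Sum>s\<in>UNIV. \<Sum>c\<in>UNIV. T a b s * F a c * psi0 c b s d)
     + (\<Sum>a\<in>UNIV. \<Sum>b\<in>UNIV. \<Sum>s\<in>UNIV. \<Sum>c\<in>UNIV. T a b s * F b c * psi0 a c s d) + Y
     + (\<Sum>a\<in>UNIV. \<Sum>b\<in>UNIV. \<Sum>s\<in>UNIV. \<Sum>c\<in>UNIV. T a b s * F d c * psi0 a b s c)"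
    by (simp only: Y_def distrib_left sum.distrib sum_distrib_left mult.assoc)
  also have "(\<Sum>a\<in>UNIV. \<Sum>b\<in>UNIV. \<Sum>s\<in>UNIV. \<Sum>c\<in>UNIV. T a b s * F a c * psi0 c b s d) = Y"
  proof -
    have e: "T a b s * F a c * psi0 c b s d = T b s a * F a c * psi0 b s c d" for a b s c
      using cyc[of c b s d] alt3_cycle[OF T, of a b s] by simp
    show ?thesis unfolding Y_def
      by (subst e, rule sum_rot3[of "\<lambda>a b s. \<Sum>c\<in>UNIV. T b s a * F a c * psi0 b s c d" UNIV UNIV UNIV])
  qed
  also have "(\<Sum>a\<in>UNIV. \<Sum>b\<in>UNIV. \<Sum>s\<in>UNIV. \<Sum>c\<in>UNIV. T a b s * F b c * psi0 a c s d) = Y"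
  proof -
    have e: "T a b s * F b c * psi0 a c s d = T s a b * F b c * psi0 s a c d" for a b s c
      using cyc[of s a c d] alt3_cycle[OF T, of s a b] by simp
    show ?thesis unfolding Y_def
      by (subst e, rule sum_rot3[of "\<lambda>s a b. \<Sum>c\<in>UNIV. T s a b * F b c * psi0 s a c d" UNIV UNIV UNIV, symmetric])
  qed
  also have "(\<Sum>a\<in>UNIV. \<Sum>b\<in>UNIV. \<Sum>s\<in>UNIV. \<Sum>c\<in>UNIV. T a b s * F d c * psi0 a b s c)
     = - (\<Sum>c\<in>UNIV. (\<Sum>a\<in>UNIV. \<Sum>b\<in>UNIV. \<Sum>s\<in>UNIV. T a b s * psi0 a b s c) * F c d)"
    by (subst sum_rot4[symmetric], subst (1) sk) (simp add: sum_distrib_right sum_distrib_left sum_negf mult_ac)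
  finally show ?thesis by (simp add: Y_def)
qed

text \<open>Contracting a with b in \<open>dV\<close> gives the divergence of R paired with T plus
  the sum in question. The divergence is a linear combination of R itself, so its pairing with T
  vanishes by \<open>V\<close>.\<close>

lemma curvature_nabla_torsion_orthogonal:
  fixes R :: "i7 \<Rightarrow> i7 \<Rightarrow> i7 \<Rightarrow> i7 \<Rightarrow> real" and N :: "i7 \<Rightarrow> i7 \<Rightarrow> i7 \<Rightarrow> i7 \<Rightarrow> i7 \<Rightarrow> real"
  assumes n12: "\<And>x i j k l. N x i j k l = - N x j i k l"
    and instanton_nabla: "\<And>x i j k. (\<Sum>a\<in>UNIV. \<Sum>b\<in>UNIV. N x a b i j * phi0 a b k) = 0"
    and r12: "\<And>i j k l. R i j k l = - R j i k l"
    and inst: "\<And>i j k. (\<Sum>a\<in>UNIV. \<Sum>b\<in>UNIV. R a b i j * phi0 a b k) = 0"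
    and T: "alt3 T"
    and bianchi2: "\<And>x u v w z. N x u v w z + N u v x w z + N v x u w z
      + (\<Sum>s\<in>UNIV. T x u s * R s v w z + T u v s * R s x w z + T v x s * R s u w z) = 0"
    and V: "\<And>b. (\<Sum>d\<in>UNIV. \<Sum>i\<in>UNIV. \<Sum>j\<in>UNIV. R b d i j * T d i j) = 0"
    and dV: "\<And>a b. (\<Sum>d\<in>UNIV. \<Sum>i\<in>UNIV. \<Sum>j\<in>UNIV. N a b d i j * T d i j + R b d i j * nT a d i j) = 0"
  shows "(\<Sum>a\<in>UNIV. \<Sum>d\<in>UNIV. \<Sum>i\<in>UNIV. \<Sum>j\<in>UNIV. R a d i j * nT a d i j) = 0"
proof -
  define \<Theta> where "\<Theta> c = (\<Sum>a\<in>UNIV. \<Sum>b\<in>UNIV. \<Sum>s\<in>UNIV. T a b s * psi0 a b s c)" for c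
  have cyc: "psi0 i j k b = psi0 j k i b" for i j k b
    using psi0_swap12 psi0_swap23 by (metis minus_minus)
  \<comment> \<open>The second Bianchi identity contracted with \<open>psi0\<close>: each of the
    three derivative terms gives -2 times the divergence by the g_2 eigenvalue, and the three
    torsion terms together give \<Theta> R by \<open>g2_psi_torsion\<close>. \<Theta> is the
    7-dimensional part of T.\<close>
  have div: "6 * (\<Sum>x\<in>UNIV. N x x d w z) = (\<Sum>c\<in>UNIV. \<Theta> c * R c d w z)" for d w z
  proof -
    have c1: "(\<Sum>x\<in>UNIV. \<Sum>u\<in>UNIV. \<Sum>v\<in>UNIV. f u v x * psi0 x u v d) = (\<Sum>x\<in>UNIV. \<Sum>u\<in>UNIV. \<Sum>v\<in>UNIV. f x u v * psi0 x u v d)" for f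
      by (subst cyc, subst sum_rot3, rule refl)
    have c2: "(\<Sum>x\<in>UNIV. \<Sum>u\<in>UNIV. \<Sum>v\<in>UNIV. f v x u * psi0 x u v d) = (\<Sum>x\<in>UNIV. \<Sum>u\<in>UNIV. \<Sum>v\<in>UNIV. f x u v * psi0 x u v d)" for f
      by (subst cyc[symmetric], subst sum_rot3[symmetric], rule refl)
    have "(\<Sum>x\<in>UNIV. \<Sum>u\<in>UNIV. \<Sum>v\<in>UNIV. N x u v w z * psi0 x u v d) = (\<Sum>x\<in>UNIV. - 2 * N x x d w z)"
      by (subst cyc, simp only: g2_psi_of_contr[OF instanton_nabla n12])
    then have n: "(\<Sum>x\<in>UNIV. \<Sum>u\<in>UNIV. \<Sum>v\<in>UNIV. N x u v w z * psi0 x u v d) = - 2 * (\<Sum>x\<in>UNIV. N x x d w z)"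
      by (simp only: sum_distrib_left)
    have t: "3 * (\<Sum>x\<in>UNIV. \<Sum>u\<in>UNIV. \<Sum>v\<in>UNIV. (\<Sum>s\<in>UNIV. T x u s * R s v w z) * psi0 x u v d) = (\<Sum>c\<in>UNIV. \<Theta> c * R c d w z)"
    proof -
      have "(\<Sum>x\<in>UNIV. \<Sum>u\<in>UNIV. \<Sum>v\<in>UNIV. (\<Sum>s\<in>UNIV. T x u s * R s v w z) * psi0 x u v d)
          = (\<Sum>x\<in>UNIV. \<Sum>u\<in>UNIV. \<Sum>s\<in>UNIV. \<Sum>v\<in>UNIV. T x u s * R s v w z * psi0 x u v d)"
        by (simp only: sum_distrib_right) (intro sum.cong refl sum.swap)
      then show ?thesis
        unfolding \<Theta>_def using g2_psi_torsion[OF g2_inv_of_contr[OF inst r12] r12 T] by simp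
    qed
    have "(\<Sum>x\<in>UNIV. \<Sum>u\<in>UNIV. \<Sum>v\<in>UNIV. (N x u v w z + N u v x w z + N v x u w z
      + (\<Sum>s\<in>UNIV. T x u s * R s v w z + T u v s * R s x w z + T v x s * R s u w z)) * psi0 x u v d) = 0"
      by (simp only: bianchi2) simp
    then have "3 * (\<Sum>x\<in>UNIV. \<Sum>u\<in>UNIV. \<Sum>v\<in>UNIV. N x u v w z * psi0 x u v d)
       + 3 * (\<Sum>x\<in>UNIV. \<Sum>u\<in>UNIV. \<Sum>v\<in>UNIV. (\<Sum>s\<in>UNIV. T x u s * R s v w z) * psi0 x u v d) = 0"
      using c1[of "\<lambda>x u v. N x u v w z"] c2[of "\<lambda>x u v. N x u v w z"]
        c1[of "\<lambda>x u v. \<Sum>s\<in>UNIV. T x u s * R s v w z"] c2[of "\<lambda>x u v. \<Sum>s\<in>UNIV. T x u s * R s v w z"]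
      by (simp only: distrib_right sum.distrib)
    with n t show ?thesis by simp
  qed
  have "(\<Sum>a\<in>UNIV. \<Sum>d\<in>UNIV. \<Sum>i\<in>UNIV. \<Sum>j\<in>UNIV. N a a d i j * T d i j)
      = (\<Sum>d\<in>UNIV. \<Sum>i\<in>UNIV. \<Sum>j\<in>UNIV. (\<Sum>a\<in>UNIV. N a a d i j) * T d i j)"
    by (subst sum_rot4) (simp only: sum_distrib_right)
  also have "\<dots> = (\<Sum>d\<in>UNIV. \<Sum>i\<in>UNIV. \<Sum>j\<in>UNIV. (\<Sum>c\<in>UNIV. \<Theta> c * R c d i j) * T d i j) / 6"
    by (simp add: div[symmetric] sum_divide_distrib)
  also have "(\<Sum>d\<in>UNIV. \<Sum>i\<in>UNIV. \<Sum>j\<in>UNIV. (\<Sum>c\<in>UNIV. \<Theta> c * R c d i j) * T d i j)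
     = (\<Sum>c\<in>UNIV. \<Theta> c * (\<Sum>d\<in>UNIV. \<Sum>i\<in>UNIV. \<Sum>j\<in>UNIV. R c d i j * T d i j))"
    by (simp only: sum_distrib_left sum_distrib_right mult.assoc, subst (2) sum_rot4, rule refl)
  also have "\<dots> = 0" by (simp add: V)
  finally have "(\<Sum>a\<in>UNIV. \<Sum>d\<in>UNIV. \<Sum>i\<in>UNIV. \<Sum>j\<in>UNIV. N a a d i j * T d i j) = 0" by simp
  moreover have "(\<Sum>a\<in>UNIV. \<Sum>d\<in>UNIV. \<Sum>i\<in>UNIV. \<Sum>j\<in>UNIV. N a a d i j * T d i j + R a d i j * nT a d i j) = 0"
    by (simp only: dV) simp
  ultimately show ?thesis by (simp only: sum.distrib)
qed

section \<open>Clifford multiplication on the octonions\<close>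

lemma sum_swap13: "(\<Sum>x\<in>X. \<Sum>y\<in>Y. \<Sum>z\<in>Z. f x y z) = (\<Sum>z\<in>Z. \<Sum>y\<in>Y. \<Sum>x\<in>X. f x y z)"
proof -
  have "(\<Sum>x\<in>X. \<Sum>y\<in>Y. \<Sum>z\<in>Z. f x y z) = (\<Sum>y\<in>Y. \<Sum>z\<in>Z. \<Sum>x\<in>X. f x y z)" by (rule sum_rot3)
  also have "\<dots> = (\<Sum>z\<in>Z. \<Sum>y\<in>Y. \<Sum>x\<in>X. f x y z)" by (rule sum.swap)
  finally show ?thesis .
qed

text \<open>Sums over all index tuples, not only the increasing ones: \<open>hat2\<close> and
  \<open>hat3\<close> are 2 and 6 times the Clifford elements of the forms, which accounts for the
  constants -6, 4, -4 and -24 below. An arbitrary algebra is allowed because only the relations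
  \<open>clifford\<close> are used.\<close>

definition hat2 :: "(i7 \<Rightarrow> 'a) \<Rightarrow> (i7 \<Rightarrow> i7 \<Rightarrow> real) \<Rightarrow> 'a::real_algebra_1" where
  "hat2 g t = (\<Sum>j\<in>UNIV. \<Sum>k\<in>UNIV. t j k *\<^sub>R (g j * g k))"

definition hat3 :: "(i7 \<Rightarrow> 'a) \<Rightarrow> (i7 \<Rightarrow> i7 \<Rightarrow> i7 \<Rightarrow> real) \<Rightarrow> 'a::real_algebra_1" where
  "hat3 g T = (\<Sum>i\<in>UNIV. \<Sum>j\<in>UNIV. \<Sum>k\<in>UNIV. T i j k *\<^sub>R (g i * g j * g k))"

definition clifford :: "(i7 \<Rightarrow> 'a::real_algebra_1) \<Rightarrow> bool" where
  "clifford g \<longleftrightarrow> (\<forall>i j. g i * g j + g j * g i = (- 2 * dl i j) *\<^sub>R 1)"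

lemma sum_dl_scaleR [simp]:
  fixes f :: "i7 \<Rightarrow> 'a::real_vector"
  shows "(\<Sum>a\<in>UNIV. dl a b *\<^sub>R f a) = f b" "(\<Sum>a\<in>UNIV. dl b a *\<^sub>R f a) = f b"
    "(\<Sum>a\<in>UNIV. (dl a b * c a) *\<^sub>R f a) = c b *\<^sub>R f b" "(\<Sum>a\<in>UNIV. (dl b a * c a) *\<^sub>R f a) = c b *\<^sub>R f b"
    "(\<Sum>a\<in>UNIV. (r * (dl a b * c a)) *\<^sub>R f a) = (r * c b) *\<^sub>R f b" "(\<Sum>a\<in>UNIV. (r * (dl b a * c a)) *\<^sub>R f a) = (r * c b) *\<^sub>R f b"
proof -
  have "dl a b *\<^sub>R x = (if a = b then x else 0)" "(dl a b * r) *\<^sub>R x = (if a = b then r *\<^sub>R x else 0)"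
    "(s * (dl a b * r)) *\<^sub>R x = (if a = b then (s * r) *\<^sub>R x else 0)"
    for a b r s and x :: 'a
    by (simp_all add: dl_def)
  then show "(\<Sum>a\<in>UNIV. dl a b *\<^sub>R f a) = f b" "(\<Sum>a\<in>UNIV. dl b a *\<^sub>R f a) = f b"
    "(\<Sum>a\<in>UNIV. (dl a b * c a) *\<^sub>R f a) = c b *\<^sub>R f b" "(\<Sum>a\<in>UNIV. (dl b a * c a) *\<^sub>R f a) = c b *\<^sub>R f b"
    "(\<Sum>a\<in>UNIV. (r * (dl a b * c a)) *\<^sub>R f a) = (r * c b) *\<^sub>R f b" "(\<Sum>a\<in>UNIV. (r * (dl b a * c a)) *\<^sub>R f a) = (r * c b) *\<^sub>R f b"
    by simp_all
qed

lemma hat3_add: "hat3 g (\<lambda>i j k. S i j k + T i j k) = hat3 g S + hat3 g T"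
  by (simp add: hat3_def scaleR_add_left sum.distrib)

lemma hat3_scale: "hat3 g (\<lambda>i j k. c * T i j k) = c *\<^sub>R hat3 g T"
  by (simp add: hat3_def scaleR_sum_right)

text \<open>Moving \<open>g a\<close> through three factors leaves one contraction for each slot,
  with alternating signs; antisymmetry of T makes the three contributions equal.\<close>

lemma clifford_anticomm_hat3:
  assumes cl: "clifford g" and T: "alt3 T"
  shows "g a * hat3 g T + hat3 g T * g a = - 6 *\<^sub>R hat2 g (T a)"
proof -
  have c: "g i * g j = (- 2 * dl i j) *\<^sub>R 1 - g j * g i" for i j
    using cl unfolding clifford_def by (metis add_diff_cancel_right')
  have 1: "g a * (g i * g j * g k) + g i * g j * g k * g a
     = - 2 *\<^sub>R (dl a i *\<^sub>R (g j * g k) - dl a j *\<^sub>R (g i * g k) + dl a k *\<^sub>R (g i * g j))" for i j k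
  proof -
    have "g a * (g i * g j * g k) = (g a * g i) * g j * g k" by (simp add: mult.assoc)
    also have "\<dots> = (- 2 * dl a i) *\<^sub>R (g j * g k) - g i * (g a * g j) * g k"
      by (subst c) (simp add: algebra_simps)
    also have "\<dots> = (- 2 * dl a i) *\<^sub>R (g j * g k) + (2 * dl a j) *\<^sub>R (g i * g k) + g i * g j * (g a * g k)"
      by (subst c[of a j]) (simp add: algebra_simps)
    also have "\<dots> = (- 2 * dl a i) *\<^sub>R (g j * g k) + (2 * dl a j) *\<^sub>R (g i * g k) - (2 * dl a k) *\<^sub>R (g i * g j)
        - g i * g j * g k * g a"
      by (subst c[of a k]) (simp add: algebra_simps)
    finally show ?thesis by (simp add: algebra_simps)
  qed
  have "g a * hat3 g T + hat3 g T * g a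
     = (\<Sum>i\<in>UNIV. \<Sum>j\<in>UNIV. \<Sum>k\<in>UNIV. T i j k *\<^sub>R (g a * (g i * g j * g k) + g i * g j * g k * g a))"
    by (simp add: hat3_def sum_distrib_left sum_distrib_right sum.distrib scaleR_add_right)
  also have "\<dots> = - 2 *\<^sub>R ((\<Sum>i\<in>UNIV. dl a i *\<^sub>R (\<Sum>j\<in>UNIV. \<Sum>k\<in>UNIV. T i j k *\<^sub>R (g j * g k)))
      - (\<Sum>i\<in>UNIV. \<Sum>j\<in>UNIV. dl a j *\<^sub>R (\<Sum>k\<in>UNIV. T i j k *\<^sub>R (g i * g k)))
      + (\<Sum>i\<in>UNIV. \<Sum>j\<in>UNIV. \<Sum>k\<in>UNIV. dl a k *\<^sub>R (T i j k *\<^sub>R (g i * g j))))"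
    unfolding 1 by (simp add: scaleR_sum_right sum.distrib sum_subtractf scaleR_add_right scaleR_diff_right
        sum_negf mult_ac)
  also have "\<dots> = - 2 *\<^sub>R (hat2 g (T a) - (\<Sum>i\<in>UNIV. \<Sum>k\<in>UNIV. T i a k *\<^sub>R (g i * g k)) + (\<Sum>i\<in>UNIV. \<Sum>j\<in>UNIV. T i j a *\<^sub>R (g i * g j)))"
    by (simp add: hat2_def)
  also have "(\<Sum>i\<in>UNIV. \<Sum>k\<in>UNIV. T i a k *\<^sub>R (g i * g k)) = - hat2 g (T a)"
    by (simp add: hat2_def alt3_swap12[OF T, of _ a] sum_negf)
  also have "(\<Sum>i\<in>UNIV. \<Sum>j\<in>UNIV. T i j a *\<^sub>R (g i * g j)) = hat2 g (T a)"
    by (simp add: hat2_def alt3_cycle[OF T, of a])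
  also have "- 2 *\<^sub>R (hat2 g (T a) - - hat2 g (T a) + hat2 g (T a)) = - 6 *\<^sub>R hat2 g (T a)"
  proof -
    have "hat2 g (T a) - - hat2 g (T a) + hat2 g (T a) = (1 + 1 + 1) *\<^sub>R hat2 g (T a)"
      by (simp only: scaleR_add_left scaleR_one) simp
    then show ?thesis by simp
  qed
  finally show ?thesis .
qed

text \<open>The commutator realizes the action of so(7) on vectors.\<close>

lemma clifford_comm_hat2:
  assumes cl: "clifford g" and t: "\<And>i j. t i j = - t j i"
  shows "hat2 g t * g j - g j * hat2 g t = 4 *\<^sub>R (\<Sum>b\<in>UNIV. t j b *\<^sub>R g b)"
proof -
  have c: "g i * g j = (- 2 * dl i j) *\<^sub>R 1 - g j * g i" for i j
    using cl unfolding clifford_def by (metis add_diff_cancel_right')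
  have 1: "g a * g b * g j - g j * (g a * g b) = 2 *\<^sub>R (dl a j *\<^sub>R g b - dl b j *\<^sub>R g a)" for a b
  proof -
    have "g a * g b * g j = g a * (g b * g j)" by (simp add: mult.assoc)
    also have "\<dots> = (- 2 * dl b j) *\<^sub>R g a - (g a * g j) * g b"
      by (subst c) (simp add: algebra_simps)
    also have "\<dots> = (- 2 * dl b j) *\<^sub>R g a + (2 * dl a j) *\<^sub>R g b + g j * g a * g b"
      by (subst c[of a j]) (simp add: algebra_simps)
    finally show ?thesis by (simp add: algebra_simps)
  qed
  have "hat2 g t * g j - g j * hat2 g t = (\<Sum>a\<in>UNIV. \<Sum>b\<in>UNIV. t a b *\<^sub>R (g a * g b * g j - g j * (g a * g b)))"
    by (simp add: hat2_def sum_distrib_left sum_distrib_right sum_subtractf scaleR_diff_right)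
  also have "\<dots> = 2 *\<^sub>R ((\<Sum>a\<in>UNIV. dl a j *\<^sub>R (\<Sum>b\<in>UNIV. t a b *\<^sub>R g b)) - (\<Sum>a\<in>UNIV. \<Sum>b\<in>UNIV. dl b j *\<^sub>R (t a b *\<^sub>R g a)))"
    unfolding 1 by (simp add: scaleR_sum_right sum_subtractf scaleR_diff_right mult_ac)
  also have "(\<Sum>a\<in>UNIV. \<Sum>b\<in>UNIV. dl b j *\<^sub>R (t a b *\<^sub>R g a)) = (\<Sum>a\<in>UNIV. t a j *\<^sub>R g a)" by simp
  also have "\<dots> = - (\<Sum>a\<in>UNIV. t j a *\<^sub>R g a)" by (subst t) (simp add: sum_negf)
  finally show ?thesis by (simp add: scaleR_2[symmetric])
qed

text \<open>Commutation with a 2-form is a derivation, so \<open>T a\<close> acts on each of the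
  three slots of T by \<open>clifford_comm_hat2\<close>; the sum of these three contractions is
  \<open>- sig T a\<close>.\<close>

lemma clifford_comm_hat2_hat3:
  assumes cl: "clifford g" and T: "alt3 T"
  shows "hat2 g (T a) * hat3 g T - hat3 g T * hat2 g (T a) = - 4 *\<^sub>R hat3 g (sig T a)"
proof -
  define \<tau> where "\<tau> = hat2 g (T a)"
  have D: "\<tau> * g j = g j * \<tau> + 4 *\<^sub>R (\<Sum>b\<in>UNIV. T a j b *\<^sub>R g b)" for j
    unfolding \<tau>_def using clifford_comm_hat2[OF cl, of "T a" j] alt3_swap23[OF T] by (metis add.commute diff_add_cancel)
  have 1: "\<tau> * (g i * g j * g k) - g i * g j * g k * \<tau>
     = 4 *\<^sub>R ((\<Sum>b\<in>UNIV. T a i b *\<^sub>R (g b * g j * g k)) + (\<Sum>b\<in>UNIV. T a j b *\<^sub>R (g i * g b * g k)) + (\<Sum>b\<in>UNIV. T a k b *\<^sub>R (g i * g j * g b)))" for i j k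
  proof -
    have "\<tau> * (g i * g j * g k) = (\<tau> * g i) * g j * g k" by (simp add: mult.assoc)
    also have "\<dots> = g i * (\<tau> * g j) * g k + 4 *\<^sub>R (\<Sum>b\<in>UNIV. T a i b *\<^sub>R (g b * g j * g k))"
      by (subst D) (simp add: distrib_right sum_distrib_right mult.assoc)
    also have "g i * (\<tau> * g j) * g k = g i * g j * (\<tau> * g k) + 4 *\<^sub>R (\<Sum>b\<in>UNIV. T a j b *\<^sub>R (g i * g b * g k))"
      by (subst D) (simp add: distrib_right distrib_left sum_distrib_right sum_distrib_left mult.assoc)
    also have "g i * g j * (\<tau> * g k) = g i * g j * g k * \<tau> + 4 *\<^sub>R (\<Sum>b\<in>UNIV. T a k b *\<^sub>R (g i * g j * g b))"
      by (subst D) (simp add: distrib_left sum_distrib_left mult.assoc)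
    finally show ?thesis by (simp add: scaleR_add_right)
  qed
  have "\<tau> * hat3 g T - hat3 g T * \<tau>
     = (\<Sum>i\<in>UNIV. \<Sum>j\<in>UNIV. \<Sum>k\<in>UNIV. T i j k *\<^sub>R (\<tau> * (g i * g j * g k) - g i * g j * g k * \<tau>))"
    by (simp add: hat3_def sum_distrib_left sum_distrib_right sum_subtractf scaleR_diff_right)
  also have "\<dots> = 4 *\<^sub>R ((\<Sum>i\<in>UNIV. \<Sum>j\<in>UNIV. \<Sum>k\<in>UNIV. \<Sum>b\<in>UNIV. (T a i b * T i j k) *\<^sub>R (g b * g j * g k))
      + (\<Sum>i\<in>UNIV. \<Sum>j\<in>UNIV. \<Sum>k\<in>UNIV. \<Sum>b\<in>UNIV. (T a j b * T i j k) *\<^sub>R (g i * g b * g k))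
      + (\<Sum>i\<in>UNIV. \<Sum>j\<in>UNIV. \<Sum>k\<in>UNIV. \<Sum>b\<in>UNIV. (T a k b * T i j k) *\<^sub>R (g i * g j * g b)))"
    unfolding 1 by (simp add: scaleR_sum_right scaleR_add_right sum.distrib mult_ac)
  also have "(\<Sum>i\<in>UNIV. \<Sum>j\<in>UNIV. \<Sum>k\<in>UNIV. \<Sum>b\<in>UNIV. (T a i b * T i j k) *\<^sub>R (g b * g j * g k))
     = (\<Sum>i\<in>UNIV. \<Sum>j\<in>UNIV. \<Sum>k\<in>UNIV. \<Sum>s\<in>UNIV. (T a s i * T s j k) *\<^sub>R (g i * g j * g k))"
  proof -
    have "(\<Sum>s\<in>UNIV. \<Sum>j\<in>UNIV. \<Sum>k\<in>UNIV. \<Sum>i\<in>UNIV. f s j k i) = (\<Sum>i\<in>UNIV. \<Sum>j\<in>UNIV. \<Sum>k\<in>UNIV. \<Sum>s\<in>UNIV. f s j k i)"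
      for f :: "i7 \<Rightarrow> i7 \<Rightarrow> i7 \<Rightarrow> i7 \<Rightarrow> 'a"
    proof -
      have "(\<Sum>s\<in>UNIV. \<Sum>j\<in>UNIV. \<Sum>k\<in>UNIV. \<Sum>i\<in>UNIV. f s j k i) = (\<Sum>j\<in>UNIV. \<Sum>k\<in>UNIV. \<Sum>i\<in>UNIV. \<Sum>s\<in>UNIV. f s j k i)"
        by (rule sum_rot4)
      also have "\<dots> = (\<Sum>i\<in>UNIV. \<Sum>j\<in>UNIV. \<Sum>k\<in>UNIV. \<Sum>s\<in>UNIV. f s j k i)" by (rule sum_rot3[symmetric])
      finally show ?thesis .
    qed
    then show ?thesis by this
  qed
  also have "(\<Sum>i\<in>UNIV. \<Sum>j\<in>UNIV. \<Sum>k\<in>UNIV. \<Sum>b\<in>UNIV. (T a j b * T i j k) *\<^sub>R (g i * g b * g k))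
     = (\<Sum>i\<in>UNIV. \<Sum>j\<in>UNIV. \<Sum>k\<in>UNIV. \<Sum>s\<in>UNIV. (T a s j * T i s k) *\<^sub>R (g i * g j * g k))"
    by (rule sum.cong[OF refl], rule sum_swap13)
  also have "(\<Sum>i\<in>UNIV. \<Sum>j\<in>UNIV. \<Sum>k\<in>UNIV. \<Sum>b\<in>UNIV. (T a k b * T i j k) *\<^sub>R (g i * g j * g b))
     = (\<Sum>i\<in>UNIV. \<Sum>j\<in>UNIV. \<Sum>k\<in>UNIV. \<Sum>s\<in>UNIV. (T a s k * T i j s) *\<^sub>R (g i * g j * g k))"
    by (rule sum.cong[OF refl], rule sum.cong[OF refl], rule sum.swap)
  also have "4 *\<^sub>R ((\<Sum>i\<in>UNIV. \<Sum>j\<in>UNIV. \<Sum>k\<in>UNIV. \<Sum>s\<in>UNIV. (T a s i * T s j k) *\<^sub>R (g i * g j * g k))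
     + (\<Sum>i\<in>UNIV. \<Sum>j\<in>UNIV. \<Sum>k\<in>UNIV. \<Sum>s\<in>UNIV. (T a s j * T i s k) *\<^sub>R (g i * g j * g k))
     + (\<Sum>i\<in>UNIV. \<Sum>j\<in>UNIV. \<Sum>k\<in>UNIV. \<Sum>s\<in>UNIV. (T a s k * T i j s) *\<^sub>R (g i * g j * g k)))
     = - 4 *\<^sub>R hat3 g (sig T a)"
  proof -
    have e: "T a s i * T s j k + T a s j * T i s k + T a s k * T i j s
        = - (T a i s * T s j k + T i j s * T s a k + T j a s * T s i k)" for s i j k
      using alt3_swap23[OF T, of a s i] alt3_swap12[OF T, of i s k] alt3_swap12[OF T, of a s k] alt3_cycle[OF T, of j a s] by simp
    have sg: "sig T a i j k = - (\<Sum>s\<in>UNIV. T a s i * T s j k + T a s j * T i s k + T a s k * T i j s)" for i j k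
      by (simp only: e sig_def sum_negf minus_minus)
    have "hat3 g (sig T a) = - ( (\<Sum>i\<in>UNIV. \<Sum>j\<in>UNIV. \<Sum>k\<in>UNIV. \<Sum>s\<in>UNIV. (T a s i * T s j k) *\<^sub>R (g i * g j * g k))
     + (\<Sum>i\<in>UNIV. \<Sum>j\<in>UNIV. \<Sum>k\<in>UNIV. \<Sum>s\<in>UNIV. (T a s j * T i s k) *\<^sub>R (g i * g j * g k))
     + (\<Sum>i\<in>UNIV. \<Sum>j\<in>UNIV. \<Sum>k\<in>UNIV. \<Sum>s\<in>UNIV. (T a s k * T i j s) *\<^sub>R (g i * g j * g k)))"
      unfolding hat3_def sg by (simp only: scaleR_minus_left scaleR_sum_left scaleR_add_left sum.distrib sum_negf)
    then show ?thesis by (simp only: scaleR_minus_right scaleR_minus_left minus_minus)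
  qed
  finally show ?thesis by (simp add: \<tau>_def)
qed

text \<open>The commutator of the square of h with \<open>g a\<close> is the commutator of h with
  the anticommutator of h and \<open>g a\<close>, which is a 2-form; 24 = 6 * 4. Hence \<sigma>
  measures the failure of the square to commute with the generators.\<close>

lemma clifford_comm_hat3_square:
  assumes cl: "clifford g" and T: "alt3 T"
  shows "hat3 g T * hat3 g T * g a - g a * (hat3 g T * hat3 g T) = - 24 *\<^sub>R hat3 g (sig T a)"
proof -
  let ?h = "hat3 g T"
  have e: "?h * g a = - 6 *\<^sub>R hat2 g (T a) - g a * ?h"
    using clifford_anticomm_hat3[OF cl T, of a] by (metis add_diff_cancel_left')
  have "?h * ?h * g a = ?h * (?h * g a)" by (simp add: mult.assoc)
  also have "\<dots> = - 6 *\<^sub>R (?h * hat2 g (T a)) - (?h * g a) * ?h"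
    by (subst e) (simp add: algebra_simps)
  also have "\<dots> = 6 *\<^sub>R (hat2 g (T a) * ?h - ?h * hat2 g (T a)) + g a * (?h * ?h)"
    by (subst e) (simp add: algebra_simps)
  finally show ?thesis unfolding clifford_comm_hat2_hat3[OF cl T] by (simp add: algebra_simps)
qed

text \<open>An anticommutator with one generator and a commutator with another recover the
  components of T.\<close>

lemma clifford_hat3_inj:
  assumes cl: "clifford g" and T: "alt3 T" and z: "hat3 g T = 0"
    and indep: "\<And>c. (\<Sum>b\<in>UNIV. c b *\<^sub>R g b) = 0 \<Longrightarrow> c = (\<lambda>_. 0)"
  shows "T i j k = 0"
proof -
  have "hat2 g (T i) = 0" using clifford_anticomm_hat3[OF cl T, of i] z by simp
  then have "(\<Sum>b\<in>UNIV. T i j b *\<^sub>R g b) = 0"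
    using clifford_comm_hat2[OF cl, of "T i" j, OF alt3_swap23[OF T]] by simp
  from indep[OF this] show ?thesis by metis
qed

section \<open>Operators on the octonions\<close>

type_synonym oct = "real \<times> (real^i7)"

text \<open>Endomorphisms are made a type of their own so that they form an instance of
  \<open>real_algebra_1\<close>, to which the Clifford identities apply.\<close>

typedef oct_op = "{f :: oct \<Rightarrow> oct. linear f}" morphisms app Abs_op
  using linear_id by blast

lemma linear_app: "linear (app f)" using app by simp

lemma app_Abs: "linear f \<Longrightarrow> app (Abs_op f) = f" by (simp add: Abs_op_inverse)

lemma oct_op_eqI: "(\<And>x. app f x = app g x) \<Longrightarrow> f = g"
  by (metis app_inject ext)

instantiation oct_op :: real_algebra_1
begin
definition "0 = Abs_op (\<lambda>x. 0)"
definition "1 = Abs_op (\<lambda>x. x)"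
definition "f + g = Abs_op (\<lambda>x. app f x + app g x)"
definition "f - g = Abs_op (\<lambda>x. app f x - app g x)"
definition "- f = Abs_op (\<lambda>x. - app f x)"
definition "c *\<^sub>R f = Abs_op (\<lambda>x. c *\<^sub>R app f x)"
definition "f * g = Abs_op (\<lambda>x. app f (app g x))"

lemma app_simps [simp]: "app 0 x = 0" "app 1 x = x" "app (f + g) x = app f x + app g x"
  "app (f - g) x = app f x - app g x" "app (- f) x = - app f x" "app (c *\<^sub>R f) x = c *\<^sub>R app f x"
  "app (f * g) x = app f (app g x)"
  unfolding zero_oct_op_def one_oct_op_def plus_oct_op_def minus_oct_op_def uminus_oct_op_def
    scaleR_oct_op_def times_oct_op_def
  using linear_compose[OF linear_app[of g] linear_app[of f]] linear_app[of f] linear_app[of g]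
  by (simp_all add: app_Abs linear_zero linear_id[unfolded id_def] linear_compose_add linear_compose_sub
      linear_compose_neg linear_compose_scale_right comp_def)

instance
proof
  show "(0::oct_op) \<noteq> 1"
  proof
    assume "(0::oct_op) = 1"
    then have "app 0 (1, 0) = app 1 (1, 0)" by simp
    then show False by (simp add: zero_prod_def)
  qed
qed (auto intro!: oct_op_eqI simp: algebra_simps linear_add[OF linear_app] linear_cmul[OF linear_app])
end

lemma app_lin [simp]: "app f (x + y) = app f x + app f y" "app f (x - y) = app f x - app f y"
   "app f (- x) = - app f x" "app f (c *\<^sub>R x) = c *\<^sub>R app f x" "app f 0 = 0"
  using linear_app[of f] by (simp_all add: linear_add linear_cmul linear_diff linear_neg linear_0)

lemma app_sum: "app (sum F S) x = (\<Sum>i\<in>S. app (F i) x)"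
  by (induction S rule: infinite_finite_induct) auto

lemma app_sum_right: "app f (sum F S) = (\<Sum>i\<in>S. app f (F i))"
  by (induction S rule: infinite_finite_induct) auto

text \<open>Left multiplication of octonions by the imaginary units.\<close>

definition gam :: "i7 \<Rightarrow> oct_op" where
  "gam i = Abs_op (\<lambda>(a, v). (- v $ i, \<chi> j. dl i j * a + (\<Sum>k\<in>UNIV. phi0 i k j * v $ k)))"

lemma app_gam: "app (gam i) x = (- snd x $ i, \<chi> j. dl i j * fst x + (\<Sum>k\<in>UNIV. phi0 i k j * snd x $ k))"
  unfolding gam_def
  by (subst app_Abs)
     (auto intro!: linearI simp: case_prod_beta prod_eq_iff vec_eq_iff algebra_simps sum.distrib sum_distrib_left)

text \<open>The polarized form of u(ux) = -|u|^2 x for imaginary octonions. In the two products the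
  \<open>psi0\<close> parts cancel by antisymmetry, and the delta terms of \<open>phi0_phi0\<close>
  remain.\<close>

lemma gam_clifford: "clifford gam"
  unfolding clifford_def
proof (intro allI oct_op_eqI, rename_tac i j x)
  fix i j and x :: oct
  have A: "phi0 i j k + phi0 j i k = 0" for k using phi0_swap12[of i j k] by simp
  have B: "(\<Sum>m\<in>UNIV. phi0 i m k * phi0 j n m) + (\<Sum>m\<in>UNIV. phi0 j m k * phi0 i n m)
      = dl i k * dl j n + dl j k * dl i n - 2 * dl i j * dl n k" for n k
  proof -
    have *: "phi0 i m k * phi0 j n m = phi0 k i m * phi0 j n m" "phi0 j m k * phi0 i n m = phi0 k j m * phi0 i n m" for m
      by (simp_all add: phi0_cycle[of k])
    have "psi0 k i j n = - psi0 k j i n" by (rule psi0_swap23)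
    then show ?thesis unfolding * phi0_phi0 by (simp add: dl_sym[of k j] dl_sym[of k i] dl_sym[of k n] dl_sym[of j i])
  qed
  have C: "(\<Sum>m\<in>UNIV. phi0 i m k * (\<Sum>n\<in>UNIV. phi0 j n m * snd x $ n)) + (\<Sum>m\<in>UNIV. phi0 j m k * (\<Sum>n\<in>UNIV. phi0 i n m * snd x $ n))
     = dl i k * snd x $ j + dl j k * snd x $ i - 2 * dl i j * snd x $ k" for k
  proof -
    have s: "(\<Sum>m\<in>UNIV. phi0 i m k * (\<Sum>n\<in>UNIV. phi0 j n m * snd x $ n))
       = (\<Sum>n\<in>UNIV. (\<Sum>m\<in>UNIV. phi0 i m k * phi0 j n m) * snd x $ n)" for i j
      by (simp only: sum_distrib_left sum_distrib_right mult.assoc) (rule sum.swap)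
    have "(\<Sum>n\<in>UNIV. (\<Sum>m\<in>UNIV. phi0 i m k * phi0 j n m) * snd x $ n) + (\<Sum>n\<in>UNIV. (\<Sum>m\<in>UNIV. phi0 j m k * phi0 i n m) * snd x $ n)
      = (\<Sum>n\<in>UNIV. (dl i k * dl j n + dl j k * dl i n - 2 * dl i j * dl n k) * snd x $ n)"
      unfolding B[symmetric] by (simp add: sum.distrib algebra_simps)
    also have "\<dots> = (\<Sum>n\<in>UNIV. dl j n * (dl i k * snd x $ n)) + (\<Sum>n\<in>UNIV. dl i n * (dl j k * snd x $ n)) - (\<Sum>n\<in>UNIV. dl n k * (2 * dl i j * snd x $ n))"
      by (simp add: sum.distrib sum_subtractf algebra_simps)
    finally show ?thesis unfolding s by simp
  qed
  have E: "(\<Sum>k\<in>UNIV. phi0 i k j * snd x $ k) = - (\<Sum>k\<in>UNIV. phi0 j k i * snd x $ k)"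
    by (simp add: sum_negf[symmetric]) (metis phi0_swap12 phi0_swap23 mult_minus_left minus_minus)
  have F: "(\<Sum>m\<in>UNIV. fst x * (dl i m * phi0 j m k)) = fst x * phi0 j i k" for i j k
    by (simp add: sum_distrib_left[symmetric])
  have G: "fst x * phi0 i j k + fst x * phi0 j i k = 0" for k
    using A by (metis distrib_left mult_zero_right)
  have H: "dl i j * (2 * snd x $ k) + (fst x * phi0 j i k + (fst x * phi0 i j k +
       ((\<Sum>m\<in>UNIV. phi0 i m k * (\<Sum>n\<in>UNIV. phi0 j n m * snd x $ n)) + (\<Sum>m\<in>UNIV. phi0 j m k * (\<Sum>n\<in>UNIV. phi0 i n m * snd x $ n)))))
     = dl i k * snd x $ j + dl j k * snd x $ i" for k
    using C[of k] G[of k] by simp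
  show "app (gam i * gam j + gam j * gam i) x = app ((- 2 * dl i j) *\<^sub>R 1) x"
    using E H by (auto simp: app_gam prod_eq_iff vec_eq_iff dl_sym[of j i] distrib_left sum.distrib F algebra_simps)
qed

lemma gam_skew: "app (gam i) x \<bullet> y = - (x \<bullet> app (gam i) y)"
proof -
  have 1: "(\<Sum>j\<in>UNIV. (\<Sum>k\<in>UNIV. phi0 i k j * snd x $ k) * snd y $ j) = - (\<Sum>j\<in>UNIV. snd x $ j * (\<Sum>k\<in>UNIV. phi0 i k j * snd y $ k))"
    by (simp only: sum_distrib_left sum_distrib_right sum_negf[symmetric], subst sum.swap, subst phi0_swap23)
       (simp add: mult_ac)
  show ?thesis
    using 1 by (simp add: app_gam inner_prod_def inner_vec_def distrib_left distrib_right sum.distrib mult.assoc algebra_simps)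
       (simp add: mult.left_commute[of _ "dl _ _"] mult.assoc)
qed

text \<open>The unit octonion. Together with its images under the \<open>gam i\<close> it is an
  orthonormal basis, so an equation between operators may be tested on these eight vectors.\<close>

abbreviation eta :: oct where "eta \<equiv> (1, 0)"

lemma gam_eta: "app (gam i) eta = (0, axis i 1)"
  by (auto simp: app_gam prod_eq_iff vec_eq_iff axis_def dl_def)

lemma oct_expand: "x = fst x *\<^sub>R eta + (\<Sum>i\<in>UNIV. (snd x $ i) *\<^sub>R app (gam i) eta)"
  by (auto simp: gam_eta prod_eq_iff vec_eq_iff axis_def fst_sum snd_sum if_distrib[of "\<lambda>x. _ * x"] cong: if_cong)

text \<open>Here \<phi> enters: it is the trilinear expression of the spinor \<open>eta\<close>, so
  the contraction of T with \<phi> becomes a matrix entry of the operator of T.\<close>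

lemma gam3_eta: "app (gam i * gam j * gam k) eta \<bullet> eta = - phi0 i j k"
  by (simp add: gam_eta) (simp add: app_gam inner_prod_def axis_def if_distrib[of "\<lambda>x. _ * x"] cong: if_cong add: phi0_cycle[of i j k])

lemma hat3_eta: "app (hat3 gam T) eta \<bullet> eta = - (\<Sum>i\<in>UNIV. \<Sum>j\<in>UNIV. \<Sum>k\<in>UNIV. T i j k * phi0 i j k)"
  unfolding hat3_def using gam3_eta
  by (simp add: app_sum inner_sum_left sum_negf del: app_simps(7))

text \<open>Three skew factors give one sign, and reversing the indices of T gives another.\<close>

lemma hat3_sym: assumes T: "alt3 T" shows "app (hat3 gam T) x \<bullet> y = x \<bullet> app (hat3 gam T) y"
proof -
  have "app (hat3 gam T) x \<bullet> y = (\<Sum>i\<in>UNIV. \<Sum>j\<in>UNIV. \<Sum>k\<in>UNIV. - T i j k * (x \<bullet> app (gam k * gam j * gam i) y))"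
    unfolding hat3_def by (simp add: app_sum inner_sum_left gam_skew)
  also have "\<dots> = (\<Sum>i\<in>UNIV. \<Sum>j\<in>UNIV. \<Sum>k\<in>UNIV. - T k j i * (x \<bullet> app (gam i * gam j * gam k) y))"
    by (rule sum_swap13)
  also have "\<dots> = x \<bullet> app (hat3 gam T) y"
  proof -
    have "- T k j i = T i j k" for i j k using alt3_swap12[OF T, of k j i] alt3_cycle[OF T, of i j k] alt3_cycle[OF T, of j k i]
        by simp
    then show ?thesis unfolding hat3_def by (simp add: app_sum inner_sum_right)
  qed
  finally show ?thesis .
qed

text \<open>The bilinear map polarizing \<open>sig\<close>, through which derivatives of
  \<open>sig\<close> are expressed.\<close>

definition sig2 :: "(i7 \<Rightarrow> i7 \<Rightarrow> i7 \<Rightarrow> real) \<Rightarrow> (i7 \<Rightarrow> i7 \<Rightarrow> i7 \<Rightarrow> real) \<Rightarrow> i7 \<Rightarrow> i7 \<Rightarrow> i7 \<Rightarrow> i7 \<Rightarrow> real" where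
  "sig2 S T i j k l = (\<Sum>s\<in>UNIV. S i j s * T s k l + S j k s * T s i l + S k i s * T s j l)"

lemma sig_add: "sig (\<lambda>i j k. S i j k + T i j k) i j k l = sig S i j k l + sig T i j k l + (sig2 S T i j k l + sig2 T S i j k l)"
  by (simp add: sig_def sig2_def sum.distrib[symmetric] algebra_simps)

lemma sig_cycle4: assumes T: "alt3 T" shows "sig T i j k l = - sig T j k l i"
  using sig_swap34[OF T, of i j k l] sig_cycle3[of T i j l k] sig_swap34[OF T, of j l i k] sig_swap12[OF T, of j l k i] sig_cycle3[of T l j k i]
  by simp

text \<open>The square of h is symmetric and \<open>gam l\<close> is skew, so the commutator formula
  evaluated at \<open>eta\<close> yields twice this entry. If the right side vanishes for all l,
  then \<open>eta\<close> is an eigenvector of the square.\<close>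

lemma hat3_square_eta:
  assumes T: "alt3 T"
  shows "app (hat3 gam T * hat3 gam T) eta \<bullet> app (gam l) eta
     = - 12 * (\<Sum>i\<in>UNIV. \<Sum>j\<in>UNIV. \<Sum>k\<in>UNIV. sig T i j k l * phi0 i j k)"
proof -
  let ?h = "hat3 gam T"
  have "app (?h * ?h * gam l - gam l * (?h * ?h)) eta \<bullet> eta = app (- 24 *\<^sub>R hat3 gam (sig T l)) eta \<bullet> eta"
    by (simp only: clifford_comm_hat3_square[OF gam_clifford T])
  also have "\<dots> = 24 * (\<Sum>i\<in>UNIV. \<Sum>j\<in>UNIV. \<Sum>k\<in>UNIV. sig T l i j k * phi0 i j k)"
    using hat3_eta[of "sig T l"] by simp
  also have "(\<Sum>i\<in>UNIV. \<Sum>j\<in>UNIV. \<Sum>k\<in>UNIV. sig T l i j k * phi0 i j k) = - (\<Sum>i\<in>UNIV. \<Sum>j\<in>UNIV. \<Sum>k\<in>UNIV. sig T i j k l * phi0 i j k)"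
    by (subst sig_cycle4[OF T]) (simp only: mult_minus_left sum_negf)
  also have "app (?h * ?h * gam l - gam l * (?h * ?h)) eta \<bullet> eta = 2 * (app (?h * ?h) eta \<bullet> app (gam l) eta)"
  proof -
    have "app ?h (app ?h (app (gam l) eta)) \<bullet> eta = app (gam l) eta \<bullet> app ?h (app ?h eta)"
      by (simp only: hat3_sym[OF T])
    moreover have "app (gam l) (app ?h (app ?h eta)) \<bullet> eta = - (app ?h (app ?h eta) \<bullet> app (gam l) eta)"
      by (rule gam_skew)
    ultimately show ?thesis
      by (simp only: app_simps inner_diff_left) (simp add: inner_commute)
  qed
  finally show ?thesis by simp
qed

text \<open>Polarization of \<open>hat3_square_eta\<close>. With a covariant derivative of T in
  place of S it expresses the differentiated eigenvector equation.\<close>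

lemma hat3_anticomm_eta:
  assumes S: "alt3 S" and T: "alt3 T"
  shows "app (hat3 gam S * hat3 gam T + hat3 gam T * hat3 gam S) eta \<bullet> app (gam l) eta
     = - 12 * (\<Sum>i\<in>UNIV. \<Sum>j\<in>UNIV. \<Sum>k\<in>UNIV. (sig2 S T i j k l + sig2 T S i j k l) * phi0 i j k)"
proof -
  have "alt3 (\<lambda>i j k. S i j k + T i j k)"
    unfolding alt3_def
  proof (intro allI conjI)
    fix i j k
    show "S i j k + T i j k = - (S j i k + T j i k)"
      using alt3_swap12[OF S, of i j k] alt3_swap12[OF T, of i j k] by linarith
    show "S i j k + T i j k = - (S i k j + T i k j)"
      using alt3_swap23[OF S, of i j k] alt3_swap23[OF T, of i j k] by linarith
  qed
  from hat3_square_eta[OF this, of l] hat3_square_eta[OF S, of l] hat3_square_eta[OF T, of l]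
  show ?thesis
    by (simp add: hat3_add sig_add distrib_right sum.distrib inner_add_left)
qed

lemma gam_indep: "(\<Sum>b\<in>UNIV. c b *\<^sub>R gam b) = 0 \<Longrightarrow> c = (\<lambda>_. 0)"
proof
  fix i
  assume "(\<Sum>b\<in>UNIV. c b *\<^sub>R gam b) = 0"
  then have "snd (app (\<Sum>b\<in>UNIV. c b *\<^sub>R gam b) eta) $ i = 0" by simp
  then show "c i = 0"
    by (simp add: app_sum gam_eta snd_sum axis_def if_distrib[of "\<lambda>x. _ * x"] cong: if_cong)
qed

lemma oct_eqI: "x \<bullet> eta = y \<bullet> eta \<Longrightarrow> (\<And>i. x \<bullet> app (gam i) eta = y \<bullet> app (gam i) eta) \<Longrightarrow> x = y"
  by (auto simp: gam_eta inner_axis prod_eq_iff vec_eq_iff inner_prod_def)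

text \<open>In terms of the Clifford operator \<open>h\<close> of \<open>T\<close> and \<open>h\<^sup>2 \<eta> = \<mu> \<eta>\<close>, differentiating the latter relation
  gives \<open>B (h X + X h) \<eta> = 0\<close> with \<open>B = h\<^sup>2 - \<mu>\<close>; writing \<open>h \<eta> = (\<lambda> + \<theta>) \<eta>\<close> this is \<open>B (h + \<lambda>) = B \<theta>\<close>,
  and comparing with the adjoint equation yields \<open>(h + \<lambda>)\<^sup>2 B = - |\<theta>|\<^sup>2 B\<close>, whence \<open>B = 0\<close> by positivity.\<close>

lemma sig_zero:
  assumes T: "alt3 T" and S: "\<And>a. alt3 (S a)" and ST: "\<And>a i j k. S a i j k = sig T i j k a / 3"
    and v: "\<And>l. (\<Sum>i\<in>UNIV. \<Sum>j\<in>UNIV. \<Sum>k\<in>UNIV. sig T i j k l * phi0 i j k) = 0"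
    and dv: "\<And>a l. (\<Sum>i\<in>UNIV. \<Sum>j\<in>UNIV. \<Sum>k\<in>UNIV. (sig2 (S a) T i j k l + sig2 T (S a) i j k l) * phi0 i j k) = 0"
  shows "sig T i j k l = 0"
proof -
  define h where "h = hat3 gam T"
  have hs: "app h x \<bullet> y = x \<bullet> app h y" for x y unfolding h_def by (rule hat3_sym[OF T])
  define \<mu> where "\<mu> = app (h * h) eta \<bullet> eta"
  define B where "B = h * h - \<mu> *\<^sub>R 1"
  have Bs: "app B x \<bullet> y = x \<bullet> app B y" for x y
    by (simp add: B_def inner_diff_left inner_diff_right hs)
  have hB: "h * B = B * h" by (simp add: B_def algebra_simps)
  have Beta: "app B eta = 0"
  proof (rule oct_eqI)
    show "app B eta \<bullet> eta = 0 \<bullet> eta"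
      by (simp add: B_def inner_diff_left \<mu>_def)
    show "app B eta \<bullet> app (gam i) eta = 0 \<bullet> app (gam i) eta" for i
      using hat3_square_eta[OF T, of i] v[of i]
      by (simp add: B_def inner_diff_left h_def) (simp add: gam_eta inner_prod_def)
  qed
  \<comment> \<open>72 = 24 * 3: \<open>S a\<close> is a third of \<sigma>, and cycling the index a
    from the last to the first place of \<sigma> costs a sign.\<close>
  have comm: "h * h * gam a - gam a * (h * h) = 72 *\<^sub>R hat3 gam (S a)" for a
  proof -
    have "S a = (\<lambda>i j k. (- 1 / 3) * sig T a i j k)"
    proof (intro ext)
      fix i j k
      have "sig T a i j k = - sig T i j k a"
        by (rule sig_cycle4[OF T])
      then show "S a i j k = (- 1 / 3) * sig T a i j k" using ST by simp
    qed
    then have "hat3 gam (S a) = (- 1 / 3) *\<^sub>R hat3 gam (sig T a)" using hat3_scale by metis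
    then show ?thesis unfolding h_def clifford_comm_hat3_square[OF gam_clifford T] by simp
  qed
  \<comment> \<open>Commuting B past the anticommutator of h and \<open>gam a\<close> leaves 72
    times the anticommutator of h and \<open>S a\<close>. Applied to \<open>eta\<close>, this has no
    imaginary component by \<open>dv\<close>, and no real one because B is symmetric and kills
    \<open>eta\<close>.\<close>
  have BX: "app (B * (h * gam a + gam a * h)) eta = 0" for a
  proof -
    let ?s = "hat3 gam (S a)"
    have "72 *\<^sub>R (h * ?s + ?s * h) = h * (72 *\<^sub>R ?s) + (72 *\<^sub>R ?s) * h" by (simp add: scaleR_add_right)
    also have "\<dots> = h * (h * h * gam a - gam a * (h * h)) + (h * h * gam a - gam a * (h * h)) * h"
      by (simp only: comm)
    finally have "B * (h * gam a + gam a * h) = 72 *\<^sub>R (h * ?s + ?s * h) + (h * gam a + gam a * h) * B"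
      by (simp add: B_def algebra_simps)
    then have e: "app (B * (h * gam a + gam a * h)) eta = 72 *\<^sub>R app (?s * h + h * ?s) eta"
      by (simp add: Beta add.commute)
    show ?thesis
    proof (rule oct_eqI)
      show "app (B * (h * gam a + gam a * h)) eta \<bullet> eta = 0 \<bullet> eta"
        by (simp only: app_simps(7)[of B] Bs Beta inner_zero_right inner_zero_left)
      show "app (B * (h * gam a + gam a * h)) eta \<bullet> app (gam i) eta = 0 \<bullet> app (gam i) eta" for i
        unfolding e inner_scaleR_left unfolding h_def hat3_anticomm_eta[OF S T] dv by simp
    qed
  qed
  define lam where "lam = fst (app h eta)"
  define \<theta> where "\<theta> = (\<Sum>i\<in>UNIV. (snd (app h eta) $ i) *\<^sub>R gam i)"
  have heta: "app h eta = app (lam *\<^sub>R 1 + \<theta>) eta"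
    using oct_expand[of "app h eta"] by (simp add: lam_def \<theta>_def app_sum)
  have th_skew: "app \<theta> x \<bullet> y = - (x \<bullet> app \<theta> y)" for x y
    by (simp add: \<theta>_def app_sum inner_sum_left inner_sum_right gam_skew sum_negf)
  define c where "c i = snd (app h eta) $ i" for i
  define n where "n = sqrt (\<Sum>i\<in>UNIV. c i * c i)"
  have anti: "gam a * \<theta> + \<theta> * gam a = (- 2 * c a) *\<^sub>R 1" for a
  proof -
    have "gam a * \<theta> + \<theta> * gam a = (\<Sum>i\<in>UNIV. c i *\<^sub>R (gam a * gam i + gam i * gam a))"
      by (simp add: \<theta>_def c_def sum_distrib_left sum_distrib_right sum.distrib scaleR_add_right)
    also have "\<dots> = (\<Sum>i\<in>UNIV. dl a i *\<^sub>R ((- 2 * c i) *\<^sub>R 1))"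
      using gam_clifford unfolding clifford_def by (simp add: mult_ac)
    finally show ?thesis by (simp only: sum_dl_scaleR)
  qed
  have n2: "n\<^sup>2 = (\<Sum>i\<in>UNIV. c i * c i)" unfolding n_def by (simp add: sum_nonneg)
  have th2: "\<theta> * \<theta> = - (n\<^sup>2) *\<^sub>R 1"
  proof -
    have th: "\<theta> = (\<Sum>i\<in>UNIV. c i *\<^sub>R gam i)" by (simp add: \<theta>_def c_def)
    have "\<theta> * \<theta> = (\<Sum>i\<in>UNIV. c i *\<^sub>R (gam i * \<theta>))"
      by (subst th) (simp only: sum_distrib_right mult_scaleR_left)
    moreover have "\<theta> * \<theta> = (\<Sum>i\<in>UNIV. c i *\<^sub>R (\<theta> * gam i))"
      by (subst (2) th) (simp only: sum_distrib_left mult_scaleR_right)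
    ultimately have "2 *\<^sub>R (\<theta> * \<theta>) = (\<Sum>i\<in>UNIV. c i *\<^sub>R (gam i * \<theta> + \<theta> * gam i))"
      by (simp only: sum.distrib scaleR_add_right scaleR_2)
    also have "\<dots> = (- 2 * n\<^sup>2) *\<^sub>R 1"
      unfolding anti n2 by (simp add: scaleR_sum_left sum_distrib_left mult_ac sum_negf)
    finally have "2 *\<^sub>R (\<theta> * \<theta>) = 2 *\<^sub>R (- (n\<^sup>2) *\<^sub>R 1)" by simp
    then show ?thesis by (simp only: scaleR_cancel_left) simp
  qed
  \<comment> \<open>Tested on the basis: on \<open>eta\<close> both sides vanish; on
    \<open>gam a eta\<close>, \<open>BX\<close> moves h and \<open>anti\<close> moves \<theta>
    across \<open>gam a\<close>, and the leftover multiple of B \<open>eta\<close> is zero.\<close>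
  have key0: "app (B * (h + lam *\<^sub>R 1)) x = app (B * \<theta>) x" for x
  proof -
    have e1: "app (B * (h + lam *\<^sub>R 1)) eta = app (B * \<theta>) eta"
    proof -
      have "app (B * h) eta = 0" unfolding hB[symmetric] by (simp add: Beta)
      moreover have "app B (app h eta) = lam *\<^sub>R app B eta + app B (app \<theta> eta)" unfolding heta by (simp del: scaleR_Pair)
      ultimately show ?thesis by (simp add: Beta del: scaleR_Pair)
    qed
    have e2: "app (B * (h + lam *\<^sub>R 1)) (app (gam a) eta) = app (B * \<theta>) (app (gam a) eta)" for a
    proof -
      have "app (gam a * h) eta = app (gam a) (app (lam *\<^sub>R 1 + \<theta>) eta)" by (simp add: heta)
      also have "\<dots> = lam *\<^sub>R app (gam a) eta + app (gam a * \<theta>) eta" by (simp del: scaleR_Pair)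
      also have "gam a * \<theta> = (- 2 * c a) *\<^sub>R 1 - \<theta> * gam a" using anti[of a] by (simp add: eq_diff_eq)
      finally have "app B (app (gam a * h) eta) = lam *\<^sub>R app B (app (gam a) eta) - app B (app \<theta> (app (gam a) eta))"
        by (simp add: Beta del: scaleR_Pair)
      moreover have "app B (app h (app (gam a) eta)) = - app B (app (gam a * h) eta)"
        using BX[of a] by (simp add: eq_neg_iff_add_eq_0 del: scaleR_Pair)
      ultimately show ?thesis by (simp del: scaleR_Pair)
    qed
    show ?thesis
      by (subst (1 2) oct_expand) (simp only: app_lin app_sum_right e1 e2)
  qed
  have key: "B * (h + lam *\<^sub>R 1) = B * \<theta>" using key0 by (rule oct_op_eqI)
  have key': "(h + lam *\<^sub>R 1) * B = - \<theta> * B"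
  proof (rule oct_op_eqI)
    fix x
    have "app ((h + lam *\<^sub>R 1) * B) x \<bullet> y = app (- \<theta> * B) x \<bullet> y" for y
    proof -
      have "app ((h + lam *\<^sub>R 1) * B) x \<bullet> y = x \<bullet> app (B * (h + lam *\<^sub>R 1)) y"
        by (simp add: inner_add_left inner_add_right hs Bs)
      also have "\<dots> = app (- \<theta> * B) x \<bullet> y" unfolding key by (simp add: th_skew Bs)
      finally show ?thesis .
    qed
    then show "app ((h + lam *\<^sub>R 1) * B) x = app (- \<theta> * B) x" using vector_eq_rdot by blast
  qed
  have cm: "(h + lam *\<^sub>R 1) * B = B * (h + lam *\<^sub>R 1)" using hB by (simp add: algebra_simps)
  \<comment> \<open>Because h commutes with B, \<open>key\<close> can be applied twice, each time
    trading a factor on the left for \<theta> on the right.\<close>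
  have sq: "(h + lam *\<^sub>R 1) * ((h + lam *\<^sub>R 1) * B) = - (n\<^sup>2) *\<^sub>R B"
  proof -
    have ck: "(h + lam *\<^sub>R 1) * B = B * \<theta>" by (simp only: cm key)
    have "(h + lam *\<^sub>R 1) * ((h + lam *\<^sub>R 1) * B) = ((h + lam *\<^sub>R 1) * B) * \<theta>"
      by (subst (1) ck) (simp only: mult.assoc)
    also have "\<dots> = B * (\<theta> * \<theta>)" by (simp only: ck mult.assoc)
    finally show ?thesis by (simp add: th2)
  qed
  \<comment> \<open>By \<open>sq\<close> and symmetry, the squared norm of the vector in
    \<open>z\<close> is -n^2 times the squared norm of B u, so both are zero.\<close>
  have z: "app (h + lam *\<^sub>R 1) (app B u) = 0" and nB: "n = 0 \<or> app B u = 0" for u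
  proof -
    let ?w = "app (h + lam *\<^sub>R 1) (app B u)"
    have "?w \<bullet> ?w = app ((h + lam *\<^sub>R 1) * ((h + lam *\<^sub>R 1) * B)) u \<bullet> app B u"
      by (simp add: inner_add_left inner_add_right hs)
    also have "\<dots> = - (n\<^sup>2 * (app B u \<bullet> app B u))" unfolding sq by simp
    finally have e: "?w \<bullet> ?w = - (n\<^sup>2 * (app B u \<bullet> app B u))" .
    have "n\<^sup>2 * (app B u \<bullet> app B u) \<ge> 0" by simp
    then have "?w \<bullet> ?w = 0" using e inner_ge_zero[of ?w] by linarith
    then show "?w = 0" "n = 0 \<or> app B u = 0" using e by auto
  qed
  have "app B u = 0" for u
  \<comment> \<open>If n = 0, then \<open>eta\<close> is an eigenvector of h itself and \<mu> =
    lam^2, so B is (h - lam)(h + lam). By \<open>z\<close> the factor h + lam kills the range of B;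
    thus B B = 0, and B = 0 by symmetry.\<close>
  proof (cases "n = 0")
    case True
    then have "c i = 0" for i using n2 by (simp add: sum_nonneg_eq_0_iff)
    then have "\<theta> = 0" by (simp add: \<theta>_def c_def)
    then have "app h eta = lam *\<^sub>R eta" using heta by (simp del: scaleR_Pair)
    then have "app (h * h) eta = lam *\<^sub>R (lam *\<^sub>R eta)" by (simp del: scaleR_Pair)
    then have "\<mu> = lam * lam" by (simp add: \<mu>_def inner_prod_def)
    then have "B = (h - lam *\<^sub>R 1) * (h + lam *\<^sub>R 1)" by (simp add: B_def algebra_simps)
    then have "app B (app B u) = app (h - lam *\<^sub>R 1) (app (h + lam *\<^sub>R 1) (app B u))" by (metis app_simps(7))
    then have "app B (app B u) = 0" by (simp only: z app_lin)
    then have "app B u \<bullet> app B u = 0" using Bs by (metis inner_zero_right)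
    then show ?thesis by simp
  qed (use nB in blast)
  then have "B = 0" by (intro oct_op_eqI) simp
  then have "h * h = \<mu> *\<^sub>R 1" by (simp add: B_def)
  then have "hat3 gam (sig T i) = 0"
    using clifford_comm_hat3_square[OF gam_clifford T, of i] unfolding h_def[symmetric] by simp
  moreover have "alt3 (sig T i)"
    unfolding alt3_def using sig_swap12[OF T] sig_swap34[OF T] sig_cycle3[of T] by metis
  ultimately have "sig T i j k l = 0"
    using clifford_hat3_inj[OF gam_clifford _ _ gam_indep] by blast
  then show ?thesis .
qed

section \<open>Alternating forms and adapted frames\<close>

lemma multilinear_linear:
  assumes "multilinear k \<alpha>" "length as + Suc (length bs) = k"
  shows "linear (\<lambda>x. \<alpha> (as @ x # bs))"
proof -
  have "linear (\<lambda>x. \<alpha> ((as @ 0 # bs)[length as := x]))"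
    using assms(1)[unfolded multilinear_def, rule_format, of "as @ 0 # bs" "length as"] assms(2) by simp
  then show ?thesis by simp
qed

lemma alternating_linear:
  assumes "alternating k \<alpha>" "length as + Suc (length bs) = k"
  shows "linear (\<lambda>x. \<alpha> (as @ x # bs))"
  using assms multilinear_linear unfolding alternating_def by blast

lemma alternating_repeat:
  assumes "alternating k \<alpha>" "length as + Suc (Suc (length bs + length cs)) = k"
  shows "\<alpha> (as @ x # bs @ x # cs) = 0"
proof -
  let ?vs = "as @ x # bs @ x # cs" and ?j = "Suc (length as + length bs)"
  have "?vs ! length as = x" by simp
  moreover have "?vs ! ?j = x" by (simp add: nth_append)
  moreover have "length ?vs = k" "length as < ?j" "?j < k" using assms(2) by simp_all
  ultimately show ?thesis
    using assms(1) unfolding alternating_def by metis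
qed

lemma alternating_swap:
  assumes a: "alternating k \<alpha>" and l: "length as + Suc (Suc (length bs)) = k"
  shows "\<alpha> (as @ x # y # bs) = - \<alpha> (as @ y # x # bs)"
proof -
  have z: "\<alpha> (as @ x # x # bs) = 0" for x using alternating_repeat[OF a, of as "[]" bs x] l by simp
  have l1: "linear (\<lambda>x. \<alpha> (as @ x # y # bs))" for y by (rule alternating_linear[OF a]) (use l in simp)
  have l2: "linear (\<lambda>y. \<alpha> (as @ x # y # bs))" for x
    using alternating_linear[OF a, of "as @ [x]" bs] l by simp
  have "0 = \<alpha> (as @ (x + y) # (x + y) # bs)" by (simp add: z)
  also have "\<dots> = \<alpha> (as @ x # (x + y) # bs) + \<alpha> (as @ y # (x + y) # bs)"
    using linear_add[OF l1] .
  also have "\<dots> = \<alpha> (as @ x # y # bs) + \<alpha> (as @ y # x # bs)"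
    using linear_add[OF l2] by (simp add: z)
  finally show ?thesis by simp
qed

text \<open>The parity of the number of inversions, in a form that rewriting evaluates on concrete
  lists.\<close>

fun lsign :: "i7 list \<Rightarrow> real" where
  "lsign [] = 1"
| "lsign (x # xs) = (- 1) ^ length (filter (\<lambda>y. ix y < ix x) xs) * lsign xs"

lemma alternating_insort:
  assumes a: "alternating k \<alpha>" and l: "length as + Suc (length xs) = k" and s: "sorted (map ix xs)"
  shows "\<alpha> (as @ map E (x # xs)) = (- 1) ^ length (filter (\<lambda>y. ix y < ix x) xs) * \<alpha> (as @ map E (insort_key ix x xs))"
  using l s
proof (induction xs arbitrary: as)
  case (Cons y ys)
  show ?case
  proof (cases "ix x \<le> ix y")
    case True
    then have "filter (\<lambda>z. ix z < ix x) (y # ys) = []" using Cons.prems by (auto simp: filter_empty_conv)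
    then show ?thesis using True by simp
  next
    case False
    have "\<alpha> (as @ E x # E y # map E ys) = - \<alpha> ((as @ [E y]) @ map E (x # ys))"
      using alternating_swap[OF a, of as "map E ys" "E x" "E y"] Cons.prems by simp
    also have "\<dots> = - ((- 1) ^ length (filter (\<lambda>y. ix y < ix x) ys) * \<alpha> ((as @ [E y]) @ map E (insort_key ix x ys)))"
      using Cons.IH[of "as @ [E y]"] Cons.prems by simp
    finally show ?thesis using False by simp
  qed
qed simp

lemma alternating_sort:
  assumes a: "alternating k \<alpha>" and l: "length as + length xs = k"
  shows "\<alpha> (as @ map E xs) = lsign xs * \<alpha> (as @ map E (sort_key ix xs))"
  using l
proof (induction xs arbitrary: as)
  case (Cons x xs)
  have "\<alpha> (as @ map E (x # xs)) = lsign xs * \<alpha> ((as @ [E x]) @ map E (sort_key ix xs))"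
    using Cons.IH[of "as @ [E x]"] Cons.prems by simp
  also have "\<alpha> ((as @ [E x]) @ map E (sort_key ix xs)) = (- 1) ^ length (filter (\<lambda>y. ix y < ix x) (sort_key ix xs)) * \<alpha> (as @ map E (insort_key ix x (sort_key ix xs)))"
    using alternating_insort[OF a, of as "sort_key ix xs" E x] Cons.prems by simp
  also have "length (filter (\<lambda>y. ix y < ix x) (sort_key ix xs)) = length (filter (\<lambda>y. ix y < ix x) xs)"
    by (metis mset_filter mset_sort size_mset)
  finally show ?case by simp
qed simp

abbreviation L7 :: "i7 list" where "L7 \<equiv> [I1, I2, I3, I4, I5, I6, I7]"

text \<open>The Levi-Civita symbol, used on lists of length seven.\<close>

definition eps :: "i7 list \<Rightarrow> real" where
  "eps l = (if distinct l then lsign l else 0)"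

lemma sort_key_L7:
  assumes "distinct l" "length l = 7" shows "sort_key ix l = L7"
proof -
  have "card (set l) = 7" using assms distinct_card by metis
  moreover have "card (UNIV :: i7 set) = 7" by (simp add: UNIV_i7)
  ultimately have "set l = UNIV" by (intro card_subset_eq) auto
  have "sorted (map ix (sort_key ix l))" by simp
  moreover have "distinct (map ix (sort_key ix l))" using assms inj_on_subset[OF inj_ix] by (simp add: distinct_map)
  moreover have "set (map ix (sort_key ix l)) = set (map ix L7)" using \<open>set l = UNIV\<close> by (simp add: UNIV_i7)
  moreover have "sorted (map ix L7)" "distinct (map ix L7)" by simp_all
  ultimately have "map ix (sort_key ix l) = map ix L7" by (intro sorted_distinct_set_unique)
  then show ?thesis using inj_ix by (metis inj_map_eq_map)
qed

lemma alternating_eps: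
  assumes a: "alternating 7 \<alpha>" and l: "length l = 7"
  shows "\<alpha> (map E l) = eps l * \<alpha> (map E L7)"
proof (cases "distinct l")
  case True
  then show ?thesis using alternating_sort[OF a, of "[]" l E] l sort_key_L7[OF True l] by (simp add: eps_def)
next
  case False
  then obtain as bs cs x where "l = as @ [x] @ bs @ [x] @ cs" using not_distinct_decomp by blast
  then have "\<alpha> (map E l) = 0"
    using alternating_repeat[OF a, of "map E as" "map E bs" "map E cs" "E x"] l by simp
  then show ?thesis using False by (simp add: eps_def)
qed

definition dual_frames :: "(i7 \<Rightarrow> vec7 \<Rightarrow> real) \<Rightarrow> (i7 \<Rightarrow> vec7) \<Rightarrow> bool" where
  "dual_frames e E \<longleftrightarrow> (\<forall>i. linear (e i)) \<and> (\<forall>i j. e i (E j) = dl i j) \<and> (\<forall>v. v = (\<Sum>i\<in>UNIV. e i v *\<^sub>R E i))"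

text \<open>Arguments are expanded in the frame one at a time, by induction on the number of those
  that are still arbitrary.\<close>

lemma alternating_zero_on_frame:
  assumes a: "alternating 7 \<alpha>" and d: "dual_frames e E" and z: "\<alpha> (map E L7) = 0" and l: "length vs = 7"
  shows "\<alpha> vs = 0"
proof -
  have "\<forall>is ws. length is + length ws = 7 \<longrightarrow> length ws = n \<longrightarrow> \<alpha> (map E is @ ws) = 0" for n
  proof (induction n)
    case 0
    then show ?case using alternating_eps[OF a] z by auto
  next
    case (Suc n)
    show ?case
    proof (intro allI impI)
      fix "is" :: "i7 list" and ws :: "vec7 list"
      assume "length is + length ws = 7" and "length ws = Suc n"
      then obtain v ws' where ws: "ws = v # ws'" "length is + Suc (length ws') = 7" "length ws' = n" by (cases ws) auto
      have lin: "linear (\<lambda>v. \<alpha> (map E is @ v # ws'))" by (rule alternating_linear[OF a]) (use ws in simp)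
      have "\<alpha> (map E is @ v # ws') = \<alpha> (map E is @ (\<Sum>i\<in>UNIV. e i v *\<^sub>R E i) # ws')"
        using d unfolding dual_frames_def by metis
      also have "\<dots> = (\<Sum>i\<in>UNIV. e i v * \<alpha> (map E (is @ [i]) @ ws'))"
        by (simp add: linear_sum[OF lin] linear_cmul[OF lin])
      also have "\<dots> = 0"
      proof (intro sum.neutral ballI)
        fix i
        have "\<alpha> (map E (is @ [i]) @ ws') = 0" using Suc.IH[rule_format, of "is @ [i]" ws'] ws by simp
        then show "e i v * \<alpha> (map E (is @ [i]) @ ws') = 0" by simp
      qed
      finally show "\<alpha> (map E is @ ws) = 0" using ws by simp
    qed
  qed
  from this[of 7, rule_format, of "[]" vs] l show ?thesis by simp
qed

lemma wedge_covectors_alternating: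
  assumes lin: "\<And>a. a \<in> set as \<Longrightarrow> linear a"
  shows "alternating (length as) (wedge_covectors as)"
  unfolding alternating_def multilinear_def
proof (intro conjI allI impI)
  fix vs :: "vec7 list" and i assume l: "length vs = length as" and i: "i < length as"
  show "linear (\<lambda>x. wedge_covectors as (vs[i := x]))"
    unfolding wedge_covectors_def
  proof (intro linear_compose_sum ballI)
    fix \<pi> assume "\<pi> \<in> {\<pi>. \<pi> permutes {..<length as}}"
    then have p: "\<pi> permutes {..<length as}" by simp
    \<comment> \<open>The only factor of the product that reads the i-th argument.\<close>
    define m where "m = inv \<pi> i"
    have m: "m < length as" "\<pi> m = i"
      using permutes_in_image[OF permutes_inv[OF p]] i permutes_inverses(1)[OF p] by (auto simp: m_def)
    have ne: "\<pi> j \<noteq> i" if "j \<noteq> m" for j using that m permutes_inj[OF p] by (metis injD)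
    have "(\<Prod>j<length as. (as ! j) (vs[i := x] ! \<pi> j)) = (as ! m) x * (\<Prod>j\<in>{..<length as} - {m}. (as ! j) (vs ! \<pi> j))" for x
    proof -
      have "(\<Prod>j<length as. (as ! j) (vs[i := x] ! \<pi> j))
         = (as ! m) (vs[i := x] ! \<pi> m) * (\<Prod>j\<in>{..<length as} - {m}. (as ! j) (vs[i := x] ! \<pi> j))"
        by (rule prod.remove) (use m in auto)
      also have "(\<Prod>j\<in>{..<length as} - {m}. (as ! j) (vs[i := x] ! \<pi> j)) = (\<Prod>j\<in>{..<length as} - {m}. (as ! j) (vs ! \<pi> j))"
        by (intro prod.cong refl) (metis Diff_iff ne nth_list_update_neq singletonI)
      finally show ?thesis using m i l by simp
    qed
    moreover have "linear (as ! m)" using lin m by simp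
    ultimately show "linear (\<lambda>x. of_int (sign \<pi>) * (\<Prod>j<length as. (as ! j) (vs[i := x] ! \<pi> j)))"
      by (auto intro!: linearI simp: linear_add linear_cmul algebra_simps)
  qed
next
  fix vs :: "vec7 list" and i j assume l: "length vs = length as" and ij: "i < j" "j < length as" "vs ! i = vs ! j"
  let ?t = "Transposition.transpose i j"
  have t: "?t permutes {..<length as}" using ij by (intro permutes_swap_id) auto
  let ?f = "\<lambda>\<pi>. of_int (sign \<pi>) * (\<Prod>m<length as. (as ! m) (vs ! \<pi> m)) :: real"
  have "sum ?f {\<pi>. \<pi> permutes {..<length as}} = sum (\<lambda>\<pi>. ?f (?t \<circ> \<pi>)) {\<pi>. \<pi> permutes {..<length as}}"
    by (rule sum.reindex_bij_witness[of _ "\<lambda>\<pi>. ?t \<circ> \<pi>" "\<lambda>\<pi>. ?t \<circ> \<pi>"])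
       (auto simp: o_assoc permutes_compose[OF _ t])
  also have "\<dots> = - sum ?f {\<pi>. \<pi> permutes {..<length as}}"
    unfolding sum_negf[symmetric]
  proof (intro sum.cong refl)
    fix \<pi> assume "\<pi> \<in> {\<pi>. \<pi> permutes {..<length as}}"
    then have p: "permutation \<pi>" using permutation_permutes finite_lessThan by blast
    have "sign (?t \<circ> \<pi>) = - sign \<pi>"
      using sign_compose[OF permutation_swap_id p] ij by (simp add: sign_swap_id)
    moreover have "vs ! ?t n = vs ! n" for n using ij by (simp add: Transposition.transpose_def)
    ultimately show "?f (?t \<circ> \<pi>) = - ?f \<pi>" by simp
  qed
  finally show "wedge_covectors as vs = 0" unfolding wedge_covectors_def by simp
qed

lemma wedge_covectors_alternating7:
  assumes "\<And>i. linear (e i)" "length l = 7"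
  shows "alternating 7 (wedge_covectors (map e l))"
proof -
  have "alternating (length (map e l)) (wedge_covectors (map e l))"
    by (rule wedge_covectors_alternating) (use assms in auto)
  then show ?thesis using assms(2) by simp
qed

lemma permutes_lt: "\<pi> permutes {..<n} \<Longrightarrow> i < n \<Longrightarrow> \<pi> i < (n::nat)"
  using permutes_in_image[of \<pi> "{..<n}" i] by simp

text \<open>A matrix and its transpose have the same determinant: replace each permutation by its
  inverse.\<close>

lemma wedge_covectors_transpose:
  assumes d: "\<And>i j. e i (E j) = dl i j" and l: "length l = length m"
  shows "wedge_covectors (map e l) (map E m) = wedge_covectors (map e m) (map E l)"
proof -
  let ?P = "{\<pi>. \<pi> permutes {..<length m}}"
  have "wedge_covectors (map e l) (map E m) = (\<Sum>\<pi>\<in>?P. of_int (sign \<pi>) * (\<Prod>i<length m. dl (l ! i) (m ! \<pi> i)))"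
    unfolding wedge_covectors_def using l
    by (auto intro!: sum.cong prod.cong simp: d permutes_lt)
  also have "\<dots> = (\<Sum>\<pi>\<in>?P. of_int (sign (inv \<pi>)) * (\<Prod>i<length m. dl (l ! i) (m ! inv \<pi> i)))"
    by (rule sum_permutations_inverse)
  also have "\<dots> = (\<Sum>\<pi>\<in>?P. of_int (sign \<pi>) * (\<Prod>i<length m. dl (m ! i) (l ! \<pi> i)))"
  proof (intro sum.cong refl)
    fix \<pi> assume "\<pi> \<in> ?P"
    then have p: "\<pi> permutes {..<length m}" by simp
    have "(\<Prod>i<length m. dl (l ! i) (m ! inv \<pi> i)) = (\<Prod>i<length m. dl (l ! \<pi> i) (m ! inv \<pi> (\<pi> i)))"
      using prod.permute[OF p, of "\<lambda>i. dl (l ! i) (m ! inv \<pi> i)"] by (simp add: o_def)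
    also have "\<dots> = (\<Prod>i<length m. dl (m ! i) (l ! \<pi> i))"
      by (simp add: permutes_inverses(2)[OF p]) (simp add: dl_def eq_commute)
    finally show "of_int (sign (inv \<pi>)) * (\<Prod>i<length m. dl (l ! i) (m ! inv \<pi> i)) = of_int (sign \<pi>) * (\<Prod>i<length m. dl (m ! i) (l ! \<pi> i))"
      using sign_inverse[of \<pi>] p permutation_permutes[of \<pi>] finite_lessThan by (metis)
  qed
  also have "\<dots> = wedge_covectors (map e m) (map E l)"
    unfolding wedge_covectors_def using l
    by (auto intro!: sum.cong prod.cong simp: d permutes_lt)
  finally show ?thesis .
qed

lemma wedge_covectors_dual:
  assumes d: "\<And>i j. e i (E j) = dl i j" and di: "distinct l"
  shows "wedge_covectors (map e l) (map E l) = 1"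
proof -
  let ?P = "{\<pi>. \<pi> permutes {..<length l}}"
  have "wedge_covectors (map e l) (map E l) = (\<Sum>\<pi>\<in>?P. of_int (sign \<pi>) * (\<Prod>i<length l. dl (l ! i) (l ! \<pi> i)))"
    unfolding wedge_covectors_def
    by (auto intro!: sum.cong prod.cong simp: d permutes_lt)
  also have "\<dots> = (\<Sum>\<pi>\<in>?P. if \<pi> = id then 1 else 0)"
  proof (intro sum.cong refl)
    fix \<pi> assume "\<pi> \<in> ?P"
    then have p: "\<pi> permutes {..<length l}" by simp
    show "of_int (sign \<pi>) * (\<Prod>i<length l. dl (l ! i) (l ! \<pi> i)) = (if \<pi> = id then 1 else 0 :: real)"
    proof (cases "\<pi> = id")
      case False
      then obtain i where i: "\<pi> i \<noteq> i" by (auto simp: fun_eq_iff)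
      then have "i < length l" using p by (auto simp: permutes_def)
      moreover then have "\<pi> i < length l" by (rule permutes_lt[OF p])
      ultimately have "l ! i \<noteq> l ! \<pi> i" using i di by (simp add: nth_eq_iff_index_eq)
      then have "(\<Prod>i<length l. dl (l ! i) (l ! \<pi> i)) = 0" using \<open>i < length l\<close>
        by (intro prod_zero) (auto simp: dl_def)
      then show ?thesis using False by simp
    qed (simp add: dl_def)
  qed
  also have "\<dots> = 1"
    by (simp add: finite_permutations permutes_id)
  finally show ?thesis .
qed

lemma wedge_covectors_eps:
  assumes d: "\<And>i j. e i (E j) = dl i j" and lin: "\<And>i. linear (e i)" and l: "length l = 7"
  shows "wedge_covectors (map e L7) (map E l) = eps l" "wedge_covectors (map e l) (map E L7) = eps l"
proof -
  have "alternating 7 (wedge_covectors (map e L7))"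
    by (rule wedge_covectors_alternating7) (use lin in auto)
  then show 1: "wedge_covectors (map e L7) (map E l) = eps l"
    using alternating_eps[of "wedge_covectors (map e L7)" l E] l wedge_covectors_dual[of e E L7, OF d] by simp
  have "length l = length L7" using l by simp
  from wedge_covectors_transpose[OF d this] 1
  show "wedge_covectors (map e l) (map E L7) = eps l" by simp
qed

text \<open>Top forms are one-dimensional: the difference of the two sides vanishes on the
  frame.\<close>

lemma alternating_7_eq:
  assumes a: "alternating 7 \<alpha>" and d: "dual_frames e E" and l: "length vs = 7"
  shows "\<alpha> vs = \<alpha> (map E L7) * wedge_covectors (map e L7) vs"
proof -
  define c where "c = \<alpha> (map E L7)"
  have lin: "linear (e i)" and dd: "e i (E j) = dl i j" for i j using d by (auto simp: dual_frames_def)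
  have w: "alternating 7 (wedge_covectors (map e L7))"
    by (rule wedge_covectors_alternating7) (use lin in auto)
  have "alternating 7 (\<lambda>vs. \<alpha> vs - c * wedge_covectors (map e L7) vs)"
    using a w unfolding alternating_def multilinear_def
    by (auto intro!: linear_compose_sub linear_compose_scale_right[where 'a = vec7 and 'b = real, unfolded real_scaleR_def])
  from alternating_zero_on_frame[OF this d _ l] show ?thesis
    using wedge_covectors_dual[of e E L7, OF dd] by (simp add: c_def)
qed

section \<open>Recovering metric and orientation from the 3-form\<close>

lemma sum_permutes_3:
  "(\<Sum>\<pi> | \<pi> permutes {..<3::nat}. of_int (sign \<pi>) * f (\<pi> 0) (\<pi> 1) (\<pi> 2))
    = f 0 1 2 - f 0 2 1 - f 1 0 2 + f 1 2 0 + f 2 0 1 - (f 2 1 0 :: real)"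
proof -
  have s: "{..<3::nat} = insert 0 (insert 1 {2})" by auto
  have f12: "finite {1::nat, 2}" "0 \<notin> {1::nat, 2}" and f2: "finite {2::nat}" "1 \<notin> {2::nat}" by auto
  show ?thesis
    unfolding s sum_over_permutations_insert[OF f12] sum_over_permutations_insert[OF f2] permutes_sing
    by (simp add: sign_swap_id permutation_swap_id sign_compose sign_id swap_id_eq Transposition.transpose_def)
qed

lemma wedge_covectors_3:
  "wedge_covectors [a, b, c] [x, y, z] = a x * b y * c z - a x * b z * c y - a y * b x * c z
     + a y * b z * c x + a z * b x * c y - a z * b y * c x"
  using sum_permutes_3[of "\<lambda>i j k. a ([x, y, z] ! i) * b ([x, y, z] ! j) * c ([x, y, z] ! k)"]
  by (simp add: wedge_covectors_def eval_nat_numeral lessThan_Suc mult_ac)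

definition adapted_frame :: "tensor \<Rightarrow> (i7 \<Rightarrow> vec7 \<Rightarrow> real) \<Rightarrow> (i7 \<Rightarrow> vec7) \<Rightarrow> bool" where
  "adapted_frame \<phi> e E \<longleftrightarrow> dual_frames e E \<and>
     (\<forall>x y z. \<phi> [x, y, z] = (\<Sum>a\<in>UNIV. \<Sum>b\<in>UNIV. \<Sum>c\<in>UNIV. phi0 a b c * (e a x * e b y * e c z)))"

lemma phi_model_phi0:
  "phi_model e [x, y, z] = (\<Sum>a\<in>UNIV. \<Sum>b\<in>UNIV. \<Sum>c\<in>UNIV. phi0 a b c * (e (ix a) x * e (ix b) y * e (ix c) z))"
  by (simp add: phi_model_def Let_def wedge_covectors_3 sum_i7 phi0_def)

text \<open>The seven covectors form an injective linear map into a space of the same dimension;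
  preimages of the standard basis are the dual frame.\<close>

lemma coframe_dual:
  assumes c: "coframe e'"
  obtains E where "dual_frames (\<lambda>i. e' (ix i)) E"
proof -
  define L :: "vec7 \<Rightarrow> real^i7" where "L v = (\<chi> i. e' (ix i) v)" for v
  have ixr: "ix i \<in> {1..7}" for i by (cases i) auto
  have lin: "linear (e' (ix i))" for i using c ixr by (auto simp: coframe_def)
  have L: "linear L" by (auto intro!: linearI simp: L_def vec_eq_iff linear_add[OF lin] linear_cmul[OF lin])
  have ex: "\<exists>a. i = ix a" if "i \<in> {1..7}" for i using that range_ix by (metis imageE)
  have "v = 0" if "L v = 0" for v
  proof -
    have "e' (ix a) v = 0" for a using that by (simp add: L_def vec_eq_iff)
    then have "\<forall>i\<in>{1..7}. e' i v = 0" using ex by blast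
    then show ?thesis using c unfolding coframe_def by blast
  qed
  then have inj: "inj L" by (simp add: linear_injective_0[OF L])
  have "dim (range L) = dim (UNIV :: vec7 set)" using dim_image_eq[OF L, of UNIV] inj by simp
  then have "dim (range L) = DIM(real^i7)" by (simp add: UNIV_i7)
  then have "span (range L) = UNIV" using dim_eq_full by blast
  then have surj: "range L = UNIV" using L by (metis linear_span_image span_UNIV)
  then obtain M where M: "L (M x) = x" for x by (metis surj_f_inv_f)
  define E where "E i = M (axis i 1)" for i
  have d: "e' (ix i) (E j) = dl i j" for i j
  proof -
    have "L (E j) $ i = dl i j" by (simp add: E_def M axis_def dl_def)
    then show ?thesis by (simp add: L_def)
  qed
  have "v = (\<Sum>i\<in>UNIV. e' (ix i) v *\<^sub>R E i)" for v
  proof (rule injD[OF inj])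
    show "L v = L (\<Sum>i\<in>UNIV. e' (ix i) v *\<^sub>R E i)"
      by (simp add: L_def vec_eq_iff linear_sum[OF lin] linear_cmul[OF lin] d)
  qed
  then have "dual_frames (\<lambda>i. e' (ix i)) E" unfolding dual_frames_def using lin d by blast
  then show ?thesis by (rule that)
qed

lemma adapted_coframe_frame:
  assumes "adapted_coframe \<phi> e'"
  obtains E where "adapted_frame \<phi> (\<lambda>i. e' (ix i)) E"
proof -
  obtain E where "dual_frames (\<lambda>i. e' (ix i)) E" using assms coframe_dual unfolding adapted_coframe_def by blast
  then have "adapted_frame \<phi> (\<lambda>i. e' (ix i)) E"
    using assms unfolding adapted_frame_def adapted_coframe_def by (simp add: phi_model_phi0)
  then show ?thesis by (rule that)
qed

text \<open>Reduces 343 terms to the seven triples of the Fano plane, each with its 3! orderings.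
  With \<open>phi0_sum_skew\<close> it keeps the seven-index sum in \<open>phi0_cubed_eps\<close>
  small.\<close>

lemma phi0_sum_alt3:
  assumes X: "alt3 X"
  shows "(\<Sum>a\<in>UNIV. \<Sum>b\<in>UNIV. \<Sum>c\<in>UNIV. phi0 a b c * X a b c)
    = 6 * (X I1 I2 I7 + X I1 I3 I5 - X I1 I4 I6 - X I2 I3 I6 - X I2 I4 I5 + X I3 I4 I7 + X I5 I6 I7)"
proof -
  have d: "X a a b = 0" "X a b b = 0" for a b using alt3_swap12[OF X, of a a b] alt3_swap23[OF X, of a b b] by simp_all
  have o: "ix b < ix a \<Longrightarrow> X a b c = - X b a c" "ix c < ix b \<Longrightarrow> X a b c = - X a c b" for a b c
    using alt3_swap12[OF X, of a b c] alt3_swap23[OF X, of a b c] by simp_all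
  show ?thesis by (simp add: sum_i7 phi0_def d o)
qed

lemma phi0_sum_skew:
  assumes X: "\<And>b c. X b c = - X c b"
  shows "(\<Sum>b\<in>UNIV. \<Sum>c\<in>UNIV. phi0 I1 b c * X b c) = 2 * (X I2 I7 + X I3 I5 - X I4 I6)"
    "(\<Sum>b\<in>UNIV. \<Sum>c\<in>UNIV. phi0 I2 b c * X b c) = 2 * (- X I1 I7 - X I3 I6 - X I4 I5)"
    "(\<Sum>b\<in>UNIV. \<Sum>c\<in>UNIV. phi0 I3 b c * X b c) = 2 * (- X I1 I5 + X I2 I6 + X I4 I7)"
    "(\<Sum>b\<in>UNIV. \<Sum>c\<in>UNIV. phi0 I4 b c * X b c) = 2 * (X I1 I6 + X I2 I5 - X I3 I7)"
    "(\<Sum>b\<in>UNIV. \<Sum>c\<in>UNIV. phi0 I5 b c * X b c) = 2 * (X I1 I3 - X I2 I4 + X I6 I7)"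
    "(\<Sum>b\<in>UNIV. \<Sum>c\<in>UNIV. phi0 I6 b c * X b c) = 2 * (- X I1 I4 - X I2 I3 - X I5 I7)"
    "(\<Sum>b\<in>UNIV. \<Sum>c\<in>UNIV. phi0 I7 b c * X b c) = 2 * (X I1 I2 + X I3 I4 + X I5 I6)"
proof -
  have d: "X a a = 0" for a using X[of a a] by simp
  have o: "ix b < ix a \<Longrightarrow> X a b = - X b a" for a b by (rule X)
  show "(\<Sum>b\<in>UNIV. \<Sum>c\<in>UNIV. phi0 I1 b c * X b c) = 2 * (X I2 I7 + X I3 I5 - X I4 I6)"
    "(\<Sum>b\<in>UNIV. \<Sum>c\<in>UNIV. phi0 I2 b c * X b c) = 2 * (- X I1 I7 - X I3 I6 - X I4 I5)"
    "(\<Sum>b\<in>UNIV. \<Sum>c\<in>UNIV. phi0 I3 b c * X b c) = 2 * (- X I1 I5 + X I2 I6 + X I4 I7)"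
    "(\<Sum>b\<in>UNIV. \<Sum>c\<in>UNIV. phi0 I4 b c * X b c) = 2 * (X I1 I6 + X I2 I5 - X I3 I7)"
    "(\<Sum>b\<in>UNIV. \<Sum>c\<in>UNIV. phi0 I5 b c * X b c) = 2 * (X I1 I3 - X I2 I4 + X I6 I7)"
    "(\<Sum>b\<in>UNIV. \<Sum>c\<in>UNIV. phi0 I6 b c * X b c) = 2 * (- X I1 I4 - X I2 I3 - X I5 I7)"
    "(\<Sum>b\<in>UNIV. \<Sum>c\<in>UNIV. phi0 I7 b c * X b c) = 2 * (X I1 I2 + X I3 I4 + X I5 I6)"
    by (simp_all add: sum_i7 phi0_def d o)
qed

lemma eps_swap:
  assumes d: "dual_frames e E" and l: "length as + Suc (Suc (length bs)) = 7"
  shows "eps (as @ x # y # bs) = - eps (as @ y # x # bs)"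
proof -
  have lin: "linear (e i)" and dd: "e i (E j) = dl i j" for i j using d by (auto simp: dual_frames_def)
  have a: "alternating 7 (wedge_covectors (map e L7))" by (rule wedge_covectors_alternating7) (use lin in auto)
  have "eps l = wedge_covectors (map e L7) (map E l)" if "length l = 7" for l
    using wedge_covectors_eps(1)[OF dd lin that] by simp
  then show ?thesis
    using alternating_swap[OF a, of "map E as" "map E bs" "E x" "E y"] l by (simp del: list.map(2)) (simp)
qed

text \<open>The classical identity \<open>(u \<lrcorner> \<phi>) \<and> (v \<lrcorner> \<phi>)
  \<and> \<phi> = 6 g(u, v) vol\<close> in components, with sums over unordered indices: 144 = 6 *
  2! * 2! * 3!.\<close>

lemma phi0_cubed_eps:
  assumes d: "dual_frames e E"
  shows "(\<Sum>b\<in>UNIV. \<Sum>c\<in>UNIV. phi0 a b c * (\<Sum>f\<in>UNIV. \<Sum>g\<in>UNIV. phi0 d f g *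
     (\<Sum>h\<in>UNIV. \<Sum>k\<in>UNIV. \<Sum>m\<in>UNIV. phi0 h k m * eps [b, c, f, g, h, k, m]))) = 144 * dl a d"
proof -
  have s12: "eps [b, c, f, g, h, k, m] = - eps [c, b, f, g, h, k, m]" for b c f g h k m
    using eps_swap[OF d, of "[]" "[f, g, h, k, m]" b c] by simp
  have s34: "eps [b, c, f, g, h, k, m] = - eps [b, c, g, f, h, k, m]" for b c f g h k m
    using eps_swap[OF d, of "[b, c]" "[h, k, m]" f g] by simp
  have s56: "eps [b, c, f, g, h, k, m] = - eps [b, c, f, g, k, h, m]" for b c f g h k m
    using eps_swap[OF d, of "[b, c, f, g]" "[m]" h k] by simp
  have s67: "eps [b, c, f, g, h, k, m] = - eps [b, c, f, g, h, m, k]" for b c f g h k m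
    using eps_swap[OF d, of "[b, c, f, g, h]" "[]" k m] by simp
  define Y where "Y b c f g = 6 * (eps [b, c, f, g, I1, I2, I7] + eps [b, c, f, g, I1, I3, I5] - eps [b, c, f, g, I1, I4, I6]
     - eps [b, c, f, g, I2, I3, I6] - eps [b, c, f, g, I2, I4, I5] + eps [b, c, f, g, I3, I4, I7] + eps [b, c, f, g, I5, I6, I7])" for b c f g
  have Y: "(\<Sum>h\<in>UNIV. \<Sum>k\<in>UNIV. \<Sum>m\<in>UNIV. phi0 h k m * eps [b, c, f, g, h, k, m]) = Y b c f g" for b c f g
    unfolding Y_def by (rule phi0_sum_alt3[of "\<lambda>h k m. eps [b, c, f, g, h, k, m]"])
       (unfold alt3_def, intro allI conjI s56 s67)
  have Y12: "Y b c f g = - Y c b f g" and Y34: "Y b c f g = - Y b c g f" for b c f g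
    unfolding Y_def using s12[of b c f g] s34[of b c f g] by simp_all
  define Z where "Z d b c = (\<Sum>f\<in>UNIV. \<Sum>g\<in>UNIV. phi0 d f g * Y b c f g)" for d b c
  have Z12: "Z d b c = - Z d c b" for d b c
    unfolding Z_def by (subst Y12) (simp only: mult_minus_right sum_negf)
  have *: "(\<Sum>b\<in>UNIV. \<Sum>c\<in>UNIV. phi0 a b c * (\<Sum>f\<in>UNIV. \<Sum>g\<in>UNIV. phi0 d f g *
     (\<Sum>h\<in>UNIV. \<Sum>k\<in>UNIV. \<Sum>m\<in>UNIV. phi0 h k m * eps [b, c, f, g, h, k, m])))
     = (\<Sum>b\<in>UNIV. \<Sum>c\<in>UNIV. phi0 a b c * Z d b c)"
    unfolding Y Z_def ..
  show ?thesis
    unfolding *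
    by (cases a; simp only: phi0_sum_skew[of "Z d", OF Z12]; cases d;
        simp only: Z_def phi0_sum_skew[of "Y _ _", OF Y34]; simp add: Y_def eps_def dl_def)
qed

definition S3 :: "(i7 \<Rightarrow> i7 \<Rightarrow> i7 \<Rightarrow> real) \<Rightarrow> real" where
  "S3 F = (\<Sum>a\<in>UNIV. \<Sum>b\<in>UNIV. \<Sum>c\<in>UNIV. phi0 a b c * F a b c)"

lemma S3_mult: "x * S3 F = S3 (\<lambda>a b c. x * F a b c)"
  unfolding S3_def by (simp add: sum_distrib_left mult.left_commute)

lemma S3_sum: "(\<Sum>x\<in>X. S3 (F x)) = S3 (\<lambda>a b c. \<Sum>x\<in>X. F x a b c)"
  unfolding S3_def sum_distrib_left by (subst sum_rot4, rule refl)

text \<open>This is 2! * 2! * 3! times the 7-form \<open>(u \<lrcorner> \<phi>) \<and> (v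
  \<lrcorner> \<phi>) \<and> \<phi>\<close>, written with values of \<phi> alone and hence visibly
  independent of the frame. \<open>Bsum\<close> is its expression in a coframe.\<close>

definition Bform :: "tensor \<Rightarrow> vec7 \<Rightarrow> vec7 \<Rightarrow> tensor" where
  "Bform \<phi> u v xs = (\<Sum>\<pi> | \<pi> permutes {..<7::nat}. of_int (sign \<pi>) *
      (\<phi> [u, xs ! \<pi> 0, xs ! \<pi> 1] * (\<phi> [v, xs ! \<pi> 2, xs ! \<pi> 3] * \<phi> [xs ! \<pi> 4, xs ! \<pi> 5, xs ! \<pi> 6])))"

definition Bsum :: "(i7 \<Rightarrow> vec7 \<Rightarrow> real) \<Rightarrow> vec7 \<Rightarrow> vec7 \<Rightarrow> tensor" where
  "Bsum e u v xs = S3 (\<lambda>a b c. S3 (\<lambda>d f g. S3 (\<lambda>h k m.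
     (e a u * e d v) * wedge_covectors (map e [b, c, f, g, h, k, m]) xs)))"

lemma Bform_eq_Bsum:
  assumes "adapted_frame \<phi> e E"
  shows "Bform \<phi> u v xs = Bsum e u v xs"
proof -
  have p: "\<phi> [x, y, z] = S3 (\<lambda>a b c. e a x * e b y * e c z)" for x y z
    using assms unfolding adapted_frame_def S3_def by blast
  have w: "(e a u * e d v) * wedge_covectors (map e [b, c, f, g, h, k, m]) xs
     = (\<Sum>\<pi> | \<pi> permutes {..<7::nat}. of_int (sign \<pi>) * ((e a u * e b (xs ! \<pi> 0) * e c (xs ! \<pi> 1)) *
       ((e d v * e f (xs ! \<pi> 2) * e g (xs ! \<pi> 3)) * (e h (xs ! \<pi> 4) * e k (xs ! \<pi> 5) * e m (xs ! \<pi> 6)))))"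
    for a b c d f g h k m
    by (simp add: wedge_covectors_def sum_distrib_left eval_nat_numeral lessThan_Suc mult_ac)
  have *: "S3 F * S3 G = S3 (\<lambda>a b c. S3 (\<lambda>d f g. F a b c * G d f g))" for F G
  proof -
    have "S3 F * S3 G = S3 (\<lambda>a b c. F a b c * S3 G)"
      using S3_mult[of "S3 G" F] by (simp only: mult.commute)
    also have "\<dots> = S3 (\<lambda>a b c. S3 (\<lambda>d f g. F a b c * G d f g))" by (simp only: S3_mult)
    finally show ?thesis .
  qed
  show ?thesis
    unfolding Bform_def Bsum_def w p * by (simp only: S3_mult S3_sum)
qed

lemma alternating_S3:
  assumes "\<And>a b c. alternating k (\<lambda>xs. F a b c xs)"
  shows "alternating k (\<lambda>xs. S3 (\<lambda>a b c. F a b c xs))"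
  unfolding alternating_def multilinear_def S3_def
proof (intro conjI allI impI)
  fix vs :: "vec7 list" and i assume "length vs = k" "i < k"
  then have l: "linear (\<lambda>x. F a b c (vs[i := x]))" for a b c
    using assms unfolding alternating_def multilinear_def by blast
  show "linear (\<lambda>x. \<Sum>a\<in>UNIV. \<Sum>b\<in>UNIV. \<Sum>c\<in>UNIV. phi0 a b c * F a b c (vs[i := x]))"
    by (intro linear_compose_sum ballI) (auto intro!: linearI simp: linear_add[OF l] linear_cmul[OF l] algebra_simps)
next
  fix vs :: "vec7 list" and i j assume "length vs = k" "i < j" "j < k" "vs ! i = vs ! j"
  then have "F a b c vs = 0" for a b c using assms unfolding alternating_def by blast
  then show "(\<Sum>a\<in>UNIV. \<Sum>b\<in>UNIV. \<Sum>c\<in>UNIV. phi0 a b c * F a b c vs) = 0" by simp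
qed

lemma alternating_scale:
  assumes "alternating k \<alpha>" shows "alternating k (\<lambda>xs. c * \<alpha> xs)"
proof -
  have "linear (\<lambda>x. c * f x)" if "linear f" for f :: "vec7 \<Rightarrow> real"
    by (auto intro!: linearI simp: linear_add[OF that] linear_cmul[OF that] algebra_simps)
  then show ?thesis using assms unfolding alternating_def multilinear_def by auto
qed

lemma Bsum_alternating: "(\<And>i. linear (e i)) \<Longrightarrow> alternating 7 (Bsum e u v)"
  unfolding Bsum_def by (intro alternating_S3 alternating_scale wedge_covectors_alternating7) auto

lemma Bsum_frame:
  assumes d: "dual_frames e E"
  shows "Bsum e u v (map E L7) = 144 * (\<Sum>a\<in>UNIV. e a u * e a v)"
proof -
  have lin: "linear (e i)" and dd: "e i (E j) = dl i j" for i j using d by (auto simp: dual_frames_def)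
  have w: "wedge_covectors (map e [b, c, f, g, h, k, m]) (map E L7) = eps [b, c, f, g, h, k, m]" for b c f g h k m
    by (rule wedge_covectors_eps(2)[OF dd lin]) simp
  have "Bsum e u v (map E L7) = (\<Sum>a\<in>UNIV. \<Sum>b\<in>UNIV. \<Sum>c\<in>UNIV. \<Sum>d\<in>UNIV. phi0 a b c * (e a u * (e d v * (\<Sum>f\<in>UNIV. \<Sum>g\<in>UNIV. phi0 d f g *
     (\<Sum>h\<in>UNIV. \<Sum>k\<in>UNIV. \<Sum>m\<in>UNIV. phi0 h k m * eps [b, c, f, g, h, k, m])))))"
    unfolding Bsum_def w S3_def by (simp only: sum_distrib_left mult_ac)
  also have "\<dots> = (\<Sum>a\<in>UNIV. \<Sum>d\<in>UNIV. \<Sum>b\<in>UNIV. \<Sum>c\<in>UNIV. phi0 a b c * (e a u * (e d v * (\<Sum>f\<in>UNIV. \<Sum>g\<in>UNIV. phi0 d f g *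
     (\<Sum>h\<in>UNIV. \<Sum>k\<in>UNIV. \<Sum>m\<in>UNIV. phi0 h k m * eps [b, c, f, g, h, k, m])))))"
    by (rule sum.cong[OF refl], rule sum_rot3[symmetric])
  also have "\<dots> = (\<Sum>a\<in>UNIV. \<Sum>d\<in>UNIV. e a u * (e d v * (\<Sum>b\<in>UNIV. \<Sum>c\<in>UNIV. phi0 a b c * (\<Sum>f\<in>UNIV. \<Sum>g\<in>UNIV. phi0 d f g *
     (\<Sum>h\<in>UNIV. \<Sum>k\<in>UNIV. \<Sum>m\<in>UNIV. phi0 h k m * eps [b, c, f, g, h, k, m])))))"
    by (simp only: sum_distrib_left mult_ac)
  also have "\<dots> = (\<Sum>a\<in>UNIV. \<Sum>d\<in>UNIV. dl a d * (144 * e a u * e d v))"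
    unfolding phi0_cubed_eps[OF d] by (simp only: mult_ac)
  also have "\<dots> = 144 * (\<Sum>a\<in>UNIV. e a u * e a v)" by (simp add: sum_distrib_left mult_ac)
  finally show ?thesis .
qed

text \<open>Equality of the two metrics makes the transition matrix orthogonal (\<open>t\<close> in
  the proof), so traces agree. This carries sums over the chosen \<open>G2_frame\<close> to the
  differentiable frame.\<close>

lemma frame_contraction:
  assumes d: "dual_frames e E" and d': "dual_frames e' E'"
    and g: "\<And>u v. (\<Sum>a\<in>UNIV. e a u * e a v) = (\<Sum>a\<in>UNIV. e' a u * e' a v)"
    and l1: "\<And>y. linear (\<lambda>x. f x y)" and l2: "\<And>x. linear (f x)"
  shows "(\<Sum>a\<in>UNIV. f (E' a) (E' a)) = (\<Sum>a\<in>UNIV. f (E a) (E a) :: real)"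
proof -
  have x: "v = (\<Sum>i\<in>UNIV. e i v *\<^sub>R E i)" "v = (\<Sum>i\<in>UNIV. e' i v *\<^sub>R E' i)" "e i (E j) = dl i j" "e' i (E' j) = dl i j" for v i j
    using d d' unfolding dual_frames_def by blast+
  have t: "e b (E' a) = e' a (E b)" for a b
    using g[of "E b" "E' a"] by (simp add: x)
  have "(\<Sum>a\<in>UNIV. f (E' a) (E' a)) = (\<Sum>a\<in>UNIV. f (\<Sum>b\<in>UNIV. e b (E' a) *\<^sub>R E b) (E' a))"
    using x(1) by metis
  also have "\<dots> = (\<Sum>a\<in>UNIV. \<Sum>b\<in>UNIV. e b (E' a) * f (E b) (E' a))"
    by (simp add: linear_sum[OF l1] linear_cmul[OF l1])
  also have "\<dots> = (\<Sum>b\<in>UNIV. \<Sum>a\<in>UNIV. e' a (E b) * f (E b) (E' a))"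
    unfolding t by (rule sum.swap)
  also have "\<dots> = (\<Sum>b\<in>UNIV. f (E b) (\<Sum>a\<in>UNIV. e' a (E b) *\<^sub>R E' a))"
    by (simp add: linear_sum[OF l2] linear_cmul[OF l2])
  also have "\<dots> = (\<Sum>b\<in>UNIV. f (E b) (E b))"
    using x(2) by metis
  finally show ?thesis .
qed

lemma adapted_frame_phi0:
  assumes "adapted_frame \<phi> e E" shows "\<phi> [E a, E b, E c] = phi0 a b c"
  using assms unfolding adapted_frame_def dual_frames_def
  by (simp add: mult.assoc mult.left_commute[of "phi0 _ _ _"] sum_distrib_left[symmetric])

lemma adapted_frame_linear:
  assumes "adapted_frame \<phi> e E"
  shows "linear (\<lambda>x. \<phi> [x, y, z])" "linear (\<lambda>y. \<phi> [x, y, z])" "linear (\<lambda>z. \<phi> [x, y, z])"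
proof -
  have l: "linear (e i)" for i using assms unfolding adapted_frame_def dual_frames_def by blast
  have p: "\<phi> [x, y, z] = (\<Sum>a\<in>UNIV. \<Sum>b\<in>UNIV. \<Sum>c\<in>UNIV. phi0 a b c * (e a x * e b y * e c z))" for x y z
    using assms unfolding adapted_frame_def by blast
  show "linear (\<lambda>x. \<phi> [x, y, z])" "linear (\<lambda>y. \<phi> [x, y, z])" "linear (\<lambda>z. \<phi> [x, y, z])"
    unfolding p
    by (intro linear_compose_sum ballI; auto intro!: linearI simp: linear_add[OF l] linear_cmul[OF l] algebra_simps)+
qed

lemma frame_contraction3:
  assumes d: "dual_frames e E" and d': "dual_frames e' E'"
    and g: "\<And>u v. (\<Sum>a\<in>UNIV. e a u * e a v) = (\<Sum>a\<in>UNIV. e' a u * e' a v)"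
    and p: "\<And>y z. linear (\<lambda>x. p x y z)" "\<And>x z. linear (\<lambda>y. p x y z)" "\<And>x y. linear (\<lambda>z. p x y z)"
    and q: "\<And>y z. linear (\<lambda>x. q x y z)" "\<And>x z. linear (\<lambda>y. q x y z)" "\<And>x y. linear (\<lambda>z. q x y z)"
  shows "(\<Sum>a\<in>UNIV. \<Sum>b\<in>UNIV. \<Sum>c\<in>UNIV. p (E' a) (E' b) (E' c) * q (E' a) (E' b) (E' c))
    = (\<Sum>a\<in>UNIV. \<Sum>b\<in>UNIV. \<Sum>c\<in>UNIV. p (E a) (E b) (E c) * q (E a) (E b) (E c) :: real)"
proof -
  note l = p[THEN linear_add] p[THEN linear_cmul] q[THEN linear_add] q[THEN linear_cmul]
  have 1: "(\<Sum>c\<in>UNIV. p x y (E' c) * q x' y' (E' c)) = (\<Sum>c\<in>UNIV. p x y (E c) * q x' y' (E c))" for x y x' y'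
    by (rule frame_contraction[OF d d' g, where f = "\<lambda>z z'. p x y z * q x' y' z'"])
       (auto intro!: linearI simp: l algebra_simps)
  have 2: "(\<Sum>b\<in>UNIV. \<Sum>c\<in>UNIV. p x (E' b) (E c) * q x' (E' b) (E c)) = (\<Sum>b\<in>UNIV. \<Sum>c\<in>UNIV. p x (E b) (E c) * q x' (E b) (E c))" for x x'
    by (rule frame_contraction[OF d d' g, where f = "\<lambda>y y'. \<Sum>c\<in>UNIV. p x y (E c) * q x' y' (E c)"])
       (auto intro!: linearI simp: l algebra_simps sum.distrib sum_distrib_left)
  have 3: "(\<Sum>a\<in>UNIV. \<Sum>b\<in>UNIV. \<Sum>c\<in>UNIV. p (E' a) (E b) (E c) * q (E' a) (E b) (E c))
    = (\<Sum>a\<in>UNIV. \<Sum>b\<in>UNIV. \<Sum>c\<in>UNIV. p (E a) (E b) (E c) * q (E a) (E b) (E c))"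
    by (rule frame_contraction[OF d d' g, where f = "\<lambda>x x'. \<Sum>b\<in>UNIV. \<Sum>c\<in>UNIV. p x (E b) (E c) * q x' (E b) (E c)"])
       (auto intro!: linearI simp: l algebra_simps sum.distrib sum_distrib_left)
  show ?thesis unfolding 1 2 3 ..
qed

text \<open>\<open>G\<^sub>2 \<subset> SO(7)\<close>: the form \<open>(u \<lrcorner> \<phi>) \<and> (v \<lrcorner> \<phi>) \<and> \<phi>\<close> determines the metric up to the determinant of
  the change of frame, and the norm of \<open>\<phi>\<close> fixes this factor.\<close>

lemma adapted_frame_unique:
  assumes A: "adapted_frame \<phi> e E" and A': "adapted_frame \<phi> e' E'"
  shows "(\<Sum>a\<in>UNIV. e a u * e a v) = (\<Sum>a\<in>UNIV. e' a u * e' a v)"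
    and "length vs = 7 \<Longrightarrow> wedge_covectors (map e L7) vs = wedge_covectors (map e' L7) vs"
proof -
  have D: "dual_frames e E" and D': "dual_frames e' E'" using A A' by (auto simp: adapted_frame_def)
  have lin: "linear (e i)" "linear (e' i)" for i using D D' by (auto simp: dual_frames_def)
  define d where "d = wedge_covectors (map e L7) (map E' L7)"
  \<comment> \<open>The same 7-form evaluated on both frames; the change of frame multiplies it by
    its determinant d.\<close>
  have g: "(\<Sum>a\<in>UNIV. e' a u * e' a v) = d * (\<Sum>a\<in>UNIV. e a u * e a v)" for u v
  proof -
    have "Bsum e u v (map E' L7) = Bsum e u v (map E L7) * d"
      unfolding d_def by (rule alternating_7_eq[OF Bsum_alternating[OF lin(1)] D]) simp
    moreover have "Bsum e u v (map E' L7) = Bsum e' u v (map E' L7)"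
      using Bform_eq_Bsum[OF A] Bform_eq_Bsum[OF A'] by metis
    ultimately show ?thesis unfolding Bsum_frame[OF D] Bsum_frame[OF D'] by (simp add: mult.commute)
  qed
  have "d > 0"
  proof (rule ccontr)
    assume "\<not> d > 0"
    moreover have "(\<Sum>a\<in>UNIV. e a (E' I1) * e a (E' I1)) \<ge> 0" by (simp add: sum_nonneg)
    ultimately have "d * (\<Sum>a\<in>UNIV. e a (E' I1) * e a (E' I1)) \<le> 0" by (simp add: mult_nonpos_nonneg)
    moreover have "(\<Sum>a\<in>UNIV. e' a (E' I1) * e' a (E' I1)) = 1" using D' unfolding dual_frames_def by (simp add: dl_def[of I1 I1])
    ultimately show False using g by simp
  qed
  \<comment> \<open>Scaled by r, the second frame is orthonormal for the first metric, and \<phi>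
    has components \<open>r ^ 3 * phi0\<close> there. The sum of squared components, 42 = 6 * 7 in
    the first frame, is thus also 42 r^6, so r = 1.\<close>
  define r where "r = sqrt d"
  have r: "r > 0" "r * r = d" using \<open>d > 0\<close> by (auto simp: r_def)
  define f where "f a v = e' a v / r" for a v
  define F where "F a = r *\<^sub>R E' a" for a
  have DF: "dual_frames f F"
    unfolding dual_frames_def
  proof (intro conjI allI)
    show "linear (f i)" for i unfolding f_def by (auto intro!: linearI simp: linear_add[OF lin(2)] linear_cmul[OF lin(2)] add_divide_distrib)
    show "f i (F j) = dl i j" for i j using D' r unfolding dual_frames_def by (simp add: f_def F_def linear_cmul[OF lin(2)])
    show "v = (\<Sum>i\<in>UNIV. f i v *\<^sub>R F i)" for v using D' r unfolding dual_frames_def by (simp add: f_def F_def)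
  qed
  have gF: "(\<Sum>a\<in>UNIV. e a u * e a v) = (\<Sum>a\<in>UNIV. f a u * f a v)" for u v
    using g[of u v] r \<open>d > 0\<close> by (simp add: f_def sum_divide_distrib[symmetric])
  have "(\<Sum>a\<in>UNIV. \<Sum>b\<in>UNIV. \<Sum>c\<in>UNIV. \<phi> [F a, F b, F c] * \<phi> [F a, F b, F c])
      = (\<Sum>a\<in>UNIV. \<Sum>b\<in>UNIV. \<Sum>c\<in>UNIV. \<phi> [E a, E b, E c] * \<phi> [E a, E b, E c])"
    by (rule frame_contraction3[OF D DF gF, where p = "\<lambda>x y z. \<phi> [x, y, z]" and q = "\<lambda>x y z. \<phi> [x, y, z]"])
       (rule adapted_frame_linear[OF A])+
  moreover have "\<phi> [F a, F b, F c] = r ^ 3 * phi0 a b c" for a b c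
    unfolding F_def
    by (simp add: adapted_frame_linear[OF A, THEN linear_cmul] adapted_frame_phi0[OF A'] power3_eq_cube)
  moreover have n42: "(\<Sum>a\<in>UNIV. \<Sum>b\<in>UNIV. \<Sum>c\<in>UNIV. phi0 a b c * phi0 a b c) = 42"
    by (subst sum_rot3[symmetric]) (simp only: phi0_contr2, simp add: dl_def UNIV_i7)
  moreover have "(\<Sum>a\<in>UNIV. \<Sum>b\<in>UNIV. \<Sum>c\<in>UNIV. (r ^ 3 * phi0 a b c) * (r ^ 3 * phi0 a b c))
     = r ^ 6 * (\<Sum>a\<in>UNIV. \<Sum>b\<in>UNIV. \<Sum>c\<in>UNIV. phi0 a b c * phi0 a b c)"
    by (simp add: sum_distrib_left eval_nat_numeral mult_ac)
  ultimately have "r ^ 6 = 1" unfolding adapted_frame_phi0[OF A] by simp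
  then have "r = 1" using r power_eq_imp_eq_base[of r 6 1] by simp
  then have "d = 1" using r by simp
  then show "(\<Sum>a\<in>UNIV. e a u * e a v) = (\<Sum>a\<in>UNIV. e' a u * e' a v)" using g by simp
  show "wedge_covectors (map e L7) vs = wedge_covectors (map e' L7) vs" if "length vs = 7"
    using alternating_7_eq[OF wedge_covectors_alternating7[of e L7, OF lin(1)] D' that] \<open>d = 1\<close> by (simp add: d_def)
qed

section \<open>The chosen coframe and sums over multi-indices\<close>

lemma ix_range: "ix i \<in> {1..7}" by (cases i) auto

lemma ix_ex: "i \<in> {1..7} \<Longrightarrow> \<exists>a. i = ix a" using range_ix by (metis imageE)

lemma multi_indices_0: "(\<Sum>is\<in>multi_indices 0. f is) = f []"
proof -
  have "multi_indices 0 = {[]}" by (auto simp: multi_indices_def)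
  then show ?thesis by simp
qed

lemma multi_indices_Suc: "(\<Sum>is\<in>multi_indices (Suc k). f is) = (\<Sum>a\<in>UNIV. \<Sum>is\<in>multi_indices k. f (ix a # is))"
proof -
  have fin: "finite (multi_indices k)"
    unfolding multi_indices_def using finite_lists_length_eq[of "{1..7::nat}" k] by (simp add: conj_commute)
  have eq: "multi_indices (Suc k) = (\<lambda>(a, is). ix a # is) ` (UNIV \<times> multi_indices k)"
  proof (intro set_eqI iffI)
    fix l assume "l \<in> multi_indices (Suc k)"
    then obtain i "is" where l: "l = i # is" "i \<in> {1..7}" "is \<in> multi_indices k"
      by (auto simp: multi_indices_def length_Suc_conv)
    then obtain a where "i = ix a" using ix_ex by blast
    then show "l \<in> (\<lambda>(a, is). ix a # is) ` (UNIV \<times> multi_indices k)" using l by force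
  next
    fix l assume "l \<in> (\<lambda>(a, is). ix a # is) ` (UNIV \<times> multi_indices k)"
    then obtain a "is" where "l = ix a # is" "is \<in> multi_indices k" by auto
    then show "l \<in> multi_indices (Suc k)" using ix_range[of a] by (auto simp: multi_indices_def subset_iff)
  qed
  have inj: "inj_on (\<lambda>(a, is). ix a # is) (UNIV \<times> multi_indices k)"
    using inj_ix by (auto simp: inj_on_def)
  have "(\<Sum>is\<in>multi_indices (Suc k). f is) = sum (f \<circ> (\<lambda>(a, is). ix a # is)) (UNIV \<times> multi_indices k)"
    unfolding eq by (rule sum.reindex[OF inj])
  also have "\<dots> = (\<Sum>a\<in>UNIV. \<Sum>is\<in>multi_indices k. f (ix a # is))"
    by (simp add: sum.cartesian_product case_prod_beta o_def)
  finally show ?thesis .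
qed

lemmas multi_indices_sum = multi_indices_0 multi_indices_Suc eval_nat_numeral

lemma G2_frame_adapted:
  assumes "adapted_coframe \<phi> e'"
  shows "adapted_frame \<phi> (\<lambda>i. G2_coframe \<phi> (ix i)) (\<lambda>i. G2_frame \<phi> (ix i))"
proof -
  have "adapted_coframe \<phi> (G2_coframe \<phi>)" unfolding G2_coframe_def using someI[of "adapted_coframe \<phi>" e'] assms by simp
  then obtain E where E: "adapted_frame \<phi> (\<lambda>i. G2_coframe \<phi> (ix i)) E" by (rule adapted_coframe_frame)
  have "G2_frame \<phi> (ix i) = E i" for i
    unfolding G2_frame_def
  proof (rule the_equality)
    show "\<forall>j\<in>{1..7}. G2_coframe \<phi> j (E i) = (if j = ix i then 1 else 0)"
    proof
      fix j :: nat assume "j \<in> {1..7}"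
      then obtain b where "j = ix b" using ix_ex by blast
      then show "G2_coframe \<phi> j (E i) = (if j = ix i then 1 else 0)"
        using E inj_ix unfolding adapted_frame_def dual_frames_def by (auto simp: dl_def inj_eq)
    qed
    fix v assume v: "\<forall>j\<in>{1..7}. G2_coframe \<phi> j v = (if j = ix i then 1 else 0)"
    have "G2_coframe \<phi> (ix b) v = dl b i" for b
      using v ix_range[of b] inj_ix by (auto simp: dl_def inj_eq)
    moreover have "v = (\<Sum>b\<in>UNIV. G2_coframe \<phi> (ix b) v *\<^sub>R E b)"
      using E unfolding adapted_frame_def dual_frames_def by blast
    ultimately show "v = E i" by simp
  qed
  then have "(\<lambda>i. G2_frame \<phi> (ix i)) = E" by auto
  with E show ?thesis by simp
qed

context
  fixes \<phi> :: tensor and e E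
  assumes A: "adapted_frame \<phi> e E" and c: "\<exists>e'. adapted_coframe \<phi> e'"
begin

lemma A0: "adapted_frame \<phi> (\<lambda>i. G2_coframe \<phi> (ix i)) (\<lambda>i. G2_frame \<phi> (ix i))"
  using G2_frame_adapted c by blast

lemma D0: "dual_frames (\<lambda>i. G2_coframe \<phi> (ix i)) (\<lambda>i. G2_frame \<phi> (ix i))" and D: "dual_frames e E"
  using A A0 unfolding adapted_frame_def by auto

lemma G2_metric_frame: "G2_metric \<phi> u v = (\<Sum>a\<in>UNIV. e a u * e a v)"
  unfolding G2_metric_def sum_ix by (rule adapted_frame_unique(1)[OF A0 A])

lemma G2_vol_frame: assumes "length vs = 7" shows "G2_vol \<phi> vs = wedge_covectors (map e L7) vs"
proof -
  have "map (G2_coframe \<phi>) [1..<8] = map (\<lambda>i. G2_coframe \<phi> (ix i)) L7"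
    by (simp add: upt_rec eval_nat_numeral)
  then show ?thesis unfolding G2_vol_def using adapted_frame_unique(2)[OF A0 A assms] by simp
qed

lemma adapted_metric_eq: "(\<Sum>a\<in>UNIV. e a u * e a v) = (\<Sum>a\<in>UNIV. G2_coframe \<phi> (ix a) u * G2_coframe \<phi> (ix a) v)"
  by (rule adapted_frame_unique(1)[OF A A0])

lemma hodge_3_frame:
  assumes al: "alternating 3 \<alpha>" and l: "length ws = 4"
  shows "hodge \<phi> 3 \<alpha> ws = 1 / 6 * (\<Sum>a\<in>UNIV. \<Sum>b\<in>UNIV. \<Sum>c\<in>UNIV. \<alpha> [E a, E b, E c] * wedge_covectors (map e L7) (E a # E b # E c # ws))"
proof -
  have lin: "linear (e i)" for i using D by (auto simp: dual_frames_def)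
  note w = wedge_covectors_alternating7[of e L7, OF lin]
  have "hodge \<phi> 3 \<alpha> ws = 1 / 6 * (\<Sum>a\<in>UNIV. \<Sum>b\<in>UNIV. \<Sum>c\<in>UNIV.
     \<alpha> [G2_frame \<phi> (ix a), G2_frame \<phi> (ix b), G2_frame \<phi> (ix c)] *
     wedge_covectors (map e L7) (G2_frame \<phi> (ix a) # G2_frame \<phi> (ix b) # G2_frame \<phi> (ix c) # ws))"
    unfolding hodge_def using l by (simp add: multi_indices_sum G2_vol_frame fact_numeral)
  also have "(\<Sum>a\<in>UNIV. \<Sum>b\<in>UNIV. \<Sum>c\<in>UNIV.
     \<alpha> [G2_frame \<phi> (ix a), G2_frame \<phi> (ix b), G2_frame \<phi> (ix c)] *
     wedge_covectors (map e L7) (G2_frame \<phi> (ix a) # G2_frame \<phi> (ix b) # G2_frame \<phi> (ix c) # ws))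
    = (\<Sum>a\<in>UNIV. \<Sum>b\<in>UNIV. \<Sum>c\<in>UNIV. \<alpha> [E a, E b, E c] * wedge_covectors (map e L7) (E a # E b # E c # ws))"
    using alternating_linear[OF al, of "[]" "[_, _]"] alternating_linear[OF al, of "[_]" "[_]"] alternating_linear[OF al, of "[_, _]" "[]"]
      alternating_linear[OF w, of "[]" "_ # _ # ws"] alternating_linear[OF w, of "[_]" "_ # ws"] alternating_linear[OF w, of "[_, _]" ws] l
    by (intro frame_contraction3[OF D D0 adapted_metric_eq, where p = "\<lambda>x y z. \<alpha> [x, y, z]" and q = "\<lambda>x y z. wedge_covectors (map e L7) (x # y # z # ws)"])
       simp_all
  finally show ?thesis .
qed

end

section \<open>Second derivatives and derivatives of frames\<close>

text \<open>The second difference over the parallelogram with sides h u and h v: the mean value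
  theorem along u turns it into an increment of the first derivative, whose linearization at p gives
  h^2 A v up to a small multiple of h^2.\<close>

lemma young_aux:
  fixes f :: "'a::real_normed_vector \<Rightarrow> real"
  assumes W: "open W" "p \<in> W" and f: "\<And>q. q \<in> W \<Longrightarrow> (f has_derivative f' q) (at q)"
    and A: "((\<lambda>q. f' q u) has_derivative A) (at p)" and e: "e > 0"
  shows "\<exists>d>0. \<forall>h. 0 < h \<longrightarrow> h < d \<longrightarrow>
    \<bar>f (p + h *\<^sub>R u + h *\<^sub>R v) - f (p + h *\<^sub>R u) - f (p + h *\<^sub>R v) + f p - h\<^sup>2 * A v\<bar> \<le> e * h\<^sup>2 * (2 * norm u + norm v)"
proof -
  let ?F = "\<lambda>q. f' q u"
  interpret A: bounded_linear A using A by (rule has_derivative_bounded_linear)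
  obtain d1 where d1: "d1 > 0" "ball p d1 \<subseteq> W" using W openE by blast
  obtain d2 where d2: "d2 > 0" "\<And>y. norm (y - p) < d2 \<Longrightarrow> norm (?F y - ?F p - A (y - p)) \<le> e * norm (y - p)"
    using A e unfolding has_derivative_at_alt by blast
  define n where "n = norm u + norm v + 1"
  have n: "n > 0" by (simp add: n_def add_nonneg_pos)
  define d where "d = min d1 d2 / n"
  have "d > 0" using d1 d2 n by (simp add: d_def)
  moreover have "\<bar>f (p + h *\<^sub>R u + h *\<^sub>R v) - f (p + h *\<^sub>R u) - f (p + h *\<^sub>R v) + f p - h\<^sup>2 * A v\<bar> \<le> e * h\<^sup>2 * (2 * norm u + norm v)"
    if h: "0 < h" "h < d" for h
  proof -
    have small: "norm (s *\<^sub>R u + t *\<^sub>R v) < min d1 d2" if "0 \<le> s" "s \<le> h" "0 \<le> t" "t \<le> h" for s t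
    proof -
      have "norm (s *\<^sub>R u + t *\<^sub>R v) \<le> s * norm u + t * norm v"
        using that by (intro order_trans[OF norm_triangle_ineq]) simp
      also have "\<dots> \<le> h * norm u + h * norm v" using that by (intro add_mono mult_right_mono) auto
      also have "\<dots> < h * n" using h by (simp add: n_def algebra_simps)
      also have "\<dots> < min d1 d2" using h n by (simp add: d_def pos_less_divide_eq)
      finally show ?thesis .
    qed
    have inW: "p + s *\<^sub>R u + t *\<^sub>R v \<in> W" if "0 \<le> s" "s \<le> h" "0 \<le> t" "t \<le> h" for s t
    proof -
      have "dist p (p + x) = norm x" for x by (simp add: dist_norm)
      from this[of "s *\<^sub>R u + t *\<^sub>R v"]
      have "dist p (p + s *\<^sub>R u + t *\<^sub>R v) = norm (s *\<^sub>R u + t *\<^sub>R v)" by (simp add: add.assoc)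
      then show ?thesis using small[OF that] d1 by auto
    qed
    define g where "g s = f (p + s *\<^sub>R u + h *\<^sub>R v) - f (p + s *\<^sub>R u)" for s
    have der: "((\<lambda>s. f (p + s *\<^sub>R u + t *\<^sub>R v)) has_real_derivative ?F (p + s *\<^sub>R u + t *\<^sub>R v)) (at s)"
      if "0 \<le> s" "s \<le> h" "0 \<le> t" "t \<le> h" for s t
    proof -
      have 1: "((\<lambda>s. p + s *\<^sub>R u + t *\<^sub>R v) has_derivative (\<lambda>x. x *\<^sub>R u)) (at s)"
        by (auto intro!: derivative_eq_intros)
      have 2: "(f has_derivative f' (p + s *\<^sub>R u + t *\<^sub>R v)) (at (p + s *\<^sub>R u + t *\<^sub>R v))"
        using f[OF inW[OF that]] .
      have "((\<lambda>s. f (p + s *\<^sub>R u + t *\<^sub>R v)) has_derivative (\<lambda>x. f' (p + s *\<^sub>R u + t *\<^sub>R v) (x *\<^sub>R u))) (at s)"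
        using has_derivative_compose[OF 1 2] .
      moreover have "f' (p + s *\<^sub>R u + t *\<^sub>R v) (x *\<^sub>R u) = x * ?F (p + s *\<^sub>R u + t *\<^sub>R v)" for x
        using linear_cmul[OF has_derivative_linear[OF 2]] by simp
      ultimately show ?thesis by (simp add: has_field_derivative_def mult.commute[of _ "?F _"] cong: )
    qed
    have "\<exists>z. 0 < z \<and> z < h \<and> g h - g 0 = (h - 0) * (?F (p + z *\<^sub>R u + h *\<^sub>R v) - ?F (p + z *\<^sub>R u))"
    proof (rule MVT2)
      show "(g has_real_derivative ?F (p + s *\<^sub>R u + h *\<^sub>R v) - ?F (p + s *\<^sub>R u)) (at s)" if "0 \<le> s" "s \<le> h" for s
        unfolding g_def using der[of s h] der[of s 0] that h by (intro DERIV_diff) auto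
    qed (use h in simp)
    then obtain z where z: "0 < z" "z < h" "g h - g 0 = h * (?F (p + z *\<^sub>R u + h *\<^sub>R v) - ?F (p + z *\<^sub>R u))" by auto
    define r where "r x = ?F (p + x) - ?F p - A x" for x
    have rb: "\<bar>r x\<bar> \<le> e * norm x" if "norm x < d2" for x using d2(2)[of "p + x"] that by (simp add: r_def)
    have r1: "\<bar>r (z *\<^sub>R u + h *\<^sub>R v)\<bar> \<le> e * (h * norm u + h * norm v)"
    proof -
      have "\<bar>r (z *\<^sub>R u + h *\<^sub>R v)\<bar> \<le> e * norm (z *\<^sub>R u + h *\<^sub>R v)" using small[of z h] z h by (intro rb) auto
      also have "norm (z *\<^sub>R u + h *\<^sub>R v) \<le> z * norm u + h * norm v"
        using z h by (intro order_trans[OF norm_triangle_ineq]) simp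
      also have "\<dots> \<le> h * norm u + h * norm v" using z by (intro add_mono mult_right_mono) auto
      finally show ?thesis using e by simp
    qed
    have r2: "\<bar>r (z *\<^sub>R u)\<bar> \<le> e * (h * norm u)"
    proof -
      have "\<bar>r (z *\<^sub>R u)\<bar> \<le> e * norm (z *\<^sub>R u)" using small[of z 0] z h by (intro rb) auto
      also have "norm (z *\<^sub>R u) \<le> h * norm u" using z by (simp add: mult_right_mono)
      finally show ?thesis using e by simp
    qed
    have eqF: "?F (p + z *\<^sub>R u + h *\<^sub>R v) - ?F (p + z *\<^sub>R u) = h * A v + r (z *\<^sub>R u + h *\<^sub>R v) - r (z *\<^sub>R u)"
      by (simp add: r_def add.assoc A.add A.scaleR)
    have "g h - g 0 - h\<^sup>2 * A v = h * (r (z *\<^sub>R u + h *\<^sub>R v) - r (z *\<^sub>R u))"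
      unfolding z(3) eqF by (simp add: algebra_simps power2_eq_square)
    then have "\<bar>g h - g 0 - h\<^sup>2 * A v\<bar> = h * \<bar>r (z *\<^sub>R u + h *\<^sub>R v) - r (z *\<^sub>R u)\<bar>"
      using h by (simp add: abs_mult)
    also have "\<dots> \<le> h * (e * (h * norm u + h * norm v) + e * (h * norm u))"
      using r1 r2 h by (intro mult_left_mono) auto
    also have "\<dots> = e * h\<^sup>2 * (2 * norm u + norm v)" by (simp add: algebra_simps power2_eq_square)
    finally show ?thesis by (simp add: g_def algebra_simps)
  qed
  ultimately show ?thesis by blast
qed

text \<open>The second difference is symmetric in u and v, so both mixed derivatives are its limit
  after division by h^2. Skewness of the curvature, its g_2 property and the second Bianchi identity
  all rest on this symmetry.\<close>

lemma young_real:
  fixes f :: "'a::real_normed_vector \<Rightarrow> real"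
  assumes W: "open W" "p \<in> W" and f: "\<And>q. q \<in> W \<Longrightarrow> (f has_derivative f' q) (at q)"
    and A: "((\<lambda>q. f' q u) has_derivative A) (at p)" and B: "((\<lambda>q. f' q v) has_derivative B) (at p)"
  shows "A v = B u"
proof -
  have le: "\<bar>A v - B u\<bar> \<le> 0 + e * (3 * norm u + 3 * norm v)" if e: "e > 0" for e
  proof -
    obtain d1 where d1: "d1 > 0" "\<And>h. 0 < h \<Longrightarrow> h < d1 \<Longrightarrow>
      \<bar>f (p + h *\<^sub>R u + h *\<^sub>R v) - f (p + h *\<^sub>R u) - f (p + h *\<^sub>R v) + f p - h\<^sup>2 * A v\<bar> \<le> e * h\<^sup>2 * (2 * norm u + norm v)"
      using young_aux[OF W f A e] by blast
    obtain d2 where d2: "d2 > 0" "\<And>h. 0 < h \<Longrightarrow> h < d2 \<Longrightarrow>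
      \<bar>f (p + h *\<^sub>R v + h *\<^sub>R u) - f (p + h *\<^sub>R v) - f (p + h *\<^sub>R u) + f p - h\<^sup>2 * B u\<bar> \<le> e * h\<^sup>2 * (2 * norm v + norm u)"
      using young_aux[OF W f B e] by blast
    define h where "h = min d1 d2 / 2"
    have h: "0 < h" "h < d1" "h < d2" using d1 d2 by (auto simp: h_def)
    have eq: "p + h *\<^sub>R v + h *\<^sub>R u = p + h *\<^sub>R u + h *\<^sub>R v" by (simp add: algebra_simps)
    have "\<bar>h\<^sup>2 * A v - h\<^sup>2 * B u\<bar> \<le> e * h\<^sup>2 * (2 * norm u + norm v) + e * h\<^sup>2 * (2 * norm v + norm u)"
      using d1(2)[OF h(1,2)] d2(2)[OF h(1,3)] unfolding eq by linarith
    then have "h\<^sup>2 * \<bar>A v - B u\<bar> \<le> h\<^sup>2 * (e * (3 * norm u + 3 * norm v))"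
    proof -
      have "h\<^sup>2 * \<bar>A v - B u\<bar> = \<bar>h\<^sup>2 * A v - h\<^sup>2 * B u\<bar>"
        by (simp only: right_diff_distrib[symmetric] abs_mult abs_power2)
      moreover assume "\<bar>h\<^sup>2 * A v - h\<^sup>2 * B u\<bar> \<le> e * h\<^sup>2 * (2 * norm u + norm v) + e * h\<^sup>2 * (2 * norm v + norm u)"
      ultimately show ?thesis by (simp add: algebra_simps)
    qed
    then show ?thesis using h by simp
  qed
  have "\<bar>A v - B u\<bar> \<le> 0"
  proof (rule field_le_epsilon)
    fix x :: real assume x: "x > 0"
    let ?n = "3 * norm u + 3 * norm v + 1"
    have n: "?n > 0" by (simp add: add_nonneg_pos)
    have "\<bar>A v - B u\<bar> \<le> x / ?n * (3 * norm u + 3 * norm v)" using le[of "x / ?n"] x n by simp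
    also have "\<dots> \<le> x / ?n * ?n" using x n by (intro mult_left_mono) auto
    also have "\<dots> = x" using n by simp
    finally show "\<bar>A v - B u\<bar> \<le> 0 + x" by simp
  qed
  then show ?thesis by simp
qed

lemma young:
  fixes f :: "'a::real_normed_vector \<Rightarrow> 'b::euclidean_space"
  assumes W: "open W" "p \<in> W" and f: "\<And>q. q \<in> W \<Longrightarrow> (f has_derivative f' q) (at q)"
    and A: "((\<lambda>q. f' q u) has_derivative A) (at p)" and B: "((\<lambda>q. f' q v) has_derivative B) (at p)"
  shows "A v = B u"
proof (rule euclidean_eqI)
  fix b :: 'b assume "b \<in> Basis"
  show "A v \<bullet> b = B u \<bullet> b"
    by (rule young_real[OF W, where f = "\<lambda>q. f q \<bullet> b" and f' = "\<lambda>q u. f' q u \<bullet> b"])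
       (intro has_derivative_inner_left f A B; assumption)+
qed

text \<open>A product rule for a field of linear maps whose derivatives are known on constant
  vectors: expanding the argument in the Euclidean basis leaves products with scalar
  functions.\<close>

lemma has_derivative_multilinear1:
  fixes h :: "'a::real_normed_vector \<Rightarrow> 'b::euclidean_space \<Rightarrow> 'c::real_normed_vector"
  assumes W: "open W" "p \<in> W" and lin: "\<And>q. q \<in> W \<Longrightarrow> linear (h q)"
    and d: "\<And>y. ((\<lambda>q. h q y) has_derivative h' y) (at p)" and Y: "(Y has_derivative Y') (at p)"
  shows "((\<lambda>q. h q (Y q)) has_derivative (\<lambda>u. h' (Y p) u + h p (Y' u))) (at p)"
proof -
  have exp: "h q y = (\<Sum>b\<in>Basis. (y \<bullet> b) *\<^sub>R h q b)" if "q \<in> W" for q y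
  proof -
    have "h q y = h q (\<Sum>b\<in>Basis. (y \<bullet> b) *\<^sub>R b)" by (simp add: euclidean_representation)
    then show ?thesis by (simp add: linear_sum[OF lin[OF that]] linear_cmul[OF lin[OF that]])
  qed
  have h'exp: "h' y u = (\<Sum>b\<in>Basis. (y \<bullet> b) *\<^sub>R h' b u)" for y u
  proof -
    have "((\<lambda>q. \<Sum>b\<in>Basis. (y \<bullet> b) *\<^sub>R h q b) has_derivative (\<lambda>u. \<Sum>b\<in>Basis. (y \<bullet> b) *\<^sub>R h' b u)) (at p)"
      by (intro has_derivative_sum has_derivative_scaleR_right d)
    then have "((\<lambda>q. h q y) has_derivative (\<lambda>u. \<Sum>b\<in>Basis. (y \<bullet> b) *\<^sub>R h' b u)) (at p)"
      by (rule has_derivative_transform_within_open[OF _ W]) (simp add: exp[symmetric])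
    then show ?thesis using has_derivative_unique[OF d[of y]] by metis
  qed
  have "((\<lambda>q. \<Sum>b\<in>Basis. (Y q \<bullet> b) *\<^sub>R h q b) has_derivative (\<lambda>u. \<Sum>b\<in>Basis. (Y p \<bullet> b) *\<^sub>R h' b u + (Y' u \<bullet> b) *\<^sub>R h p b)) (at p)"
    by (intro has_derivative_sum has_derivative_scaleR d has_derivative_inner_left Y)
  then have "((\<lambda>q. h q (Y q)) has_derivative (\<lambda>u. \<Sum>b\<in>Basis. (Y p \<bullet> b) *\<^sub>R h' b u + (Y' u \<bullet> b) *\<^sub>R h p b)) (at p)"
    by (rule has_derivative_transform_within_open[OF _ W]) (simp add: exp[symmetric])
  then show ?thesis by (simp add: sum.distrib h'exp[of "Y p"] exp[OF W(2), of "Y' _"])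
qed

lemma has_derivative_multilinear2:
  fixes h :: "'a::real_normed_vector \<Rightarrow> 'b::euclidean_space \<Rightarrow> 'b \<Rightarrow> 'c::real_normed_vector"
  assumes W: "open W" "p \<in> W"
    and l: "\<And>q y. q \<in> W \<Longrightarrow> linear (\<lambda>x. h q x y)" "\<And>q x. q \<in> W \<Longrightarrow> linear (\<lambda>y. h q x y)"
    and d: "\<And>x y. ((\<lambda>q. h q x y) has_derivative h' x y) (at p)"
    and X: "(X has_derivative X') (at p)" and Y: "(Y has_derivative Y') (at p)"
  shows "((\<lambda>q. h q (X q) (Y q)) has_derivative (\<lambda>u. h' (X p) (Y p) u + h p (X' u) (Y p) + h p (X p) (Y' u))) (at p)"
  using has_derivative_multilinear1[OF W l(2) has_derivative_multilinear1[OF W l(1) d X] Y] .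

lemma has_derivative_multilinear3:
  fixes h :: "'a::real_normed_vector \<Rightarrow> 'b::euclidean_space \<Rightarrow> 'b \<Rightarrow> 'b \<Rightarrow> 'c::real_normed_vector"
  assumes W: "open W" "p \<in> W"
    and l: "\<And>q y z. q \<in> W \<Longrightarrow> linear (\<lambda>x. h q x y z)" "\<And>q x z. q \<in> W \<Longrightarrow> linear (\<lambda>y. h q x y z)"
      "\<And>q x y. q \<in> W \<Longrightarrow> linear (\<lambda>z. h q x y z)"
    and d: "\<And>x y z. ((\<lambda>q. h q x y z) has_derivative h' x y z) (at p)"
    and X: "(X has_derivative X') (at p)" and Y: "(Y has_derivative Y') (at p)" and Z: "(Z has_derivative Z') (at p)"
  shows "((\<lambda>q. h q (X q) (Y q) (Z q)) has_derivative (\<lambda>u. h' (X p) (Y p) (Z p) u + h p (X' u) (Y p) (Z p)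
     + h p (X p) (Y' u) (Z p) + h p (X p) (Y p) (Z' u))) (at p)"
  using has_derivative_multilinear1[OF W l(3) has_derivative_multilinear2[OF W l(1,2) d X Y] Z] .

lemma has_derivative_multilinear4:
  fixes h :: "'a::real_normed_vector \<Rightarrow> 'b::euclidean_space \<Rightarrow> 'b \<Rightarrow> 'b \<Rightarrow> 'b \<Rightarrow> 'c::real_normed_vector"
  assumes W: "open W" "p \<in> W"
    and l: "\<And>q y z w. q \<in> W \<Longrightarrow> linear (\<lambda>x. h q x y z w)" "\<And>q x z w. q \<in> W \<Longrightarrow> linear (\<lambda>y. h q x y z w)"
      "\<And>q x y w. q \<in> W \<Longrightarrow> linear (\<lambda>z. h q x y z w)" "\<And>q x y z. q \<in> W \<Longrightarrow> linear (\<lambda>w. h q x y z w)"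
    and d: "\<And>x y z w. ((\<lambda>q. h q x y z w) has_derivative h' x y z w) (at p)"
    and X: "(X has_derivative X') (at p)" and Y: "(Y has_derivative Y') (at p)" and Z: "(Z has_derivative Z') (at p)"
    and V: "(V has_derivative V') (at p)"
  shows "((\<lambda>q. h q (X q) (Y q) (Z q) (V q)) has_derivative (\<lambda>u. h' (X p) (Y p) (Z p) (V p) u + h p (X' u) (Y p) (Z p) (V p)
     + h p (X p) (Y' u) (Z p) (V p) + h p (X p) (Y p) (Z' u) (V p) + h p (X p) (Y p) (Z p) (V' u))) (at p)"
  using has_derivative_multilinear1[OF W l(4) has_derivative_multilinear3[OF W l(1,2,3) d X Y Z] V] .

lemma differentiable_prod:
  fixes f :: "'i \<Rightarrow> 'a::real_normed_vector \<Rightarrow> real"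
  shows "(\<And>i. i \<in> S \<Longrightarrow> f i differentiable (at p)) \<Longrightarrow> (\<lambda>q. \<Prod>i\<in>S. f i q) differentiable (at p)"
  by (induction S rule: infinite_finite_induct) auto

lemma differentiable_det:
  fixes M :: "'a::real_normed_vector \<Rightarrow> real^'n^'n"
  assumes "\<And>i j. (\<lambda>q. M q $ i $ j) differentiable (at p)"
  shows "(\<lambda>q. det (M q)) differentiable (at p)"
  unfolding det_def by (intro differentiable_sum ballI differentiable_mult differentiable_const differentiable_prod assms) (simp add: finite_permutations)

text \<open>Cramer's rule relative to the fixed frame at p writes the coefficients of the dual frame
  as quotients of determinants of differentiable functions.\<close>

lemma dual_frame_differentiable:
  assumes W: "open W" "p \<in> W" and D: "\<And>q. q \<in> W \<Longrightarrow> dual_frames (e q) (E q)"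
    and e: "\<And>i v. (\<lambda>q. e q i v) differentiable (at p)"
  shows "(\<lambda>q. E q j) differentiable (at p)"
proof -
  define P where "P q = (\<chi> i k. e q i (E p k))" for q
  define M where "M k q = (\<chi> i m. if m = k then axis j 1 $ i else P q $ i $ m)" for k q
  have x: "v = (\<Sum>i\<in>UNIV. e q i v *\<^sub>R E q i)" "e q i (E q k) = dl i k" "linear (e q i)" if "q \<in> W" for v q i k
    using D[OF that] unfolding dual_frames_def by blast+
  have Pv: "(P q *v y) $ i = e q i (\<Sum>k\<in>UNIV. y $ k *\<^sub>R E p k)" if "q \<in> W" for q y i
    by (simp add: P_def matrix_vector_mult_def linear_sum[OF x(3)[OF that]] linear_cmul[OF x(3)[OF that]] mult.commute)
  have det: "det (P q) \<noteq> 0" if q: "q \<in> W" for q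
  proof -
    have "y = 0" if "P q *v y = 0" for y
    proof -
      have "e q i (\<Sum>k\<in>UNIV. y $ k *\<^sub>R E p k) = 0" for i using Pv[OF q, of y i] that by simp
      then have z: "(\<Sum>k\<in>UNIV. y $ k *\<^sub>R E p k) = 0"
        by (subst x(1)[OF q, of "\<Sum>k\<in>UNIV. y $ k *\<^sub>R E p k"]) simp
      have "e p m (\<Sum>k\<in>UNIV. y $ k *\<^sub>R E p k) = y $ m" for m
        by (simp add: linear_sum[OF x(3)[OF W(2)]] linear_cmul[OF x(3)[OF W(2)]] x(2)[OF W(2)])
      then have "y $ m = 0" for m unfolding z linear_0[OF x(3)[OF W(2)]] by simp
      then show "y = 0" by (simp add: vec_eq_iff)
    qed
    then have "\<exists>B. B ** P q = mat 1" using matrix_left_invertible_ker by blast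
    then show ?thesis using invertible_det_nz invertible_left_inverse by blast
  qed
  have "E q j = (\<Sum>k\<in>UNIV. (det (M k q) / det (P q)) *\<^sub>R E p k)" if q: "q \<in> W" for q
  proof -
    define y where "y = (\<chi> k. e p k (E q j))"
    have y: "E q j = (\<Sum>k\<in>UNIV. y $ k *\<^sub>R E p k)"
      unfolding y_def vec_lambda_beta by (rule x(1)[OF W(2)])
    have "P q *v y = axis j 1"
      using Pv[OF q, of y, folded y] x(2)[OF q] by (simp add: vec_eq_iff axis_def dl_def eq_commute)
    then have "y = (\<chi> k. det (M k q) / det (P q))"
      using cramer[OF det[OF q], of y "axis j 1"] by (simp add: M_def)
    then show ?thesis using y by simp
  qed
  then have eq: "\<And>q. q \<in> W \<Longrightarrow> (\<Sum>k\<in>UNIV. (det (M k q) / det (P q)) *\<^sub>R E p k) = E q j" by simp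
  have "(\<lambda>q. P q $ i $ k) differentiable (at p)" for i k using e by (simp add: P_def)
  moreover then have "(\<lambda>q. M m q $ i $ k) differentiable (at p)" for i k m by (cases "k = m") (simp_all add: M_def)
  ultimately have "(\<lambda>q. \<Sum>k\<in>UNIV. (det (M k q) / det (P q)) *\<^sub>R E p k) differentiable (at p)"
    using det[OF W(2)] by (intro differentiable_sum ballI differentiable_scaleR differentiable_divide differentiable_const differentiable_det) auto
  then obtain X where "((\<lambda>q. \<Sum>k\<in>UNIV. (det (M k q) / det (P q)) *\<^sub>R E p k) has_derivative X) (at p)"
    unfolding differentiable_def by blast
  from has_derivative_transform_within_open[OF this W eq] show ?thesis unfolding differentiable_def by blast
qed

section \<open>The characteristic connection in an adapted coframe\<close>

lemma nabla_const: "nabla \<Gamma> (\<lambda>_. u) (\<lambda>_. v) p = \<Gamma> p u v"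
  by (simp add: nabla_def frechet_derivative_const)

lemma nabla_tensor_2: "nabla_tensor \<Gamma> \<alpha> p [u, v, w] = frechet_derivative (\<lambda>q. \<alpha> q [v, w]) (at p) u
    - (\<alpha> p [\<Gamma> p u v, w] + \<alpha> p [v, \<Gamma> p u w])"
  by (simp add: nabla_tensor_def nabla_const eval_nat_numeral lessThan_Suc algebra_simps)

lemma nabla_tensor_3: "nabla_tensor \<Gamma> \<alpha> p [u, v, w, x] = frechet_derivative (\<lambda>q. \<alpha> q [v, w, x]) (at p) u
    - (\<alpha> p [\<Gamma> p u v, w, x] + \<alpha> p [v, \<Gamma> p u w, x] + \<alpha> p [v, w, \<Gamma> p u x])"
  by (simp add: nabla_tensor_def nabla_const eval_nat_numeral lessThan_Suc algebra_simps)

lemma torsion_christoffel: "torsion \<Gamma> p u v = \<Gamma> p u v - \<Gamma> p v u"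
  by (simp add: torsion_def nabla_const lie_bracket_def frechet_derivative_const)

text \<open>One neighbourhood in a chart that carries a differentiable adapted coframe. The second
  derivative of \<Gamma> enters through the first derivative of the curvature in the second Bianchi
  identity.\<close>

locale g2_region =
  fixes W :: "vec7 set" and \<phi> :: tfield and \<Gamma> :: christoffel and e :: "vec7 \<Rightarrow> nat \<Rightarrow> vec7 \<Rightarrow> real"
  assumes W: "open W"
    and adapted: "\<And>q. q \<in> W \<Longrightarrow> adapted_coframe (\<phi> q) (e q)"
    and e_diff: "\<And>q i v. q \<in> W \<Longrightarrow> i \<in> {1..7} \<Longrightarrow> (\<lambda>q. e q i v) differentiable (at q)"
    and phi_diff: "\<And>q vs. q \<in> W \<Longrightarrow> length vs = 3 \<Longrightarrow> (\<lambda>q. \<phi> q vs) differentiable (at q)"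
    and bil: "\<And>q. q \<in> W \<Longrightarrow> bilinear (\<Gamma> q)"
    and Gamma_diff: "\<And>q u v. q \<in> W \<Longrightarrow> (\<lambda>q. \<Gamma> q u v) differentiable (at q)"
    and Gamma_diff2: "\<And>q u v w. q \<in> W \<Longrightarrow> (\<lambda>q. frechet_derivative (\<lambda>q. \<Gamma> q v w) (at q) u) differentiable (at q)"
    and nabla_metric: "\<And>q vs. q \<in> W \<Longrightarrow> length vs = 3 \<Longrightarrow> nabla_tensor \<Gamma> (metric_tensor \<phi>) q vs = 0"
    and nabla_phi: "\<And>q vs. q \<in> W \<Longrightarrow> length vs = 4 \<Longrightarrow> nabla_tensor \<Gamma> \<phi> q vs = 0"
    and torsion_alt: "\<And>q. q \<in> W \<Longrightarrow> alternating 3 (torsion_form \<phi> \<Gamma> q)"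
begin

abbreviation "g q u v \<equiv> G2_metric (\<phi> q) u v"

definition ee :: "vec7 \<Rightarrow> i7 \<Rightarrow> vec7 \<Rightarrow> real" where "ee q i = e q (ix i)"

text \<open>The coframe determines its dual frame, so this choice at each point is differentiable
  (\<open>E_der\<close>).\<close>

definition E :: "vec7 \<Rightarrow> i7 \<Rightarrow> vec7" where "E q = (SOME E. adapted_frame (\<phi> q) (ee q) E)"

lemma frame: assumes "q \<in> W" shows "adapted_frame (\<phi> q) (ee q) (E q)"
proof -
  obtain E' where "adapted_frame (\<phi> q) (\<lambda>i. e q (ix i)) E'" using adapted_coframe_frame[OF adapted[OF assms]] by blast
  then show ?thesis unfolding E_def ee_def using someI[of "adapted_frame (\<phi> q) (\<lambda>i. e q (ix i))" E'] by simp
qed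

lemma frame_dual: "q \<in> W \<Longrightarrow> dual_frames (ee q) (E q)"
  using frame unfolding adapted_frame_def by blast

lemma ex_coframe: "q \<in> W \<Longrightarrow> \<exists>e'. adapted_coframe (\<phi> q) e'"
  using adapted by blast

lemma g_frame: "q \<in> W \<Longrightarrow> g q u v = (\<Sum>a\<in>UNIV. ee q a u * ee q a v)"
  by (rule G2_metric_frame[OF frame ex_coframe])

lemma ee_linear: "q \<in> W \<Longrightarrow> linear (ee q a)"
  using frame_dual unfolding dual_frames_def by blast

lemma frame_expand: "q \<in> W \<Longrightarrow> v = (\<Sum>a\<in>UNIV. ee q a v *\<^sub>R E q a)"
  using frame_dual unfolding dual_frames_def by blast

lemma ee_E: "q \<in> W \<Longrightarrow> ee q a (E q b) = dl a b"
  using frame_dual unfolding dual_frames_def by blast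

lemma g_sym: "q \<in> W \<Longrightarrow> g q u v = g q v u"
  by (simp add: g_frame mult.commute)

lemma g_linear1: "q \<in> W \<Longrightarrow> linear (\<lambda>u. g q u v)"
  by (auto intro!: linearI simp: g_frame linear_add[OF ee_linear] linear_cmul[OF ee_linear] sum.distrib sum_distrib_left algebra_simps)

lemma g_linear2: "q \<in> W \<Longrightarrow> linear (\<lambda>v. g q u v)"
  using g_linear1[of q u] by (simp add: g_sym)

lemmas g_lin = linear_add[OF g_linear1] linear_add[OF g_linear2] linear_cmul[OF g_linear1] linear_cmul[OF g_linear2]
  linear_diff[OF g_linear1] linear_diff[OF g_linear2] linear_neg[OF g_linear1] linear_neg[OF g_linear2]

lemma g_frame_comp: "q \<in> W \<Longrightarrow> g q u (E q a) = ee q a u"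
  by (simp add: g_frame ee_E)

lemma g_nondeg: assumes q: "q \<in> W" and z: "\<And>z. g q u z = 0" shows "u = 0"
  using frame_expand[OF q, of u] z[of "E q _"] by (simp add: g_frame_comp[OF q])

text \<open>Differentiability comes from the coframe expression of the metric, the value from
  \<nabla>g = 0. Since the derivative is again an expression in g and \<Gamma>, it can be
  differentiated once more.\<close>

lemma g_der:
  assumes q: "q \<in> W"
  shows "((\<lambda>q. g q v w) has_derivative (\<lambda>u. g q (\<Gamma> q u v) w + g q v (\<Gamma> q u w))) (at q)"
proof -
  have "(\<lambda>q. \<Sum>a\<in>UNIV. ee q a v * ee q a w) differentiable (at q)"
    unfolding ee_def by (intro differentiable_sum ballI differentiable_mult e_diff q ix_range) auto
  then obtain A where A: "((\<lambda>q. \<Sum>a\<in>UNIV. ee q a v * ee q a w) has_derivative A) (at q)" unfolding differentiable_def by blast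
  have B: "((\<lambda>q. g q v w) has_derivative A) (at q)"
    by (rule has_derivative_transform_within_open[OF A W q]) (simp add: g_frame)
  have "A u = g q (\<Gamma> q u v) w + g q v (\<Gamma> q u w)" for u
    using nabla_metric[OF q, of "[u, v, w]"] frechet_derivative_at[OF B]
    by (simp add: nabla_tensor_2 metric_tensor_def)
  then have "A = (\<lambda>u. g q (\<Gamma> q u v) w + g q v (\<Gamma> q u w))" by auto
  with B show ?thesis by simp
qed

lemma phi_der:
  assumes q: "q \<in> W"
  shows "((\<lambda>q. \<phi> q [x, y, z]) has_derivative
     (\<lambda>u. \<phi> q [\<Gamma> q u x, y, z] + \<phi> q [x, \<Gamma> q u y, z] + \<phi> q [x, y, \<Gamma> q u z])) (at q)"
proof -
  have "(\<lambda>q. \<phi> q [x, y, z]) differentiable (at q)" using phi_diff[OF q] by simp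
  then have B: "((\<lambda>q. \<phi> q [x, y, z]) has_derivative frechet_derivative (\<lambda>q. \<phi> q [x, y, z]) (at q)) (at q)"
    by (simp add: frechet_derivative_works)
  have "frechet_derivative (\<lambda>q. \<phi> q [x, y, z]) (at q) u = \<phi> q [\<Gamma> q u x, y, z] + \<phi> q [x, \<Gamma> q u y, z] + \<phi> q [x, y, \<Gamma> q u z]" for u
    using nabla_phi[OF q, of "[u, x, y, z]"] by (simp add: nabla_tensor_3)
  then have "frechet_derivative (\<lambda>q. \<phi> q [x, y, z]) (at q) = (\<lambda>u. \<phi> q [\<Gamma> q u x, y, z] + \<phi> q [x, \<Gamma> q u y, z] + \<phi> q [x, y, \<Gamma> q u z])" by auto
  with B show ?thesis by simp
qed

lemma Gamma_linear: "q \<in> W \<Longrightarrow> linear (\<lambda>v. \<Gamma> q u v)" "q \<in> W \<Longrightarrow> linear (\<lambda>u. \<Gamma> q u v)"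
  using bil unfolding bilinear_def by blast+

lemmas Gamma_lin = linear_add[OF Gamma_linear(1)] linear_add[OF Gamma_linear(2)] linear_cmul[OF Gamma_linear(1)] linear_cmul[OF Gamma_linear(2)]
  linear_diff[OF Gamma_linear(1)] linear_diff[OF Gamma_linear(2)]

definition dG :: "vec7 \<Rightarrow> vec7 \<Rightarrow> vec7 \<Rightarrow> vec7 \<Rightarrow> vec7" where
  "dG q u v w = frechet_derivative (\<lambda>q. \<Gamma> q v w) (at q) u"

definition ddG :: "vec7 \<Rightarrow> vec7 \<Rightarrow> vec7 \<Rightarrow> vec7 \<Rightarrow> vec7 \<Rightarrow> vec7" where
  "ddG q x u v w = frechet_derivative (\<lambda>q. dG q u v w) (at q) x"

lemma Gamma_der: "q \<in> W \<Longrightarrow> ((\<lambda>q. \<Gamma> q v w) has_derivative (\<lambda>u. dG q u v w)) (at q)"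
  unfolding dG_def using Gamma_diff by (simp add: frechet_derivative_works)

lemma dG_der: "q \<in> W \<Longrightarrow> ((\<lambda>q. dG q u v w) has_derivative (\<lambda>x. ddG q x u v w)) (at q)"
  unfolding ddG_def unfolding dG_def using Gamma_diff2 by (simp add: frechet_derivative_works)

lemma ddG_sym: assumes q: "q \<in> W" shows "ddG q x u v w = ddG q u x v w"
  by (rule young[OF W q Gamma_der dG_der[OF q] dG_der[OF q]])

lemma Gamma2_der:
  assumes q: "q \<in> W"
  shows "((\<lambda>q. \<Gamma> q u (\<Gamma> q v w)) has_derivative (\<lambda>x. dG q x u (\<Gamma> q v w) + \<Gamma> q u (dG q x v w))) (at q)"
  by (rule has_derivative_multilinear1[OF W q Gamma_linear(1) Gamma_der[OF q] Gamma_der[OF q]])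

definition tau :: "vec7 \<Rightarrow> vec7 \<Rightarrow> vec7 \<Rightarrow> vec7" where "tau q u v = \<Gamma> q u v - \<Gamma> q v u"

definition Rm :: "vec7 \<Rightarrow> vec7 \<Rightarrow> vec7 \<Rightarrow> vec7 \<Rightarrow> vec7" where
  "Rm q u v w = dG q u v w - dG q v u w + \<Gamma> q u (\<Gamma> q v w) - \<Gamma> q v (\<Gamma> q u w)"

definition dRm :: "vec7 \<Rightarrow> vec7 \<Rightarrow> vec7 \<Rightarrow> vec7 \<Rightarrow> vec7 \<Rightarrow> vec7" where
  "dRm q x u v w = ddG q x u v w - ddG q x v u w + (dG q x u (\<Gamma> q v w) + \<Gamma> q u (dG q x v w))
     - (dG q x v (\<Gamma> q u w) + \<Gamma> q v (dG q x u w))"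

definition T :: "vec7 \<Rightarrow> vec7 \<Rightarrow> vec7 \<Rightarrow> vec7 \<Rightarrow> real" where "T q u v w = g q (tau q u v) w"

definition R :: "vec7 \<Rightarrow> vec7 \<Rightarrow> vec7 \<Rightarrow> vec7 \<Rightarrow> vec7 \<Rightarrow> real" where "R q u v w z = g q (Rm q u v w) z"

lemma Rm_curvature: assumes q: "q \<in> W" shows "curvature \<Gamma> q u v w = Rm q u v w"
proof -
  have "nabla \<Gamma> (\<lambda>_. u) (nabla \<Gamma> (\<lambda>_. v) (\<lambda>_. w)) q = dG q u v w + \<Gamma> q u (\<Gamma> q v w)" for u v
  proof -
    have "nabla \<Gamma> (\<lambda>_. v) (\<lambda>_. w) = (\<lambda>q. \<Gamma> q v w)" by (rule ext) (simp add: nabla_const)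
    then show ?thesis by (simp add: nabla_def[of \<Gamma> "\<lambda>_. u"] dG_def)
  qed
  moreover have "nabla \<Gamma> (lie_bracket (\<lambda>_. u) (\<lambda>_. v)) (\<lambda>_. w) q = 0"
    using linear_0[OF Gamma_linear(2)[OF q]] by (simp add: nabla_def lie_bracket_def frechet_derivative_const)
  ultimately show ?thesis by (simp add: curvature_def Let_def Rm_def)
qed

lemma tau_der: "q \<in> W \<Longrightarrow> ((\<lambda>q. tau q u v) has_derivative (\<lambda>x. dG q x u v - dG q x v u)) (at q)"
  unfolding tau_def by (intro has_derivative_diff Gamma_der)

lemma Rm_der: "q \<in> W \<Longrightarrow> ((\<lambda>q. Rm q u v w) has_derivative (\<lambda>x. dRm q x u v w)) (at q)"
  unfolding Rm_def dRm_def by (intro has_derivative_diff has_derivative_add Gamma2_der dG_der)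

lemma g_vec_der:
  assumes q: "q \<in> W" and X: "(X has_derivative X') (at q)"
  shows "((\<lambda>q. g q (X q) z) has_derivative (\<lambda>x. g q (\<Gamma> q x (X q)) z + g q (X q) (\<Gamma> q x z) + g q (X' x) z)) (at q)"
  by (rule has_derivative_multilinear1[OF W q g_linear1 g_der[OF q] X])

lemma g_vec_der':
  assumes q: "q \<in> W" and X: "(X has_derivative X') (at q)"
  shows "((\<lambda>q. g q z (X q)) has_derivative (\<lambda>x. g q (\<Gamma> q x z) (X q) + g q z (\<Gamma> q x (X q)) + g q z (X' x))) (at q)"
  by (rule has_derivative_multilinear1[OF W q g_linear2 g_der[OF q] X])

text \<open>The second derivatives of the metric are symmetric; exchanging the directions cancels
  the products of first-order terms and leaves the curvature.\<close>

lemma Rm_skew: assumes q: "q \<in> W" shows "g q (Rm q u v w) z = - g q w (Rm q u v z)"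
proof -
  have d: "((\<lambda>q. g q (\<Gamma> q u w) z + g q w (\<Gamma> q u z)) has_derivative
      (\<lambda>x. (g q (\<Gamma> q x (\<Gamma> q u w)) z + g q (\<Gamma> q u w) (\<Gamma> q x z) + g q (dG q x u w) z)
         + (g q (\<Gamma> q x w) (\<Gamma> q u z) + g q w (\<Gamma> q x (\<Gamma> q u z)) + g q w (dG q x u z)))) (at q)" for u
    by (intro has_derivative_add g_vec_der g_vec_der' Gamma_der q)
  from young[OF W q g_der d d, of v u]
  show ?thesis by (simp add: Rm_def g_lin q algebra_simps)
qed

lemma phi_linear:
  assumes q: "q \<in> W"
  shows "linear (\<lambda>x. \<phi> q [x, y, z])" "linear (\<lambda>y. \<phi> q [x, y, z])" "linear (\<lambda>z. \<phi> q [x, y, z])"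
  using adapted_frame_linear[OF frame[OF q]] by blast+

lemma phi_vec_der:
  assumes q: "q \<in> W" and X: "(X has_derivative X') (at q)"
  shows "((\<lambda>q. \<phi> q [X q, y, z]) has_derivative (\<lambda>u. \<phi> q [\<Gamma> q u (X q), y, z] + \<phi> q [X q, \<Gamma> q u y, z] + \<phi> q [X q, y, \<Gamma> q u z] + \<phi> q [X' u, y, z])) (at q)"
   "((\<lambda>q. \<phi> q [y, X q, z]) has_derivative (\<lambda>u. \<phi> q [\<Gamma> q u y, X q, z] + \<phi> q [y, \<Gamma> q u (X q), z] + \<phi> q [y, X q, \<Gamma> q u z] + \<phi> q [y, X' u, z])) (at q)"
   "((\<lambda>q. \<phi> q [y, z, X q]) has_derivative (\<lambda>u. \<phi> q [\<Gamma> q u y, z, X q] + \<phi> q [y, \<Gamma> q u z, X q] + \<phi> q [y, z, \<Gamma> q u (X q)] + \<phi> q [y, z, X' u])) (at q)"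
  by (rule has_derivative_multilinear1[OF W q phi_linear(1) phi_der[OF q] X], assumption,
      rule has_derivative_multilinear1[OF W q phi_linear(2) phi_der[OF q] X], assumption,
      rule has_derivative_multilinear1[OF W q phi_linear(3) phi_der[OF q] X], assumption)

text \<open>The argument of \<open>Rm_skew\<close> applied to \<phi>: the curvature endomorphisms
  lie in g_2.\<close>

lemma Rm_phi: assumes q: "q \<in> W"
  shows "\<phi> q [Rm q u v x, y, z] + \<phi> q [x, Rm q u v y, z] + \<phi> q [x, y, Rm q u v z] = 0"
proof -
  note l = linear_add[OF phi_linear(1)[OF q]] linear_add[OF phi_linear(2)[OF q]] linear_add[OF phi_linear(3)[OF q]]
    linear_diff[OF phi_linear(1)[OF q]] linear_diff[OF phi_linear(2)[OF q]] linear_diff[OF phi_linear(3)[OF q]]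
  note d = has_derivative_add[OF has_derivative_add[OF phi_vec_der(1)[OF q Gamma_der[OF q]] phi_vec_der(2)[OF q Gamma_der[OF q]]]
      phi_vec_der(3)[OF q Gamma_der[OF q]]]
  from young[OF W q phi_der d d, of v u] show ?thesis by (simp add: Rm_def l algebra_simps)
qed

text \<open>The covariant derivative of the vector-valued torsion, lowered with g. As g is parallel,
  it is the covariant derivative of the 3-form (\<open>T_der\<close>).\<close>

definition nT :: "vec7 \<Rightarrow> vec7 \<Rightarrow> vec7 \<Rightarrow> vec7 \<Rightarrow> vec7 \<Rightarrow> real" where
  "nT q x u v w = g q (\<Gamma> q x (tau q u v) + (dG q x u v - dG q x v u) - tau q (\<Gamma> q x u) v - tau q u (\<Gamma> q x v)) w"

lemma T_der: assumes q: "q \<in> W"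
  shows "((\<lambda>q. T q u v w) has_derivative (\<lambda>x. nT q x u v w + T q (\<Gamma> q x u) v w + T q u (\<Gamma> q x v) w + T q u v (\<Gamma> q x w))) (at q)"
proof -
  have "((\<lambda>q. T q u v w) has_derivative (\<lambda>x. g q (\<Gamma> q x (tau q u v)) w + g q (tau q u v) (\<Gamma> q x w) + g q (dG q x u v - dG q x v u) w)) (at q)"
    unfolding T_def by (rule g_vec_der[OF q tau_der[OF q]])
  then show ?thesis by (simp add: nT_def T_def g_lin q algebra_simps)
qed

lemma bianchi1: assumes q: "q \<in> W"
  shows "R q u v w z + R q v w u z + R q w u v z = nT q u v w z + nT q v w u z + nT q w u v z
    + (T q (tau q u v) w z + T q (tau q v w) u z + T q (tau q w u) v z)"
proof -
  have "Rm q u v w + Rm q v w u + Rm q w u v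
    = (\<Gamma> q u (tau q v w) + (dG q u v w - dG q u w v) - tau q (\<Gamma> q u v) w - tau q v (\<Gamma> q u w))
    + (\<Gamma> q v (tau q w u) + (dG q v w u - dG q v u w) - tau q (\<Gamma> q v w) u - tau q w (\<Gamma> q v u))
    + (\<Gamma> q w (tau q u v) + (dG q w u v - dG q w v u) - tau q (\<Gamma> q w u) v - tau q u (\<Gamma> q w v))
    + (tau q (tau q u v) w + tau q (tau q v w) u + tau q (tau q w u) v)"
    by (simp add: Rm_def tau_def Gamma_lin q algebra_simps)
  then show ?thesis unfolding R_def nT_def T_def by (simp add: g_lin[symmetric] q)
qed

definition N :: "vec7 \<Rightarrow> vec7 \<Rightarrow> vec7 \<Rightarrow> vec7 \<Rightarrow> vec7 \<Rightarrow> vec7 \<Rightarrow> real" where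
  "N q x u v w z = g q (\<Gamma> q x (Rm q u v w) + dRm q x u v w - Rm q (\<Gamma> q x u) v w - Rm q u (\<Gamma> q x v) w - Rm q u v (\<Gamma> q x w)) z"

lemma R_der: assumes q: "q \<in> W"
  shows "((\<lambda>q. R q u v w z) has_derivative (\<lambda>x. N q x u v w z + R q (\<Gamma> q x u) v w z + R q u (\<Gamma> q x v) w z + R q u v (\<Gamma> q x w) z + R q u v w (\<Gamma> q x z))) (at q)"
proof -
  have "((\<lambda>q. R q u v w z) has_derivative (\<lambda>x. g q (\<Gamma> q x (Rm q u v w)) z + g q (Rm q u v w) (\<Gamma> q x z) + g q (dRm q x u v w) z)) (at q)"
    unfolding R_def by (rule g_vec_der[OF q Rm_der[OF q]])
  then show ?thesis by (simp add: N_def R_def g_lin q algebra_simps)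
qed

text \<open>Linearity of \<Gamma> holds on an open set, so it passes to derivatives by their
  uniqueness.\<close>

lemma dG_linear:
  assumes q: "q \<in> W"
  shows "linear (\<lambda>u. dG q u v w)" "linear (\<lambda>v. dG q u v w)" "linear (\<lambda>w. dG q u v w)"
proof -
  show "linear (\<lambda>u. dG q u v w)" using has_derivative_linear[OF Gamma_der[OF q]] .
  have a: "dG q u (x + y) w = dG q u x w + dG q u y w" "dG q u v (x + y) = dG q u v x + dG q u v y"
     "dG q u (c *\<^sub>R x) w = c *\<^sub>R dG q u x w" "dG q u v (c *\<^sub>R x) = c *\<^sub>R dG q u v x" for x y c u v w
    using has_derivative_unique[OF Gamma_der[OF q] has_derivative_transform_within_open[OF has_derivative_add[OF Gamma_der[OF q] Gamma_der[OF q]] W q, of x w y w "\<lambda>q. \<Gamma> q (x + y) w"]]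
      has_derivative_unique[OF Gamma_der[OF q] has_derivative_transform_within_open[OF has_derivative_add[OF Gamma_der[OF q] Gamma_der[OF q]] W q, of v x v y "\<lambda>q. \<Gamma> q v (x + y)"]]
      has_derivative_unique[OF Gamma_der[OF q] has_derivative_transform_within_open[OF has_derivative_scaleR_right[OF Gamma_der[OF q]] W q, of c x w "\<lambda>q. \<Gamma> q (c *\<^sub>R x) w"]]
      has_derivative_unique[OF Gamma_der[OF q] has_derivative_transform_within_open[OF has_derivative_scaleR_right[OF Gamma_der[OF q]] W q, of c v x "\<lambda>q. \<Gamma> q v (c *\<^sub>R x)"]]
    by (simp_all add: Gamma_lin fun_eq_iff)
  show "linear (\<lambda>v. dG q u v w)" "linear (\<lambda>w. dG q u v w)" by (auto intro!: linearI simp: a)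
qed

lemmas dG_lin = linear_add[OF dG_linear(1)] linear_add[OF dG_linear(2)] linear_add[OF dG_linear(3)]
  linear_diff[OF dG_linear(1)] linear_diff[OF dG_linear(2)] linear_diff[OF dG_linear(3)]
  linear_cmul[OF dG_linear(1)] linear_cmul[OF dG_linear(2)] linear_cmul[OF dG_linear(3)]

lemma Rm_linear:
  assumes q: "q \<in> W"
  shows "linear (\<lambda>u. Rm q u v w)" "linear (\<lambda>v. Rm q u v w)" "linear (\<lambda>w. Rm q u v w)"
  by (auto intro!: linearI simp: Rm_def dG_lin Gamma_lin q algebra_simps)

lemma bianchi2: assumes q: "q \<in> W"
  shows "N q x u v w z + N q u v x w z + N q v x u w z
    + (R q (tau q x u) v w z + R q (tau q u v) x w z + R q (tau q v x) u w z) = 0"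
proof -
  note l = linear_add[OF Rm_linear(1)] linear_diff[OF Rm_linear(1)]
  have sk: "Rm q u (\<Gamma> q x v) w = - Rm q (\<Gamma> q x v) u w" for u x v by (simp add: Rm_def)
  \<comment> \<open>The covariant derivative of the curvature without the corrections in u and v.
    Its cyclic sum vanishes by \<open>ddG_sym\<close>, and the omitted corrections cancel against
    the torsion terms.\<close>
  define n where "n x u v = \<Gamma> q x (Rm q u v w) + dRm q x u v w - Rm q u v (\<Gamma> q x w)" for x u v
  have "n x u v + n u v x + n v x u = 0"
    unfolding n_def dRm_def
    by (simp add: Rm_def Gamma_lin q ddG_sym[OF q, of u x] ddG_sym[OF q, of v x] ddG_sym[OF q, of v u] algebra_simps)
  moreover have "N q x u v w z = g q (n x u v - Rm q (\<Gamma> q x u) v w + Rm q (\<Gamma> q x v) u w) z" for x u v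
    unfolding N_def n_def sk by (simp add: algebra_simps)
  moreover have "R q (tau q x u) v w z = g q (Rm q (\<Gamma> q x u) v w - Rm q (\<Gamma> q u x) v w) z" for x u v
    unfolding R_def tau_def by (simp add: l q)
  ultimately show ?thesis
    by (simp add: g_lin[symmetric] q algebra_simps linear_0[OF g_linear1])
qed

end

text \<open>For the connection form \<open>\<omega>\<close> of a metric connection, this is the difference between the derivatives
  of the components and the components of the covariant derivative.\<close>

definition act3 :: "(i7 \<Rightarrow> i7 \<Rightarrow> real) \<Rightarrow> (i7 \<Rightarrow> i7 \<Rightarrow> i7 \<Rightarrow> real) \<Rightarrow> i7 \<Rightarrow> i7 \<Rightarrow> i7 \<Rightarrow> real" where
  "act3 \<omega> P i j k = (\<Sum>s\<in>UNIV. \<omega> i s * P s j k) + (\<Sum>s\<in>UNIV. \<omega> j s * P i s k) + (\<Sum>s\<in>UNIV. \<omega> k s * P i j s)"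

definition act2 :: "(i7 \<Rightarrow> i7 \<Rightarrow> real) \<Rightarrow> (i7 \<Rightarrow> i7 \<Rightarrow> real) \<Rightarrow> i7 \<Rightarrow> i7 \<Rightarrow> real" where
  "act2 \<omega> P i j = (\<Sum>s\<in>UNIV. \<omega> i s * P s j) + (\<Sum>s\<in>UNIV. \<omega> j s * P i s)"

definition con3 :: "(i7 \<Rightarrow> i7 \<Rightarrow> i7 \<Rightarrow> real) \<Rightarrow> (i7 \<Rightarrow> i7 \<Rightarrow> i7 \<Rightarrow> real) \<Rightarrow> real" where
  "con3 P Q = (\<Sum>i\<in>UNIV. \<Sum>j\<in>UNIV. \<Sum>k\<in>UNIV. P i j k * Q i j k)"

definition con2 :: "(i7 \<Rightarrow> i7 \<Rightarrow> real) \<Rightarrow> (i7 \<Rightarrow> i7 \<Rightarrow> real) \<Rightarrow> real" where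
  "con2 P Q = (\<Sum>i\<in>UNIV. \<Sum>j\<in>UNIV. P i j * Q i j)"

text \<open>Skew matrices are minus their adjoints; this moves connection terms from one factor of a
  contraction to the other.\<close>

lemma skew_cancel:
  assumes sk: "\<And>a b. \<omega> a b = - \<omega> b a"
  shows "(\<Sum>d\<in>UNIV. (\<Sum>s\<in>UNIV. \<omega> d s * A s) * B d) + (\<Sum>d\<in>UNIV. A d * (\<Sum>s\<in>UNIV. \<omega> d s * B s)) = (0::real)"
proof -
  have "(\<Sum>d\<in>UNIV. A d * (\<Sum>s\<in>UNIV. \<omega> d s * B s)) = (\<Sum>d\<in>UNIV. \<Sum>s\<in>UNIV. \<omega> s d * A s * B d)"
    by (simp only: sum_distrib_left, subst sum.swap) (simp only: mult_ac)
  also have "\<dots> = - (\<Sum>d\<in>UNIV. \<Sum>s\<in>UNIV. \<omega> d s * A s * B d)"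
    by (subst sk) (simp only: mult_minus_left sum_negf)
  also have "(\<Sum>d\<in>UNIV. \<Sum>s\<in>UNIV. \<omega> d s * A s * B d) = (\<Sum>d\<in>UNIV. (\<Sum>s\<in>UNIV. \<omega> d s * A s) * B d)"
    by (simp only: sum_distrib_right)
  finally show ?thesis by simp
qed

lemma skew_cancel':
  assumes sk: "\<And>a b. \<omega> a b = - \<omega> b a"
  shows "(\<Sum>d\<in>UNIV. (\<Sum>s\<in>UNIV. \<omega> d s * A s) * B d + A d * (\<Sum>s\<in>UNIV. \<omega> d s * B s)) = (0::real)"
  unfolding sum.distrib by (rule skew_cancel) (rule sk)

lemma con2_skew:
  assumes sk: "\<And>a b. \<omega> a b = - \<omega> b a"
  shows "con2 (act2 \<omega> P) Q + con2 P (act2 \<omega> Q) = 0"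
proof -
  have 1: "(\<Sum>i\<in>UNIV. \<Sum>j\<in>UNIV. (\<Sum>s\<in>UNIV. \<omega> i s * P s j) * Q i j) + (\<Sum>i\<in>UNIV. \<Sum>j\<in>UNIV. P i j * (\<Sum>s\<in>UNIV. \<omega> i s * Q s j)) = 0"
  proof -
    have "(\<Sum>i\<in>UNIV. \<Sum>j\<in>UNIV. (\<Sum>s\<in>UNIV. \<omega> i s * P s j) * Q i j) = (\<Sum>j\<in>UNIV. \<Sum>i\<in>UNIV. (\<Sum>s\<in>UNIV. \<omega> i s * P s j) * Q i j)"
      by (rule sum.swap)
    moreover have "(\<Sum>i\<in>UNIV. \<Sum>j\<in>UNIV. P i j * (\<Sum>s\<in>UNIV. \<omega> i s * Q s j)) = (\<Sum>j\<in>UNIV. \<Sum>i\<in>UNIV. P i j * (\<Sum>s\<in>UNIV. \<omega> i s * Q s j))"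
      by (rule sum.swap)
    moreover have "(\<Sum>j\<in>UNIV. \<Sum>i\<in>UNIV. (\<Sum>s\<in>UNIV. \<omega> i s * P s j) * Q i j + P i j * (\<Sum>s\<in>UNIV. \<omega> i s * Q s j)) = 0"
      by (intro sum.neutral ballI skew_cancel'[OF sk])
    ultimately show ?thesis unfolding sum.distrib by linarith
  qed
  have 2: "(\<Sum>i\<in>UNIV. \<Sum>j\<in>UNIV. (\<Sum>s\<in>UNIV. \<omega> j s * P i s) * Q i j + P i j * (\<Sum>s\<in>UNIV. \<omega> j s * Q i s)) = 0"
    by (intro sum.neutral ballI skew_cancel'[OF sk])
  show ?thesis using 1 2 unfolding con2_def act2_def distrib_left distrib_right sum.distrib by linarith
qed

lemma con3_skew:
  assumes sk: "\<And>a b. \<omega> a b = - \<omega> b a"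
  shows "con3 (act3 \<omega> P) Q + con3 P (act3 \<omega> Q) = 0"
proof -
  have 2: "(\<Sum>i\<in>UNIV. con2 (act2 \<omega> (P i)) (Q i)) + (\<Sum>i\<in>UNIV. con2 (P i) (act2 \<omega> (Q i))) = 0"
    unfolding sum.distrib[symmetric] con2_skew[OF sk] by simp
  have 1: "(\<Sum>i\<in>UNIV. \<Sum>j\<in>UNIV. \<Sum>k\<in>UNIV. (\<Sum>s\<in>UNIV. \<omega> i s * P s j k) * Q i j k)
     + (\<Sum>i\<in>UNIV. \<Sum>j\<in>UNIV. \<Sum>k\<in>UNIV. P i j k * (\<Sum>s\<in>UNIV. \<omega> i s * Q s j k)) = 0"
  proof -
    have "(\<Sum>i\<in>UNIV. \<Sum>j\<in>UNIV. \<Sum>k\<in>UNIV. (\<Sum>s\<in>UNIV. \<omega> i s * P s j k) * Q i j k)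
       = (\<Sum>j\<in>UNIV. \<Sum>k\<in>UNIV. \<Sum>i\<in>UNIV. (\<Sum>s\<in>UNIV. \<omega> i s * P s j k) * Q i j k)" by (rule sum_rot3)
    moreover have "(\<Sum>i\<in>UNIV. \<Sum>j\<in>UNIV. \<Sum>k\<in>UNIV. P i j k * (\<Sum>s\<in>UNIV. \<omega> i s * Q s j k))
       = (\<Sum>j\<in>UNIV. \<Sum>k\<in>UNIV. \<Sum>i\<in>UNIV. P i j k * (\<Sum>s\<in>UNIV. \<omega> i s * Q s j k))" by (rule sum_rot3)
    moreover have "(\<Sum>j\<in>UNIV. \<Sum>k\<in>UNIV. \<Sum>i\<in>UNIV. (\<Sum>s\<in>UNIV. \<omega> i s * P s j k) * Q i j k + P i j k * (\<Sum>s\<in>UNIV. \<omega> i s * Q s j k)) = 0"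
      by (intro sum.neutral ballI skew_cancel'[OF sk])
    ultimately show ?thesis unfolding sum.distrib by linarith
  qed
  show ?thesis using 1 2 unfolding con3_def con2_def act3_def act2_def distrib_left distrib_right sum.distrib by linarith
qed

text \<open>An invariant contraction commutes with the derivation action: the terms at the summed
  index cancel by skewness, and the four free indices remain.\<close>

lemma sig2_act3:
  assumes sk: "\<And>a b. \<omega> a b = - \<omega> b a"
  shows "sig2 (act3 \<omega> T) T i j k l + sig2 T (act3 \<omega> T) i j k l
    = act3 \<omega> (\<lambda>i j k. sig T i j k l) i j k + (\<Sum>m\<in>UNIV. \<omega> l m * sig T i j k m)"
proof -
  define c where "c i j k l = (\<Sum>s\<in>UNIV. T i j s * T s k l)" for i j k l
  have c: "(\<Sum>s\<in>UNIV. act3 \<omega> T i j s * T s k l) + (\<Sum>s\<in>UNIV. T i j s * act3 \<omega> T s k l)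
     = (\<Sum>m\<in>UNIV. \<omega> i m * c m j k l) + (\<Sum>m\<in>UNIV. \<omega> j m * c i m k l) + (\<Sum>m\<in>UNIV. \<omega> k m * c i j m l) + (\<Sum>m\<in>UNIV. \<omega> l m * c i j k m)"
    for i j k l
  proof -
    have "(\<Sum>s\<in>UNIV. (\<Sum>m\<in>UNIV. \<omega> i m * T m j s) * T s k l) = (\<Sum>m\<in>UNIV. \<omega> i m * c m j k l)"
      "(\<Sum>s\<in>UNIV. (\<Sum>m\<in>UNIV. \<omega> j m * T i m s) * T s k l) = (\<Sum>m\<in>UNIV. \<omega> j m * c i m k l)"
      "(\<Sum>s\<in>UNIV. T i j s * (\<Sum>m\<in>UNIV. \<omega> k m * T s m l)) = (\<Sum>m\<in>UNIV. \<omega> k m * c i j m l)"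
      "(\<Sum>s\<in>UNIV. T i j s * (\<Sum>m\<in>UNIV. \<omega> l m * T s k m)) = (\<Sum>m\<in>UNIV. \<omega> l m * c i j k m)"
      unfolding c_def sum_distrib_left sum_distrib_right by (subst sum.swap, simp only: mult_ac)+
    with skew_cancel[of \<omega> "\<lambda>s. T i j s" "\<lambda>s. T s k l", OF sk] show ?thesis
      unfolding act3_def distrib_left distrib_right sum.distrib by linarith
  qed
  have s: "sig T i j k l = c i j k l + c j k i l + c k i j l" for i j k l
    by (simp add: sig_def c_def sum.distrib)
  show ?thesis
    using c[of i j k l] c[of j k i l] c[of k i j l]
    unfolding s sig2_def act3_def[of \<omega> "\<lambda>i j k. c i j k l + c j k i l + c k i j l"] sum.distrib distrib_left by linarith
qed

section \<open>Derivatives of components in the adapted frame\<close>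

context g2_region
begin

lemma T_linear: assumes q: "q \<in> W"
  shows "linear (\<lambda>u. T q u v w)" "linear (\<lambda>v. T q u v w)" "linear (\<lambda>w. T q u v w)"
  by (auto intro!: linearI simp: T_def tau_def g_lin Gamma_lin q algebra_simps)

lemma R_linear: assumes q: "q \<in> W"
  shows "linear (\<lambda>u. R q u v w z)" "linear (\<lambda>v. R q u v w z)" "linear (\<lambda>w. R q u v w z)" "linear (\<lambda>z. R q u v w z)"
  by (auto intro!: linearI simp: R_def g_lin q linear_add[OF Rm_linear(1)] linear_add[OF Rm_linear(2)] linear_add[OF Rm_linear(3)]
      linear_cmul[OF Rm_linear(1)] linear_cmul[OF Rm_linear(2)] linear_cmul[OF Rm_linear(3)])

lemma T_torsion_form: "torsion_form \<phi> \<Gamma> q [u, v, w] = T q u v w"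
  by (simp add: torsion_form_def torsion_christoffel T_def tau_def)

lemma T_swap: assumes q: "q \<in> W" shows "T q u v w = - T q v u w" "T q u v w = - T q u w v"
  using alternating_swap[OF torsion_alt[OF q], of "[]" "[w]" u v] alternating_swap[OF torsion_alt[OF q], of "[u]" "[]" v w]
  by (simp_all add: T_torsion_form)

definition Tf where "Tf q i j k = T q (E q i) (E q j) (E q k)"
definition Rf where "Rf q i j k l = R q (E q i) (E q j) (E q k) (E q l)"
definition nTf where "nTf q a i j k = nT q (E q a) (E q i) (E q j) (E q k)"
definition Nf where "Nf q a i j k l = N q (E q a) (E q i) (E q j) (E q k) (E q l)"
definition dE where "dE q b = frechet_derivative (\<lambda>q. E q b) (at q)"
text \<open>The connection form \<open>g(\<nabla>\<^sub>a E\<^sub>b, E\<^sub>c)\<close> of the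
  moving frame.\<close>

definition om where "om q a b c = ee q c (dE q b (E q a) + \<Gamma> q (E q a) (E q b))"

lemma E_der: assumes q: "q \<in> W" shows "((\<lambda>q. E q b) has_derivative dE q b) (at q)"
proof -
  have "(\<lambda>q. ee q i v) differentiable (at q)" for i v unfolding ee_def by (intro e_diff q ix_range)
  then have "(\<lambda>q. E q b) differentiable (at q)"
    by (intro dual_frame_differentiable[OF W q frame_dual])
  then show ?thesis unfolding dE_def by (simp add: frechet_derivative_works)
qed

lemma dE_om: assumes q: "q \<in> W" shows "dE q b (E q a) = (\<Sum>s\<in>UNIV. om q a b s *\<^sub>R E q s) - \<Gamma> q (E q a) (E q b)"
  using frame_expand[OF q, of "dE q b (E q a) + \<Gamma> q (E q a) (E q b)"] by (simp add: om_def eq_diff_eq)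

lemma om_skew: assumes q: "q \<in> W" shows "om q a b c = - om q a c b"
proof -
  have d: "((\<lambda>q. g q (E q b) (E q c)) has_derivative (\<lambda>u. (g q (\<Gamma> q u (E q b)) (E q c) + g q (E q b) (\<Gamma> q u (E q c)))
      + g q (dE q b u) (E q c) + g q (E q b) (dE q c u))) (at q)"
    by (rule has_derivative_multilinear2[OF W q g_linear1 g_linear2 g_der[OF q] E_der[OF q] E_der[OF q]])
  have "((\<lambda>q. g q (E q b) (E q c)) has_derivative (\<lambda>u. 0)) (at q)"
    by (rule has_derivative_transform_within_open[OF has_derivative_const[of "dl b c"] W q])
       (simp add: g_frame_comp ee_E dl_sym[of c b])
  from has_derivative_unique[OF d this]
  have "g q (\<Gamma> q (E q a) (E q b)) (E q c) + g q (E q b) (\<Gamma> q (E q a) (E q c)) + g q (dE q b (E q a)) (E q c) + g q (E q b) (dE q c (E q a)) = 0"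
    by (metis (mono_tags, lifting))
  then show ?thesis
    by (simp add: om_def g_frame_comp q g_sym[OF q, of "E q b"] linear_add[OF ee_linear])
qed

text \<open>By \<open>dE_om\<close> the derivatives of the frame vectors contain \<Gamma> with the
  opposite sign, so it cancels and only the connection form is left.\<close>

lemma frame_component_der:
  fixes h :: "vec7 \<Rightarrow> vec7 \<Rightarrow> vec7 \<Rightarrow> vec7 \<Rightarrow> real"
  assumes q: "q \<in> W"
    and l: "\<And>q y z. q \<in> W \<Longrightarrow> linear (\<lambda>x. h q x y z)" "\<And>q x z. q \<in> W \<Longrightarrow> linear (\<lambda>y. h q x y z)"
      "\<And>q x y. q \<in> W \<Longrightarrow> linear (\<lambda>z. h q x y z)"
    and d: "\<And>x y z. ((\<lambda>q. h q x y z) has_derivative (\<lambda>u. n u x y z + h q (\<Gamma> q u x) y z + h q x (\<Gamma> q u y) z + h q x y (\<Gamma> q u z))) (at q)"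
  shows "\<exists>D. ((\<lambda>q. h q (E q i) (E q j) (E q k)) has_derivative D) (at q) \<and>
    (\<forall>a. D (E q a) = n (E q a) (E q i) (E q j) (E q k) + act3 (om q a) (\<lambda>i j k. h q (E q i) (E q j) (E q k)) i j k)"
proof (intro exI conjI allI)
  show "((\<lambda>q. h q (E q i) (E q j) (E q k)) has_derivative (\<lambda>u. (n u (E q i) (E q j) (E q k) + h q (\<Gamma> q u (E q i)) (E q j) (E q k)
     + h q (E q i) (\<Gamma> q u (E q j)) (E q k) + h q (E q i) (E q j) (\<Gamma> q u (E q k)))
     + h q (dE q i u) (E q j) (E q k) + h q (E q i) (dE q j u) (E q k) + h q (E q i) (E q j) (dE q k u))) (at q)"
    by (rule has_derivative_multilinear3[OF W q l d E_der[OF q] E_der[OF q] E_der[OF q]])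
  note ll = linear_diff[OF l(1)[OF q]] linear_diff[OF l(2)[OF q]] linear_diff[OF l(3)[OF q]]
    linear_sum[OF l(1)[OF q]] linear_sum[OF l(2)[OF q]] linear_sum[OF l(3)[OF q]]
    linear_cmul[OF l(1)[OF q]] linear_cmul[OF l(2)[OF q]] linear_cmul[OF l(3)[OF q]]
  fix a
  show "(n (E q a) (E q i) (E q j) (E q k) + h q (\<Gamma> q (E q a) (E q i)) (E q j) (E q k)
     + h q (E q i) (\<Gamma> q (E q a) (E q j)) (E q k) + h q (E q i) (E q j) (\<Gamma> q (E q a) (E q k)))
     + h q (dE q i (E q a)) (E q j) (E q k) + h q (E q i) (dE q j (E q a)) (E q k) + h q (E q i) (E q j) (dE q k (E q a))
    = n (E q a) (E q i) (E q j) (E q k) + act3 (om q a) (\<lambda>i j k. h q (E q i) (E q j) (E q k)) i j k"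
    unfolding dE_om[OF q] by (simp add: ll act3_def)
qed

lemma Tf_der: "q \<in> W \<Longrightarrow> \<exists>D. ((\<lambda>q. Tf q i j k) has_derivative D) (at q) \<and> (\<forall>a. D (E q a) = nTf q a i j k + act3 (om q a) (Tf q) i j k)"
  unfolding Tf_def nTf_def by (rule frame_component_der[OF _ T_linear T_der])

lemma phi_E: "q \<in> W \<Longrightarrow> \<phi> q [E q a, E q b, E q c] = phi0 a b c"
  by (rule adapted_frame_phi0[OF frame])

text \<open>The components of \<phi> are constant and \<phi> is parallel, so the connection term
  vanishes: the connection form takes values in g_2.\<close>

lemma om_phi0: assumes q: "q \<in> W" shows "act3 (om q a) phi0 i j k = 0"
proof -
  have d: "((\<lambda>q. \<phi> q [x, y, z]) has_derivative
     (\<lambda>u. 0 + \<phi> q [\<Gamma> q u x, y, z] + \<phi> q [x, \<Gamma> q u y, z] + \<phi> q [x, y, \<Gamma> q u z])) (at q)" for x y z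
    using phi_der[OF q] by simp
  obtain D where D: "((\<lambda>q. \<phi> q [E q i, E q j, E q k]) has_derivative D) (at q)"
    "D (E q a) = 0 + act3 (om q a) (\<lambda>i j k. \<phi> q [E q i, E q j, E q k]) i j k"
    using frame_component_der[OF q phi_linear d, of i j k] by blast
  have "((\<lambda>q. \<phi> q [E q i, E q j, E q k]) has_derivative (\<lambda>u. 0)) (at q)"
    by (rule has_derivative_transform_within_open[OF has_derivative_const[of "phi0 i j k"] W q]) (simp add: phi_E)
  from has_derivative_unique[OF D(1) this] D(2) show ?thesis by (simp add: phi_E q)
qed

lemma Rf_der:
  assumes q: "q \<in> W"
  shows "\<exists>D. ((\<lambda>q. Rf q i j k l) has_derivative D) (at q) \<and>
    (\<forall>a. D (E q a) = Nf q a i j k l + (\<Sum>s\<in>UNIV. om q a i s * Rf q s j k l) + (\<Sum>s\<in>UNIV. om q a j s * Rf q i s k l)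
       + (\<Sum>s\<in>UNIV. om q a k s * Rf q i j s l) + (\<Sum>s\<in>UNIV. om q a l s * Rf q i j k s))"
proof (intro exI conjI allI)
  show "((\<lambda>q. Rf q i j k l) has_derivative (\<lambda>u. (N q u (E q i) (E q j) (E q k) (E q l) + R q (\<Gamma> q u (E q i)) (E q j) (E q k) (E q l)
     + R q (E q i) (\<Gamma> q u (E q j)) (E q k) (E q l) + R q (E q i) (E q j) (\<Gamma> q u (E q k)) (E q l) + R q (E q i) (E q j) (E q k) (\<Gamma> q u (E q l)))
     + R q (dE q i u) (E q j) (E q k) (E q l) + R q (E q i) (dE q j u) (E q k) (E q l) + R q (E q i) (E q j) (dE q k u) (E q l)
     + R q (E q i) (E q j) (E q k) (dE q l u))) (at q)"
    unfolding Rf_def by (rule has_derivative_multilinear4[OF W q R_linear R_der[OF q] E_der[OF q] E_der[OF q] E_der[OF q] E_der[OF q]])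
  note ll = linear_diff[OF R_linear(1)[OF q]] linear_diff[OF R_linear(2)[OF q]] linear_diff[OF R_linear(3)[OF q]] linear_diff[OF R_linear(4)[OF q]]
    linear_sum[OF R_linear(1)[OF q]] linear_sum[OF R_linear(2)[OF q]] linear_sum[OF R_linear(3)[OF q]] linear_sum[OF R_linear(4)[OF q]]
    linear_cmul[OF R_linear(1)[OF q]] linear_cmul[OF R_linear(2)[OF q]] linear_cmul[OF R_linear(3)[OF q]] linear_cmul[OF R_linear(4)[OF q]]
  fix a
  show "(N q (E q a) (E q i) (E q j) (E q k) (E q l) + R q (\<Gamma> q (E q a) (E q i)) (E q j) (E q k) (E q l)
     + R q (E q i) (\<Gamma> q (E q a) (E q j)) (E q k) (E q l) + R q (E q i) (E q j) (\<Gamma> q (E q a) (E q k)) (E q l) + R q (E q i) (E q j) (E q k) (\<Gamma> q (E q a) (E q l)))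
     + R q (dE q i (E q a)) (E q j) (E q k) (E q l) + R q (E q i) (dE q j (E q a)) (E q k) (E q l) + R q (E q i) (E q j) (dE q k (E q a)) (E q l)
     + R q (E q i) (E q j) (E q k) (dE q l (E q a))
    = Nf q a i j k l + (\<Sum>s\<in>UNIV. om q a i s * Rf q s j k l) + (\<Sum>s\<in>UNIV. om q a j s * Rf q i s k l)
       + (\<Sum>s\<in>UNIV. om q a k s * Rf q i j s l) + (\<Sum>s\<in>UNIV. om q a l s * Rf q i j k s)"
    unfolding dE_om[OF q] by (simp add: ll Nf_def Rf_def)
qed

definition dR where "dR q i j k l = frechet_derivative (\<lambda>q. Rf q i j k l) (at q)"
definition dT where "dT q i j k = frechet_derivative (\<lambda>q. Tf q i j k) (at q)"

lemma dT_der: "q \<in> W \<Longrightarrow> ((\<lambda>q. Tf q i j k) has_derivative dT q i j k) (at q)"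
  and dT_E: "q \<in> W \<Longrightarrow> dT q i j k (E q a) = nTf q a i j k + act3 (om q a) (Tf q) i j k"
proof -
  assume q: "q \<in> W"
  then obtain D where D: "((\<lambda>q. Tf q i j k) has_derivative D) (at q)"
    "\<And>a. D (E q a) = nTf q a i j k + act3 (om q a) (Tf q) i j k" using Tf_der by blast
  have e: "dT q i j k = D" unfolding dT_def using frechet_derivative_at[OF D(1)] by simp
  show "((\<lambda>q. Tf q i j k) has_derivative dT q i j k) (at q)" unfolding e by (rule D(1))
  show "dT q i j k (E q a) = nTf q a i j k + act3 (om q a) (Tf q) i j k" unfolding e by (rule D(2))
qed

lemma dR_der: "q \<in> W \<Longrightarrow> ((\<lambda>q. Rf q i j k l) has_derivative dR q i j k l) (at q)"
  and dR_E: "q \<in> W \<Longrightarrow> dR q i j k l (E q a) = Nf q a i j k l + (\<Sum>s\<in>UNIV. om q a i s * Rf q s j k l)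
       + (\<Sum>s\<in>UNIV. om q a j s * Rf q i s k l) + (\<Sum>s\<in>UNIV. om q a k s * Rf q i j s l) + (\<Sum>s\<in>UNIV. om q a l s * Rf q i j k s)"
proof -
  assume q: "q \<in> W"
  then obtain D where D: "((\<lambda>q. Rf q i j k l) has_derivative D) (at q)"
    "\<And>a. D (E q a) = Nf q a i j k l + (\<Sum>s\<in>UNIV. om q a i s * Rf q s j k l)
       + (\<Sum>s\<in>UNIV. om q a j s * Rf q i s k l) + (\<Sum>s\<in>UNIV. om q a k s * Rf q i j s l) + (\<Sum>s\<in>UNIV. om q a l s * Rf q i j k s)"
    using Rf_der by blast
  have e: "dR q i j k l = D" unfolding dR_def using frechet_derivative_at[OF D(1)] by simp
  show "((\<lambda>q. Rf q i j k l) has_derivative dR q i j k l) (at q)" unfolding e by (rule D(1))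
  show "dR q i j k l (E q a) = Nf q a i j k l + (\<Sum>s\<in>UNIV. om q a i s * Rf q s j k l)
       + (\<Sum>s\<in>UNIV. om q a j s * Rf q i s k l) + (\<Sum>s\<in>UNIV. om q a k s * Rf q i j s l) + (\<Sum>s\<in>UNIV. om q a l s * Rf q i j k s)"
    unfolding e by (rule D(2))
qed

lemma Tf_alt3: "q \<in> W \<Longrightarrow> alt3 (Tf q)"
  unfolding alt3_def Tf_def using T_swap by blast

lemma tau_E: assumes q: "q \<in> W" shows "tau q u v = (\<Sum>s\<in>UNIV. T q u v (E q s) *\<^sub>R E q s)"
  using frame_expand[OF q, of "tau q u v"] by (simp add: T_def g_frame_comp[OF q])

lemma T_tau: assumes q: "q \<in> W" shows "T q (tau q (E q i) (E q j)) (E q k) (E q l) = (\<Sum>s\<in>UNIV. Tf q i j s * Tf q s k l)"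
  unfolding tau_E[OF q, of "E q i"] by (simp add: linear_sum[OF T_linear(1)[OF q]] linear_cmul[OF T_linear(1)[OF q]] Tf_def)

lemma R_tau: assumes q: "q \<in> W" shows "R q (tau q (E q i) (E q j)) (E q k) (E q l) (E q m) = (\<Sum>s\<in>UNIV. Tf q i j s * Rf q s k l m)"
  unfolding tau_E[OF q, of "E q i"] by (simp add: linear_sum[OF R_linear(1)[OF q]] linear_cmul[OF R_linear(1)[OF q]] Tf_def Rf_def)

lemma bianchi1_frame: assumes q: "q \<in> W"
  shows "Rf q i j k l + Rf q j k i l + Rf q k i j l = nTf q i j k l + nTf q j k i l + nTf q k i j l + sig (Tf q) i j k l"
  using bianchi1[OF q, of "E q i" "E q j" "E q k" "E q l"] unfolding T_tau[OF q]
  by (simp add: Rf_def nTf_def sig_def sum.distrib)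

lemma bianchi2_frame: assumes q: "q \<in> W"
  shows "Nf q x u v w z + Nf q u v x w z + Nf q v x u w z
      + (\<Sum>s\<in>UNIV. Tf q x u s * Rf q s v w z + Tf q u v s * Rf q s x w z + Tf q v x s * Rf q s u w z) = 0"
  using bianchi2[OF q, of "E q x" "E q u" "E q v" "E q w" "E q z"] unfolding R_tau[OF q]
  by (simp add: Nf_def sum.distrib)

lemma Rf_skew: assumes q: "q \<in> W" shows "Rf q i j k l = - Rf q j i k l" "Rf q i j k l = - Rf q i j l k"
  using Rm_skew[OF q, of "E q i" "E q j" "E q k" "E q l"] g_sym[OF q, of "E q k"]
  by (simp_all add: Rf_def R_def Rm_def g_lin q)

lemma Rf_g2: assumes q: "q \<in> W"
  shows "(\<Sum>s\<in>UNIV. Rf q u v i s * phi0 s j k + Rf q u v j s * phi0 i s k + Rf q u v k s * phi0 i j s) = 0"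
proof -
  have x: "Rm q (E q u) (E q v) (E q i) = (\<Sum>s\<in>UNIV. Rf q u v i s *\<^sub>R E q s)" for i
    using frame_expand[OF q, of "Rm q (E q u) (E q v) (E q i)"] by (simp add: Rf_def R_def g_frame_comp[OF q])
  show ?thesis
    using Rm_phi[OF q, of "E q u" "E q v" "E q i" "E q j" "E q k"] unfolding x
    by (simp add: linear_sum[OF phi_linear(1)[OF q]] linear_sum[OF phi_linear(2)[OF q]] linear_sum[OF phi_linear(3)[OF q]]
       linear_cmul[OF phi_linear(1)[OF q]] linear_cmul[OF phi_linear(2)[OF q]] linear_cmul[OF phi_linear(3)[OF q]] phi_E[OF q] sum.distrib)
qed

lemma nT_swap: assumes q: "q \<in> W" shows "nT q x u v w = - nT q x v u w" "nT q x u v w = - nT q x u w v"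
proof -
  have "((\<lambda>q. T q u v w) has_derivative (\<lambda>x. - (nT q x v u w + T q (\<Gamma> q x v) u w + T q v (\<Gamma> q x u) w + T q v u (\<Gamma> q x w)))) (at q)"
    by (rule has_derivative_transform_within_open[OF has_derivative_minus[OF T_der[OF q, of v u w]] W q]) (subst T_swap(1), assumption, simp)
  from has_derivative_unique[OF T_der[OF q] this]
  have "nT q x u v w + T q (\<Gamma> q x u) v w + T q u (\<Gamma> q x v) w + T q u v (\<Gamma> q x w)
      = - (nT q x v u w + T q (\<Gamma> q x v) u w + T q v (\<Gamma> q x u) w + T q v u (\<Gamma> q x w))" by metis
  then show "nT q x u v w = - nT q x v u w"
    using T_swap(1)[OF q, of "\<Gamma> q x u" v w] T_swap(1)[OF q, of u "\<Gamma> q x v" w] T_swap(1)[OF q, of u v "\<Gamma> q x w"] by linarith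
  have "((\<lambda>q. T q u v w) has_derivative (\<lambda>x. - (nT q x u w v + T q (\<Gamma> q x u) w v + T q u (\<Gamma> q x w) v + T q u w (\<Gamma> q x v)))) (at q)"
    by (rule has_derivative_transform_within_open[OF has_derivative_minus[OF T_der[OF q, of u w v]] W q]) (subst T_swap(2), assumption, simp)
  from has_derivative_unique[OF T_der[OF q] this]
  have "nT q x u v w + T q (\<Gamma> q x u) v w + T q u (\<Gamma> q x v) w + T q u v (\<Gamma> q x w)
      = - (nT q x u w v + T q (\<Gamma> q x u) w v + T q u (\<Gamma> q x w) v + T q u w (\<Gamma> q x v))" by metis
  then show "nT q x u v w = - nT q x u w v"
    using T_swap(2)[OF q, of "\<Gamma> q x u" v w] T_swap(2)[OF q, of u "\<Gamma> q x v" w] T_swap(2)[OF q, of u v "\<Gamma> q x w"] by linarith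
qed

lemma nTf_alt3: "q \<in> W \<Longrightarrow> alt3 (nTf q a)"
  unfolding alt3_def nTf_def using nT_swap by blast

lemma const_der:
  assumes q: "q \<in> W" and f: "(f has_derivative D) (at q)" and c: "\<And>p. p \<in> W \<Longrightarrow> f p = (c::real)"
  shows "D u = 0"
proof -
  have "(f has_derivative (\<lambda>u. 0)) (at q)"
    by (rule has_derivative_transform_within_open[OF has_derivative_const[of c] W q]) (simp add: c)
  from has_derivative_unique[OF f this] show ?thesis by metis
qed

end

section \<open>Consequences of the instanton, Ricci and constant type conditions\<close>

locale g2_special = g2_region +
  fixes K :: real
  assumes inst: "\<And>q i j k. q \<in> W \<Longrightarrow> (\<Sum>a\<in>UNIV. \<Sum>b\<in>UNIV. Rf q a b i j * phi0 a b k) = 0"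
    and ricci: "\<And>q i j. q \<in> W \<Longrightarrow> (\<Sum>a\<in>UNIV. Rf q a i j a) = 0"
    and const: "\<And>q. q \<in> W \<Longrightarrow> con3 (Tf q) phi0 = K"
begin

text \<open>Differentiate the instanton equation. The connection terms in i and j are instanton
  equations again; those in a and b move over to \<phi>, whose invariance turns them into a rotation
  of k, again covered by the equation.\<close>

lemma instanton_nabla: assumes q: "q \<in> W" shows "(\<Sum>a\<in>UNIV. \<Sum>b\<in>UNIV. Nf q x a b i j * phi0 a b k) = 0"
proof -
  let ?o = "om q x"
  define D where "D = dR q"
    have D: "\<And>i j k l. ((\<lambda>q. Rf q i j k l) has_derivative D i j k l) (at q)"
    "\<And>i j k l. D i j k l (E q x) = Nf q x i j k l + (\<Sum>s\<in>UNIV. ?o i s * Rf q s j k l) + (\<Sum>s\<in>UNIV. ?o j s * Rf q i s k l)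
       + (\<Sum>s\<in>UNIV. ?o k s * Rf q i j s l) + (\<Sum>s\<in>UNIV. ?o l s * Rf q i j k s)"
    unfolding D_def by (rule dR_der[OF q], rule dR_E[OF q])
  have "((\<lambda>q. \<Sum>a\<in>UNIV. \<Sum>b\<in>UNIV. Rf q a b i j * phi0 a b k) has_derivative (\<lambda>u. \<Sum>a\<in>UNIV. \<Sum>b\<in>UNIV. D a b i j u * phi0 a b k)) (at q)"
    by (intro has_derivative_sum has_derivative_mult_left D(1))
  from const_der[OF q this, of 0 "E q x"] inst
  have 0: "(\<Sum>a\<in>UNIV. \<Sum>b\<in>UNIV. D a b i j (E q x) * phi0 a b k) = 0" by blast
  have 1: "(\<Sum>a\<in>UNIV. \<Sum>b\<in>UNIV. (\<Sum>s\<in>UNIV. ?o i s * Rf q a b s j) * phi0 a b k) = 0"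
  proof -
    have "(\<Sum>a\<in>UNIV. \<Sum>b\<in>UNIV. (\<Sum>s\<in>UNIV. ?o i s * Rf q a b s j) * phi0 a b k)
      = (\<Sum>s\<in>UNIV. ?o i s * (\<Sum>a\<in>UNIV. \<Sum>b\<in>UNIV. Rf q a b s j * phi0 a b k))"
      by (simp only: sum_distrib_left sum_distrib_right mult.assoc, subst sum_rot3[symmetric], rule refl)
    then show ?thesis by (simp add: inst q)
  qed
  have 2: "(\<Sum>a\<in>UNIV. \<Sum>b\<in>UNIV. (\<Sum>s\<in>UNIV. ?o j s * Rf q a b i s) * phi0 a b k) = 0"
  proof -
    have "(\<Sum>a\<in>UNIV. \<Sum>b\<in>UNIV. (\<Sum>s\<in>UNIV. ?o j s * Rf q a b i s) * phi0 a b k)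
      = (\<Sum>s\<in>UNIV. ?o j s * (\<Sum>a\<in>UNIV. \<Sum>b\<in>UNIV. Rf q a b i s * phi0 a b k))"
      by (simp only: sum_distrib_left sum_distrib_right mult.assoc, subst sum_rot3[symmetric], rule refl)
    then show ?thesis by (simp add: inst q)
  qed
  have 3: "con2 (act2 ?o (\<lambda>a b. Rf q a b i j)) (\<lambda>a b. phi0 a b k) = 0"
  proof -
    have "act2 ?o (\<lambda>a b. phi0 a b k) a b = - (\<Sum>s\<in>UNIV. ?o k s * phi0 a b s)" for a b
      using om_phi0[OF q, of x a b k] by (simp add: act2_def act3_def)
    then have "con2 (\<lambda>a b. Rf q a b i j) (act2 ?o (\<lambda>a b. phi0 a b k))
      = - (\<Sum>a\<in>UNIV. \<Sum>b\<in>UNIV. Rf q a b i j * (\<Sum>s\<in>UNIV. ?o k s * phi0 a b s))"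
      by (simp add: con2_def sum_negf)
    also have "(\<Sum>a\<in>UNIV. \<Sum>b\<in>UNIV. Rf q a b i j * (\<Sum>s\<in>UNIV. ?o k s * phi0 a b s))
      = (\<Sum>s\<in>UNIV. ?o k s * (\<Sum>a\<in>UNIV. \<Sum>b\<in>UNIV. Rf q a b i j * phi0 a b s))"
      by (simp only: sum_distrib_left mult.left_commute, subst sum_rot3[symmetric], rule refl)
    also have "\<dots> = 0" by (simp add: inst q)
    finally show ?thesis using con2_skew[of ?o "\<lambda>a b. Rf q a b i j" "\<lambda>a b. phi0 a b k", OF om_skew[OF q]] by simp
  qed
  show ?thesis using 0 1 2 3 unfolding D(2) con2_def act2_def distrib_right sum.distrib by linarith
qed

text \<open>Differentiate the Ricci equation: the connection terms on the two traced slots cancel by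
  skewness, the others are Ricci traces.\<close>

lemma ricci_nabla: assumes q: "q \<in> W" shows "(\<Sum>a\<in>UNIV. Nf q x a i j a) = 0"
proof -
  let ?o = "om q x"
  define D where "D = dR q"
    have D: "\<And>i j k l. ((\<lambda>q. Rf q i j k l) has_derivative D i j k l) (at q)"
    "\<And>i j k l. D i j k l (E q x) = Nf q x i j k l + (\<Sum>s\<in>UNIV. ?o i s * Rf q s j k l) + (\<Sum>s\<in>UNIV. ?o j s * Rf q i s k l)
       + (\<Sum>s\<in>UNIV. ?o k s * Rf q i j s l) + (\<Sum>s\<in>UNIV. ?o l s * Rf q i j k s)"
    unfolding D_def by (rule dR_der[OF q], rule dR_E[OF q])
  have "((\<lambda>q. \<Sum>a\<in>UNIV. Rf q a i j a) has_derivative (\<lambda>u. \<Sum>a\<in>UNIV. D a i j a u)) (at q)"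
    by (intro has_derivative_sum D(1))
  from const_der[OF q this, of 0 "E q x"] ricci
  have 0: "(\<Sum>a\<in>UNIV. D a i j a (E q x)) = 0" by blast
  have 1: "(\<Sum>a\<in>UNIV. \<Sum>s\<in>UNIV. ?o i s * Rf q a s j a) = 0" "(\<Sum>a\<in>UNIV. \<Sum>s\<in>UNIV. ?o j s * Rf q a i s a) = 0"
    by (subst sum.swap, simp add: sum_distrib_left[symmetric] ricci q)+
  have "(\<Sum>a\<in>UNIV. \<Sum>s\<in>UNIV. ?o a s * Rf q a i j s) = (\<Sum>a\<in>UNIV. \<Sum>s\<in>UNIV. ?o s a * Rf q s i j a)"
    by (rule sum.swap)
  also have "\<dots> = - (\<Sum>a\<in>UNIV. \<Sum>s\<in>UNIV. ?o a s * Rf q s i j a)"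
    by (subst om_skew[OF q]) (simp only: mult_minus_left sum_negf)
  finally show ?thesis using 0 1 unfolding D(2) sum.distrib by linarith
qed

lemma curvature_torsion_zero: assumes q: "q \<in> W" shows "con3 (Rf q b) (Tf q) = 0"
  unfolding con3_def
proof (rule second_bianchi_trace[where N = "Nf q"])
  show "Nf q x i j k l = - Nf q x j i k l" for x i j k l
  proof -
    define D where "D = dR q"
    have D: "\<And>i j k l. ((\<lambda>q. Rf q i j k l) has_derivative D i j k l) (at q)"
      "\<And>i j k l. D i j k l (E q x) = Nf q x i j k l + (\<Sum>s\<in>UNIV. om q x i s * Rf q s j k l) + (\<Sum>s\<in>UNIV. om q x j s * Rf q i s k l)
       + (\<Sum>s\<in>UNIV. om q x k s * Rf q i j s l) + (\<Sum>s\<in>UNIV. om q x l s * Rf q i j k s)"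
      unfolding D_def by (rule dR_der[OF q], rule dR_E[OF q])
    have "D i j k l (E q x) + D j i k l (E q x) = 0"
      by (rule const_der[where c = 0, OF q has_derivative_add[OF D(1)[of i j k l] D(1)[of j i k l]]]) (subst Rf_skew(1), assumption, simp)
    moreover have "(\<Sum>s\<in>UNIV. om q x i s * Rf q s j k l) = - (\<Sum>s\<in>UNIV. om q x i s * Rf q j s k l)"
      "(\<Sum>s\<in>UNIV. om q x j s * Rf q i s k l) = - (\<Sum>s\<in>UNIV. om q x j s * Rf q s i k l)"
      "(\<Sum>s\<in>UNIV. om q x k s * Rf q i j s l) = - (\<Sum>s\<in>UNIV. om q x k s * Rf q j i s l)"
      "(\<Sum>s\<in>UNIV. om q x l s * Rf q i j k s) = - (\<Sum>s\<in>UNIV. om q x l s * Rf q j i k s)"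
      by (subst Rf_skew(1)[OF q], simp only: mult_minus_right sum_negf)+
    ultimately show ?thesis unfolding D(2) by linarith
  qed
  show "Nf q x i j k l = - Nf q x i j l k" for x i j k l
  proof -
    define D where "D = dR q"
    have D: "\<And>i j k l. ((\<lambda>q. Rf q i j k l) has_derivative D i j k l) (at q)"
      "\<And>i j k l. D i j k l (E q x) = Nf q x i j k l + (\<Sum>s\<in>UNIV. om q x i s * Rf q s j k l) + (\<Sum>s\<in>UNIV. om q x j s * Rf q i s k l)
       + (\<Sum>s\<in>UNIV. om q x k s * Rf q i j s l) + (\<Sum>s\<in>UNIV. om q x l s * Rf q i j k s)"
      unfolding D_def by (rule dR_der[OF q], rule dR_E[OF q])
    have "D i j k l (E q x) + D i j l k (E q x) = 0"
      by (rule const_der[where c = 0, OF q has_derivative_add[OF D(1)[of i j k l] D(1)[of i j l k]]]) (subst Rf_skew(2), assumption, simp)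
    moreover have "(\<Sum>s\<in>UNIV. om q x i s * Rf q s j k l) = - (\<Sum>s\<in>UNIV. om q x i s * Rf q s j l k)"
      "(\<Sum>s\<in>UNIV. om q x j s * Rf q i s k l) = - (\<Sum>s\<in>UNIV. om q x j s * Rf q i s l k)"
      "(\<Sum>s\<in>UNIV. om q x k s * Rf q i j s l) = - (\<Sum>s\<in>UNIV. om q x k s * Rf q i j l s)"
      "(\<Sum>s\<in>UNIV. om q x l s * Rf q i j k s) = - (\<Sum>s\<in>UNIV. om q x l s * Rf q i j s k)"
      by (subst Rf_skew(2)[OF q], simp only: mult_minus_right sum_negf)+
    ultimately show ?thesis unfolding D(2) by linarith
  qed
qed (fact ricci_nabla[OF q] Rf_skew[OF q] ricci[OF q] Tf_alt3[OF q] bianchi2_frame[OF q])+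

text \<open>The covariant derivative of \<open>curvature_torsion_zero\<close>: connection terms in
  d, i, j cancel between the factors, and the one in b is that identity once more.\<close>

lemma nabla_curvature_torsion_zero: assumes q: "q \<in> W"
  shows "(\<Sum>d\<in>UNIV. \<Sum>i\<in>UNIV. \<Sum>j\<in>UNIV. Nf q a b d i j * Tf q d i j + Rf q b d i j * nTf q a d i j) = 0"
proof -
  let ?o = "om q a"
  define D where "D = dR q"
    have D: "\<And>i j k l. ((\<lambda>q. Rf q i j k l) has_derivative D i j k l) (at q)"
    "\<And>i j k l. D i j k l (E q a) = Nf q a i j k l + (\<Sum>s\<in>UNIV. ?o i s * Rf q s j k l) + (\<Sum>s\<in>UNIV. ?o j s * Rf q i s k l)
       + (\<Sum>s\<in>UNIV. ?o k s * Rf q i j s l) + (\<Sum>s\<in>UNIV. ?o l s * Rf q i j k s)"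
    unfolding D_def by (rule dR_der[OF q], rule dR_E[OF q])
  define F where "F = dT q"
  have F: "\<And>i j k. ((\<lambda>q. Tf q i j k) has_derivative F i j k) (at q)"
    "\<And>i j k. F i j k (E q a) = nTf q a i j k + act3 ?o (Tf q) i j k"
    unfolding F_def by (rule dT_der[OF q], rule dT_E[OF q])
  have "((\<lambda>q. \<Sum>d\<in>UNIV. \<Sum>i\<in>UNIV. \<Sum>j\<in>UNIV. Rf q b d i j * Tf q d i j) has_derivative
     (\<lambda>u. \<Sum>d\<in>UNIV. \<Sum>i\<in>UNIV. \<Sum>j\<in>UNIV. Rf q b d i j * F d i j u + D b d i j u * Tf q d i j)) (at q)"
    by (intro has_derivative_sum has_derivative_mult D(1) F(1))
  from const_der[OF q this, of 0 "E q a"] curvature_torsion_zero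
  have 0: "(\<Sum>d\<in>UNIV. \<Sum>i\<in>UNIV. \<Sum>j\<in>UNIV. Rf q b d i j * F d i j (E q a) + D b d i j (E q a) * Tf q d i j) = 0"
    unfolding con3_def by blast
  have "D b d i j (E q a) = Nf q a b d i j + act3 ?o (Rf q b) d i j + (\<Sum>s\<in>UNIV. ?o b s * Rf q s d i j)" for d i j
    unfolding D(2) act3_def by simp
  moreover have "(\<Sum>d\<in>UNIV. \<Sum>i\<in>UNIV. \<Sum>j\<in>UNIV. (\<Sum>s\<in>UNIV. ?o b s * Rf q s d i j) * Tf q d i j) = 0"
  proof -
    have "(\<Sum>d\<in>UNIV. \<Sum>i\<in>UNIV. \<Sum>j\<in>UNIV. (\<Sum>s\<in>UNIV. ?o b s * Rf q s d i j) * Tf q d i j)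
       = (\<Sum>s\<in>UNIV. ?o b s * con3 (Rf q s) (Tf q))"
      unfolding con3_def by (simp only: sum_distrib_left sum_distrib_right mult.assoc, subst sum_rot4[symmetric], rule refl)
    then show ?thesis by (simp add: curvature_torsion_zero q)
  qed
  moreover have "con3 (act3 ?o (Rf q b)) (Tf q) + con3 (Rf q b) (act3 ?o (Tf q)) = 0"
    by (rule con3_skew[OF om_skew[OF q]])
  ultimately show ?thesis using 0 unfolding F(2) con3_def by (simp add: distrib_left distrib_right sum.distrib)
qed

lemma nabla_torsion_sigma: assumes q: "q \<in> W" shows "nTf q l i j k = sig (Tf q) i j k l / 3"
proof (rule nabla_torsion_eq(1)[where R = "Rf q"])
  have n12: "Nf q x i j k l = - Nf q x j i k l" for x i j k l
  proof -
    have r: "Rm q v u w = - Rm q u v w" "dRm q x v u w = - dRm q x u v w" for u v w x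
      by (simp_all add: Rm_def dRm_def)
    show ?thesis
      unfolding Nf_def N_def r(1)[of "E q j" "E q i"] r(2)[of _ "E q j" "E q i"] r(1)[of "\<Gamma> q (E q x) (E q j)" "E q i"]
        r(1)[of "E q j" "\<Gamma> q (E q x) (E q i)"] linear_neg[OF Gamma_linear(1)[OF q]]
      by (simp add: g_lin q)
  qed
  show "(\<Sum>a\<in>UNIV. \<Sum>d\<in>UNIV. \<Sum>i\<in>UNIV. \<Sum>j\<in>UNIV. Rf q a d i j * nTf q a d i j) = 0"
    by (rule curvature_nabla_torsion_orthogonal[OF n12 instanton_nabla[OF q] Rf_skew(1)[OF q] inst[OF q] Tf_alt3[OF q] bianchi2_frame[OF q]
         curvature_torsion_zero[OF q, unfolded con3_def] nabla_curvature_torsion_zero[OF q]])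
  \<comment> \<open>One g_2 factor of R is the instanton condition, the other comes from
    \<nabla>\<phi> = 0.\<close>
  show "Rf q i j k l + Rf q j k i l + Rf q k i j l + Rf q k l i j + Rf q i l j k + Rf q j l k i = 0" for i j k l
    by (rule curvature_alt_zero[OF Rf_skew[OF q] g2_psi_of_contr[OF inst[OF q] Rf_skew(1)[OF q]]
         g2_psi_of_inv[OF Rf_g2[OF q] Rf_skew(2)[OF q]] ricci[OF q]])
qed (fact Rf_skew[OF q] Tf_alt3[OF q] nTf_alt3[OF q] bianchi1_frame[OF q])+

text \<open>The contraction of T with \<phi> is the constant K and \<phi> is parallel, so \<nabla>T,
  which is \<sigma>/3, contracts with \<phi> to zero.\<close>

lemma sigma_phi_zero: assumes q: "q \<in> W" shows "(\<Sum>i\<in>UNIV. \<Sum>j\<in>UNIV. \<Sum>k\<in>UNIV. sig (Tf q) i j k l * phi0 i j k) = 0"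
proof -
  let ?o = "om q l"
  define F where "F = dT q"
  have F: "\<And>i j k. ((\<lambda>q. Tf q i j k) has_derivative F i j k) (at q)"
    "\<And>i j k. F i j k (E q l) = nTf q l i j k + act3 ?o (Tf q) i j k"
    unfolding F_def by (rule dT_der[OF q], rule dT_E[OF q])
  have "((\<lambda>q. con3 (Tf q) phi0) has_derivative (\<lambda>u. \<Sum>i\<in>UNIV. \<Sum>j\<in>UNIV. \<Sum>k\<in>UNIV. F i j k u * phi0 i j k)) (at q)"
    unfolding con3_def by (intro has_derivative_sum has_derivative_mult_left F(1))
  from const_der[OF q this const, of "E q l"]
  have "(\<Sum>i\<in>UNIV. \<Sum>j\<in>UNIV. \<Sum>k\<in>UNIV. nTf q l i j k * phi0 i j k) + con3 (act3 ?o (Tf q)) phi0 = 0"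
    by (simp add: F(2) con3_def distrib_right sum.distrib)
  moreover have "con3 (act3 ?o (Tf q)) phi0 = 0"
    using con3_skew[of ?o "Tf q" phi0, OF om_skew[OF q]] by (simp add: con3_def om_phi0[OF q])
  ultimately have "(\<Sum>i\<in>UNIV. \<Sum>j\<in>UNIV. \<Sum>k\<in>UNIV. sig (Tf q) i j k l / 3 * phi0 i j k) = 0"
    unfolding nabla_torsion_sigma[OF q] by simp
  then show ?thesis by (simp add: sum_divide_distrib[symmetric])
qed

text \<open>The covariant derivative of \<open>sigma_phi_zero\<close>. By \<open>sig2_act3\<close>
  the connection terms act on \<sigma>; those in i, j, k drop out as \<phi> is invariant, and the
  one in l is \<open>sigma_phi_zero\<close> itself.\<close>

lemma nabla_sigma_phi_zero: assumes q: "q \<in> W"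
  shows "(\<Sum>i\<in>UNIV. \<Sum>j\<in>UNIV. \<Sum>k\<in>UNIV. (sig2 (nTf q a) (Tf q) i j k l + sig2 (Tf q) (nTf q a) i j k l) * phi0 i j k) = 0"
proof -
  let ?o = "om q a"
  define F where "F = dT q"
  have F: "\<And>i j k. ((\<lambda>q. Tf q i j k) has_derivative F i j k) (at q)"
    "\<And>i j k. F i j k (E q a) = nTf q a i j k + act3 ?o (Tf q) i j k"
    unfolding F_def by (rule dT_der[OF q], rule dT_E[OF q])
  have "((\<lambda>q. sig (Tf q) i j k l) has_derivative (\<lambda>u. sig2 (\<lambda>i j k. F i j k u) (Tf q) i j k l + sig2 (Tf q) (\<lambda>i j k. F i j k u) i j k l)) (at q)" for i j k
  proof -
    have "((\<lambda>q. \<Sum>s\<in>UNIV. Tf q i j s * Tf q s k l + Tf q j k s * Tf q s i l + Tf q k i s * Tf q s j l) has_derivative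
       (\<lambda>u. \<Sum>s\<in>UNIV. (Tf q i j s * F s k l u + F i j s u * Tf q s k l) + (Tf q j k s * F s i l u + F j k s u * Tf q s i l)
          + (Tf q k i s * F s j l u + F k i s u * Tf q s j l))) (at q)"
      by (intro has_derivative_sum has_derivative_add has_derivative_mult F(1))
    moreover have "(\<Sum>s\<in>UNIV. (Tf q i j s * F s k l u + F i j s u * Tf q s k l) + (Tf q j k s * F s i l u + F j k s u * Tf q s i l)
          + (Tf q k i s * F s j l u + F k i s u * Tf q s j l))
       = sig2 (\<lambda>i j k. F i j k u) (Tf q) i j k l + sig2 (Tf q) (\<lambda>i j k. F i j k u) i j k l" for u
      unfolding sig2_def sum.distrib[symmetric] by (intro sum.cong refl) (simp add: algebra_simps)
    ultimately show ?thesis unfolding sig_def by simp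
  qed
  then have "((\<lambda>q. \<Sum>i\<in>UNIV. \<Sum>j\<in>UNIV. \<Sum>k\<in>UNIV. sig (Tf q) i j k l * phi0 i j k) has_derivative
     (\<lambda>u. \<Sum>i\<in>UNIV. \<Sum>j\<in>UNIV. \<Sum>k\<in>UNIV. (sig2 (\<lambda>i j k. F i j k u) (Tf q) i j k l + sig2 (Tf q) (\<lambda>i j k. F i j k u) i j k l) * phi0 i j k)) (at q)"
    by (intro has_derivative_sum has_derivative_mult_left)
  from const_der[OF q this, of 0 "E q a"] sigma_phi_zero
  have 0: "(\<Sum>i\<in>UNIV. \<Sum>j\<in>UNIV. \<Sum>k\<in>UNIV. (sig2 (\<lambda>i j k. F i j k (E q a)) (Tf q) i j k l + sig2 (Tf q) (\<lambda>i j k. F i j k (E q a)) i j k l) * phi0 i j k) = 0"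
    by blast
  have "sig2 (\<lambda>i j k. F i j k (E q a)) (Tf q) i j k l + sig2 (Tf q) (\<lambda>i j k. F i j k (E q a)) i j k l
     = (sig2 (nTf q a) (Tf q) i j k l + sig2 (Tf q) (nTf q a) i j k l)
       + (sig2 (act3 ?o (Tf q)) (Tf q) i j k l + sig2 (Tf q) (act3 ?o (Tf q)) i j k l)" for i j k
    unfolding F(2) sig2_def by (simp add: distrib_left distrib_right sum.distrib)
  moreover have "(\<Sum>i\<in>UNIV. \<Sum>j\<in>UNIV. \<Sum>k\<in>UNIV. (sig2 (act3 ?o (Tf q)) (Tf q) i j k l + sig2 (Tf q) (act3 ?o (Tf q)) i j k l) * phi0 i j k) = 0"
  proof -
    have "(\<Sum>i\<in>UNIV. \<Sum>j\<in>UNIV. \<Sum>k\<in>UNIV. (\<Sum>m\<in>UNIV. ?o l m * sig (Tf q) i j k m) * phi0 i j k)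
       = (\<Sum>m\<in>UNIV. ?o l m * (\<Sum>i\<in>UNIV. \<Sum>j\<in>UNIV. \<Sum>k\<in>UNIV. sig (Tf q) i j k m * phi0 i j k))"
      by (simp only: sum_distrib_left sum_distrib_right mult.assoc, subst sum_rot4[symmetric], rule refl)
    moreover have "con3 (act3 ?o (\<lambda>i j k. sig (Tf q) i j k l)) phi0 = 0"
      using con3_skew[of ?o "\<lambda>i j k. sig (Tf q) i j k l" phi0, OF om_skew[OF q]] by (simp add: con3_def om_phi0[OF q])
    ultimately show ?thesis
      unfolding sig2_act3[OF om_skew[OF q]] con3_def distrib_right sum.distrib by (simp add: sigma_phi_zero q)
  qed
  ultimately show ?thesis using 0 by (simp only: distrib_right[of "sig2 (nTf q a) _ _ _ _ _ + _"] sum.distrib)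
qed

lemma sig_Tf: "q \<in> W \<Longrightarrow> sig (Tf q) i j k l = 0"
  by (rule sig_zero[OF Tf_alt3 nTf_alt3 nabla_torsion_sigma sigma_phi_zero nabla_sigma_phi_zero])

lemma nTf_zero: "q \<in> W \<Longrightarrow> nTf q a i j k = 0"
  by (simp add: nabla_torsion_sigma sig_Tf)

end

section \<open>Translating hypotheses and conclusions into frame components\<close>

lemma zero_on_frame3:
  fixes h :: "vec7 \<Rightarrow> vec7 \<Rightarrow> vec7 \<Rightarrow> real"
  assumes d: "dual_frames e E"
    and l: "\<And>y z. linear (\<lambda>x. h x y z)" "\<And>x z. linear (\<lambda>y. h x y z)" "\<And>x y. linear (\<lambda>z. h x y z)"
    and z: "\<And>i j k. h (E i) (E j) (E k) = 0"
  shows "h x y z = 0"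
proof -
  have x: "v = (\<Sum>i\<in>UNIV. e i v *\<^sub>R E i)" for v using d unfolding dual_frames_def by blast
  have 1: "h (E i) (E j) z = 0" for i j z
    by (subst x[of z]) (simp add: linear_sum[OF l(3)] linear_cmul[OF l(3)] assms(5))
  have 2: "h (E i) y z = 0" for i y z
    by (subst x[of y]) (simp add: linear_sum[OF l(2)] linear_cmul[OF l(2)] 1)
  show ?thesis
    by (subst x[of x]) (simp add: linear_sum[OF l(1)] linear_cmul[OF l(1)] 2)
qed

lemma zero_on_frame4:
  fixes h :: "vec7 \<Rightarrow> vec7 \<Rightarrow> vec7 \<Rightarrow> vec7 \<Rightarrow> real"
  assumes d: "dual_frames e E"
    and l: "\<And>y z w. linear (\<lambda>x. h x y z w)" "\<And>x z w. linear (\<lambda>y. h x y z w)" "\<And>x y w. linear (\<lambda>z. h x y z w)"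
      "\<And>x y z. linear (\<lambda>w. h x y z w)"
    and z: "\<And>i j k m. h (E i) (E j) (E k) (E m) = 0"
  shows "h x y z w = 0"
proof -
  have x: "v = (\<Sum>i\<in>UNIV. e i v *\<^sub>R E i)" for v using d unfolding dual_frames_def by blast
  have "h (E i) y z w = 0" for i y z w
    by (rule zero_on_frame3[OF d l(2,3,4) z])
  then show ?thesis by (subst x[of x]) (simp add: linear_sum[OF l(1)] linear_cmul[OF l(1)])
qed

text \<open>Both sides are alternating, so the 35 components with increasing indices decide. The
  factor 6 counts the orderings of the three contracted indices.\<close>

lemma star_phi0: "S3 (\<lambda>i j k. eps [i, j, k, a, b, c, d]) = 6 * psi0 a b c d"
  if D: "dual_frames e E"
proof -
  have s12: "eps [i, j, k, a, b, c, d] = - eps [j, i, k, a, b, c, d]" for i j k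
    using eps_swap[OF D, of "[]" "[k, a, b, c, d]" i j] by simp
  have s23: "eps [i, j, k, a, b, c, d] = - eps [i, k, j, a, b, c, d]" for i j k
    using eps_swap[OF D, of "[i]" "[a, b, c, d]" j k] by simp
  have "alt3 (\<lambda>i j k. eps [i, j, k, a, b, c, d])"
    unfolding alt3_def by (intro allI conjI s12 s23)
  note 1 = phi0_sum_alt3[OF this]
  define Q where "Q a b c d = eps [I1, I2, I7, a, b, c, d] + eps [I1, I3, I5, a, b, c, d] - eps [I1, I4, I6, a, b, c, d]
     - eps [I2, I3, I6, a, b, c, d] - eps [I2, I4, I5, a, b, c, d] + eps [I3, I4, I7, a, b, c, d] + eps [I5, I6, I7, a, b, c, d]" for a b c d
  have e45: "eps [i, j, k, a, b, c, d] = - eps [i, j, k, b, a, c, d]" for i j k a b c d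
    using eps_swap[OF D, of "[i, j, k]" "[c, d]" a b] by simp
  have e56: "eps [i, j, k, a, b, c, d] = - eps [i, j, k, a, c, b, d]" for i j k a b c d
    using eps_swap[OF D, of "[i, j, k, a]" "[d]" b c] by simp
  have e67: "eps [i, j, k, a, b, c, d] = - eps [i, j, k, a, b, d, c]" for i j k a b c d
    using eps_swap[OF D, of "[i, j, k, a, b]" "[]" c d] by simp
  define \<alpha> where "\<alpha> a b c d = Q a b c d - psi0 a b c d" for a b c d
  have s: "\<alpha> a b c d = - \<alpha> b a c d" "\<alpha> a b c d = - \<alpha> a c b d" "\<alpha> a b c d = - \<alpha> a b d c" for a b c d
    unfolding \<alpha>_def Q_def using e45[of _ _ _ a b c d] e56[of _ _ _ a b c d] e67[of _ _ _ a b c d]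
      psi0_swap12[of a b c d] psi0_swap23[of a b c d] psi0_swap34[of a b c d] by simp_all
  have o: "\<alpha> i i k l = 0" "\<alpha> k i i l = 0" "\<alpha> k l i i = 0" "ix j < ix i \<Longrightarrow> \<alpha> i j k l = - \<alpha> j i k l"
     "ix k < ix j \<Longrightarrow> \<alpha> i j k l = - \<alpha> i k j l" "ix l < ix k \<Longrightarrow> \<alpha> i j k l = - \<alpha> i j l k" for i j k l
    using s(1)[of i i k l] s(2)[of k i i l] s(3)[of k l i i] s(1)[of i j k l] s(2)[of i j k l] s(3)[of i j k l] by simp_all
  have z: "\<alpha> I1 I2 I3 I4 = 0" "\<alpha> I1 I2 I3 I5 = 0" "\<alpha> I1 I2 I3 I6 = 0" "\<alpha> I1 I2 I3 I7 = 0" "\<alpha> I1 I2 I4 I5 = 0" "\<alpha> I1 I2 I4 I6 = 0" "\<alpha> I1 I2 I4 I7 = 0" "\<alpha> I1 I2 I5 I6 = 0" "\<alpha> I1 I2 I5 I7 = 0" "\<alpha> I1 I2 I6 I7 = 0" "\<alpha> I1 I3 I4 I5 = 0" "\<alpha> I1 I3 I4 I6 = 0" "\<alpha> I1 I3 I4 I7 = 0" "\<alpha> I1 I3 I5 I6 = 0" "\<alpha> I1 I3 I5 I7 = 0" "\<alpha> I1 I3 I6 I7 = 0" "\<alpha> I1 I4 I5 I6 = 0" "\<alpha> I1 I4 I5 I7 = 0" "\<alpha> I1 I4 I6 I7 = 0" "\<alpha> I1 I5 I6 I7 = 0" "\<alpha> I2 I3 I4 I5 = 0" "\<alpha> I2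 I3 I4 I6 = 0" "\<alpha> I2 I3 I4 I7 = 0" "\<alpha> I2 I3 I5 I6 = 0" "\<alpha> I2 I3 I5 I7 = 0" "\<alpha> I2 I3 I6 I7 = 0" "\<alpha> I2 I4 I5 I6 = 0" "\<alpha> I2 I4 I5 I7 = 0" "\<alpha> I2 I4 I6 I7 = 0" "\<alpha> I2 I5 I6 I7 = 0" "\<alpha> I3 I4 I5 I6 = 0" "\<alpha> I3 I4 I5 I7 = 0" "\<alpha> I3 I4 I6 I7 = 0" "\<alpha> I3 I5 I6 I7 = 0" "\<alpha> I4 I5 I6 I7 = 0"
    by (simp_all add: \<alpha>_def Q_def psi0_explicit dl_def eps_def)
  have "\<alpha> a b c d = 0"
    by (cases a; cases b; cases c; cases d; simp add: o z)
  then show ?thesis using 1 unfolding S3_def \<alpha>_def Q_def by simp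
qed

definition psi_pairing :: "(i7 \<Rightarrow> i7 \<Rightarrow> i7 \<Rightarrow> i7 \<Rightarrow> real) \<Rightarrow> real" where
  "psi_pairing f = (\<Sum>a\<in>UNIV. \<Sum>b\<in>UNIV. \<Sum>c\<in>UNIV. \<Sum>d\<in>UNIV. f a b c d * psi0 a b c d)"

lemma psi_pairing_swap12: "psi_pairing (\<lambda>a b c d. f b a c d) = - psi_pairing f"
proof -
  have "psi_pairing (\<lambda>a b c d. f b a c d) = (\<Sum>a\<in>UNIV. \<Sum>b\<in>UNIV. \<Sum>c\<in>UNIV. \<Sum>d\<in>UNIV. f a b c d * psi0 b a c d)"
    unfolding psi_pairing_def by (rule sum.swap)
  then show ?thesis unfolding psi_pairing_def by (subst (asm) psi0_swap12) (simp add: sum_negf)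
qed

lemma psi_pairing_swap23: "psi_pairing (\<lambda>a b c d. f a c b d) = - psi_pairing f"
proof -
  have "psi_pairing (\<lambda>a b c d. f a c b d) = (\<Sum>a\<in>UNIV. \<Sum>b\<in>UNIV. \<Sum>c\<in>UNIV. \<Sum>d\<in>UNIV. f a b c d * psi0 a c b d)"
    unfolding psi_pairing_def by (rule sum.cong[OF refl], rule sum.swap)
  then show ?thesis unfolding psi_pairing_def by (subst (asm) psi0_swap23) (simp add: sum_negf)
qed

lemma psi_pairing_swap34: "psi_pairing (\<lambda>a b c d. f a b d c) = - psi_pairing f"
proof -
  have "psi_pairing (\<lambda>a b c d. f a b d c) = (\<Sum>a\<in>UNIV. \<Sum>b\<in>UNIV. \<Sum>c\<in>UNIV. \<Sum>d\<in>UNIV. f a b c d * psi0 a b d c)"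
    unfolding psi_pairing_def by (rule sum.cong[OF refl], rule sum.cong[OF refl], rule sum.swap)
  then show ?thesis unfolding psi_pairing_def by (subst (asm) psi0_swap34) (simp add: sum_negf)
qed

text \<open>By total antisymmetry of \<open>psi0\<close>, reordering the indices makes all six terms
  equal.\<close>

lemma psi_pairing_torsion:
  "psi_pairing (\<lambda>a b c d. f a b c d - f a c b d + f a d b c + f b c a d - f b d a c + f c d a b) = 6 * psi_pairing f"
proof -
  have 1: "psi_pairing (\<lambda>a b c d. f a c b d) = - psi_pairing f" by (rule psi_pairing_swap23)
  have 2: "psi_pairing (\<lambda>a b c d. f a d b c) = psi_pairing f" using psi_pairing_swap34[of "\<lambda>a b c d. f a c b d"] 1 by simp
  have 3: "psi_pairing (\<lambda>a b c d. f b c a d) = psi_pairing f" using psi_pairing_swap12[of "\<lambda>a b c d. f a c b d"] 1 by simp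
  have 4: "psi_pairing (\<lambda>a b c d. f b d a c) = - psi_pairing f" using psi_pairing_swap12[of "\<lambda>a b c d. f a d b c"] 2 by simp
  have 5: "psi_pairing (\<lambda>a b c d. f c d a b) = psi_pairing f" using psi_pairing_swap23[of "\<lambda>a b c d. f b d a c"] 4 by simp
  have "psi_pairing (\<lambda>a b c d. f a b c d - f a c b d + f a d b c + f b c a d - f b d a c + f c d a b)
    = psi_pairing f - psi_pairing (\<lambda>a b c d. f a c b d) + psi_pairing (\<lambda>a b c d. f a d b c) + psi_pairing (\<lambda>a b c d. f b c a d) - psi_pairing (\<lambda>a b c d. f b d a c) + psi_pairing (\<lambda>a b c d. f c d a b)"
    unfolding psi_pairing_def by (simp only: left_diff_distrib distrib_right sum.distrib sum_subtractf)
  then show ?thesis unfolding 1 2 3 4 5 by simp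
qed

lemma length_3: "length vs = 3 \<Longrightarrow> \<exists>a b c. vs = [a, b, c]"
  and length_4: "length vs = 4 \<Longrightarrow> \<exists>a b c d. vs = [a, b, c, d]"
  and length_5: "length vs = 5 \<Longrightarrow> \<exists>a b c d e. vs = [a, b, c, d, e]"
  by (auto simp: eval_nat_numeral length_Suc_conv)

lemma ext_deriv_3: "ext_deriv \<omega> p [a, b, c, d] = frechet_derivative (\<lambda>q. \<omega> q [b, c, d]) (at p) a
   - frechet_derivative (\<lambda>q. \<omega> q [a, c, d]) (at p) b + frechet_derivative (\<lambda>q. \<omega> q [a, b, d]) (at p) c
   - frechet_derivative (\<lambda>q. \<omega> q [a, b, c]) (at p) d"
  by (simp add: ext_deriv_def eval_nat_numeral lessThan_Suc)

lemma ext_deriv_4: "ext_deriv \<omega> p [a, b, c, d, e] = frechet_derivative (\<lambda>q. \<omega> q [b, c, d, e]) (at p) a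
   - frechet_derivative (\<lambda>q. \<omega> q [a, c, d, e]) (at p) b + frechet_derivative (\<lambda>q. \<omega> q [a, b, d, e]) (at p) c
   - frechet_derivative (\<lambda>q. \<omega> q [a, b, c, e]) (at p) d + frechet_derivative (\<lambda>q. \<omega> q [a, b, c, d]) (at p) e"
  by (simp add: ext_deriv_def eval_nat_numeral lessThan_Suc)

context g2_region
begin

lemma G2_frame_frame: "q \<in> W \<Longrightarrow> adapted_frame (\<phi> q) (\<lambda>i. G2_coframe (\<phi> q) (ix i)) (\<lambda>i. G2_frame (\<phi> q) (ix i))"
  using G2_frame_adapted adapted by blast

lemma G2_frame_dual: "q \<in> W \<Longrightarrow> dual_frames (\<lambda>i. G2_coframe (\<phi> q) (ix i)) (\<lambda>i. G2_frame (\<phi> q) (ix i))"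
  using G2_frame_frame unfolding adapted_frame_def by blast

lemma contraction:
  fixes f :: "vec7 \<Rightarrow> vec7 \<Rightarrow> real"
  assumes q: "q \<in> W" and l: "\<And>y. linear (\<lambda>x. f x y)" "\<And>x. linear (f x)"
  shows "(\<Sum>a\<in>UNIV. f (G2_frame (\<phi> q) (ix a)) (G2_frame (\<phi> q) (ix a))) = (\<Sum>a\<in>UNIV. f (E q a) (E q a))"
  by (rule frame_contraction[OF frame_dual[OF q] G2_frame_dual[OF q] adapted_frame_unique(1)[OF frame[OF q] G2_frame_frame[OF q]] l])

lemma curvature_tensor_R: "q \<in> W \<Longrightarrow> curvature_tensor \<phi> \<Gamma> q x y z v = R q x y z v"
  by (simp add: curvature_tensor_def Rm_curvature R_def)

lemma ricci_frame: "q \<in> W \<Longrightarrow> Defs.ricci \<phi> \<Gamma> q x y = (\<Sum>a\<in>UNIV. R q (E q a) x y (E q a))"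
  unfolding Defs.ricci_def Let_def sum_ix curvature_tensor_R
  by (rule contraction) (auto intro: R_linear)

text \<open>The summed indices change frame by orthogonality, the free ones by
  multilinearity.\<close>

lemma instanton_frame:
  assumes q: "q \<in> W"
    and raw: "\<And>i j k. i \<in> {1..7} \<Longrightarrow> j \<in> {1..7} \<Longrightarrow> k \<in> {1..7} \<Longrightarrow> (\<Sum>a = 1..7. \<Sum>b = 1..7.
      curvature_tensor \<phi> \<Gamma> q (G2_frame (\<phi> q) a) (G2_frame (\<phi> q) b) (G2_frame (\<phi> q) i) (G2_frame (\<phi> q) j)
        * \<phi> q [G2_frame (\<phi> q) a, G2_frame (\<phi> q) b, G2_frame (\<phi> q) k]) = 0"
  shows "(\<Sum>a\<in>UNIV. \<Sum>b\<in>UNIV. Rf q a b i j * phi0 a b k) = 0"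
proof -
  define F where "F a = G2_frame (\<phi> q) (ix a)" for a
  note l = R_linear[OF q, THEN linear_add] R_linear[OF q, THEN linear_cmul] phi_linear[OF q, THEN linear_add] phi_linear[OF q, THEN linear_cmul]
  have "(\<Sum>a\<in>UNIV. \<Sum>b\<in>UNIV. R q (F a) (F b) x y * \<phi> q [F a, F b, z]) = 0" for x y z
  proof (rule zero_on_frame3[OF G2_frame_dual[OF q], where h = "\<lambda>x y z. \<Sum>a\<in>UNIV. \<Sum>b\<in>UNIV. R q (F a) (F b) x y * \<phi> q [F a, F b, z]"])
    show "(\<Sum>a\<in>UNIV. \<Sum>b\<in>UNIV. R q (F a) (F b) (G2_frame (\<phi> q) (ix i)) (G2_frame (\<phi> q) (ix j)) * \<phi> q [F a, F b, G2_frame (\<phi> q) (ix k)]) = 0" for i j k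
      using raw[OF ix_range[of i] ix_range[of j] ix_range[of k]] unfolding sum_ix curvature_tensor_R[OF q] F_def .
  qed (auto intro!: linearI simp: l algebra_simps sum.distrib sum_distrib_left)
  moreover have "(\<Sum>b\<in>UNIV. R q x' (F b) x y * \<phi> q [x'', F b, z]) = (\<Sum>b\<in>UNIV. R q x' (E q b) x y * \<phi> q [x'', E q b, z])" for x y z x' x''
    unfolding F_def by (rule contraction[OF q, where f = "\<lambda>u v. R q x' u x y * \<phi> q [x'', v, z]"])
      (auto intro!: linearI simp: l algebra_simps)
  moreover have "(\<Sum>a\<in>UNIV. \<Sum>b\<in>UNIV. R q (F a) (E q b) x y * \<phi> q [F a, E q b, z]) = (\<Sum>a\<in>UNIV. \<Sum>b\<in>UNIV. R q (E q a) (E q b) x y * \<phi> q [E q a, E q b, z])" for x y z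
    unfolding F_def by (rule contraction[OF q, where f = "\<lambda>u v. \<Sum>b\<in>UNIV. R q u (E q b) x y * \<phi> q [v, E q b, z]"])
      (auto intro!: linearI simp: l algebra_simps sum.distrib sum_distrib_left)
  ultimately have "(\<Sum>a\<in>UNIV. \<Sum>b\<in>UNIV. R q (E q a) (E q b) (E q i) (E q j) * \<phi> q [E q a, E q b, E q k]) = 0" by simp
  then show ?thesis by (simp add: Rf_def phi_E q)
qed

text \<open>As \<phi> is parallel, each partial derivative is a sum of three \<Gamma> terms;
  alternation keeps only the skew part of \<Gamma>, the torsion.\<close>

lemma ext_deriv_phi:
  assumes q: "q \<in> W"
  shows "ext_deriv \<phi> q [a, b, c, d] = \<phi> q [tau q a b, c, d] - \<phi> q [tau q a c, b, d] + \<phi> q [tau q a d, b, c]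
    + \<phi> q [tau q b c, a, d] - \<phi> q [tau q b d, a, c] + \<phi> q [tau q c d, a, b]"
proof -
  have p: "\<phi> q [x, y, z] = - \<phi> q [y, x, z]" "\<phi> q [x, y, z] = - \<phi> q [x, z, y]" for x y z
  proof -
    have z: "phi0 i j k + phi0 j i k = 0" "phi0 i j k + phi0 i k j = 0" for i j k
      using phi0_swap12[of i j k] phi0_swap23[of i j k] by simp_all
    have "\<phi> q [x, y, z] + \<phi> q [y, x, z] = 0"
      by (rule zero_on_frame3[OF frame_dual[OF q], where h = "\<lambda>x y z. \<phi> q [x, y, z] + \<phi> q [y, x, z]"])
         (auto intro!: linear_compose_add phi_linear q simp: phi_E q z)
    then show "\<phi> q [x, y, z] = - \<phi> q [y, x, z]" by simp
    have "\<phi> q [x, y, z] + \<phi> q [x, z, y] = 0"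
      by (rule zero_on_frame3[OF frame_dual[OF q], where h = "\<lambda>x y z. \<phi> q [x, y, z] + \<phi> q [x, z, y]"])
         (auto intro!: linear_compose_add phi_linear q simp: phi_E q z)
    then show "\<phi> q [x, y, z] = - \<phi> q [x, z, y]" by simp
  qed
  have D: "frechet_derivative (\<lambda>q. \<phi> q [x, y, z]) (at q) u = \<phi> q [\<Gamma> q u x, y, z] + \<phi> q [x, \<Gamma> q u y, z] + \<phi> q [x, y, \<Gamma> q u z]" for x y z u
    unfolding frechet_derivative_at[OF phi_der[OF q, of x y z], symmetric] ..
  have c: "\<phi> q [x, \<Gamma> q u y, z] = - \<phi> q [\<Gamma> q u y, x, z]" "\<phi> q [x, y, \<Gamma> q u z] = \<phi> q [\<Gamma> q u z, x, y]" for x y z u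
    using p(1)[of x "\<Gamma> q u y" z] p(2)[of x y "\<Gamma> q u z"] p(1)[of x "\<Gamma> q u z" y] by simp_all
  show ?thesis unfolding ext_deriv_3 D c tau_def
    by (simp add: linear_diff[OF phi_linear(1)[OF q]])
qed

text \<open>The constants cancel: 1/4! from the inner product of 4-forms, 6 equal terms, and 4 from
  \<open>psi0_phi0_contr\<close>.\<close>

lemma constant_frame:
  assumes q: "q \<in> W"
  shows "form_inner (\<phi> q) 4 (ext_deriv \<phi> q) (hodge (\<phi> q) 3 (\<phi> q)) = con3 (Tf q) phi0"
proof -
  define f where "f i = G2_coframe (\<phi> q) (ix i)" for i
  define F where "F i = G2_frame (\<phi> q) (ix i)" for i
  have A: "adapted_frame (\<phi> q) f F" using G2_frame_frame[OF q] unfolding f_def F_def .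
  have dF: "dual_frames f F" using A unfolding adapted_frame_def by blast
  then have lin: "linear (f i)" and dd: "f i (F j) = dl i j" for i j by (auto simp: dual_frames_def)
  have pF: "\<phi> q [F a, F b, F c] = phi0 a b c" for a b c by (rule adapted_frame_phi0[OF A])
  have st: "hodge (\<phi> q) 3 (\<phi> q) [F a, F b, F c, F d] = psi0 a b c d" for a b c d
  proof -
    have "alternating 3 (\<phi> q)" unfolding alternating_def multilinear_def
    proof (intro conjI allI impI)
      fix vs :: "vec7 list" and i :: nat assume "length vs = 3" "i < 3"
      then obtain x y z where "vs = [x, y, z]" "i = 0 \<or> i = 1 \<or> i = 2"
        using length_3[of vs] by fastforce
      then show "linear (\<lambda>x. \<phi> q (vs[i := x]))" using phi_linear[OF q] by auto
    next
      have z: "phi0 i j k + phi0 j i k = 0" "phi0 i j k + phi0 i k j = 0" "phi0 i j k + phi0 k j i = 0" for i j k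
        using phi0_swap12[of i j k] phi0_swap23[of i j k] phi0_cycle[of k j i] phi0_swap23[of j i k] phi0_swap12[of j i k] by simp_all
      have "\<phi> q [x, y, z] + \<phi> q [y, x, z] = 0" for x y z
        by (rule zero_on_frame3[OF frame_dual[OF q], where h = "\<lambda>x y z. \<phi> q [x, y, z] + \<phi> q [y, x, z]"])
           (auto intro!: linear_compose_add phi_linear q simp: phi_E q z)
      from this[of x x for x] have 1: "\<phi> q [x, x, z] = 0" for x z by simp
      have "\<phi> q [x, y, z] + \<phi> q [x, z, y] = 0" for x y z
        by (rule zero_on_frame3[OF frame_dual[OF q], where h = "\<lambda>x y z. \<phi> q [x, y, z] + \<phi> q [x, z, y]"])
           (auto intro!: linear_compose_add phi_linear q simp: phi_E q z)
      from this[of _ x x for x] have 2: "\<phi> q [z, x, x] = 0" for x z by simp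
      have "\<phi> q [x, y, z] + \<phi> q [z, y, x] = 0" for x y z
        by (rule zero_on_frame3[OF frame_dual[OF q], where h = "\<lambda>x y z. \<phi> q [x, y, z] + \<phi> q [z, y, x]"])
           (auto intro!: linear_compose_add phi_linear q simp: phi_E q z)
      from this[of x _ x for x] have 3: "\<phi> q [x, z, x] = 0" for x z by simp
      fix vs :: "vec7 list" and i j :: nat assume "length vs = 3" "i < j" "j < 3" "vs ! i = vs ! j"
      then obtain x y z where "vs = [x, y, z]" "i = 0 \<and> j = 1 \<or> i = 0 \<and> j = 2 \<or> i = 1 \<and> j = 2"
        using length_3[of vs] by fastforce
      then show "\<phi> q vs = 0" using \<open>vs ! i = vs ! j\<close> 1 2 3 by auto
    qed
    from hodge_3_frame[OF A ex_coframe[OF q] this, of "[F a, F b, F c, F d]"]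
    have "hodge (\<phi> q) 3 (\<phi> q) [F a, F b, F c, F d] = 1 / 6 * S3 (\<lambda>i j k. wedge_covectors (map f L7) (map F [i, j, k, a, b, c, d]))"
      unfolding S3_def by (simp add: pF)
    also have "\<dots> = 1 / 6 * S3 (\<lambda>i j k. eps [i, j, k, a, b, c, d])"
      by (subst wedge_covectors_eps(1)[OF dd lin]) auto
    finally show ?thesis using star_phi0[OF dF] by simp
  qed
  have tF: "tau q (F a) (F b) = (\<Sum>s\<in>UNIV. T q (F a) (F b) (F s) *\<^sub>R F s)" for a b
  proof -
    have t: "T q (F a) (F b) (F s) = f s (tau q (F a) (F b))" for s
      unfolding T_def G2_metric_frame[OF A ex_coframe[OF q]] by (simp add: dd)
    have "v = (\<Sum>s\<in>UNIV. f s v *\<^sub>R F s)" for v using dF unfolding dual_frames_def by blast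
    then show ?thesis unfolding t .
  qed
  define X where "X a b c d = \<phi> q [tau q (F a) (F b), F c, F d]" for a b c d
  have "form_inner (\<phi> q) 4 (ext_deriv \<phi> q) (hodge (\<phi> q) 3 (\<phi> q))
     = 1 / 24 * psi_pairing (\<lambda>a b c d. X a b c d - X a c b d + X a d b c + X b c a d - X b d a c + X c d a b)"
    unfolding form_inner_def psi_pairing_def
    by (simp add: multi_indices_sum fact_numeral F_def[symmetric] st[unfolded numeral_3_eq_3] ext_deriv_phi[OF q] X_def)
  also have "\<dots> = 1 / 4 * psi_pairing X" unfolding psi_pairing_torsion by simp
  also have "psi_pairing X = (\<Sum>a\<in>UNIV. \<Sum>b\<in>UNIV. \<Sum>s\<in>UNIV. T q (F a) (F b) (F s) * (4 * phi0 a b s))"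
  proof -
    have "X a b c d = (\<Sum>s\<in>UNIV. T q (F a) (F b) (F s) * phi0 s c d)" for a b c d
      unfolding X_def tF by (simp add: linear_sum[OF phi_linear(1)[OF q]] linear_cmul[OF phi_linear(1)[OF q]] pF)
    then have "psi_pairing X = (\<Sum>a\<in>UNIV. \<Sum>b\<in>UNIV. \<Sum>c\<in>UNIV. \<Sum>d\<in>UNIV. \<Sum>s\<in>UNIV. T q (F a) (F b) (F s) * (psi0 a b c d * phi0 c d s))"
      unfolding psi_pairing_def by (simp add: sum_distrib_left sum_distrib_right phi0_cycle[symmetric] mult_ac)
    also have "\<dots> = (\<Sum>a\<in>UNIV. \<Sum>b\<in>UNIV. \<Sum>s\<in>UNIV. T q (F a) (F b) (F s) * (\<Sum>c\<in>UNIV. \<Sum>d\<in>UNIV. psi0 a b c d * phi0 c d s))"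
      by (simp only: sum_distrib_left) (intro sum.cong refl sum_rot3[symmetric])
    finally show ?thesis unfolding psi0_phi0_contr .
  qed
  also have "1 / 4 * \<dots> = (\<Sum>a\<in>UNIV. \<Sum>b\<in>UNIV. \<Sum>s\<in>UNIV. T q (F a) (F b) (F s) * \<phi> q [F a, F b, F s])"
    by (simp add: sum_distrib_left pF)
  also have "\<dots> = (\<Sum>a\<in>UNIV. \<Sum>b\<in>UNIV. \<Sum>s\<in>UNIV. T q (E q a) (E q b) (E q s) * \<phi> q [E q a, E q b, E q s])"
    by (rule frame_contraction3[OF frame_dual[OF q] dF adapted_frame_unique(1)[OF frame[OF q] A] T_linear[OF q] phi_linear[OF q]])
  finally show ?thesis by (simp add: con3_def Tf_def phi_E q)
qed

end

lemma permutes_sum_swap: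
  assumes t: "i < (4::nat)" "j < 4" "i \<noteq> j"
  shows "(\<Sum>\<pi> | \<pi> permutes {..<4::nat}. of_int (sign \<pi>) * f \<pi>) = - (\<Sum>\<pi> | \<pi> permutes {..<4::nat}. of_int (sign \<pi>) * f (\<pi> \<circ> Transposition.transpose i j) :: real)"
proof -
  let ?t = "Transposition.transpose i j"
  have t: "?t permutes {..<4}" using t by (intro permutes_swap_id) auto
  have "(\<Sum>\<pi> | \<pi> permutes {..<4::nat}. of_int (sign \<pi>) * f \<pi>) = (\<Sum>\<pi> | \<pi> permutes {..<4::nat}. of_int (sign (\<pi> \<circ> ?t)) * f (\<pi> \<circ> ?t))"
    by (rule sum_permutations_compose_right[OF t])
  also have "\<dots> = (\<Sum>\<pi> | \<pi> permutes {..<4::nat}. - (of_int (sign \<pi>) * f (\<pi> \<circ> ?t)))"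
  proof (intro sum.cong refl)
    fix \<pi> assume "\<pi> \<in> {\<pi>. \<pi> permutes {..<4::nat}}"
    then have p: "permutation \<pi>" using permutation_permutes finite_lessThan by blast
    have "sign (\<pi> \<circ> ?t) = - sign \<pi>"
      using sign_compose[OF p permutation_swap_id] assms(3) by (simp add: sign_swap_id)
    then show "of_int (sign (\<pi> \<circ> ?t)) * f (\<pi> \<circ> ?t) = - (of_int (sign \<pi>) * f (\<pi> \<circ> ?t))" by simp
  qed
  finally show ?thesis by (simp add: sum_negf)
qed

text \<open>Each cyclic rearrangement is a product of two adjacent transpositions, so it does not
  change the signed sum; three times this sum is zero.\<close>

lemma permutes_sum_cyclic_zero:
  fixes Q :: "nat \<Rightarrow> nat \<Rightarrow> nat \<Rightarrow> nat \<Rightarrow> real"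
  assumes c: "\<And>a b c d. Q a b c d + Q b c a d + Q c a b d = 0"
  shows "(\<Sum>\<pi> | \<pi> permutes {..<4::nat}. of_int (sign \<pi>) * Q (\<pi> 0) (\<pi> 1) (\<pi> 2) (\<pi> 3)) = 0"
proof -
  let ?S = "\<lambda>F. (\<Sum>\<pi> | \<pi> permutes {..<4::nat}. of_int (sign \<pi>) * F (\<pi> 0) (\<pi> 1) (\<pi> 2) (\<pi> 3)) :: real"
  have s01: "?S (\<lambda>a b c d. F b a c d) = - ?S F" for F
    using permutes_sum_swap[of 0 1 "\<lambda>\<pi>. F (\<pi> 0) (\<pi> 1) (\<pi> 2) (\<pi> 3)"] by (simp add: Transposition.transpose_def)
  have s12: "?S (\<lambda>a b c d. F a c b d) = - ?S F" for F
    using permutes_sum_swap[of 1 2 "\<lambda>\<pi>. F (\<pi> 0) (\<pi> 1) (\<pi> 2) (\<pi> 3)"] by (simp add: Transposition.transpose_def)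
  have 1: "?S (\<lambda>a b c d. Q b c a d) = ?S Q" using s01[of "\<lambda>a b c d. Q a c b d"] s12[of Q] by simp
  have 2: "?S (\<lambda>a b c d. Q c a b d) = ?S Q" using s12[of "\<lambda>a b c d. Q b a c d"] s01[of Q] by simp
  have "?S (\<lambda>a b c d. Q a b c d + Q b c a d + Q c a b d) = 0" unfolding c by simp
  then have "?S Q + ?S (\<lambda>a b c d. Q b c a d) + ?S (\<lambda>a b c d. Q c a b d) = 0"
    by (simp only: distrib_left sum.distrib)
  then show ?thesis unfolding 1 2 by simp
qed

text \<open>When the arguments i and j coincide, only the terms k = i and k = j survive, and
  expanding the form with x + y in both places shows that they cancel.\<close>

lemma alternating_derivation:
  assumes a: "alternating n \<alpha>" and A: "linear A"
  shows "alternating n (\<lambda>vs. \<Sum>k<n. \<alpha> (vs[k := A (vs ! k)]))"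
  unfolding alternating_def multilinear_def
proof (intro conjI allI impI)
  fix vs :: "vec7 list" and i assume l: "length vs = n" and i: "i < n"
  have m: "linear (\<lambda>x. \<alpha> (ws[i := x]))" if "length ws = n" for ws
    using a that i unfolding alternating_def multilinear_def by blast
  show "linear (\<lambda>x. \<Sum>k<n. \<alpha> (vs[i := x, k := A (vs[i := x] ! k)]))"
  proof (intro linear_compose_sum ballI)
    fix k assume "k \<in> {..<n}"
    show "linear (\<lambda>x. \<alpha> (vs[i := x, k := A (vs[i := x] ! k)]))"
    proof (cases "k = i")
      case True
      then show ?thesis using linear_compose[OF A m[OF l]] l i by (simp add: o_def)
    next
      case False
      then show ?thesis using m[of "vs[k := A (vs ! k)]"] l by (simp add: list_update_swap)
    qed
  qed
next
  fix vs :: "vec7 list" and i j assume l: "length vs = n" and ij: "i < j" "j < n" "vs ! i = vs ! j"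
  define x where "x = vs ! i"
  define y where "y = A x"
  have z: "\<alpha> ws = 0" if "length ws = n" "ws ! i = ws ! j" for ws
    using a that ij unfolding alternating_def by blast
  have m: "linear (\<lambda>x. \<alpha> (ws[k := x]))" if "length ws = n" "k < n" for ws k
    using a that unfolding alternating_def multilinear_def by blast
  have "0 = \<alpha> (vs[i := x + y, j := x + y])" using l ij by (subst z) auto
  also have "\<dots> = \<alpha> (vs[i := x + y, j := x]) + \<alpha> (vs[i := x + y, j := y])"
    using linear_add[OF m[of "vs[i := x + y]" j]] l ij by simp
  also have "\<alpha> (vs[i := x + y, j := x]) = \<alpha> (vs[j := x, i := x]) + \<alpha> (vs[j := x, i := y])"
    using linear_add[OF m[of "vs[j := x]" i]] l ij by (simp add: list_update_swap[of i j])
  also have "\<alpha> (vs[i := x + y, j := y]) = \<alpha> (vs[j := y, i := x]) + \<alpha> (vs[j := y, i := y])"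
    using linear_add[OF m[of "vs[j := y]" i]] l ij by (simp add: list_update_swap[of i j])
  also have "\<alpha> (vs[j := x, i := x]) = 0" using l ij by (subst z) auto
  also have "\<alpha> (vs[j := y, i := y]) = 0" using l ij by (subst z) auto
  also have "vs[j := x, i := y] = vs[i := y]" using ij x_def l by (metis list_update_id)
  also have "vs[j := y, i := x] = vs[j := y]"
    using ij x_def l by (metis list_update_id list_update_swap nat_neq_iff)
  finally have ij0: "\<alpha> (vs[i := A (vs ! i)]) + \<alpha> (vs[j := A (vs ! j)]) = 0" using ij by (simp add: x_def y_def)
  have "(\<Sum>k<n. \<alpha> (vs[k := A (vs ! k)])) = (\<Sum>k\<in>{i, j}. \<alpha> (vs[k := A (vs ! k)]))"
  proof (rule sum.mono_neutral_right)
    show "\<forall>k\<in>{..<n} - {i, j}. \<alpha> (vs[k := A (vs ! k)]) = 0"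
      using l ij by (intro ballI z) auto
  qed (use ij in auto)
  also have "\<dots> = 0" using ij ij0 by simp
  finally show "(\<Sum>k<n. \<alpha> (vs[k := A (vs ! k)])) = 0" .
qed

text \<open>Invariance of the volume form under skew endomorphisms, whose trace is zero.\<close>

lemma eps_act:
  assumes d: "dual_frames e E" and sk: "\<And>a b. \<omega> a b = - \<omega> b a" and l: "length l = 7"
  shows "(\<Sum>k<7. \<Sum>s\<in>UNIV. \<omega> (l ! k) s * eps (l[k := s])) = 0"
proof -
  have lin: "linear (e i)" and dd: "e i (E j) = dl i j" for i j using d by (auto simp: dual_frames_def)
  define Z where "Z b = (\<Sum>s\<in>UNIV. \<omega> b s *\<^sub>R E s)" for b
  define A where "A v = (\<Sum>b\<in>UNIV. e b v *\<^sub>R Z b)" for v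
  have A: "linear A"
    by (auto intro!: linearI simp: A_def linear_add[OF lin] linear_cmul[OF lin] scaleR_add_left sum.distrib)
       (simp add: scaleR_sum_right)
  have AE: "A (E i) = (\<Sum>s\<in>UNIV. \<omega> i s *\<^sub>R E s)" for i by (simp add: A_def dd Z_def)
  let ?w = "wedge_covectors (map e L7)"
  have w: "alternating 7 ?w" by (rule wedge_covectors_alternating7) (use lin in auto)
  let ?b = "\<lambda>vs. \<Sum>k<7. ?w (vs[k := A (vs ! k)])"
  have b: "alternating 7 ?b" by (rule alternating_derivation[OF w A])
  have be: "?b (map E l) = (\<Sum>k<7. \<Sum>s\<in>UNIV. \<omega> (l ! k) s * eps (l[k := s]))" if l: "length l = 7" for l
  proof (intro sum.cong refl)
    fix k :: nat assume "k \<in> {..<7}"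
    then have k: "k < length l" using l by simp
    have lin': "linear (\<lambda>x. ?w ((map E l)[k := x]))" using w k l unfolding alternating_def multilinear_def by simp
    have "?w ((map E l)[k := A (map E l ! k)]) = (\<Sum>s\<in>UNIV. \<omega> (l ! k) s * ?w (map E (l[k := s])))"
      using k by (simp add: AE linear_sum[OF lin'] linear_cmul[OF lin'] map_update del: list.map)
    also have "\<dots> = (\<Sum>s\<in>UNIV. \<omega> (l ! k) s * eps (l[k := s]))"
      using wedge_covectors_eps(1)[OF dd lin] l by simp
    finally show "?w ((map E l)[k := A (map E l ! k)]) = (\<Sum>s\<in>UNIV. \<omega> (l ! k) s * eps (l[k := s]))" .
  qed
  have dg: "\<omega> a a = 0" for a using sk[of a a] by simp
  have "?b (map E L7) = (\<Sum>k<7. \<Sum>s\<in>UNIV. \<omega> (L7 ! k) s * eps (L7[k := s]))" by (rule be) simp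
  also have "\<dots> = 0" by (simp add: eval_nat_numeral lessThan_Suc sum_i7 eps_def dg)
  finally have "?b (map E L7) = 0" .
  then have "?b (map E l) = 0" using alternating_eps[OF b l, of E] by simp
  then show ?thesis using be[OF l] by simp
qed

context g2_region
begin

lemma nT_linear:
  assumes q: "q \<in> W"
  shows "linear (\<lambda>x. nT q x u v w)" "linear (\<lambda>u. nT q x u v w)" "linear (\<lambda>v. nT q x u v w)" "linear (\<lambda>w. nT q x u v w)"
  by (auto intro!: linearI simp: nT_def tau_def dG_lin Gamma_lin g_lin q algebra_simps)

lemma tau_linear: assumes q: "q \<in> W" shows "linear (\<lambda>u. tau q u v)" "linear (\<lambda>v. tau q u v)"
  by (auto intro!: linearI simp: tau_def Gamma_lin q algebra_simps)

lemma T_contraction: assumes q: "q \<in> W"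
  shows "(\<Sum>a\<in>UNIV. T q (E q a) u v * T q (E q a) w z) = T q (tau q u v) w z"
proof -
  have "T q (E q a) u v = T q u v (E q a)" for a
    using T_swap(1)[OF q, of "E q a" u v] T_swap(2)[OF q, of u "E q a" v] by simp
  then show ?thesis
    by (subst tau_E[OF q]) (simp add: linear_sum[OF T_linear(1)[OF q]] linear_cmul[OF T_linear(1)[OF q]])
qed

text \<open>The difference tensor b is skew in its last two arguments, as both connections are
  metric and T is a 3-form, and symmetric in its first two. Such a tensor is zero.\<close>

lemma Levi_Civita_Gamma:
  assumes q: "q \<in> W" and m: "\<And>vs. length vs = 3 \<Longrightarrow> nabla_tensor \<Gamma>' (metric_tensor \<phi>) q vs = 0"
    and t: "\<And>u v. torsion \<Gamma>' q u v = 0"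
  shows "\<Gamma>' q u v = \<Gamma> q u v - (1 / 2) *\<^sub>R tau q u v"
proof -
  define b where "b u v w = g q (\<Gamma>' q u v - \<Gamma> q u v + (1 / 2) *\<^sub>R tau q u v) w" for u v w
  have fd: "frechet_derivative (\<lambda>q. g q v w) (at q) u = g q (\<Gamma> q u v) w + g q v (\<Gamma> q u w)" for u v w
    unfolding frechet_derivative_at[OF g_der[OF q, of v w], symmetric] ..
  have m': "g q (\<Gamma> q u v) w + g q v (\<Gamma> q u w) = g q (\<Gamma>' q u v) w + g q v (\<Gamma>' q u w)" for u v w
    using m[of "[u, v, w]"] by (simp add: nabla_tensor_2 metric_tensor_def fd)
  have sym: "\<Gamma>' q u v = \<Gamma>' q v u" for u v using t[of u v] by (simp add: torsion_christoffel)
  have b1: "b u v w = - b u w v" for u v w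
    using m'[of u v w] T_swap(2)[OF q, of u v w] g_sym[OF q, of v "\<Gamma> q u w"] g_sym[OF q, of v "\<Gamma>' q u w"]
    unfolding b_def T_def by (simp add: g_lin q)
  have b2: "b u v w = b v u w" for u v w
    unfolding b_def tau_def sym[of v u] by (simp add: g_lin q field_simps)
  have "b u v w = - b u v w" for w
    using b2[of u v w] b1[of v u w] b2[of v w u] b1[of w v u] b2[of w u v] b1[of u w v] by linarith
  then have "g q (\<Gamma>' q u v - \<Gamma> q u v + (1 / 2) *\<^sub>R tau q u v) w = 0" for w unfolding b_def[symmetric] by (metis equal_neg_zero)
  from g_nondeg[OF q this] show ?thesis by (simp add: algebra_simps eq_neg_iff_add_eq_0)
qed

end

context g2_special
begin

lemma nT_zero: assumes q: "q \<in> W" shows "nT q x u v w = 0"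
  by (rule zero_on_frame4[OF frame_dual[OF q], where h = "nT q"])
     (use nT_linear[OF q] nTf_zero[OF q] in \<open>auto simp: nTf_def\<close>)

text \<open>The vanishing of \<sigma>, read as the Jacobi identity for the bracket
  \<open>tau\<close>.\<close>

lemma jacobi: assumes q: "q \<in> W"
  shows "T q (tau q u v) w z + T q (tau q v w) u z + T q (tau q w u) v z = 0"
proof (rule zero_on_frame4[OF frame_dual[OF q], where h = "\<lambda>u v w z. T q (tau q u v) w z + T q (tau q v w) u z + T q (tau q w u) v z"])
  show "T q (tau q (E q i) (E q j)) (E q k) (E q m) + T q (tau q (E q j) (E q k)) (E q i) (E q m) + T q (tau q (E q k) (E q i)) (E q j) (E q m) = 0" for i j k m
    using sig_Tf[OF q, of i j k m] by (simp add: T_tau q sig_def sum.distrib)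
  note l = T_linear[OF q, THEN linear_add] T_linear[OF q, THEN linear_cmul] tau_linear[OF q, THEN linear_add] tau_linear[OF q, THEN linear_cmul]
qed (auto intro!: linearI simp: T_linear[OF q, THEN linear_add] T_linear[OF q, THEN linear_cmul]
      tau_linear[OF q, THEN linear_add] tau_linear[OF q, THEN linear_cmul] algebra_simps)

text \<open>Summing over the frame turns the wedge squares into a signed sum of
  \<open>T q (tau q x y) w z\<close>, to which \<open>jacobi\<close> applies; 1/8 combines 1/2 with
  1 / (2! * 2!).\<close>

lemma sigma_form_zero: assumes q: "q \<in> W" and l: "length vs = 4" shows "sigma_form \<phi> (torsion_form \<phi> \<Gamma>) q vs = 0"
proof -
  have pl: "permute_list \<pi> vs = [vs ! \<pi> 0, vs ! \<pi> 1, vs ! \<pi> 2, vs ! \<pi> 3]" for \<pi>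
    using l by (simp add: permute_list_def eval_nat_numeral upt_rec)
  let ?F = "\<lambda>a. G2_frame (\<phi> q) (ix a)"
  have c: "(\<Sum>a\<in>UNIV. T q (?F a) x y * T q (?F a) w z) = T q (tau q x y) w z" for x y w z
  proof -
    have "(\<Sum>a\<in>UNIV. T q (?F a) x y * T q (?F a) w z) = (\<Sum>a\<in>UNIV. T q (E q a) x y * T q (E q a) w z)"
      by (rule contraction[OF q, where f = "\<lambda>u v. T q u x y * T q v w z"])
         (auto intro!: linearI simp: T_linear[OF q, THEN linear_add] T_linear[OF q, THEN linear_cmul] algebra_simps)
    then show ?thesis by (simp add: T_contraction q)
  qed
  have j: "(\<Sum>\<pi> | \<pi> permutes {..<4::nat}. of_int (sign \<pi>) * T q (tau q (vs ! \<pi> 0) (vs ! \<pi> 1)) (vs ! \<pi> 2) (vs ! \<pi> 3)) = 0"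
    by (rule permutes_sum_cyclic_zero[where Q = "\<lambda>a b c d. T q (tau q (vs ! a) (vs ! b)) (vs ! c) (vs ! d)"]) (rule jacobi[OF q])
  have "sigma_form \<phi> (torsion_form \<phi> \<Gamma>) q vs = 1 / 2 * (\<Sum>a\<in>UNIV. 1 / 4 * (\<Sum>\<pi> | \<pi> permutes {..<4::nat}. of_int (sign \<pi>) *
      (T q (?F a) (vs ! \<pi> 0) (vs ! \<pi> 1) * T q (?F a) (vs ! \<pi> 2) (vs ! \<pi> 3))))"
    unfolding sigma_form_def Let_def sum_ix wedge_def interior_prod_def pl
    by (simp add: T_torsion_form fact_numeral mult.assoc)
  also have "\<dots> = 1 / 8 * (\<Sum>a\<in>UNIV. \<Sum>\<pi> | \<pi> permutes {..<4::nat}. of_int (sign \<pi>) *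
      (T q (?F a) (vs ! \<pi> 0) (vs ! \<pi> 1) * T q (?F a) (vs ! \<pi> 2) (vs ! \<pi> 3)))"
    unfolding sum_distrib_left[symmetric] by simp
  also have "\<dots> = 1 / 8 * (\<Sum>\<pi> | \<pi> permutes {..<4::nat}. of_int (sign \<pi>) *
      (\<Sum>a\<in>UNIV. T q (?F a) (vs ! \<pi> 0) (vs ! \<pi> 1) * T q (?F a) (vs ! \<pi> 2) (vs ! \<pi> 3)))"
    by (subst sum.swap) (simp only: sum_distrib_left)
  also have "\<dots> = 0" unfolding c j by simp
  finally show ?thesis .
qed

lemma nabla_torsion_zero: assumes q: "q \<in> W" and l: "length vs = 4" shows "nabla_tensor \<Gamma> (torsion_form \<phi> \<Gamma>) q vs = 0"
proof -
  obtain x u v w where vs: "vs = [x, u, v, w]" using length_4[OF l] by blast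
  show ?thesis unfolding vs nabla_tensor_3 T_torsion_form frechet_derivative_at[OF T_der[OF q, of u v w], symmetric]
    by (simp add: nT_zero q)
qed

end

section \<open>The Levi-Civita connection and the codifferential\<close>

text \<open>A 4-tensor with components S on vectors with given coordinates; keeping the two apart
  splits derivatives into \<open>act4\<close> and coordinate terms.\<close>

definition quad :: "(i7 \<Rightarrow> i7 \<Rightarrow> i7 \<Rightarrow> i7 \<Rightarrow> real) \<Rightarrow> (i7 \<Rightarrow> real) \<Rightarrow> (i7 \<Rightarrow> real) \<Rightarrow> (i7 \<Rightarrow> real) \<Rightarrow> (i7 \<Rightarrow> real) \<Rightarrow> real" where
  "quad S x y z w = (\<Sum>a\<in>UNIV. \<Sum>b\<in>UNIV. \<Sum>c\<in>UNIV. \<Sum>d\<in>UNIV. S a b c d * (x a * y b * z c * w d))"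

definition act4 :: "(i7 \<Rightarrow> i7 \<Rightarrow> real) \<Rightarrow> (i7 \<Rightarrow> i7 \<Rightarrow> i7 \<Rightarrow> i7 \<Rightarrow> real) \<Rightarrow> i7 \<Rightarrow> i7 \<Rightarrow> i7 \<Rightarrow> i7 \<Rightarrow> real" where
  "act4 \<omega> S a b c d = (\<Sum>s\<in>UNIV. \<omega> a s * S s b c d) + (\<Sum>s\<in>UNIV. \<omega> b s * S a s c d)
     + (\<Sum>s\<in>UNIV. \<omega> c s * S a b s d) + (\<Sum>s\<in>UNIV. \<omega> d s * S a b c s)"

lemma quad_linear:
  assumes "\<And>a. linear (e a)"
  shows "linear (\<lambda>x. quad S (\<lambda>a. e a x) y z w)" "linear (\<lambda>x. quad S y (\<lambda>a. e a x) z w)"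
    "linear (\<lambda>x. quad S y z (\<lambda>a. e a x) w)" "linear (\<lambda>x. quad S y z w (\<lambda>a. e a x))"
  unfolding quad_def
  by (auto intro!: linearI simp: linear_add[OF assms] linear_cmul[OF assms] sum.distrib sum_distrib_left algebra_simps)

lemma quad_dl: "quad S (\<lambda>a. dl a i) (\<lambda>a. dl a j) (\<lambda>a. dl a k) (\<lambda>a. dl a l) = S i j k l"
proof -
  have "quad S (\<lambda>a. dl a i) (\<lambda>a. dl a j) (\<lambda>a. dl a k) (\<lambda>a. dl a l)
    = (\<Sum>a\<in>UNIV. dl a i * (\<Sum>b\<in>UNIV. dl b j * (\<Sum>c\<in>UNIV. dl c k * (\<Sum>d\<in>UNIV. dl d l * S a b c d))))"
    unfolding quad_def by (simp only: sum_distrib_left mult_ac)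
  then show ?thesis by simp
qed

text \<open>Infinitesimal form of the fact that rotating components and coordinates together does
  not change the value.\<close>

lemma quad_skew:
  assumes sk: "\<And>a b. \<omega> a b = - \<omega> b a"
  shows "quad (act4 \<omega> S) x y z w + quad S (\<lambda>a. \<Sum>s\<in>UNIV. \<omega> a s * x s) y z w + quad S x (\<lambda>a. \<Sum>s\<in>UNIV. \<omega> a s * y s) z w
     + quad S x y (\<lambda>a. \<Sum>s\<in>UNIV. \<omega> a s * z s) w + quad S x y z (\<lambda>a. \<Sum>s\<in>UNIV. \<omega> a s * w s) = 0"
proof -
  have pull: "k * (\<Sum>s\<in>UNIV. \<omega> d s * A s) = (\<Sum>s\<in>UNIV. \<omega> d s * (k * A s))" for k d A
    by (simp add: sum_distrib_left mult.left_commute)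
  have 4: "(\<Sum>a\<in>UNIV. \<Sum>b\<in>UNIV. \<Sum>c\<in>UNIV. \<Sum>d\<in>UNIV. (\<Sum>s\<in>UNIV. \<omega> d s * S a b c s) * (x a * y b * z c * w d) + S a b c d * (x a * y b * z c * (\<Sum>s\<in>UNIV. \<omega> d s * w s))) = 0"
  proof -
    have z: "(\<Sum>d\<in>UNIV. (\<Sum>s\<in>UNIV. \<omega> d s * S a b c s) * (x a * y b * z c * w d) + S a b c d * (x a * y b * z c * (\<Sum>s\<in>UNIV. \<omega> d s * w s))) = 0" for a b c
      unfolding pull[where k = "x a * y b * z c"] by (rule skew_cancel'[OF sk])
    then show ?thesis by simp
  qed
  have 3: "(\<Sum>a\<in>UNIV. \<Sum>b\<in>UNIV. \<Sum>c\<in>UNIV. \<Sum>d\<in>UNIV. (\<Sum>s\<in>UNIV. \<omega> c s * S a b s d) * (x a * y b * z c * w d) + S a b c d * (x a * y b * (\<Sum>s\<in>UNIV. \<omega> c s * z s) * w d)) = 0"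
  proof -
    have r: "p * q * r * s = (p * q * s) * r" for p q r s :: real by simp
    have z: "(\<Sum>c\<in>UNIV. (\<Sum>s\<in>UNIV. \<omega> c s * S a b s d) * (x a * y b * z c * w d) + S a b c d * (x a * y b * (\<Sum>s\<in>UNIV. \<omega> c s * z s) * w d)) = 0" for a b d
      unfolding r[where p = "x a" and q = "y b" and s = "w d"] pull[where k = "x a * y b * w d"] by (rule skew_cancel'[OF sk])
    have "(\<Sum>a\<in>UNIV. \<Sum>b\<in>UNIV. \<Sum>c\<in>UNIV. \<Sum>d\<in>UNIV. (\<Sum>s\<in>UNIV. \<omega> c s * S a b s d) * (x a * y b * z c * w d) + S a b c d * (x a * y b * (\<Sum>s\<in>UNIV. \<omega> c s * z s) * w d)) = (\<Sum>a\<in>UNIV. \<Sum>b\<in>UNIV. \<Sum>d\<in>UNIV. \<Sum>c\<in>UNIV. (\<Sum>s\<in>UNIV. \<omega> c s * S a b s d) * (x a * y b * z c * w d) + S a b c d * (x a * y b * (\<Sum>s\<in>UNIV. \<omega> c s * z s) * w d))"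
      by (intro sum.cong refl sum.swap)
    then show ?thesis unfolding z by simp
  qed
  have 2: "(\<Sum>a\<in>UNIV. \<Sum>b\<in>UNIV. \<Sum>c\<in>UNIV. \<Sum>d\<in>UNIV. (\<Sum>s\<in>UNIV. \<omega> b s * S a s c d) * (x a * y b * z c * w d) + S a b c d * (x a * (\<Sum>s\<in>UNIV. \<omega> b s * y s) * z c * w d)) = 0"
  proof -
    have r: "p * r * q * s = (p * q * s) * r" for p q r s :: real by simp
    have z: "(\<Sum>b\<in>UNIV. (\<Sum>s\<in>UNIV. \<omega> b s * S a s c d) * (x a * y b * z c * w d) + S a b c d * (x a * (\<Sum>s\<in>UNIV. \<omega> b s * y s) * z c * w d)) = 0" for a c d
      unfolding r[where p = "x a" and q = "z c" and s = "w d"] pull[where k = "x a * z c * w d"] by (rule skew_cancel'[OF sk])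
    have "(\<Sum>a\<in>UNIV. \<Sum>b\<in>UNIV. \<Sum>c\<in>UNIV. \<Sum>d\<in>UNIV. (\<Sum>s\<in>UNIV. \<omega> b s * S a s c d) * (x a * y b * z c * w d) + S a b c d * (x a * (\<Sum>s\<in>UNIV. \<omega> b s * y s) * z c * w d)) = (\<Sum>a\<in>UNIV. \<Sum>c\<in>UNIV. \<Sum>d\<in>UNIV. \<Sum>b\<in>UNIV. (\<Sum>s\<in>UNIV. \<omega> b s * S a s c d) * (x a * y b * z c * w d) + S a b c d * (x a * (\<Sum>s\<in>UNIV. \<omega> b s * y s) * z c * w d))"
      by (intro sum.cong refl sum_rot3)
    then show ?thesis unfolding z by simp
  qed
  have 1: "(\<Sum>a\<in>UNIV. \<Sum>b\<in>UNIV. \<Sum>c\<in>UNIV. \<Sum>d\<in>UNIV. (\<Sum>s\<in>UNIV. \<omega> a s * S s b c d) * (x a * y b * z c * w d) + S a b c d * ((\<Sum>s\<in>UNIV. \<omega> a s * x s) * y b * z c * w d)) = 0"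
  proof -
    have r: "r * p * q * s = (p * q * s) * r" for p q r s :: real by simp
    have z: "(\<Sum>a\<in>UNIV. (\<Sum>s\<in>UNIV. \<omega> a s * S s b c d) * (x a * y b * z c * w d) + S a b c d * ((\<Sum>s\<in>UNIV. \<omega> a s * x s) * y b * z c * w d)) = 0" for b c d
      unfolding r[where p = "y b" and q = "z c" and s = "w d"] pull[where k = "y b * z c * w d"] by (rule skew_cancel'[OF sk])
    have "(\<Sum>a\<in>UNIV. \<Sum>b\<in>UNIV. \<Sum>c\<in>UNIV. \<Sum>d\<in>UNIV. (\<Sum>s\<in>UNIV. \<omega> a s * S s b c d) * (x a * y b * z c * w d) + S a b c d * ((\<Sum>s\<in>UNIV. \<omega> a s * x s) * y b * z c * w d)) = (\<Sum>b\<in>UNIV. \<Sum>c\<in>UNIV. \<Sum>d\<in>UNIV. \<Sum>a\<in>UNIV. (\<Sum>s\<in>UNIV. \<omega> a s * S s b c d) * (x a * y b * z c * w d) + S a b c d * ((\<Sum>s\<in>UNIV. \<omega> a s * x s) * y b * z c * w d))"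
      by (rule sum_rot4)
    then show ?thesis unfolding z by simp
  qed
  show ?thesis using 1 2 3 4 unfolding quad_def act4_def distrib_right sum.distrib by linarith
qed

text \<open>\<open>T m\<close> acts on T by a contraction of \<sigma>. Hence replacing
  \<open>om\<close> by \<open>om'\<close> does not affect the derivative of T.\<close>

lemma act3_sig:
  assumes T: "alt3 T" and s: "\<And>i j k l. sig T i j k l = 0"
  shows "act3 (T m) T i j k = 0"
proof -
  have 1: "T m j s * T i s k = T j m s * T s i k" for s
    using T unfolding alt3_def by (metis minus_mult_minus)
  have 2: "T m k s * T i j s = T i j s * T s m k" for s
  proof -
    have "T m k s = T s m k" using T unfolding alt3_def by (metis minus_minus)
    then show ?thesis by simp
  qed
  show ?thesis using s[of m i j k] unfolding act3_def sig_def by (simp add: 1 2 sum.distrib)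
qed

lemma con3_sum: "con3 P (\<lambda>i j k. \<Sum>s\<in>UNIV. c s * Q s i j k) = (\<Sum>s\<in>UNIV. c s * con3 P (Q s))"
proof -
  have "con3 P (\<lambda>i j k. \<Sum>s\<in>UNIV. c s * Q s i j k) = (\<Sum>i\<in>UNIV. \<Sum>j\<in>UNIV. \<Sum>k\<in>UNIV. \<Sum>s\<in>UNIV. c s * (P i j k * Q s i j k))"
    unfolding con3_def by (simp only: sum_distrib_left mult.left_commute)
  also have "\<dots> = (\<Sum>s\<in>UNIV. \<Sum>i\<in>UNIV. \<Sum>j\<in>UNIV. \<Sum>k\<in>UNIV. c s * (P i j k * Q s i j k))"
    by (rule sum_rot4[symmetric])
  finally show ?thesis by (simp only: con3_def sum_distrib_left)
qed

lemma con3_add: "con3 P (\<lambda>i j k. Q i j k + Q' i j k) = con3 P Q + con3 P Q'"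
  unfolding con3_def by (simp only: distrib_left sum.distrib)

lemma con3_neg: "con3 P (\<lambda>i j k. - Q i j k) = - con3 P Q"
  unfolding con3_def by (simp add: sum_negf)

locale g2_levi_civita = g2_special +
  fixes \<Gamma>' :: christoffel
  assumes metric': "\<And>q vs. q \<in> W \<Longrightarrow> length vs = 3 \<Longrightarrow> nabla_tensor \<Gamma>' (metric_tensor \<phi>) q vs = 0"
    and torsion': "\<And>q u v. q \<in> W \<Longrightarrow> torsion \<Gamma>' q u v = 0"
begin

lemma Gamma': "q \<in> W \<Longrightarrow> \<Gamma>' q u v = \<Gamma> q u v - (1 / 2) *\<^sub>R tau q u v"
  by (rule Levi_Civita_Gamma[OF _ metric' torsion'])

lemma Gamma'_sym: "q \<in> W \<Longrightarrow> \<Gamma>' q u v = \<Gamma>' q v u"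
  using torsion'[of q u v] by (simp add: torsion_christoffel)

lemma Gamma'_linear: "q \<in> W \<Longrightarrow> linear (\<lambda>u. \<Gamma>' q u v)"
  by (auto intro!: linearI simp: Gamma' tau_def Gamma_lin algebra_simps)

text \<open>\<Gamma>' differs from \<Gamma> by half the torsion, and the action of the torsion on T
  is the expression in \<open>jacobi\<close>.\<close>

lemma T_der':
  assumes q: "q \<in> W"
  shows "((\<lambda>q. T q u v w) has_derivative (\<lambda>x. T q (\<Gamma>' q x u) v w + T q u (\<Gamma>' q x v) w + T q u v (\<Gamma>' q x w))) (at q)"
proof -
  note l = T_linear[OF q, THEN linear_diff] T_linear[OF q, THEN linear_cmul]
  have "nT q x u v w + T q (\<Gamma> q x u) v w + T q u (\<Gamma> q x v) w + T q u v (\<Gamma> q x w)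
     = T q (\<Gamma>' q x u) v w + T q u (\<Gamma>' q x v) w + T q u v (\<Gamma>' q x w)" for x
  proof -
    have "T q u v (tau q x w) = T q x w (tau q u v)" unfolding T_def by (rule g_sym[OF q])
    also have "\<dots> = T q (tau q u v) x w" using T_swap(2)[OF q, of x w "tau q u v"] T_swap(1)[OF q, of x "tau q u v" w] by simp
    finally have 1: "T q u v (tau q x w) = T q (tau q u v) x w" .
    have "tau q v x = - tau q x v" by (simp add: tau_def)
    then have 2: "T q (tau q v x) u w = T q u (tau q x v) w"
      using T_swap(1)[OF q, of "tau q x v" u w] by (simp add: linear_neg[OF T_linear(1)[OF q]])
    show ?thesis using jacobi[OF q, of x u v w] by (simp add: Gamma' q nT_zero l 1 2)
  qed
  with T_der[OF q, of u v w] show ?thesis by simp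
qed

lemma T_frechet: "q \<in> W \<Longrightarrow> frechet_derivative (\<lambda>q. T q u v w) (at q) x = T q (\<Gamma>' q x u) v w + T q u (\<Gamma>' q x v) w + T q u v (\<Gamma>' q x w)"
  unfolding frechet_derivative_at[OF T_der', of q u v w, symmetric] ..

lemma Levi_Civita_torsion_zero: assumes q: "q \<in> W" and l: "length vs = 4" shows "nabla_tensor \<Gamma>' (torsion_form \<phi> \<Gamma>) q vs = 0"
proof -
  obtain x u v w where vs: "vs = [x, u, v, w]" using length_4[OF l] by blast
  show ?thesis unfolding vs nabla_tensor_3 T_torsion_form T_frechet[OF q] by simp
qed

text \<open>T is parallel for a connection with symmetric \<Gamma>', so alternating its partial
  derivatives cancels all \<Gamma>' terms.\<close>

lemma ext_deriv_torsion_zero: assumes q: "q \<in> W" and l: "length vs = 4" shows "ext_deriv (torsion_form \<phi> \<Gamma>) q vs = 0"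
proof -
  obtain a b c d where vs: "vs = [a, b, c, d]" using length_4[OF l] by blast
  have s: "T q x (\<Gamma>' q u y) z = - T q (\<Gamma>' q u y) x z" "T q x y (\<Gamma>' q u z) = T q (\<Gamma>' q u z) x y" for x y z u
    using T_swap(1)[OF q, of x "\<Gamma>' q u y" z] T_swap(2)[OF q, of x y "\<Gamma>' q u z"] T_swap(1)[OF q, of x "\<Gamma>' q u z" y] by simp_all
  show ?thesis unfolding vs ext_deriv_3 T_torsion_form T_frechet[OF q] s
    using Gamma'_sym[OF q, of a b] Gamma'_sym[OF q, of a c] Gamma'_sym[OF q, of a d] Gamma'_sym[OF q, of b c]
      Gamma'_sym[OF q, of b d] Gamma'_sym[OF q, of c d] by simp
qed

text \<open>The Levi-Civita connection form in the same frame.\<close>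

definition om' where "om' q m a s = om q m a s - 1 / 2 * Tf q m a s"

lemma om'_skew: "q \<in> W \<Longrightarrow> om' q m a b = - om' q m b a"
  using om_skew[of q m a b] T_swap(2)[of q "E q m" "E q a" "E q b"] by (simp add: om'_def Tf_def)

lemma dT_E': assumes q: "q \<in> W" shows "dT q i j k (E q m) = act3 (om' q m) (Tf q) i j k"
proof -
  have "act3 (om' q m) (Tf q) i j k = act3 (om q m) (Tf q) i j k - 1 / 2 * act3 (Tf q m) (Tf q) i j k"
    by (simp add: act3_def om'_def left_diff_distrib sum_subtractf sum_distrib_left mult.assoc algebra_simps)
  then show ?thesis by (simp add: dT_E nTf_zero q act3_sig[OF Tf_alt3[OF q] sig_Tf[OF q]])
qed

text \<open>The components of the Hodge dual of T; \<open>St\<close> is the resulting 4-tensor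
  (\<open>hodge_torsion\<close>). In this form the dual is visibly differentiable.\<close>

definition Sf where "Sf q a b c d = 1 / 6 * con3 (Tf q) (\<lambda>i j k. eps [i, j, k, a, b, c, d])"
definition St where "St q x y z w = quad (Sf q) (\<lambda>a. ee q a x) (\<lambda>a. ee q a y) (\<lambda>a. ee q a z) (\<lambda>a. ee q a w)"
definition dS where "dS q a b c d u = 1 / 6 * con3 (\<lambda>i j k. dT q i j k u) (\<lambda>i j k. eps [i, j, k, a, b, c, d])"

lemma Sf_der: "q \<in> W \<Longrightarrow> ((\<lambda>q. Sf q a b c d) has_derivative dS q a b c d) (at q)"
  unfolding Sf_def dS_def con3_def
  by (intro has_derivative_mult_right has_derivative_sum has_derivative_mult_left dT_der)

text \<open>Along the frame, T changes by the action of \<open>om'\<close>, and the Levi-Civita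
  symbol is invariant under skew matrices (\<open>eps_act\<close>); so the dual changes by the
  action of \<open>om'\<close> on its own four indices.\<close>

lemma dS_E: assumes q: "q \<in> W" shows "dS q a b c d (E q m) = act4 (om' q m) (Sf q) a b c d"
proof -
  let ?e = "\<lambda>a b c d i j k. eps [i, j, k, a, b, c, d]"
  have f: "act3 (om' q m) (?e a b c d) = (\<lambda>i j k. - ((\<Sum>s\<in>UNIV. om' q m a s * (?e s b c d i j k)) + (\<Sum>s\<in>UNIV. om' q m b s * (?e a s c d i j k))
     + (\<Sum>s\<in>UNIV. om' q m c s * (?e a b s d i j k)) + (\<Sum>s\<in>UNIV. om' q m d s * (?e a b c s i j k))))"
  proof (intro ext)
    fix i j k
    show "act3 (om' q m) (?e a b c d) i j k = - ((\<Sum>s\<in>UNIV. om' q m a s * (?e s b c d i j k)) + (\<Sum>s\<in>UNIV. om' q m b s * (?e a s c d i j k))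
     + (\<Sum>s\<in>UNIV. om' q m c s * (?e a b s d i j k)) + (\<Sum>s\<in>UNIV. om' q m d s * (?e a b c s i j k)))"
      using eps_act[where \<omega> = "om' q m" and l = "[i, j, k, a, b, c, d]", OF frame_dual[OF q] om'_skew[OF q]]
      by (simp add: eval_nat_numeral lessThan_Suc act3_def)
  qed
  have "con3 (Tf q) (act3 (om' q m) (?e a b c d)) = - ((\<Sum>s\<in>UNIV. om' q m a s * con3 (Tf q) (?e s b c d)) + (\<Sum>s\<in>UNIV. om' q m b s * con3 (Tf q) (?e a s c d))
     + (\<Sum>s\<in>UNIV. om' q m c s * con3 (Tf q) (?e a b s d)) + (\<Sum>s\<in>UNIV. om' q m d s * con3 (Tf q) (?e a b c s)))"
    unfolding f by (simp only: con3_neg con3_add con3_sum)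
  with con3_skew[of "om' q m" "Tf q" "?e a b c d", OF om'_skew[OF q]]
  have "con3 (act3 (om' q m) (Tf q)) (?e a b c d) = (\<Sum>s\<in>UNIV. om' q m a s * con3 (Tf q) (?e s b c d)) + (\<Sum>s\<in>UNIV. om' q m b s * con3 (Tf q) (?e a s c d))
     + (\<Sum>s\<in>UNIV. om' q m c s * con3 (Tf q) (?e a b s d)) + (\<Sum>s\<in>UNIV. om' q m d s * con3 (Tf q) (?e a b c s))" by linarith
  moreover have "con3 (\<lambda>i j k. dT q i j k (E q m)) (?e a b c d) = con3 (act3 (om' q m) (Tf q)) (?e a b c d)"
    by (simp add: con3_def dT_E' q)
  ultimately show ?thesis
    unfolding dS_def act4_def Sf_def by (simp add: sum_distrib_left algebra_simps)
qed

definition de where "de q a x = frechet_derivative (\<lambda>q. ee q a x) (at q)"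

lemma de_der: assumes q: "q \<in> W" shows "((\<lambda>q. ee q a x) has_derivative de q a x) (at q)"
  and de_E: "de q a x (E q m) = ee q a (\<Gamma>' q (E q m) x) + (\<Sum>s\<in>UNIV. om' q m a s * ee q s x)"
proof -
  have d: "((\<lambda>q. ee q a x) has_derivative (\<lambda>u. g q (\<Gamma> q u x) (E q a) + g q x (\<Gamma> q u (E q a)) + g q x (dE q a u))) (at q)"
    by (rule has_derivative_transform_within_open[OF g_vec_der'[OF q E_der[OF q]] W q]) (simp add: g_frame_comp)
  have e: "de q a x = (\<lambda>u. g q (\<Gamma> q u x) (E q a) + g q x (\<Gamma> q u (E q a)) + g q x (dE q a u))"
    unfolding de_def frechet_derivative_at[OF d, symmetric] ..
  show "((\<lambda>q. ee q a x) has_derivative de q a x) (at q)" unfolding e by (rule d)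
  have "ee q a (tau q (E q m) x) = - T q (E q m) (E q a) x"
    using T_swap(2)[OF q, of "E q m" x "E q a"] by (simp add: T_def g_frame_comp q)
  also have "T q (E q m) (E q a) x = T q (E q m) (E q a) (\<Sum>s\<in>UNIV. ee q s x *\<^sub>R E q s)"
    by (rule arg_cong[OF frame_expand[OF q]])
  also have "\<dots> = (\<Sum>s\<in>UNIV. Tf q m a s * ee q s x)"
    by (simp add: linear_sum[OF T_linear(3)[OF q]] linear_cmul[OF T_linear(3)[OF q]] Tf_def mult.commute)
  finally have t: "ee q a (tau q (E q m) x) = - (\<Sum>s\<in>UNIV. Tf q m a s * ee q s x)" .
  have "de q a x (E q m) = ee q a (\<Gamma> q (E q m) x) + (\<Sum>s\<in>UNIV. om q m a s * ee q s x)"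
    unfolding e dE_om[OF q] by (simp add: g_lin q g_frame_comp linear_sum[OF g_linear2[OF q]])
  then show "de q a x (E q m) = ee q a (\<Gamma>' q (E q m) x) + (\<Sum>s\<in>UNIV. om' q m a s * ee q s x)"
    by (simp add: Gamma' q om'_def linear_diff[OF ee_linear[OF q]] linear_cmul[OF ee_linear[OF q]] t
        left_diff_distrib sum_subtractf mult.assoc sum_divide_distrib)
qed

lemma St_linear: assumes q: "q \<in> W"
  shows "linear (\<lambda>x. St q x y z w)" "linear (\<lambda>y. St q x y z w)" "linear (\<lambda>z. St q x y z w)" "linear (\<lambda>w. St q x y z w)"
  unfolding St_def by (rule quad_linear[OF ee_linear[OF q]])+

lemma St_E: "q \<in> W \<Longrightarrow> St q (E q a) (E q b) (E q c) (E q d) = Sf q a b c d"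
  by (simp add: St_def ee_E quad_dl)

lemma St_swap: assumes q: "q \<in> W"
  shows "St q x y z w = - St q y x z w" "St q x y z w = - St q x z y w" "St q x y z w = - St q x y w z"
proof -
  note D = frame_dual[OF q]
  have "eps [i, j, k, a, b, c, d] + eps [i, j, k, b, a, c, d] = 0" for i j k a b c d
    using eps_swap[OF D, of "[i, j, k]" "[c, d]" a b] by simp
  then have 1: "Sf q a b c d + Sf q b a c d = 0" for a b c d
    unfolding Sf_def distrib_left[symmetric] con3_add[symmetric] by (simp add: con3_def)
  have "eps [i, j, k, a, b, c, d] + eps [i, j, k, a, c, b, d] = 0" for i j k a b c d
    using eps_swap[OF D, of "[i, j, k, a]" "[d]" b c] by simp
  then have 2: "Sf q a b c d + Sf q a c b d = 0" for a b c d
    unfolding Sf_def distrib_left[symmetric] con3_add[symmetric] by (simp add: con3_def)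
  have "eps [i, j, k, a, b, c, d] + eps [i, j, k, a, b, d, c] = 0" for i j k a b c d
    using eps_swap[OF D, of "[i, j, k, a, b]" "[]" c d] by simp
  then have 3: "Sf q a b c d + Sf q a b d c = 0" for a b c d
    unfolding Sf_def distrib_left[symmetric] con3_add[symmetric] by (simp add: con3_def)
  have "St q x y z w + St q y x z w = 0"
    by (rule zero_on_frame4[OF D, where h = "\<lambda>x y z w. St q x y z w + St q y x z w"])
       (auto intro!: linear_compose_add St_linear q simp: St_E q 1)
  then show "St q x y z w = - St q y x z w" by simp
  have "St q x y z w + St q x z y w = 0"
    by (rule zero_on_frame4[OF D, where h = "\<lambda>x y z w. St q x y z w + St q x z y w"])
       (auto intro!: linear_compose_add St_linear q simp: St_E q 2)
  then show "St q x y z w = - St q x z y w" by simp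
  have "St q x y z w + St q x y w z = 0"
    by (rule zero_on_frame4[OF D, where h = "\<lambda>x y z w. St q x y z w + St q x y w z"])
       (auto intro!: linear_compose_add St_linear q simp: St_E q 3)
  then show "St q x y z w = - St q x y w z" by simp
qed

lemma hodge_torsion: assumes q: "q \<in> W" shows "hodge_field \<phi> 3 (torsion_form \<phi> \<Gamma>) q [x, y, z, w] = St q x y z w"
proof -
  note D = frame_dual[OF q]
  define V where "V a b c x y z w = wedge_covectors (map (ee q) L7) [E q a, E q b, E q c, x, y, z, w]" for a b c x y z w
  have al: "alternating 7 (wedge_covectors (map (ee q) L7))" by (rule wedge_covectors_alternating7) (auto intro: ee_linear q)
  have Vl: "linear (\<lambda>x. V a b c x y z w)" "linear (\<lambda>y. V a b c x y z w)" "linear (\<lambda>z. V a b c x y z w)" "linear (\<lambda>w. V a b c x y z w)" for a b c x y z w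
    using alternating_linear[OF al, of "[E q a, E q b, E q c]" "[y, z, w]"] alternating_linear[OF al, of "[E q a, E q b, E q c, x]" "[z, w]"]
      alternating_linear[OF al, of "[E q a, E q b, E q c, x, y]" "[w]"] alternating_linear[OF al, of "[E q a, E q b, E q c, x, y, z]" "[]"]
    unfolding V_def by simp_all
  have VE: "V a b c (E q i) (E q j) (E q k) (E q l) = eps [a, b, c, i, j, k, l]" for a b c i j k l
    using wedge_covectors_eps(1)[OF ee_E[OF q] ee_linear[OF q], of "[a, b, c, i, j, k, l]"] unfolding V_def by simp
  have h: "hodge_field \<phi> 3 (torsion_form \<phi> \<Gamma>) q [x, y, z, w] = 1 / 6 * con3 (Tf q) (\<lambda>a b c. V a b c x y z w)"
    unfolding hodge_field_def con3_def V_def Tf_def T_torsion_form[symmetric]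
    by (rule hodge_3_frame[OF frame[OF q] ex_coframe[OF q] torsion_alt[OF q]]) simp
  have cm: "linear (\<lambda>x. 1 / 6 * f x)" if "linear f" for f :: "vec7 \<Rightarrow> real"
    using that by (auto intro!: linearI simp: linear_add linear_cmul algebra_simps)
  have cl: "linear (\<lambda>x. con3 (Tf q) (\<lambda>a b c. V a b c x y z w))" "linear (\<lambda>y. con3 (Tf q) (\<lambda>a b c. V a b c x y z w))"
    "linear (\<lambda>z. con3 (Tf q) (\<lambda>a b c. V a b c x y z w))" "linear (\<lambda>w. con3 (Tf q) (\<lambda>a b c. V a b c x y z w))" for x y z w
    by (auto intro!: linearI simp: con3_def Vl[THEN linear_add] Vl[THEN linear_cmul] sum.distrib sum_distrib_left algebra_simps)
  have "1 / 6 * con3 (Tf q) (\<lambda>a b c. V a b c x y z w) - St q x y z w = 0"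
  proof (rule zero_on_frame4[OF D, where h = "\<lambda>x y z w. 1 / 6 * con3 (Tf q) (\<lambda>a b c. V a b c x y z w) - St q x y z w"])
    show "1 / 6 * con3 (Tf q) (\<lambda>a b c. V a b c (E q i) (E q j) (E q k) (E q m)) - St q (E q i) (E q j) (E q k) (E q m) = 0" for i j k m
      by (simp add: VE St_E q Sf_def)
  qed (intro linear_compose_sub St_linear q cm cl)+
  then show ?thesis unfolding h by simp
qed

text \<open>The dual of T is parallel for \<Gamma>': the rotations of components and of coframe
  cancel by \<open>quad_skew\<close>, leaving the \<Gamma>' terms. Equality along the frame extends
  to all directions by linearity.\<close>

lemma St_der: assumes q: "q \<in> W"
  shows "((\<lambda>q. St q x y z w) has_derivative
    (\<lambda>u. St q (\<Gamma>' q u x) y z w + St q x (\<Gamma>' q u y) z w + St q x y (\<Gamma>' q u z) w + St q x y z (\<Gamma>' q u w))) (at q)"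
proof -
  define F where "F u = (\<Sum>a\<in>UNIV. \<Sum>b\<in>UNIV. \<Sum>c\<in>UNIV. \<Sum>d\<in>UNIV.
     Sf q a b c d * ((ee q a x * ee q b y * ee q c z) * de q d w u + ((ee q a x * ee q b y) * de q c z u
       + (ee q a x * de q b y u + de q a x u * ee q b y) * ee q c z) * ee q d w)
     + dS q a b c d u * (ee q a x * ee q b y * ee q c z * ee q d w))" for u
  define G where "G u = St q (\<Gamma>' q u x) y z w + St q x (\<Gamma>' q u y) z w + St q x y (\<Gamma>' q u z) w + St q x y z (\<Gamma>' q u w)" for u
  have F: "((\<lambda>q. St q x y z w) has_derivative F) (at q)"
    unfolding St_def quad_def F_def by (intro has_derivative_sum has_derivative_mult Sf_der de_der q)
  have FE: "F (E q m) = G (E q m)" for m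
  proof -
    define P where "P a v = (\<Sum>s\<in>UNIV. om' q m a s * ee q s v)" for a v
    define H where "H v = \<Gamma>' q (E q m) v" for v
    have "F (E q m) = quad (act4 (om' q m) (Sf q)) (\<lambda>a. ee q a x) (\<lambda>a. ee q a y) (\<lambda>a. ee q a z) (\<lambda>a. ee q a w)
       + quad (Sf q) (\<lambda>a. P a x) (\<lambda>a. ee q a y) (\<lambda>a. ee q a z) (\<lambda>a. ee q a w)
       + quad (Sf q) (\<lambda>a. ee q a x) (\<lambda>a. P a y) (\<lambda>a. ee q a z) (\<lambda>a. ee q a w)
       + quad (Sf q) (\<lambda>a. ee q a x) (\<lambda>a. ee q a y) (\<lambda>a. P a z) (\<lambda>a. ee q a w)
       + quad (Sf q) (\<lambda>a. ee q a x) (\<lambda>a. ee q a y) (\<lambda>a. ee q a z) (\<lambda>a. P a w) + G (E q m)"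
      unfolding F_def G_def St_def quad_def dS_E[OF q] de_E[OF q] P_def[symmetric] H_def[symmetric] sum.distrib[symmetric]
      by (intro sum.cong refl) (simp add: algebra_simps)
    then show ?thesis unfolding P_def quad_skew[of "om' q m", OF om'_skew[OF q]] by simp
  qed
  have lF: "linear F" using has_derivative_linear[OF F] .
  have lG: "linear G" unfolding G_def
    by (intro linear_compose_add linear_compose[OF Gamma'_linear[OF q] St_linear(1)[OF q], unfolded o_def]
        linear_compose[OF Gamma'_linear[OF q] St_linear(2)[OF q], unfolded o_def]
        linear_compose[OF Gamma'_linear[OF q] St_linear(3)[OF q], unfolded o_def]
        linear_compose[OF Gamma'_linear[OF q] St_linear(4)[OF q], unfolded o_def])
  have "F u = G u" for u
  proof -
    have "F u = F (\<Sum>a\<in>UNIV. ee q a u *\<^sub>R E q a)" by (rule arg_cong[OF frame_expand[OF q]])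
    also have "\<dots> = G (\<Sum>a\<in>UNIV. ee q a u *\<^sub>R E q a)"
      by (simp add: linear_sum[OF lF] linear_cmul[OF lF] linear_sum[OF lG] linear_cmul[OF lG] FE)
    also have "\<dots> = G u" by (rule arg_cong[OF frame_expand[OF q], symmetric])
    finally show ?thesis .
  qed
  then have "F = (\<lambda>u. St q (\<Gamma>' q u x) y z w + St q x (\<Gamma>' q u y) z w + St q x y (\<Gamma>' q u z) w + St q x y z (\<Gamma>' q u w))"
    unfolding G_def by blast
  with F show ?thesis by (simp only:)
qed

lemma ext_deriv_hodge_torsion: assumes q: "q \<in> W" and l: "length vs = 5"
  shows "ext_deriv (hodge_field \<phi> 3 (torsion_form \<phi> \<Gamma>)) q vs = 0"
proof -
  obtain a b c d e' where vs: "vs = [a, b, c, d, e']" using length_5[OF l] by blast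
  have D: "frechet_derivative (\<lambda>q. hodge_field \<phi> 3 (torsion_form \<phi> \<Gamma>) q [x, y, z, w]) (at q) u
    = St q (\<Gamma>' q u x) y z w + St q x (\<Gamma>' q u y) z w + St q x y (\<Gamma>' q u z) w + St q x y z (\<Gamma>' q u w)" for x y z w u
  proof -
    have "((\<lambda>q. hodge_field \<phi> 3 (torsion_form \<phi> \<Gamma>) q [x, y, z, w]) has_derivative
      (\<lambda>u. St q (\<Gamma>' q u x) y z w + St q x (\<Gamma>' q u y) z w + St q x y (\<Gamma>' q u z) w + St q x y z (\<Gamma>' q u w))) (at q)"
      by (rule has_derivative_transform_within_open[OF St_der[OF q] W q]) (simp add: hodge_torsion)
    from frechet_derivative_at[OF this, symmetric] show ?thesis by simp
  qed
  have s: "St q x (\<Gamma>' q u y) z w = - St q (\<Gamma>' q u y) x z w" "St q x y (\<Gamma>' q u z) w = St q (\<Gamma>' q u z) x y w"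
    "St q x y z (\<Gamma>' q u w) = - St q (\<Gamma>' q u w) x y z" for x y z w u
    using St_swap(1)[OF q, of x "\<Gamma>' q u y" z w] St_swap(2)[OF q, of x y "\<Gamma>' q u z" w] St_swap(1)[OF q, of x "\<Gamma>' q u z" y w]
      St_swap(3)[OF q, of x y z "\<Gamma>' q u w"] St_swap(2)[OF q, of x y "\<Gamma>' q u w" z] St_swap(1)[OF q, of x "\<Gamma>' q u w" y z] by simp_all
  show ?thesis unfolding vs ext_deriv_4 D s
    using Gamma'_sym[OF q, of a b] Gamma'_sym[OF q, of a c] Gamma'_sym[OF q, of a d] Gamma'_sym[OF q, of a e'] Gamma'_sym[OF q, of b c]
      Gamma'_sym[OF q, of b d] Gamma'_sym[OF q, of b e'] Gamma'_sym[OF q, of c d] Gamma'_sym[OF q, of c e'] Gamma'_sym[OF q, of d e'] by simp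
qed

text \<open>The outer star acts on a form of degree \<open>8 - 3\<close>, the differential of the
  dual of T, which is zero.\<close>

lemma codiff_torsion_zero: assumes q: "q \<in> W" shows "codiff \<phi> 3 (torsion_form \<phi> \<Gamma>) q vs = 0"
  unfolding codiff_def hodge_field_def[of \<phi> "8 - 3"] hodge_def
  by (simp add: multi_indices_def ext_deriv_hodge_torsion[OF q])

end

lemma smooth_on_differentiable:
  assumes "smooth_on S f" "x \<in> S"
  shows "f differentiable (at x)" "(\<lambda>x. frechet_derivative f (at x) v) differentiable (at x)"
  using assms unfolding smooth_on_def by (auto dest: spec[of _ "Suc (Suc 0)"])

theorem theorem1p2:
  fixes A :: "'a::{t2_space, second_countable_topology} chart set"
    and \<phi> :: "'a chart \<Rightarrow> tfield"
    and D Dg :: "'a chart \<Rightarrow> christoffel"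
    and T :: "'a chart \<Rightarrow> tfield"
  assumes "smooth_atlas A"
    and "G2_structure A \<phi>"
    and "constant_type A \<phi>"
    and "levi_civita A \<phi> Dg"
    and "characteristic_connection A \<phi> D"
    and "G2_instanton A \<phi> D"
    and "ricci_flat A \<phi> D"
  defines "T \<equiv> (\<lambda>c. torsion_form (\<phi> c) (D c))"
  shows "vanishes A 4 (\<lambda>c. nabla_tensor (Dg c) (T c))
    \<and> vanishes A 4 (\<lambda>c. nabla_tensor (D c) (T c))
    \<and> vanishes A 2 (\<lambda>c. codiff (\<phi> c) 3 (T c))
    \<and> vanishes A 4 (\<lambda>c. ext_deriv (T c))
    \<and> vanishes A 4 (\<lambda>c. sigma_form (\<phi> c) (T c))"
proof -
  obtain K where K: "\<And>c p. c \<in> A \<Longrightarrow> p \<in> chart_range c \<Longrightarrow>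
      form_inner (\<phi> c p) 4 (ext_deriv (\<phi> c) p) (hodge (\<phi> c p) 3 (\<phi> c p)) = K"
    using assms(3) unfolding constant_type_def by blast
  \<comment> \<open>All conclusions are pointwise, so each point is treated in a neighbourhood with
    a smooth adapted coframe; the constant K is common to all of them.\<close>
  have local: "(\<forall>vs. length vs = 4 \<longrightarrow> nabla_tensor (Dg c) (T c) p vs = 0) \<and>
      (\<forall>vs. length vs = 4 \<longrightarrow> nabla_tensor (D c) (T c) p vs = 0) \<and>
      (\<forall>vs. length vs = 2 \<longrightarrow> codiff (\<phi> c) 3 (T c) p vs = 0) \<and>
      (\<forall>vs. length vs = 4 \<longrightarrow> ext_deriv (T c) p vs = 0) \<and>
      (\<forall>vs. length vs = 4 \<longrightarrow> sigma_form (\<phi> c) (T c) p vs = 0)"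
    if c: "c \<in> A" and p: "p \<in> chart_range c" for c p
  proof -
    have "\<exists>W e. open W \<and> p \<in> W \<and> W \<subseteq> chart_range c \<and> (\<forall>i\<in>{1..7}. \<forall>v. smooth_on W (\<lambda>q. e q i v)) \<and>
        (\<forall>q\<in>W. adapted_coframe (\<phi> c q) (e q))"
      using assms(2) c p unfolding G2_structure_def by simp
    then obtain W e where W: "open W" "p \<in> W" "W \<subseteq> chart_range c"
      and e: "\<And>i v. i \<in> {1..7} \<Longrightarrow> smooth_on W (\<lambda>q. e q i v)"
      and ad: "\<And>q. q \<in> W \<Longrightarrow> adapted_coframe (\<phi> c q) (e q)"
      by (elim exE conjE) (rule that, auto)
    have phi: "smooth_on (chart_range c) (\<lambda>q. \<phi> c q vs)" if "length vs = 3" for vs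
      using assms(2) c that unfolding G2_structure_def differential_form_def by blast
    have Gam: "smooth_on (chart_range c) (\<lambda>q. D c q u v)" for u v
      using assms(5) c unfolding characteristic_connection_def linear_connection_def by blast
    interpret r: g2_region W "\<phi> c" "D c" e
    proof
      fix q assume "q \<in> W"
      then have q: "q \<in> chart_range c" and qW: "q \<in> W" using W by blast+
      show "adapted_coframe (\<phi> c q) (e q)" using ad qW .
      show "(\<lambda>q. e q i v) differentiable (at q)" if "i \<in> {1..7}" for i v
        by (rule smooth_on_differentiable(1)[OF e[OF that] qW])
      show "(\<lambda>q. \<phi> c q vs) differentiable (at q)" if "length vs = 3" for vs
        by (rule smooth_on_differentiable(1)[OF phi[OF that] q])
      show "bilinear (D c q)"
        using assms(5) c q unfolding characteristic_connection_def linear_connection_def by blast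
      show "(\<lambda>q. D c q u v) differentiable (at q)" for u v
        by (rule smooth_on_differentiable(1)[OF Gam q])
      show "(\<lambda>q. frechet_derivative (\<lambda>q. D c q v w) (at q) u) differentiable (at q)" for u v w
        by (rule smooth_on_differentiable(2)[OF Gam q])
      show "nabla_tensor (D c) (metric_tensor (\<phi> c)) q vs = 0" if "length vs = 3" for vs
        using assms(5) c q that unfolding characteristic_connection_def vanishes_def by blast
      show "nabla_tensor (D c) (\<phi> c) q vs = 0" if "length vs = 4" for vs
        using assms(5) c q that unfolding characteristic_connection_def vanishes_def by blast
      show "alternating 3 (torsion_form (\<phi> c) (D c) q)"
        using assms(5) c q unfolding characteristic_connection_def by blast
    qed (rule W(1))
    interpret g2_levi_civita W "\<phi> c" "D c" e K "Dg c"
    proof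
      fix q assume "q \<in> W"
      then have q: "q \<in> chart_range c" and qW: "q \<in> W" using W by blast+
      show "(\<Sum>a\<in>UNIV. \<Sum>b\<in>UNIV. r.Rf q a b i j * phi0 a b k) = 0" for i j k
        using assms(6) c q unfolding G2_instanton_def Let_def by (intro r.instanton_frame[OF qW]) blast
      show "(\<Sum>a\<in>UNIV. r.Rf q a i j a) = 0" for i j
        using assms(7) c q r.ricci_frame[OF qW, of "r.E q i" "r.E q j"] unfolding ricci_flat_def r.Rf_def by simp
      show "con3 (r.Tf q) phi0 = K" using r.constant_frame[OF qW] K[OF c q] by simp
      show "nabla_tensor (Dg c) (metric_tensor (\<phi> c)) q vs = 0" if "length vs = 3" for vs
        using assms(4) c q that unfolding levi_civita_def vanishes_def by blast
      show "torsion (Dg c) q u v = 0" for u v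
        using assms(4) c q unfolding levi_civita_def by blast
    qed
    show ?thesis unfolding T_def
      using Levi_Civita_torsion_zero[OF W(2)] nabla_torsion_zero[OF W(2)] codiff_torsion_zero[OF W(2)]
        ext_deriv_torsion_zero[OF W(2)] sigma_form_zero[OF W(2)] by blast
  qed
  then show ?thesis unfolding vanishes_def by blast
qed

end
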